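(* In the setting described in the context (in particular with the solutions $u^{\mathfrak{d}_p}$ of $(E_p)$ constructed there, $0\le p\le\varsigma-1$), there exists a formal power series $$\hat u(t,z,\epsilon)=\sum_{m\ge0}h_m(t,z)\frac{\epsilon^m}{m!}\in\mathbb{F}[[\epsilon]]$$ which is a formal solution of $$Q(\partial_z)\sigma_q\hat u(t,z,\epsilon)=(\epsilon t)^{d_D}\sigma_q^{\frac{d_D}{k_2}+1}R_D(\partial_z)\hat u(t,z,\epsilon)+\sum_{\ell=1}^{D-1}\Big(\sum_{\lambda\in I_\ell}t^{d_{\lambda,\ell}}\epsilon^{\Delta_{\lambda,\ell}}\sigma_q^{\delta_\ell}c_{\lambda,\ell}(z,\epsilon)R_\ell(\partial_z)\hat u(t,z,\epsilon)\Big)+\sigma_q\hat f(t,z,\epsilon).$$ Moreover, $\hat u$ is the common $q$-Gevrey asymptotic expansion of order $1/k_1$ on $\mathcal{E}_p$ of the function $u^{\mathfrak{d}_p}$, seen as a holomorphic function from $\mathcal{E}_p$ into $\mathbb{F}$, for all $0\le p\le\varsigma-1$. In addition, $\hat u$ is of the form $$\hat u(t,z,\epsilon)=a(t,z,\epsilon)+\hat u_1(t,z,\epsilon)+\hat u_2(t,z,\epsilon),$$ where $a(t,z,\epsilon)\in\mathbb{F}\{\epsilon\}$ and $\hat u_1,\hat u_2\in\mathbb{F}[[\epsilon]]$ are such that, for every $0\le p\le\varsigma-1$, the function $u^{\mathfrak{d}_p}$ can be written as $$u^{\mathfrak{d}_p}(t,z,\epsilon)=a(t,z,\epsilon)+u_1^{\mathfrak{d}_p}(t,z,\epsilon)+u_2^{\mathfrak{d}_p}(t,z,\epsilon),$$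 where $\epsilon\mapsto u_1^{\mathfrak{d}_p}(t,z,\epsilon)$ is an $\mathbb{F}$-valued function admitting $\hat u_1$ as its $q$-Gevrey asymptotic expansion of order $1/k_1$ on $\mathcal{E}_p$, and $\epsilon\mapsto u_2^{\mathfrak{d}_p}(t,z,\epsilon)$ is an $\mathbb{F}$-valued function admitting $\hat u_2$ as its $q$-Gevrey asymptotic expansion of order $1/k_2$ on $\mathcal{E}_p$.
   Context: Notation. $q>1$ is real. For $\gamma\in\mathbb{R}$, $\sigma_q^\gamma g(t)=g(q^\gamma t)$ whenever the right-hand side makes sense (acting on $t$, resp. $T$, $\tau$), $\sigma_q=\sigma_q^1$; equations are understood wherever all terms are defined. $D(0,r)$ is the open disc, $\overline D(0,r)$ its closure, $\mathbb{C}^\star=\mathbb{C}\setminus\{0\}$, and $c_k(n):=(q^{1/k})^{n(n-1)/2}$. $E_{(\beta,\mu)}$ is the Banach space of continuous $h:\mathbb{R}\to\mathbb{C}$ with $\|h\|_{(\beta,\mu)}=\sup_m(1+|m|)^\mu e^{\beta|m|}|h(m)|<\infty$. For $R\in\mathbb{C}[X]$, $(h_1\ast^Rh_2)(m)=\int_{-\infty}^\infty h_1(m-m_1)R(im_1)h_2(m_1)dm_1$ (acting in $m$ when other variables are present). $\mathcal{F}^{-1}(h)(z)=(2\pi)^{-1/2}\int_{-\infty}^\infty h(m)e^{izm}dm$, $H_\beta=\{z\in\mathbb{C}:|\Im z|<\beta\}$. For $k>0$: $\Theta_{q^{1/k}}(x)=\sum_{n\in\mathbb{Z}}q^{-n(n-1)/(2k)}x^n$,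 $\pi_{q^{1/k}}=\frac{\log q}{k}\prod_{n\ge0}(1-q^{-(n+1)/k})^{-1}$, and $\mathcal{L}^\gamma_{q;1/k}(f)(T)=\frac1{\pi_{q^{1/k}}}\int_{L_\gamma}\frac{f(u)}{\Theta_{q^{1/k}}(u/T)}\frac{du}{u}$ with $L_\gamma=(0,\infty)e^{i\gamma}$; the value does not depend on the choice of $\gamma$ in the sector where $f$ is defined with suitable growth. Function spaces. For an unbounded sector $U_d$ with vertex $0$ and bisecting direction $d$, $\rho>0$, and $\delta>0$ with $\mathrm{dist}(U_d\cup D(0,\rho),-\delta)>0$, $\mathrm{Exp}^d_{(k,\beta,\mu,\alpha,\rho)}$ is the Banach space of continuous $h$ on $(U_d\cup\overline D(0,\rho))\times\mathbb{R}$, holomorphic in $\tau\in U_d\cup D(0,\rho)$, with norm $\sup(1+|m|)^\mu e^{\beta|m|}\exp(-\frac{k\log^2|\tau+\delta|}{2\log q}-\alpha\log|\tau+\delta|)|h(\tau,m)|<\infty$. For an infinite sector $S_d$ and a bounded domain $\mathcal{R}_d^b$, $\mathrm{Exp}^d_{(k,\beta,\mu,\nu)}$ is the Banach space of continuous $h$ on $(S_d\cup\overline{\mathcal{R}_d^b})\times\mathbb{R}$ (closure in $\mathbb{C}^\star$), holomorphic in $\tau\in S_d\cup\mathcal{R}_d^b$, with norm $\sup(1+|m|)^\mu e^{\beta|m|}\exp(-\frac{k\log^2|\tau|}{2\log q}-\nu\log|\tau|)|h(\tau,m)|<\infty$. Data. $1\le k_1<k_2$, $D\ge3$, $d_D\ge1$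 are integers, $\frac1\kappa=\frac1{k_1}-\frac1{k_2}$. For $1\le\ell\le D-1$: $I_\ell$ is a finite nonempty set of nonnegative integers, $\delta_\ell\ge1$ an integer, and for $\lambda\in I_\ell$, $d_{\lambda,\ell}\ge1$, $\Delta_{\lambda,\ell}\ge0$ are integers. Assume $\delta_1=1$, $\delta_\ell<\delta_{\ell+1}$ ($1\le\ell\le D-2$), and for all $1\le\ell\le D-1$, $\lambda\in I_\ell$: $\Delta_{\lambda,\ell}\ge d_{\lambda,\ell}$, $\frac{d_{\lambda,\ell}}{k_2}+1\ge\delta_\ell$, $\frac{d_D-1}{k_2}+1\ge\delta_\ell$. $Q,R_1,\dots,R_D\in\mathbb{C}[X]$ with $\deg Q\ge\deg R_D\ge\deg R_\ell$ ($1\le\ell\le D-1$), $Q(im)\ne0$, $R_D(im)\neq0$ for $m\in\mathbb{R}$, and $\frac{Q(im)}{R_D(im)}\in S_{Q,R_D}=\{z:|z|\ge r_{Q,R_D},|\arg z-d_{Q,R_D}|\le\eta_{Q,R_D}\}$ for all $m\in\mathbb{R}$, with some $r_{Q,R_D},\eta_{Q,R_D}>0$, $d_{Q,R_D}\in\mathbb{R}$. Let $\beta>0$, $\mu>\deg(R_D)+1$, $\epsilon_0>0$. The maps $m\mapsto C_{\lambda,\ell}(m,\epsilon)$, $m\mapsto F_n(m,\epsilon)$ ($n\ge0$) lie in $E_{(\beta,\mu)}$, depend holomorphically on $\epsilon\in D(0,\epsilon_0)$, and $\|C_{\lambda,\ell}(\cdot,\epsilon)\|_{(\beta,\mu)}\le\tilde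 C_{\lambda,\ell}$, $\|F_n(\cdot,\epsilon)\|_{(\beta,\mu)}\le C_F\rho^{-n}q^{n(n-1)/(2k_1)}$ for all $\epsilon\in D(0,\epsilon_0)$. Put $c_{\lambda,\ell}(z,\epsilon)=\mathcal{F}^{-1}(m\mapsto C_{\lambda,\ell}(m,\epsilon))(z)$. Fix $0<\beta'<\beta$. Good covering. For an integer $\varsigma\ge2$, $(\mathcal{E}_p)_{0\le p\le\varsigma-1}$ is a good covering in $\mathbb{C}^\star$: each $\mathcal{E}_p$ is an open sector with vertex $0$ and radius $\epsilon_0$, $\mathcal{E}_j\cap\mathcal{E}_k\ne\emptyset$ iff $|j-k|\le1$ (indices cyclic, $\mathcal{E}_\varsigma:=\mathcal{E}_0$), and $\bigcup_p\mathcal{E}_p=\mathcal{U}\setminus\{0\}$ for a neighborhood $\mathcal{U}$ of $0$. All indices $p$ are cyclic mod $\varsigma$. Associated family. For each $p$, $U_{\mathfrak{d}_p}$ and $S_{\mathfrak{d}_p}$ are unbounded sectors with vertex $0$ and bisecting direction $\mathfrak{d}_p$; $\delta>0$ has positive distance from $-\delta$ to each $U_{\mathfrak{d}_p}\cup D(0,\rho)$; $\tilde\delta>0$; $\mathcal{R}_{\mathfrak{d}_p,\tilde\delta}=\{T\in\mathbb{C}^\star:|1+e^{i\mathfrak{d}_p}r/T|>\tilde\delta\ \forall r\ge0\}$; $\mathcal{T}$ is an open bounded sector with vertex $0$ and radius $r_{\mathcal{T}}>0$; $\mathcal{R}^b_{\mathfrak{d}_p}=\mathcal{R}_{\mathfrak{d}_p,\tilde\delta}\cap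 D(0,\epsilon_0r_{\mathcal{T}})\subseteq\overline D(0,\rho)$; $S_{\mathfrak{d}_p}\subseteq\mathcal{R}_{\mathfrak{d}_p,\tilde\delta}$. Assume $0<\epsilon_0,r_{\mathcal{T}}<1$, $\nu+\frac{k_2}{\log q}\log r_{\mathcal{T}}<0$, $\alpha+\frac{\kappa}{\log q}\log(\epsilon_0r_{\mathcal{T}})<0$, $\epsilon_0r_{\mathcal{T}}\le q^{(\frac12-\nu)/k_2}/2$ ($\alpha,\nu$ introduced below). Let $q_l(m)$, $0\le l\le d_D-1$, be the roots of $P_m(\tau)=\frac{Q(im)}{c_{k_2}(k_2)}-\frac{R_D(im)}{c_{k_2}(d_D+k_2)}\tau^{d_D}$. Assume: (1) there is $M_1>0$ with $|\tau-q_l(m)|\ge M_1(1+|\tau|)$ for all $l$, $m\in\mathbb{R}$, $p$, $\tau\in S_{\mathfrak{d}_p}\cup\overline D(0,\rho)$; (2) there are $M_2>0$ and $l_0$ with $|\tau-q_{l_0}(m)|\ge M_2|q_{l_0}(m)|$ for all $m$, $p$, $\tau\in S_{\mathfrak{d}_p}\cup\overline D(0,\rho)$; (3) $\mathcal{R}^b_{\mathfrak{d}_p}\cap\mathcal{R}^b_{\mathfrak{d}_{p+1}}\ne\emptyset$ and $\epsilon t\in\mathcal{R}^b_{\mathfrak{d}_p}$ for all $t\in\mathcal{T}$, $\epsilon\in\mathcal{E}_p$, all $p$. Forcing term. $\psi_{k_1}(\tau,m,\epsilon)=\sum_{n\ge0}F_n(m,\epsilon)\tau^n/c_{k_1}(n)$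 (convergent on $D(0,\rho)$) extends analytically in $\tau$ to $U_{\mathfrak{d}_p}$ as $\psi_{k_1}^{\mathfrak{d}_p}\in\mathrm{Exp}^{\mathfrak{d}_p}_{(k_1,\beta,\mu,\alpha,\rho)}$ for some $\alpha>0$, with norm bounded by a constant $\zeta_{\psi_{k_1}}$ independent of $\epsilon\in D(0,\epsilon_0)$. Then $\psi_{k_2}^{\mathfrak{d}_p}(\tau,m,\epsilon):=\mathcal{L}^{\mathfrak{d}_p}_{q;1/\kappa}(h\mapsto\psi_{k_1}^{\mathfrak{d}_p}(h,m,\epsilon))(\tau)$ lies in $\mathrm{Exp}^{\mathfrak{d}_p}_{(k_2,\beta,\mu,\nu)}$, uniformly in $\epsilon$, for some $\nu\in\mathbb{R}$ (depending only on $q,k_1,k_2,\alpha$), which is fixed. Put $F^{\mathfrak{d}_p}(T,m,\epsilon)=\mathcal{L}^{\mathfrak{d}_p}_{q;1/k_2}(\tau\mapsto\psi_{k_2}^{\mathfrak{d}_p}(\tau,m,\epsilon))(T)$ and $f^{\mathfrak{d}_p}(t,z,\epsilon)=\mathcal{F}^{-1}(m\mapsto F^{\mathfrak{d}_p}(\epsilon t,m,\epsilon))(z)$, bounded holomorphic on $\mathcal{T}\times H_{\beta'}\times\mathcal{E}_p$. Problem $(E_p)$: $$Q(\partial_z)\sigma_qu^{\mathfrak{d}_p}=(\epsilon t)^{d_D}\sigma_q^{\frac{d_D}{k_2}+1}R_D(\partial_z)u^{\mathfrak{d}_p}+\sum_{\ell=1}^{D-1}\Big(\sum_{\lambda\in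 I_\ell}t^{d_{\lambda,\ell}}\epsilon^{\Delta_{\lambda,\ell}}\sigma_q^{\delta_\ell}c_{\lambda,\ell}(z,\epsilon)R_\ell(\partial_z)u^{\mathfrak{d}_p}\Big)+\sigma_qf^{\mathfrak{d}_p}(t,z,\epsilon).$$ Construction of the solutions. It is assumed that $r_{Q,R_D}$ is large enough, and that (depending on it) $\zeta_{\psi_{k_1}}$ and the $\tilde C_{\lambda,\ell}$ are small enough, so that for a fixed $\varpi>0$ and each $p$ and $\epsilon\in D(0,\epsilon_0)$: (i) the equation $Q(im)\frac{\tau^{k_1}}{c_{k_1}(k_1)}w=\frac{\tau^{d_D+k_1}}{c_{k_1}(d_D+k_1)}\sigma_q^{-d_D/\kappa}R_D(im)w+\sum_{\ell,\lambda}\frac{\epsilon^{\Delta_{\lambda,\ell}-d_{\lambda,\ell}}\tau^{d_{\lambda,\ell}+k_1}}{c_{k_1}(d_{\lambda,\ell}+k_1)}\sigma_q^{\delta_\ell-\frac{d_{\lambda,\ell}}{k_1}-1}\frac{1}{(2\pi)^{1/2}}(C_{\lambda,\ell}\ast^{R_\ell}w)+\frac{\tau^{k_1}}{c_{k_1}(k_1)}\psi_{k_1}^{\mathfrak{d}_p}$ has a unique solution $w_{k_1}^{\mathfrak{d}_p}$ in the closed ball of radius $\varpi$ of $\mathrm{Exp}^{\mathfrak{d}_p}_{(\kappa,\beta,\mu,\alpha,\rho)}$; (ii) the equation $Q(im)\frac{\tau^{k_2}}{c_{k_2}(k_2)}w=R_D(im)\frac{\tau^{d_D+k_2}}{c_{k_2}(d_D+k_2)}w+\sum_{\ell,\lambda}\frac{\epsilon^{\Delta_{\lambda,\ell}-d_{\lambda,\ell}}\tau^{d_{\lambda,\ell}+k_2}}{c_{k_2}(d_{\lambda,\ell}+k_2)}\sigma_q^{\delta_\ell-\frac{d_{\lambda,\ell}}{k_2}-1}\frac{1}{(2\pi)^{1/2}}(C_{\lambda,\ell}\ast^{R_\ell}w)+\frac{\tau^{k_2}}{c_{k_2}(k_2)}\psi_{k_2}^{\mathfrak{d}_p}$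 has a unique solution $w_{k_2}^{\mathfrak{d}_p}$ in $\mathrm{Exp}^{\mathfrak{d}_p}_{(k_2,\beta,\mu,\nu)}$, of norm $\le\varpi$; (iii) both are holomorphic in $\epsilon\in D(0,\epsilon_0)$, and $w_{k_2}^{\mathfrak{d}_p}$ is the analytic continuation in $\tau$ of $\mathcal{L}^{\mathfrak{d}_p}_{q;1/\kappa}(w_{k_1}^{\mathfrak{d}_p})(\tau,m,\epsilon)$. The solution of $(E_p)$ is $$u^{\mathfrak{d}_p}(t,z,\epsilon)=\frac1{(2\pi)^{1/2}}\frac1{\pi_{q^{1/k_2}}}\int_{-\infty}^\infty\int_{L_{\gamma_p}}\frac{w_{k_2}^{\mathfrak{d}_p}(u,m,\epsilon)}{\Theta_{q^{1/k_2}}(\frac u{\epsilon t})}\frac{du}ue^{izm}dm,$$ with a halfline $L_{\gamma_p}\subseteq S_{\mathfrak{d}_p}$ whose direction may depend on $\epsilon t$; it is bounded holomorphic on $\mathcal{T}\times H_{\beta'}\times\mathcal{E}_p$. Asymptotics. $\mathbb{F}$ is the Banach space of bounded holomorphic functions on $\mathcal{T}\times H_{\beta'}$ with the supremum norm; $\mathbb{F}\{\epsilon\}$ denotes convergent power series. A holomorphic $g:V\to\mathbb{F}$ on a bounded open sector $V$ with vertex $0$ admits $\hat g=\sum_{n\ge0}g_n\epsilon^n\in\mathbb{F}[[\epsilon]]$ as its $q$-Gevrey asymptotic expansion of order $1/k$ if for every open subsector $U$ with $\overline U\setminus\{0\}\subseteq V$ there are $A,C>0$ with $\|g(\epsilon)-\sum_{n=0}^Ng_n\epsilon^n\|_{\mathbb{F}}\le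 CA^{N+1}q^{\frac{N(N+1)}{2k}}|\epsilon|^{N+1}$ for all $\epsilon\in U$, $N\ge0$. $\hat f(t,z,\epsilon)=\sum_{m\ge0}f_m(t,z)\frac{\epsilon^m}{m!}\in\mathbb{F}[[\epsilon]]$ denotes the common $q$-Gevrey asymptotic expansion of order $1/k_1$ on $\mathcal{E}_p$ of the $f^{\mathfrak{d}_p}$, $0\le p\le\varsigma-1$ (it exists). In the formal equation, $c_{\lambda,\ell}(z,\epsilon)$ is identified with its Taylor expansion at $\epsilon=0$. *)

theory Defs
  imports "HOL-Complex_Analysis.Complex_Analysis"
begin

section \<open>Weighted supremum norms and function spaces\<close>

text \<open>
  All normed spaces below consist of complex-valued functions on a set \<open>X\<close>, normed by
  \<open>sup\<^sub>X w |h|\<close> for a positive weight \<open>w\<close>. Their elements are represented by total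
  functions; values outside \<open>X\<close> are irrelevant.
\<close>

definition wbounded :: "'x set \<Rightarrow> ('x \<Rightarrow> real) \<Rightarrow> ('x \<Rightarrow> complex) \<Rightarrow> bool" where
  "wbounded X w h \<longleftrightarrow> bdd_above ((\<lambda>x. w x * cmod (h x)) ` X)"

definition wnorm :: "'x set \<Rightarrow> ('x \<Rightarrow> real) \<Rightarrow> ('x \<Rightarrow> complex) \<Rightarrow> real" where
  "wnorm X w h = (SUP x\<in>X. w x * cmod (h x))"

text \<open>Complex differentiability on an open set of a map into the space \<open>V\<close> normed by \<open>N\<close>.\<close>

definition holo_into ::
  "('x \<Rightarrow> complex) set \<Rightarrow> (('x \<Rightarrow> complex) \<Rightarrow> real) \<Rightarrow> complex set \<Rightarrow> (complex \<Rightarrow> 'x \<Rightarrow> complex) \<Rightarrow> bool"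
where
  "holo_into V N A g \<longleftrightarrow>
     (\<forall>z\<in>A. g z \<in> V) \<and>
     (\<forall>z\<in>A. \<exists>g'\<in>V. ((\<lambda>w. N (\<lambda>x. (g w x - g z x) / (w - z) - g' x)) \<longlongrightarrow> 0) (at z))"

definition E_weight :: "real \<Rightarrow> real \<Rightarrow> real \<Rightarrow> real" where
  "E_weight \<beta> \<mu> m = (1 + \<bar>m\<bar>) powr \<mu> * exp (\<beta> * \<bar>m\<bar>)"

definition E_space :: "real \<Rightarrow> real \<Rightarrow> (real \<Rightarrow> complex) set" where
  "E_space \<beta> \<mu> = {h. continuous_on UNIV h \<and> wbounded UNIV (E_weight \<beta> \<mu>) h}"

definition E_norm :: "real \<Rightarrow> real \<Rightarrow> (real \<Rightarrow> complex) \<Rightarrow> real" where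
  "E_norm \<beta> \<mu> = wnorm UNIV (E_weight \<beta> \<mu>)"

text \<open>
  The weight of both families of \<open>Exp\<close> spaces: \<open>s\<close> is the shift in \<open>|\<tau> + s|\<close>, with \<open>s = 0\<close>
  for the second family.
\<close>

definition Exp_weight ::
  "real \<Rightarrow> real \<Rightarrow> real \<Rightarrow> real \<Rightarrow> real \<Rightarrow> real \<Rightarrow> complex \<times> real \<Rightarrow> real" where
  "Exp_weight q k \<beta> \<mu> \<alpha> s = (\<lambda>(\<tau>, m).
     E_weight \<beta> \<mu> m *
     exp (- (k * (ln (cmod (\<tau> + of_real s)))\<^sup>2 / (2 * ln q)) - \<alpha> * ln (cmod (\<tau> + of_real s))))"

text \<open>\<open>A\<close> is the domain of holomorphy, \<open>B \<supseteq> A\<close> the domain of continuity and of the supremum.\<close>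

definition Exp_space ::
  "complex set \<Rightarrow> complex set \<Rightarrow> (complex \<times> real \<Rightarrow> real) \<Rightarrow> (complex \<times> real \<Rightarrow> complex) set" where
  "Exp_space A B w =
     {h. continuous_on (B \<times> UNIV) h \<and> (\<forall>m. (\<lambda>\<tau>. h (\<tau>, m)) holomorphic_on A) \<and>
         wbounded (B \<times> UNIV) w h}"

definition Exp1_space :: "real \<Rightarrow> real \<Rightarrow> real \<Rightarrow> real \<Rightarrow> real \<Rightarrow> real \<Rightarrow> real \<Rightarrow> complex set \<Rightarrow>
    (complex \<times> real \<Rightarrow> complex) set" where
  "Exp1_space q k \<beta> \<mu> \<alpha> s \<rho> U =
     Exp_space (U \<union> ball 0 \<rho>) (U \<union> cball 0 \<rho>) (Exp_weight q k \<beta> \<mu> \<alpha> s)"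

definition Exp1_norm :: "real \<Rightarrow> real \<Rightarrow> real \<Rightarrow> real \<Rightarrow> real \<Rightarrow> real \<Rightarrow> real \<Rightarrow> complex set \<Rightarrow>
    (complex \<times> real \<Rightarrow> complex) \<Rightarrow> real" where
  "Exp1_norm q k \<beta> \<mu> \<alpha> s \<rho> U = wnorm ((U \<union> cball 0 \<rho>) \<times> UNIV) (Exp_weight q k \<beta> \<mu> \<alpha> s)"

definition Exp2_dom :: "complex set \<Rightarrow> complex set \<Rightarrow> complex set" where
  "Exp2_dom S Rb = S \<union> (closure Rb - {0})"

definition Exp2_space :: "real \<Rightarrow> real \<Rightarrow> real \<Rightarrow> real \<Rightarrow> real \<Rightarrow> complex set \<Rightarrow> complex set \<Rightarrow>
    (complex \<times> real \<Rightarrow> complex) set" where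
  "Exp2_space q k \<beta> \<mu> \<nu> S Rb = Exp_space (S \<union> Rb) (Exp2_dom S Rb) (Exp_weight q k \<beta> \<mu> \<nu> 0)"

definition Exp2_norm :: "real \<Rightarrow> real \<Rightarrow> real \<Rightarrow> real \<Rightarrow> real \<Rightarrow> complex set \<Rightarrow> complex set \<Rightarrow>
    (complex \<times> real \<Rightarrow> complex) \<Rightarrow> real" where
  "Exp2_norm q k \<beta> \<mu> \<nu> S Rb = wnorm (Exp2_dom S Rb \<times> UNIV) (Exp_weight q k \<beta> \<mu> \<nu> 0)"

text \<open>Holomorphy in several variables on an open set: the real derivative is complex linear.\<close>

definition holomorphic2_on :: "(complex \<times> complex \<Rightarrow> complex) \<Rightarrow> (complex \<times> complex) set \<Rightarrow> bool" where
  "holomorphic2_on g A \<longleftrightarrow>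
     (\<forall>x\<in>A. \<exists>a b. (g has_derivative (\<lambda>(v1, v2). a * v1 + b * v2)) (at x))"

definition holomorphic3_on ::
  "(complex \<times> complex \<times> complex \<Rightarrow> complex) \<Rightarrow> (complex \<times> complex \<times> complex) set \<Rightarrow> bool" where
  "holomorphic3_on g A \<longleftrightarrow>
     (\<forall>x\<in>A. \<exists>a b c. (g has_derivative (\<lambda>(v1, v2, v3). a * v1 + b * v2 + c * v3)) (at x))"

definition F_space :: "complex set \<Rightarrow> complex set \<Rightarrow> (complex \<times> complex \<Rightarrow> complex) set" where
  "F_space T H = {g. holomorphic2_on g (T \<times> H) \<and> bounded (g ` (T \<times> H))}"

definition F_norm :: "complex set \<Rightarrow> complex set \<Rightarrow> (complex \<times> complex \<Rightarrow> complex) \<Rightarrow> real" where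
  "F_norm T H = wnorm (T \<times> H) (\<lambda>_. 1)"

section \<open>Sectors and related domains\<close>

definition sector :: "real \<Rightarrow> real \<Rightarrow> real \<Rightarrow> complex set" where
  "sector d a r = {of_real s * cis \<theta> | s \<theta>. 0 < s \<and> s < r \<and> \<bar>\<theta> - d\<bar> < a}"

definition is_sector :: "real \<Rightarrow> complex set \<Rightarrow> bool" where
  "is_sector r V \<longleftrightarrow> (\<exists>d a. 0 < a \<and> a \<le> pi \<and> V = sector d a r)"

definition is_unbounded_sector :: "real \<Rightarrow> complex set \<Rightarrow> bool" where
  "is_unbounded_sector d V \<longleftrightarrow>
     (\<exists>a. 0 < a \<and> a \<le> pi \<and> V = {of_real s * cis \<theta> | s \<theta>. 0 < s \<and> \<bar>\<theta> - d\<bar> < a})"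

definition halfline :: "real \<Rightarrow> complex set" where
  "halfline \<gamma> = {of_real s * cis \<gamma> | s. 0 < s}"

definition strip :: "real \<Rightarrow> complex set" where
  "strip \<beta> = {z. \<bar>Im z\<bar> < \<beta>}"

definition R_dom :: "real \<Rightarrow> real \<Rightarrow> complex set" where
  "R_dom d c = {T. T \<noteq> 0 \<and> (\<forall>r\<ge>0. cmod (1 + cis d * of_real r / T) > c)}"

definition Rb_dom :: "real \<Rightarrow> real \<Rightarrow> real \<Rightarrow> complex set" where
  "Rb_dom d c r = R_dom d c \<inter> ball 0 r"

definition good_covering :: "nat \<Rightarrow> real \<Rightarrow> (nat \<Rightarrow> complex set) \<Rightarrow> bool" where
  "good_covering n r E \<longleftrightarrow>
     n \<ge> 2 \<and> (\<forall>p<n. is_sector r (E p)) \<and>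
     (\<forall>i<n. \<forall>j<n. E i \<inter> E j \<noteq> {} \<longleftrightarrow> i = j \<or> j = Suc i mod n \<or> i = Suc j mod n) \<and>
     (\<exists>U. open U \<and> 0 \<in> U \<and> (\<Union>p<n. E p) = U - {0})"

section \<open>Integral transforms and differential operators\<close>

definition cq :: "real \<Rightarrow> real \<Rightarrow> nat \<Rightarrow> real" where
  "cq q k n = (q powr (1 / k)) powr (real n * (real n - 1) / 2)"

definition rconv :: "complex poly \<Rightarrow> (real \<Rightarrow> complex) \<Rightarrow> (real \<Rightarrow> complex) \<Rightarrow> real \<Rightarrow> complex" where
  "rconv R h1 h2 m =
     (LINT m1|lborel. h1 (m - m1) * poly R (\<i> * of_real m1) * h2 m1)"

definition inv_fourier :: "(real \<Rightarrow> complex) \<Rightarrow> complex \<Rightarrow> complex" where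
  "inv_fourier h z = of_real (1 / sqrt (2 * pi)) * (LINT m|lborel. h m * exp (\<i> * z * of_real m))"

definition jtheta :: "real \<Rightarrow> real \<Rightarrow> complex \<Rightarrow> complex" where
  "jtheta q k x =
     (\<Sum>\<^sub>\<infinity>n::int. of_real (q powr (- (real_of_int n * (real_of_int n - 1)) / (2 * k))) * x powi n)"

definition pi_q :: "real \<Rightarrow> real \<Rightarrow> real" where
  "pi_q q k = ln q / k * (\<Prod>n. inverse (1 - q powr (- (real n + 1) / k)))"

text \<open>With \<open>u = r e\<^sup>i\<^sup>\<gamma>\<close> on the halfline, \<open>du / u = dr / r\<close>.\<close>

definition qlaplace :: "real \<Rightarrow> real \<Rightarrow> real \<Rightarrow> (complex \<Rightarrow> complex) \<Rightarrow> complex \<Rightarrow> complex" where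
  "qlaplace q k \<gamma> f T = of_real (1 / pi_q q k) *
     (LINT r:{0<..}|lborel.
        f (of_real r * cis \<gamma>) / jtheta q k (of_real r * cis \<gamma> / T) / of_real r)"

definition sigma_q :: "real \<Rightarrow> real \<Rightarrow> (complex \<Rightarrow> 'b) \<Rightarrow> complex \<Rightarrow> 'b" where
  "sigma_q q \<gamma> g t = g (of_real (q powr \<gamma>) * t)"

text \<open>The operator \<open>R(\<partial>\<^sub>z)\<close> for a polynomial \<open>R\<close>.\<close>

definition poly_diff :: "complex poly \<Rightarrow> (complex \<Rightarrow> complex) \<Rightarrow> complex \<Rightarrow> complex" where
  "poly_diff R g z = (\<Sum>i\<le>degree R. coeff R i * (deriv ^^ i) g z)"

section \<open>Asymptotic expansions and formal power series\<close>

text \<open>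
  A formal series in \<open>\<epsilon>\<close> with coefficients in the space of bounded holomorphic functions on
  \<open>T \<times> H\<close> is given by its sequence of coefficients (those of \<open>\<epsilon>\<^sup>n\<close>, without factorials).
\<close>

definition qgevrey_expansion :: "real \<Rightarrow> real \<Rightarrow> complex set \<Rightarrow> complex set \<Rightarrow> complex set \<Rightarrow>
    (complex \<Rightarrow> complex \<times> complex \<Rightarrow> complex) \<Rightarrow> (nat \<Rightarrow> complex \<times> complex \<Rightarrow> complex) \<Rightarrow> bool" where
  "qgevrey_expansion q k T H V g gh \<longleftrightarrow>
     holo_into (F_space T H) (F_norm T H) V g \<and> (\<forall>n. gh n \<in> F_space T H) \<and>
     (\<forall>U r. 0 < r \<and> is_sector r U \<and> closure U - {0} \<subseteq> V \<longrightarrow>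
        (\<exists>A>0. \<exists>C>0. \<forall>\<epsilon>\<in>U. \<forall>N.
           F_norm T H (\<lambda>x. g \<epsilon> x - (\<Sum>n\<le>N. gh n x * \<epsilon> ^ n)) \<le>
             C * A ^ (N + 1) * q powr (real N * (real N + 1) / (2 * k)) * cmod \<epsilon> ^ (N + 1)))"

definition F_convergent :: "complex set \<Rightarrow> complex set \<Rightarrow> (nat \<Rightarrow> complex \<times> complex \<Rightarrow> complex) \<Rightarrow> bool" where
  "F_convergent T H a \<longleftrightarrow>
     (\<forall>n. a n \<in> F_space T H) \<and> (\<exists>r>0. summable (\<lambda>n. F_norm T H (a n) * r ^ n))"

text \<open>The formal series \<open>\<sigma>\<^sub>q\<^sup>\<gamma> R(\<partial>\<^sub>z) g\<close> in \<open>\<epsilon>\<close>, evaluated at the point \<open>(t, z)\<close>.\<close>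

definition formal_op :: "real \<Rightarrow> real \<Rightarrow> complex poly \<Rightarrow> (nat \<Rightarrow> complex \<times> complex \<Rightarrow> complex) \<Rightarrow>
    complex \<Rightarrow> complex \<Rightarrow> complex fps" where
  "formal_op q \<gamma> R g t z =
     Abs_fps (\<lambda>n. sigma_q q \<gamma> (\<lambda>t'. poly_diff R (\<lambda>\<zeta>. g n (t', \<zeta>)) z) t)"

text \<open>
  The points \<open>t\<close> at which all dilations occurring in the main problem stay in the sector \<open>T\<close>,
  i.e. at which all terms of the main problem are defined.
\<close>

definition t_dom :: "real \<Rightarrow> nat \<Rightarrow> nat \<Rightarrow> nat \<Rightarrow> (nat \<Rightarrow> nat) \<Rightarrow> complex set \<Rightarrow> complex set" where
  "t_dom q k2 D d\<^sub>D \<delta> T =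
     {t. of_real q * t \<in> T \<and> of_real (q powr (real d\<^sub>D / real k2 + 1)) * t \<in> T \<and>
         (\<forall>j\<in>{1..D-1}. of_real (q powr real (\<delta> j)) * t \<in> T)}"

section \<open>The setting\<close>

text \<open>
  The index written \<open>\<ell>\<close> in the equations is called \<open>j\<close>, and \<open>\<lambda> \<in> I\<^sub>\<ell>\<close> is called \<open>l \<in> I j\<close>.
  \<open>R D\<close> is the leading polynomial \<open>R\<^sub>D\<close>; \<open>C' l j\<close> and \<open>C\<^sub>F\<close> are the bounds for \<open>C l j\<close> and \<open>F\<close>.
\<close>

locale q_data =
  fixes q :: real and k1 k2 D d\<^sub>D :: nat
    and I :: "nat \<Rightarrow> nat set" and \<delta> :: "nat \<Rightarrow> nat" and d \<Delta> :: "nat \<Rightarrow> nat \<Rightarrow> nat"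
    and Q :: "complex poly" and R :: "nat \<Rightarrow> complex poly"
    and r\<^sub>Q d\<^sub>Q \<eta>\<^sub>Q :: real
    and \<beta> \<mu> \<beta>' \<epsilon>\<^sub>0 \<rho> :: real
    and C :: "nat \<Rightarrow> nat \<Rightarrow> real \<Rightarrow> complex \<Rightarrow> complex" and C' :: "nat \<Rightarrow> nat \<Rightarrow> real"
    and F :: "nat \<Rightarrow> real \<Rightarrow> complex \<Rightarrow> complex" and C\<^sub>F :: real
    and \<kappa> :: real and c :: "nat \<Rightarrow> nat \<Rightarrow> complex \<Rightarrow> complex \<Rightarrow> complex"
  assumes q: "q > 1"
    and k: "1 \<le> k1" "k1 < k2" and D: "D \<ge> 3" and dD: "d\<^sub>D \<ge> 1"
    and kappa: "1 / \<kappa> = 1 / real k1 - 1 / real k2"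
    and I: "\<And>j. j \<in> {1..D-1} \<Longrightarrow> finite (I j) \<and> I j \<noteq> {}"
    and delta_pos: "\<And>j. j \<in> {1..D-1} \<Longrightarrow> \<delta> j \<ge> 1"
    and delta_1: "\<delta> 1 = 1"
    and delta_mono: "\<And>j. j \<in> {1..D-2} \<Longrightarrow> \<delta> j < \<delta> (Suc j)"
    and d: "\<And>j l. j \<in> {1..D-1} \<Longrightarrow> l \<in> I j \<Longrightarrow> d l j \<ge> 1"
    and Delta: "\<And>j l. j \<in> {1..D-1} \<Longrightarrow> l \<in> I j \<Longrightarrow> \<Delta> l j \<ge> d l j"
    and d_delta: "\<And>j l. j \<in> {1..D-1} \<Longrightarrow> l \<in> I j \<Longrightarrow> real (d l j) / real k2 + 1 \<ge> real (\<delta> j)"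
    and dD_delta: "\<And>j. j \<in> {1..D-1} \<Longrightarrow> (real d\<^sub>D - 1) / real k2 + 1 \<ge> real (\<delta> j)"
    and deg_Q: "degree Q \<ge> degree (R D)"
    and deg_R: "\<And>j. j \<in> {1..D-1} \<Longrightarrow> degree (R D) \<ge> degree (R j)"
    and Q_nz: "\<And>m. poly Q (\<i> * of_real m) \<noteq> 0"
    and RD_nz: "\<And>m. poly (R D) (\<i> * of_real m) \<noteq> 0"
    and sector_pos: "r\<^sub>Q > 0" "\<eta>\<^sub>Q > 0"
    and quotient_in_sector: "\<And>m. poly Q (\<i> * of_real m) / poly (R D) (\<i> * of_real m) \<in>
          {of_real s * cis \<theta> | s \<theta>. s \<ge> r\<^sub>Q \<and> \<bar>\<theta> - d\<^sub>Q\<bar> \<le> \<eta>\<^sub>Q}"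
    and beta: "\<beta> > 0" and mu: "\<mu> > real (degree (R D)) + 1"
    and beta': "0 < \<beta>'" "\<beta>' < \<beta>"
    and eps0: "0 < \<epsilon>\<^sub>0" and rho: "0 < \<rho>"
    and C_holo: "\<And>j l. j \<in> {1..D-1} \<Longrightarrow> l \<in> I j \<Longrightarrow>
          holo_into (E_space \<beta> \<mu>) (E_norm \<beta> \<mu>) (ball 0 \<epsilon>\<^sub>0) (\<lambda>\<epsilon> m. C l j m \<epsilon>)"
    and C_bound: "\<And>j l \<epsilon>. j \<in> {1..D-1} \<Longrightarrow> l \<in> I j \<Longrightarrow> \<epsilon> \<in> ball 0 \<epsilon>\<^sub>0 \<Longrightarrow>
          E_norm \<beta> \<mu> (\<lambda>m. C l j m \<epsilon>) \<le> C' l j"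
    and F_holo: "\<And>n. holo_into (E_space \<beta> \<mu>) (E_norm \<beta> \<mu>) (ball 0 \<epsilon>\<^sub>0) (\<lambda>\<epsilon> m. F n m \<epsilon>)"
    and F_bound: "\<And>n \<epsilon>. \<epsilon> \<in> ball 0 \<epsilon>\<^sub>0 \<Longrightarrow>
          E_norm \<beta> \<mu> (\<lambda>m. F n m \<epsilon>) \<le>
            C\<^sub>F * (1 / \<rho>) ^ n * q powr (real n * (real n - 1) / (2 * real k1))"
    and c_eq: "\<And>l j z \<epsilon>. c l j z \<epsilon> = inv_fourier (\<lambda>m. C l j m \<epsilon>) z"
begin

text \<open>
  The two auxiliary problems in the Borel plane, on the set \<open>X\<close> of values of \<open>\<tau>\<close>:
  \<open>k = k\<^sub>1\<close>, \<open>s = d\<^sub>D / \<kappa>\<close> gives the first and \<open>k = k\<^sub>2\<close>, \<open>s = 0\<close> the second one.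
\<close>

definition aux_equation :: "nat \<Rightarrow> real \<Rightarrow> complex set \<Rightarrow> complex \<Rightarrow>
    (complex \<Rightarrow> real \<Rightarrow> complex) \<Rightarrow> (complex \<Rightarrow> real \<Rightarrow> complex) \<Rightarrow> bool" where
  "aux_equation k s X \<epsilon> \<psi> w \<longleftrightarrow> (\<forall>\<tau>\<in>X. \<forall>m.
     poly Q (\<i> * of_real m) * (\<tau> ^ k / of_real (cq q k k)) * w \<tau> m =
       \<tau> ^ (d\<^sub>D + k) / of_real (cq q k (d\<^sub>D + k)) *
         sigma_q q (- s) (\<lambda>\<tau>'. poly (R D) (\<i> * of_real m) * w \<tau>' m) \<tau>
       + (\<Sum>j=1..D-1. \<Sum>l\<in>I j.
           \<epsilon> ^ (\<Delta> l j - d l j) * \<tau> ^ (d l j + k) / of_real (cq q k (d l j + k)) *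
           sigma_q q (real (\<delta> j) - real (d l j) / real k - 1)
             (\<lambda>\<tau>'. of_real (1 / sqrt (2 * pi)) * rconv (R j) (\<lambda>m'. C l j m' \<epsilon>) (w \<tau>') m) \<tau>)
       + \<tau> ^ k / of_real (cq q k k) * \<psi> \<tau> m)"

text \<open>The main problem on \<open>T \<times> H \<times> E\<close> for a forcing term \<open>f\<close> and an unknown \<open>u\<close>.\<close>

definition main_problem :: "complex set \<Rightarrow> complex set \<Rightarrow> complex set \<Rightarrow>
    (complex \<Rightarrow> complex \<Rightarrow> complex \<Rightarrow> complex) \<Rightarrow> (complex \<Rightarrow> complex \<Rightarrow> complex \<Rightarrow> complex) \<Rightarrow> bool" where
  "main_problem T H E f u \<longleftrightarrow> (\<forall>t\<in>t_dom q k2 D d\<^sub>D \<delta> T. \<forall>z\<in>H. \<forall>\<epsilon>\<in>E.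
     sigma_q q 1 (\<lambda>t'. poly_diff Q (\<lambda>\<zeta>. u t' \<zeta> \<epsilon>) z) t =
       (\<epsilon> * t) ^ d\<^sub>D *
         sigma_q q (real d\<^sub>D / real k2 + 1) (\<lambda>t'. poly_diff (R D) (\<lambda>\<zeta>. u t' \<zeta> \<epsilon>) z) t
       + (\<Sum>j=1..D-1. \<Sum>l\<in>I j. t ^ d l j * \<epsilon> ^ \<Delta> l j *
           sigma_q q (real (\<delta> j)) (\<lambda>t'. c l j z \<epsilon> * poly_diff (R j) (\<lambda>\<zeta>. u t' \<zeta> \<epsilon>) z) t)
       + sigma_q q 1 (\<lambda>t'. f t' z \<epsilon>) t)"

end

text \<open>
  \<open>n\<^sub>E\<close> is the number of sectors, \<open>\<delta>\<^sub>0\<close> the shift in the weight of the first \<open>Exp\<close> spaces and \<open>\<delta>\<^sub>1\<close> the constant defining the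
  domains \<open>Rb p\<close>; \<open>dir p\<close> is the bisecting direction; \<open>rt l m\<close> are the roots of \<open>P\<^sub>m\<close>.
\<close>

locale q_family = q_data q k1 k2 D d\<^sub>D I \<delta> d \<Delta> Q R r\<^sub>Q d\<^sub>Q \<eta>\<^sub>Q \<beta> \<mu> \<beta>' \<epsilon>\<^sub>0 \<rho> C C' F C\<^sub>F \<kappa> c
  for q k1 k2 D d\<^sub>D I \<delta> d \<Delta> Q R r\<^sub>Q d\<^sub>Q \<eta>\<^sub>Q \<beta> \<mu> \<beta>' \<epsilon>\<^sub>0 \<rho> C C' F C\<^sub>F \<kappa> c +
  fixes \<alpha> \<nu> :: real and n\<^sub>E :: nat and E :: "nat \<Rightarrow> complex set"
    and dir :: "nat \<Rightarrow> real" and U S :: "nat \<Rightarrow> complex set"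
    and \<delta>\<^sub>0 \<delta>\<^sub>1 r\<^sub>T :: real and T H :: "complex set" and Rb :: "nat \<Rightarrow> complex set"
    and rt :: "nat \<Rightarrow> real \<Rightarrow> complex"
  assumes covering: "good_covering n\<^sub>E \<epsilon>\<^sub>0 E"
    and U: "\<And>p. p < n\<^sub>E \<Longrightarrow> is_unbounded_sector (dir p) (U p)"
    and S: "\<And>p. p < n\<^sub>E \<Longrightarrow> is_unbounded_sector (dir p) (S p)"
    and delta0: "\<delta>\<^sub>0 > 0" "\<And>p. p < n\<^sub>E \<Longrightarrow> infdist (- of_real \<delta>\<^sub>0) (U p \<union> ball 0 \<rho>) > 0"
    and delta1: "\<delta>\<^sub>1 > 0"
    and T: "is_sector r\<^sub>T T" and H_eq: "H = strip \<beta>'"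
    and small: "\<epsilon>\<^sub>0 < 1" "0 < r\<^sub>T" "r\<^sub>T < 1"
    and Rb_eq: "\<And>p. Rb p = Rb_dom (dir p) \<delta>\<^sub>1 (\<epsilon>\<^sub>0 * r\<^sub>T)"
    and Rb_sub: "\<And>p. p < n\<^sub>E \<Longrightarrow> Rb p \<subseteq> cball 0 \<rho>"
    and S_sub: "\<And>p. p < n\<^sub>E \<Longrightarrow> S p \<subseteq> R_dom (dir p) \<delta>\<^sub>1"
    and nu_small: "\<nu> + real k2 / ln q * ln r\<^sub>T < 0"
    and alpha_small: "\<alpha> + \<kappa> / ln q * ln (\<epsilon>\<^sub>0 * r\<^sub>T) < 0"
    and radius_small: "\<epsilon>\<^sub>0 * r\<^sub>T \<le> q powr ((1 / 2 - \<nu>) / real k2) / 2"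
    and roots: "\<And>m. bij_betw (\<lambda>l. rt l m) {..<d\<^sub>D}
          {\<tau>. poly Q (\<i> * of_real m) / of_real (cq q k2 k2) -
               poly (R D) (\<i> * of_real m) / of_real (cq q k2 (d\<^sub>D + k2)) * \<tau> ^ d\<^sub>D = 0}"
    and root_dist: "\<exists>M1>0. \<forall>l<d\<^sub>D. \<forall>m. \<forall>p<n\<^sub>E. \<forall>\<tau>\<in>S p \<union> cball 0 \<rho>.
          cmod (\<tau> - rt l m) \<ge> M1 * (1 + cmod \<tau>)"
    and root_dist': "\<exists>M2>0. \<exists>l0<d\<^sub>D. \<forall>m. \<forall>p<n\<^sub>E. \<forall>\<tau>\<in>S p \<union> cball 0 \<rho>.
          cmod (\<tau> - rt l0 m) \<ge> M2 * cmod (rt l0 m)"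
    and Rb_inter: "\<And>p. p < n\<^sub>E \<Longrightarrow> Rb p \<inter> Rb (Suc p mod n\<^sub>E) \<noteq> {}"
    and eps_t: "\<And>p t \<epsilon>. p < n\<^sub>E \<Longrightarrow> t \<in> T \<Longrightarrow> \<epsilon> \<in> E p \<Longrightarrow> \<epsilon> * t \<in> Rb p"

text \<open>
  \<open>\<psi>1\<close>, \<open>\<psi>2\<close>, \<open>w1\<close>, \<open>w2\<close> take the arguments \<open>p \<tau> m \<epsilon>\<close>, and \<open>f\<close>, \<open>u\<close> the arguments \<open>p t z \<epsilon>\<close>.
  \<open>Z\<close> bounds the norms of \<open>\<psi>1\<close>, and \<open>fh n / n!\<close> are the coefficients of the expansion of the \<open>f p\<close>.

  \<open>\<gamma> p x\<close> is the direction of the halfline used for \<open>u p\<close> at \<open>\<epsilon> t = x\<close>. The integrand has its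
  poles on the halfline through \<open>- x\<close>. For a wide sector \<open>S p\<close> the integral is independent of the
  direction only as long as this halfline is not crossed; assumption \<open>gamma\<close> therefore asks that
  the halflines in the directions between \<open>dir p\<close> and \<open>\<gamma> p x\<close> stay in \<open>S p\<close> and avoid \<open>- x\<close>
  (the choice \<open>\<gamma> p x = dir p\<close> is always admissible).
\<close>

locale q_solutions = q_family q k1 k2 D d\<^sub>D I \<delta> d \<Delta> Q R r\<^sub>Q d\<^sub>Q \<eta>\<^sub>Q \<beta> \<mu> \<beta>' \<epsilon>\<^sub>0 \<rho> C C' F C\<^sub>F \<kappa> c
    \<alpha> \<nu> n\<^sub>E E dir U S \<delta>\<^sub>0 \<delta>\<^sub>1 r\<^sub>T T H Rb rt
  for q k1 k2 D d\<^sub>D I \<delta> d \<Delta> Q R r\<^sub>Q d\<^sub>Q \<eta>\<^sub>Q \<beta> \<mu> \<beta>' \<epsilon>\<^sub>0 \<rho> C C' F C\<^sub>F \<kappa> c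
    \<alpha> \<nu> n\<^sub>E E dir U S \<delta>\<^sub>0 \<delta>\<^sub>1 r\<^sub>T T H Rb rt +
  fixes \<psi>1 \<psi>2 :: "nat \<Rightarrow> complex \<Rightarrow> real \<Rightarrow> complex \<Rightarrow> complex" and Z :: real
    and f :: "nat \<Rightarrow> complex \<Rightarrow> complex \<Rightarrow> complex \<Rightarrow> complex"
    and W :: real and w1 w2 :: "nat \<Rightarrow> complex \<Rightarrow> real \<Rightarrow> complex \<Rightarrow> complex"
    and \<gamma> :: "nat \<Rightarrow> complex \<Rightarrow> real"
    and u :: "nat \<Rightarrow> complex \<Rightarrow> complex \<Rightarrow> complex \<Rightarrow> complex"
    and fh :: "nat \<Rightarrow> complex \<times> complex \<Rightarrow> complex"
  assumes alpha: "\<alpha> > 0"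
    and psi1_series: "\<And>p \<tau> m \<epsilon>. p < n\<^sub>E \<Longrightarrow> \<tau> \<in> ball 0 \<rho> \<Longrightarrow> \<epsilon> \<in> ball 0 \<epsilon>\<^sub>0 \<Longrightarrow>
          (\<lambda>n. F n m \<epsilon> * \<tau> ^ n / of_real (cq q k1 n)) sums \<psi>1 p \<tau> m \<epsilon>"
    and psi1_Exp: "\<And>p \<epsilon>. p < n\<^sub>E \<Longrightarrow> \<epsilon> \<in> ball 0 \<epsilon>\<^sub>0 \<Longrightarrow>
          (\<lambda>(\<tau>, m). \<psi>1 p \<tau> m \<epsilon>) \<in> Exp1_space q k1 \<beta> \<mu> \<alpha> \<delta>\<^sub>0 \<rho> (U p) \<and>
          Exp1_norm q k1 \<beta> \<mu> \<alpha> \<delta>\<^sub>0 \<rho> (U p) (\<lambda>(\<tau>, m). \<psi>1 p \<tau> m \<epsilon>) \<le> Z"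
    and psi2_eq: "\<And>p \<tau> m \<epsilon>. \<psi>2 p \<tau> m \<epsilon> = qlaplace q \<kappa> (dir p) (\<lambda>h. \<psi>1 p h m \<epsilon>) \<tau>"
    and psi2_Exp: "\<exists>B. \<forall>p<n\<^sub>E. \<forall>\<epsilon>\<in>ball 0 \<epsilon>\<^sub>0.
          (\<lambda>(\<tau>, m). \<psi>2 p \<tau> m \<epsilon>) \<in> Exp2_space q k2 \<beta> \<mu> \<nu> (S p) (Rb p) \<and>
          Exp2_norm q k2 \<beta> \<mu> \<nu> (S p) (Rb p) (\<lambda>(\<tau>, m). \<psi>2 p \<tau> m \<epsilon>) \<le> B"
    and f_eq: "\<And>p t z \<epsilon>. f p t z \<epsilon> =
          inv_fourier (\<lambda>m. qlaplace q k2 (dir p) (\<lambda>\<tau>. \<psi>2 p \<tau> m \<epsilon>) (\<epsilon> * t)) z"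
    and f_holo: "\<And>p. p < n\<^sub>E \<Longrightarrow> holomorphic3_on (\<lambda>(t, z, \<epsilon>). f p t z \<epsilon>) (T \<times> H \<times> E p)"
    and f_bounded: "\<And>p. p < n\<^sub>E \<Longrightarrow> bounded ((\<lambda>(t, z, \<epsilon>). f p t z \<epsilon>) ` (T \<times> H \<times> E p))"
    and W: "W > 0"
    and w1_sol: "\<And>p \<epsilon>. p < n\<^sub>E \<Longrightarrow> \<epsilon> \<in> ball 0 \<epsilon>\<^sub>0 \<Longrightarrow>
          (\<lambda>(\<tau>, m). w1 p \<tau> m \<epsilon>) \<in> Exp1_space q \<kappa> \<beta> \<mu> \<alpha> \<delta>\<^sub>0 \<rho> (U p) \<and>
          Exp1_norm q \<kappa> \<beta> \<mu> \<alpha> \<delta>\<^sub>0 \<rho> (U p) (\<lambda>(\<tau>, m). w1 p \<tau> m \<epsilon>) \<le> W \<and>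
          aux_equation k1 (real d\<^sub>D / \<kappa>) (U p \<union> cball 0 \<rho>) \<epsilon>
            (\<lambda>\<tau> m. \<psi>1 p \<tau> m \<epsilon>) (\<lambda>\<tau> m. w1 p \<tau> m \<epsilon>)"
    and w1_unique: "\<And>p \<epsilon> w \<tau> m. p < n\<^sub>E \<Longrightarrow> \<epsilon> \<in> ball 0 \<epsilon>\<^sub>0 \<Longrightarrow>
          (\<lambda>(\<tau>, m). w \<tau> m) \<in> Exp1_space q \<kappa> \<beta> \<mu> \<alpha> \<delta>\<^sub>0 \<rho> (U p) \<Longrightarrow>
          Exp1_norm q \<kappa> \<beta> \<mu> \<alpha> \<delta>\<^sub>0 \<rho> (U p) (\<lambda>(\<tau>, m). w \<tau> m) \<le> W \<Longrightarrow>
          aux_equation k1 (real d\<^sub>D / \<kappa>) (U p \<union> cball 0 \<rho>) \<epsilon> (\<lambda>\<tau> m. \<psi>1 p \<tau> m \<epsilon>) w \<Longrightarrow>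
          \<tau> \<in> U p \<union> cball 0 \<rho> \<Longrightarrow> w \<tau> m = w1 p \<tau> m \<epsilon>"
    and w2_sol: "\<And>p \<epsilon>. p < n\<^sub>E \<Longrightarrow> \<epsilon> \<in> ball 0 \<epsilon>\<^sub>0 \<Longrightarrow>
          (\<lambda>(\<tau>, m). w2 p \<tau> m \<epsilon>) \<in> Exp2_space q k2 \<beta> \<mu> \<nu> (S p) (Rb p) \<and>
          Exp2_norm q k2 \<beta> \<mu> \<nu> (S p) (Rb p) (\<lambda>(\<tau>, m). w2 p \<tau> m \<epsilon>) \<le> W \<and>
          aux_equation k2 0 (Exp2_dom (S p) (Rb p)) \<epsilon>
            (\<lambda>\<tau> m. \<psi>2 p \<tau> m \<epsilon>) (\<lambda>\<tau> m. w2 p \<tau> m \<epsilon>)"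
    and w2_unique: "\<And>p \<epsilon> w \<tau> m. p < n\<^sub>E \<Longrightarrow> \<epsilon> \<in> ball 0 \<epsilon>\<^sub>0 \<Longrightarrow>
          (\<lambda>(\<tau>, m). w \<tau> m) \<in> Exp2_space q k2 \<beta> \<mu> \<nu> (S p) (Rb p) \<Longrightarrow>
          aux_equation k2 0 (Exp2_dom (S p) (Rb p)) \<epsilon> (\<lambda>\<tau> m. \<psi>2 p \<tau> m \<epsilon>) w \<Longrightarrow>
          \<tau> \<in> Exp2_dom (S p) (Rb p) \<Longrightarrow> w \<tau> m = w2 p \<tau> m \<epsilon>"
    and w1_holo: "\<And>p \<tau> m. p < n\<^sub>E \<Longrightarrow> \<tau> \<in> U p \<union> cball 0 \<rho> \<Longrightarrow>
          (\<lambda>\<epsilon>. w1 p \<tau> m \<epsilon>) holomorphic_on ball 0 \<epsilon>\<^sub>0"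
    and w2_holo: "\<And>p \<tau> m. p < n\<^sub>E \<Longrightarrow> \<tau> \<in> Exp2_dom (S p) (Rb p) \<Longrightarrow>
          (\<lambda>\<epsilon>. w2 p \<tau> m \<epsilon>) holomorphic_on ball 0 \<epsilon>\<^sub>0"
    and w2_continuation: "\<And>p \<tau> m \<epsilon>. p < n\<^sub>E \<Longrightarrow> \<epsilon> \<in> ball 0 \<epsilon>\<^sub>0 \<Longrightarrow> \<tau> \<in> Rb p \<Longrightarrow>
          w2 p \<tau> m \<epsilon> = qlaplace q \<kappa> (dir p) (\<lambda>h. w1 p h m \<epsilon>) \<tau>"
    and gamma: "\<And>p t \<epsilon> \<theta>. p < n\<^sub>E \<Longrightarrow> t \<in> T \<Longrightarrow> \<epsilon> \<in> E p \<Longrightarrow>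
          \<theta> \<in> closed_segment (dir p) (\<gamma> p (\<epsilon> * t)) \<Longrightarrow>
          halfline \<theta> \<subseteq> S p \<and> - (\<epsilon> * t) \<notin> halfline \<theta>"
    and u_eq: "\<And>p t z \<epsilon>. u p t z \<epsilon> =
          inv_fourier (\<lambda>m. qlaplace q k2 (\<gamma> p (\<epsilon> * t)) (\<lambda>\<tau>. w2 p \<tau> m \<epsilon>) (\<epsilon> * t)) z"
    and u_holo: "\<And>p. p < n\<^sub>E \<Longrightarrow> holomorphic3_on (\<lambda>(t, z, \<epsilon>). u p t z \<epsilon>) (T \<times> H \<times> E p)"
    and u_bounded: "\<And>p. p < n\<^sub>E \<Longrightarrow> bounded ((\<lambda>(t, z, \<epsilon>). u p t z \<epsilon>) ` (T \<times> H \<times> E p))"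
    and u_solves: "\<And>p. p < n\<^sub>E \<Longrightarrow> main_problem T H (E p) (f p) (u p)"
    and f_expansion: "\<And>p. p < n\<^sub>E \<Longrightarrow>
          qgevrey_expansion q k1 T H (E p) (\<lambda>\<epsilon> (t, z). f p t z \<epsilon>) (\<lambda>n x. fh n x / fact n)"

end

theory Submission
  imports Defs
begin

text \<open>
  A finite version of the triple product gives a sharp lower bound for the theta function off the
  negative axis. It makes the q-Laplace transform along a halfline independent of the direction, and
  it shows, by a Taylor estimate near the vertex and a q-exponentially flat tail, that the transform
  maps an expansion with coefficients of growth \<open>exp (sg n\<^sup>2 / 2)\<close> to one with growth
  \<open>exp ((sg + la) n\<^sup>2 / 2)\<close>, uniformly in the parameters. Since \<open>1 / k1 = 1 / \<kappa> + 1 / k2\<close>, applying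
  this twice, to the convergent Taylor series of \<open>w1 p\<close> at 0 and then to \<open>w2 p\<close>, gives an expansion
  of \<open>u p\<close> of order \<open>1 / k1\<close>; no Cauchy-Heine argument on overlapping sectors is needed, because the
  recursion for the Taylor coefficients of \<open>w1 p\<close> does not involve \<open>p\<close>. The formal equation follows
  from the uniqueness of asymptotic series along a ray. The splitting
  of the expansion holds with \<open>a = 0\<close> and vanishing part of order \<open>1 / k2\<close>, because the whole
  of \<open>u p\<close> already has an expansion of order \<open>1 / k1\<close>.
\<close>

section \<open>The theta function\<close>

text \<open>With \<open>la = ln q / k\<close> one has q^(n(n-1)/(2k)) = exp (la n (n-1) / 2), and
  the part of the exponent that is linear in n goes into a geometric factor A^n. Keeping only the
  quadratic rate turns 1/k1 = 1/\<kappa> + 1/k2 into \<open>la1 = lak + la2\<close>, and this is how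
  the orders add up. The inverse Fourier integral comes last, so the estimates need one constant for
  all \<epsilon>, all points of \<open>Rb p\<close> and, up to division by \<open>E_weight\<close>,
  all m. Therefore Theta is bounded below outside a sector around the negative axis by an explicit
  function with the same quadratic exponent as the weights of the \<open>Exp\<close> spaces. In the
  tail the quadratic parts cancel, and what remains is linear in ln r with coefficient \<alpha> + ln
  t / la (with \<nu> in place of \<alpha> in the second transform); the smallness assumptions make
  this coefficient negative. The tail is then smaller than every power of t, with the constants of a
  q-Gevrey estimate. So the germ at 0 alone determines the expansion, and this germ is the same for
  all p.\<close>

definition theta_coeff :: "real \<Rightarrow> int \<Rightarrow> real" where
  "theta_coeff s i = s powr (real_of_int (i * (i - 1)) / 2)"

lemma theta_coeff_pos: "s > 0 \<Longrightarrow> theta_coeff s i > 0"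
  by (simp add: theta_coeff_def)

lemma theta_coeff_minus_1:
  assumes "s > 0"
  shows "theta_coeff s (i - 1) = s powr (1 - real_of_int i) * theta_coeff s i"
  using assms unfolding theta_coeff_def
  by (subst powr_add[symmetric]) (simp add: field_simps)

lemma theta_coeff_plus_1:
  assumes "s > 0"
  shows "theta_coeff s (i + 1) = s powr (real_of_int i) * theta_coeff s i"
  using assms unfolding theta_coeff_def
  by (subst powr_add[symmetric]) (simp add: field_simps)

text \<open>The ratio of consecutive terms is s^n R, which drops below 1/2 from some index
  on.\<close>

lemma theta_majorant_summable_nat:
  assumes s: "0 < s" "s < 1" and R: "R \<ge> (1::real)"
  shows "summable (\<lambda>n. theta_coeff s (int n) * R ^ n)"
proof -
  have "(\<lambda>n. s ^ n * R) \<longlonglongrightarrow> 0 * R"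
    by (intro tendsto_intros LIMSEQ_realpow_zero) (use s in auto)
  then have "eventually (\<lambda>n. s ^ n * R < 1/2) sequentially"
    by (intro order_tendstoD) auto
  then obtain N where N: "\<And>n. n \<ge> N \<Longrightarrow> s ^ n * R < 1/2"
    by (auto simp: eventually_sequentially)
  show ?thesis
  proof (rule summable_ratio_test[of "1/2" N])
    fix n assume n: "n \<ge> N"
    have "theta_coeff s (int (Suc n)) = s ^ n * theta_coeff s (int n)"
      using theta_coeff_plus_1[of s "int n"] s by (simp add: powr_realpow add.commute)
    then have "theta_coeff s (int (Suc n)) * R ^ Suc n
        = (s ^ n * R) * (theta_coeff s (int n) * R ^ n)" by simp
    also have "\<dots> \<le> 1/2 * (theta_coeff s (int n) * R ^ n)"
      using N[OF n] s R by (intro mult_right_mono) (auto simp: theta_coeff_def)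
    finally show "norm (theta_coeff s (int (Suc n)) * R ^ Suc n)
        \<le> 1/2 * norm (theta_coeff s (int n) * R ^ n)"
      using s R by (simp add: theta_coeff_def)
  qed simp
qed

text \<open>If R bounds both |x| and 1/|x|, then R^|i| bounds |x powi i| in both directions, so this
  one series dominates the Laurent series of Theta on a whole annulus.\<close>

lemma theta_majorant_summable:
  assumes s: "0 < s" "s < 1" and R: "R \<ge> (1::real)"
  shows "(\<lambda>i::int. theta_coeff s i * R ^ nat \<bar>i\<bar>) summable_on UNIV"
proof -
  have U: "(UNIV :: int set) = range int \<union> range (\<lambda>n. - int n - 1)"
  proof (intro equalityI subsetI)
    fix i :: int
    show "i \<in> range int \<union> range (\<lambda>n. - int n - 1)"
    proof (cases "i \<ge> 0")
      case True
      then have "i = int (nat i)" by simp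
      then show ?thesis by blast
    next
      case False
      then have "i = - int (nat (- i - 1)) - 1" by simp
      then show ?thesis by blast
    qed
  qed simp
  have 1: "(\<lambda>i::int. theta_coeff s i * R ^ nat \<bar>i\<bar>) summable_on range int"
    using theta_majorant_summable_nat[OF assms] s R
    by (subst summable_on_reindex)
       (auto simp: o_def theta_coeff_def intro!: norm_summable_imp_summable_on)
  have 2: "(\<lambda>i::int. theta_coeff s i * R ^ nat \<bar>i\<bar>) summable_on range (\<lambda>n. - int n - 1)"
  proof -
    have "summable (\<lambda>n. norm (theta_coeff s (- int n - 1) * R ^ nat \<bar>- int n - 1\<bar>))"
    proof (rule summable_comparison_test'[of "\<lambda>n. theta_coeff s (int n) * R ^ n * R"])
      show "summable (\<lambda>n. theta_coeff s (int n) * R ^ n * R)"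
        by (intro summable_mult2 theta_majorant_summable_nat assms)
      fix n :: nat
      \<comment> \<open>At -n-1 the exponent of s is (n+1)(n+2)/2, at n it is n(n-1)/2, and s < 1.
        The additional factor R in the majorant pays for |-n-1| = n+1.\<close>
      have "theta_coeff s (- int n - 1) \<le> theta_coeff s (int n)"
        unfolding theta_coeff_def using s by (intro powr_mono') (auto simp: field_simps)
      moreover have "nat \<bar>- int n - 1\<bar> = Suc n" by simp
      ultimately show "norm (norm (theta_coeff s (- int n - 1) * R ^ nat \<bar>- int n - 1\<bar>))
          \<le> theta_coeff s (int n) * R ^ n * R"
        using s R theta_coeff_pos[OF s(1)] by (simp add: abs_mult less_imp_le mult.commute)
    qed
    moreover have "inj (\<lambda>n. - int n - 1)" by (auto simp: inj_def)
    ultimately show ?thesis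
      by (subst summable_on_reindex) (auto simp: o_def intro!: norm_summable_imp_summable_on)
  qed
  show ?thesis unfolding U
    by (intro summable_on_Un_disjoint 1 2) auto
qed

lemma norm_powi_le_abs:
  fixes x :: complex
  assumes "x \<noteq> 0" "cmod x \<le> R" "inverse (cmod x) \<le> R"
  shows "cmod (x powi i) \<le> R ^ nat \<bar>i\<bar>"
proof (cases "i \<ge> 0")
  case True
  then show ?thesis using assms
    by (simp add: power_int_def norm_power power_mono)
next
  case False
  then show ?thesis using assms
    by (auto simp: power_int_def norm_power norm_inverse power_mono)
qed

lemma theta_term_le:
  fixes x :: complex
  assumes "0 < s" "x \<noteq> 0" "cmod x \<le> R" "inverse (cmod x) \<le> R"
  shows "norm (of_real (theta_coeff s i) * x powi i) \<le> theta_coeff s i * R ^ nat \<bar>i\<bar>"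
  using norm_powi_le_abs[OF assms(2-4), of i] theta_coeff_pos[OF assms(1), of i]
  by (simp add: norm_mult less_imp_le)

definition Theta :: "real \<Rightarrow> complex \<Rightarrow> complex" where
  "Theta s x = (\<Sum>\<^sub>\<infinity>i::int. of_real (theta_coeff s i) * x powi i)"

text \<open>Passing from q > 1 and k to the single base s = q^(-1/k) < 1 turns the theta function
  into the standard one of the triple product identity.\<close>

lemma jtheta_eq_Theta:
  assumes "q > 1" "k > 0"
  shows "jtheta q k x = Theta (q powr (- 1 / k)) x"
  unfolding jtheta_def Theta_def theta_coeff_def
proof (rule infsum_cong)
  fix i :: int
  have "- (real_of_int i * (real_of_int i - 1)) / (2 * k) = - 1 / k * (real_of_int (i * (i - 1)) / 2)"
    using assms by (simp add: field_simps)
  then show "of_real (q powr (- (real_of_int i * (real_of_int i - 1)) / (2 * k))) * x powi i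
      = of_real ((q powr (- 1 / k)) powr (real_of_int (i * (i - 1)) / 2)) * x powi i"
    by (simp only: powr_powr)
qed

lemma Theta_has_sum:
  assumes s: "0 < s" "s < 1" and x: "x \<noteq> 0"
  shows "((\<lambda>i::int. of_real (theta_coeff s i) * x powi i) has_sum Theta s x) UNIV"
proof -
  define R where "R = max 1 (max (cmod x) (inverse (cmod x)))"
  have "(\<lambda>i::int. theta_coeff s i * R ^ nat \<bar>i\<bar>) summable_on UNIV"
    by (rule theta_majorant_summable) (use s in \<open>auto simp: R_def\<close>)
  then have "(\<lambda>i::int. norm (of_real (theta_coeff s i) * x powi i)) summable_on UNIV"
  proof (rule Infinite_Sum.abs_summable_on_comparison_test')
    show "norm (of_real (theta_coeff s i) * x powi i) \<le> theta_coeff s i * R ^ nat \<bar>i\<bar>" for i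
      by (rule theta_term_le) (use s x in \<open>auto simp: R_def\<close>)
  qed
  then show ?thesis unfolding Theta_def
    by (intro has_sum_infsum) (rule abs_summable_summable)
qed

lemma Theta_holomorphic:
  assumes s: "0 < s" "s < 1"
  shows "Theta s holomorphic_on - {0}"
proof (rule holomorphic_uniform_sequence[where f = "\<lambda>N x. \<Sum>i\<in>{-int N..int N}. of_real (theta_coeff s i) * x powi i"])
  show "open (- {0::complex})" by auto
  show "(\<lambda>x. \<Sum>i\<in>{-int N..int N}. of_real (theta_coeff s i) * x powi i) holomorphic_on - {0}" for N
    by (intro holomorphic_intros) auto
  fix x :: complex assume "x \<in> - {0}"
  then have x: "x \<noteq> 0" by simp
  \<comment> \<open>In the disc of radius |x|/2 around x all moduli lie between d and 3d, so one R
    serves for y and for 1/y.\<close>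
  define d where "d = cmod x / 2"
  have d: "d > 0" using x by (simp add: d_def)
  have bd: "cmod y \<ge> d \<and> cmod y \<le> 3 * d" if "y \<in> cball x d" for y
    using that norm_triangle_ineq2[of x y] norm_triangle_ineq2[of y x]
    by (auto simp: dist_norm d_def norm_minus_commute)
  define R where "R = max 1 (max (3 * d) (inverse d))"
  have "uniform_limit (cball x d) (\<lambda>X y. \<Sum>i\<in>X. of_real (theta_coeff s i) * y powi i)
      (\<lambda>y. \<Sum>\<^sub>\<infinity>i. of_real (theta_coeff s i) * y powi i) (finite_subsets_at_top UNIV)"
  proof (rule Weierstrass_m_test_general[where M = "\<lambda>i. theta_coeff s i * R ^ nat \<bar>i\<bar>"])
    fix i :: int and y assume y: "y \<in> cball x d"
    from bd[OF y] d have "inverse (cmod y) \<le> inverse d" by (intro le_imp_inverse_le) auto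
    then show "norm (of_real (theta_coeff s i) * y powi i) \<le> theta_coeff s i * R ^ nat \<bar>i\<bar>"
      using bd[OF y] d s by (intro theta_term_le) (auto simp: R_def)
  qed (rule theta_majorant_summable; use s in \<open>auto simp: R_def\<close>)
  moreover have "filterlim (\<lambda>N. {-int N..int N}) (finite_subsets_at_top UNIV) sequentially"
  proof (subst filterlim_finite_subsets_at_top, intro allI impI)
    fix Y :: "int set" assume "finite Y \<and> Y \<subseteq> UNIV"
    then have M: "\<bar>y\<bar> \<le> Max (abs ` Y)" if "y \<in> Y" for y
      using that by auto
    show "\<forall>\<^sub>F N in sequentially. finite {-int N..int N} \<and> Y \<subseteq> {-int N..int N} \<and> {-int N..int N} \<subseteq> UNIV"
      using eventually_ge_at_top[of "nat (Max (abs ` Y))"]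
    proof eventually_elim
      case (elim N)
      have "y \<in> {-int N..int N}" if "y \<in> Y" for y using M[OF that] elim by auto
      then show ?case by auto
    qed
  qed
  ultimately have "uniform_limit (cball x d) (\<lambda>N y. \<Sum>i\<in>{-int N..int N}. of_real (theta_coeff s i) * y powi i)
      (\<lambda>y. \<Sum>\<^sub>\<infinity>i. of_real (theta_coeff s i) * y powi i) sequentially"
    by (rule filterlim_compose)
  moreover have "cball x d \<subseteq> - {0}"
  proof
    fix y assume "y \<in> cball x d"
    from bd[OF this] d show "y \<in> - {0}" by auto
  qed
  ultimately show "\<exists>d>0. cball x d \<subseteq> - {0} \<and>
     uniform_limit (cball x d) (\<lambda>N x. \<Sum>i\<in>{-int N..int N}. of_real (theta_coeff s i) * x powi i) (Theta s) sequentially"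
    using d unfolding Theta_def by blast
qed

text \<open>Raising the index by one multiplies the coefficient by s^i, which is the effect of
  dilating x by s. This functional equation later reduces the lower bound to one annulus.\<close>

lemma Theta_shift:
  assumes s: "0 < s" "s < 1" and x: "x \<noteq> 0"
  shows "Theta s (of_real s * x) = Theta s x / x"
proof -
  have "((\<lambda>i::int. of_real (theta_coeff s (i + 1)) * x powi (i + 1) / x) has_sum Theta s x / x) UNIV"
    using has_sum_cmult_left[OF Theta_has_sum[OF s x], of "1 / x"]
      has_sum_reindex_bij_betw[of "\<lambda>i. i + 1" "UNIV::int set" UNIV "\<lambda>i. of_real (theta_coeff s i) * x powi i / x"]
    by (auto simp: bij_betw_def inj_def surj_def)
  moreover have "of_real (theta_coeff s (i + 1)) * x powi (i + 1) / x
      = of_real (theta_coeff s i) * (of_real s * x) powi i" for i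
  proof -
    have "s powr (real_of_int i) = s powi i"
      using s by (simp add: powr_real_of_int')
    then show ?thesis using s x
      by (simp add: theta_coeff_plus_1 power_int_add power_int_mult_distrib of_real_power_int)
  qed
  ultimately have "((\<lambda>i::int. of_real (theta_coeff s i) * (of_real s * x) powi i) has_sum Theta s x / x) UNIV"
    by simp
  moreover have "((\<lambda>i::int. of_real (theta_coeff s i) * (of_real s * x) powi i) has_sum Theta s (of_real s * x)) UNIV"
    using s x by (intro Theta_has_sum) auto
  ultimately show ?thesis using has_sum_unique by blast
qed

section \<open>The finite Jacobi triple product\<close>

definition qpoch :: "real \<Rightarrow> nat \<Rightarrow> real" where
  "qpoch s n = (\<Prod>j<n. 1 - s ^ (j + 1))"

text \<open>The reciprocal of the q-Pochhammer symbol (s; s)_i, extended by 0 to negative i in the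
  manner of 1/Gamma. With this convention the product expansion is a sum over all integers without
  boundary terms.\<close>

definition inv_qpoch :: "real \<Rightarrow> int \<Rightarrow> real" where
  "inv_qpoch s i = (if i < 0 then 0 else 1 / qpoch s (nat i))"

definition triple_prod :: "real \<Rightarrow> nat \<Rightarrow> complex \<Rightarrow> complex" where
  "triple_prod s N x = (\<Prod>j<N. (1 + of_real (s ^ j) * x) * (1 + of_real (s ^ (j + 1)) / x))"

lemma qpoch_pos:
  assumes s: "0 < s" "s < 1"
  shows "qpoch s n > 0"
  unfolding qpoch_def by (rule prod_pos) (use s power_Suc_less_one[of s] in auto)

text \<open>L is the infinite product (s; s)_infinity. It is positive because the sum of the s^j
  converges, and it bounds the partial products from below because they decrease.\<close>

lemma qpoch_limit:
  assumes s: "0 < s" "s < 1"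
  obtains L where "L > 0" "qpoch s \<longlonglongrightarrow> L" "\<And>n. L \<le> qpoch s n"
proof -
  let ?f = "\<lambda>j. 1 - s ^ (j + 1)"
  have "summable (\<lambda>j. norm (?f j - 1))"
    using s by (simp add: summable_mult summable_geometric)
  then have "abs_convergent_prod ?f" by (rule summable_imp_abs_convergent_prod)
  then have conv: "convergent_prod ?f" by (rule abs_convergent_prod_imp_convergent_prod)
  have pos: "0 < ?f j" for j using s power_Suc_less_one[of s] by auto
  have "(\<lambda>n. \<Prod>j\<le>n. ?f j) \<longlonglongrightarrow> prodinf ?f" by (rule convergent_prod_LIMSEQ[OF conv])
  then have "(\<lambda>n. qpoch s (Suc n)) \<longlonglongrightarrow> prodinf ?f"
    by (simp add: qpoch_def lessThan_Suc_atMost)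
  then have lim: "qpoch s \<longlonglongrightarrow> prodinf ?f" by (simp add: filterlim_sequentially_Suc)
  have dec: "decseq (qpoch s)"
  proof (rule decseq_SucI)
    show "qpoch s (Suc n) \<le> qpoch s n" for n
      using qpoch_pos[OF s, of n] s by (simp add: qpoch_def mult_le_cancel_left1)
  qed
  have le: "prodinf ?f \<le> qpoch s n" for n by (rule decseq_ge[OF dec lim])
  have "prodinf ?f \<noteq> 0" using prodinf_nonzero[OF conv] pos by (metis less_irrefl)
  moreover have "prodinf ?f \<ge> 0"
    using lim by (rule LIMSEQ_le_const) (use qpoch_pos[OF s] less_imp_le in blast)
  ultimately show ?thesis using that[of "prodinf ?f"] lim le by simp
qed

text \<open>At i = 0 the factor 1 - s^0 vanishes, and for i < 0 both sides are 0, so the recursion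
  needs no restriction on i.\<close>

lemma inv_qpoch_rec:
  assumes s: "0 < s" "s < 1"
  shows "inv_qpoch s (i - 1) = (1 - s powi i) * inv_qpoch s i"
proof (cases "i \<le> 0")
  case True
  then show ?thesis by (cases "i = 0") (auto simp: inv_qpoch_def)
next
  case False
  then obtain n where n: "i = int n + 1" by (metis add.commute int_ops(4) not_le zero_less_imp_eq_int Suc_pred of_nat_0_less_iff of_nat_Suc)
  have "1 - s ^ (n + 1) > 0" using s power_Suc_less_one[of s] by auto
  moreover have "s powi (int n + 1) = s ^ (n + 1)" using power_int_of_nat[of s "n+1"] by (simp add: add.commute)
  moreover have "nat (int n + 1) = Suc n" by simp
  ultimately show ?thesis using qpoch_pos[OF s, of n] unfolding n
    by (simp add: inv_qpoch_def qpoch_def)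
qed

text \<open>The theta coefficient times the Gaussian binomial coefficient (2N over N+i) in base s;
  it vanishes for |i| > N.\<close>

definition triple_coeff :: "real \<Rightarrow> nat \<Rightarrow> int \<Rightarrow> real" where
  "triple_coeff s N i = theta_coeff s i * qpoch s (2 * N) * inv_qpoch s (int N + i) * inv_qpoch s (int N - i)"

text \<open>The new factor of the product is (1 + s^N x)(1 + s^(N+1)/x) = 1 + s^(2N+1) + s^N x +
  s^(N+1)/x, and the recursion compares the coefficients of x^i.\<close>

lemma triple_coeff_Suc:
  assumes s: "0 < s" "s < 1"
  shows "triple_coeff s (Suc N) i = triple_coeff s N i * (1 + s ^ (2 * N + 1))
    + s ^ N * triple_coeff s N (i - 1) + s ^ (N + 1) * triple_coeff s N (i + 1)"
proof -
  \<comment> \<open>In terms of a and b the neighbouring values of \<open>inv_qpoch\<close> differ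
    from \<open>A\<close> and \<open>B\<close> by the factors 1-a, 1-a/s, 1-b, 1-b/s, and the two
    new factors of \<open>qpoch\<close> are 1-ab/s and 1-ab. The claim becomes a single rational
    identity in a, b and s.\<close>
  define a b where "a = s powi (int N + 1 + i)" and "b = s powi (int N + 1 - i)"
  define A B where "A = inv_qpoch s (int N + 1 + i)" and "B = inv_qpoch s (int N + 1 - i)"
  have s0: "s \<noteq> 0" using s by simp
  have ab: "a * b = s ^ (2 * N + 2)"
    unfolding a_def b_def using s0 power_int_of_nat[of s "2 * N + 2"]
    by (subst power_int_add[symmetric]) (auto simp: add.commute)
  have abs: "a * b / s = s ^ (2 * N + 1)" using ab s0 by simp
  have as: "s powi (int N + i) = a / s"
    unfolding a_def using s0 by (simp add: power_int_add power_int_add_1 add.commute add.left_commute)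
  have bs: "s powi (int N - i) = b / s"
    unfolding b_def using s0 by (simp add: power_int_add power_int_diff)
  have r1: "inv_qpoch s (int N + i) = (1 - a) * A"
    using inv_qpoch_rec[OF s, of "int N + 1 + i"] by (simp add: a_def A_def)
  have r2: "inv_qpoch s (int N - i) = (1 - b) * B"
    using inv_qpoch_rec[OF s, of "int N + 1 - i"] by (simp add: b_def B_def)
  have r3: "inv_qpoch s (int N + (i - 1)) = (1 - a / s) * ((1 - a) * A)"
    using inv_qpoch_rec[OF s, of "int N + i"] unfolding as r1 by (simp only: add_diff_eq)
  have r4: "inv_qpoch s (int N - (i + 1)) = (1 - b / s) * ((1 - b) * B)"
    using inv_qpoch_rec[OF s, of "int N - i"] by (simp add: bs r2 algebra_simps)
  have r5: "inv_qpoch s (int N - (i - 1)) = B" "inv_qpoch s (int N + (i + 1)) = A"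
    by (simp_all add: A_def B_def algebra_simps)
  have r6: "inv_qpoch s (int (Suc N) + i) = A" "inv_qpoch s (int (Suc N) - i) = B"
    by (simp_all add: A_def B_def algebra_simps)
  have t1: "s ^ N * theta_coeff s (i - 1) = b * theta_coeff s i"
  proof -
    have "s powr (1 - real_of_int i) = s powi (1 - i)"
      using s powr_real_of_int'[of s "1 - i"] by simp
    then show ?thesis using s0
      by (simp add: theta_coeff_minus_1[OF s(1)] b_def power_int_add power_int_diff)
  qed
  have t2: "s ^ (N + 1) * theta_coeff s (i + 1) = a * theta_coeff s i"
  proof -
    have "s powr (real_of_int i) = s powi i"
      using s powr_real_of_int'[of s i] by simp
    then show ?thesis using s0
      by (simp add: theta_coeff_plus_1[OF s(1)] a_def power_int_add)
  qed
  have q: "qpoch s (2 * Suc N) = qpoch s (2 * N) * (1 - a * b / s) * (1 - a * b)"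
    unfolding abs ab by (simp add: qpoch_def)
  have "triple_coeff s N i * (1 + s ^ (2 * N + 1)) + s ^ N * triple_coeff s N (i - 1) + s ^ (N + 1) * triple_coeff s N (i + 1)
     = theta_coeff s i * qpoch s (2 * N) * ((1 - a) * A) * ((1 - b) * B) * (1 + a * b / s)
     + (s ^ N * theta_coeff s (i - 1)) * qpoch s (2 * N) * ((1 - a / s) * ((1 - a) * A)) * B
     + (s ^ (N + 1) * theta_coeff s (i + 1)) * qpoch s (2 * N) * A * ((1 - b / s) * ((1 - b) * B))"
    unfolding triple_coeff_def r1 r2 r3 r4 r5 abs by (simp only: mult.assoc mult.commute mult.left_commute)
  also have "\<dots> = theta_coeff s i * qpoch s (2 * N) * A * B *
      ((1 - a) * (1 - b) * (1 + a * b / s) + b * (1 - a / s) * (1 - a) + a * (1 - b / s) * (1 - b))"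
    unfolding t1 t2 using s0 by (simp add: field_simps)
  also have "(1 - a) * (1 - b) * (1 + a * b / s) + b * (1 - a / s) * (1 - a) + a * (1 - b / s) * (1 - b)
     = (1 - a * b / s) * (1 - a * b)"
    using s0 by (simp add: field_simps)
  finally show ?thesis unfolding triple_coeff_def r6 q by (simp only: mult.assoc mult.commute mult.left_commute)
qed

text \<open>Induction on N: multiplication by x and by 1/x shifts the index (\<open>A\<close> and
  \<open>B\<close>), and \<open>triple_coeff_Suc\<close> collects the terms.\<close>

lemma triple_prod_has_sum:
  assumes s: "0 < s" "s < 1" and x: "x \<noteq> 0"
  shows "((\<lambda>i. of_real (triple_coeff s N i) * x powi i) has_sum triple_prod s N x) UNIV"
proof (induction N)
  case 0
  have "triple_coeff s 0 i = (if i = 0 then 1 else 0)" for i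
    using s by (auto simp: triple_coeff_def inv_qpoch_def qpoch_def theta_coeff_def)
  then show ?case
    by (intro has_sum_finite_neutralI[of "{0}"]) (auto simp: triple_prod_def)
next
  case (Suc N)
  let ?c = "\<lambda>i. of_real (triple_coeff s N i) :: complex"
  have A: "((\<lambda>i. ?c (i - 1) * x powi i) has_sum x * triple_prod s N x) UNIV"
  proof -
    have "((\<lambda>i. x * (?c i * x powi i)) has_sum x * triple_prod s N x) UNIV"
      by (intro has_sum_cmult_right Suc.IH)
    moreover have "bij_betw (\<lambda>i::int. i - 1) UNIV UNIV"
      by (rule bij_betw_byWitness[of _ "\<lambda>i. i + 1"]) auto
    ultimately have "((\<lambda>i. x * (?c (i - 1) * x powi (i - 1))) has_sum x * triple_prod s N x) UNIV"
      by (subst has_sum_reindex_bij_betw[where g = "\<lambda>i::int. i - 1" and f = "\<lambda>i. x * (?c i * x powi i)"])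
    then show ?thesis using x by (simp add: power_int_diff)
  qed
  have B: "((\<lambda>i. ?c (i + 1) * x powi i) has_sum triple_prod s N x / x) UNIV"
  proof -
    have "((\<lambda>i. (1 / x) * (?c i * x powi i)) has_sum (1 / x) * triple_prod s N x) UNIV"
      by (intro has_sum_cmult_right Suc.IH)
    moreover have "bij_betw (\<lambda>i::int. i + 1) UNIV UNIV"
      by (rule bij_betw_byWitness[of _ "\<lambda>i. i - 1"]) auto
    ultimately have "((\<lambda>i. (1 / x) * (?c (i + 1) * x powi (i + 1))) has_sum (1 / x) * triple_prod s N x) UNIV"
      by (subst has_sum_reindex_bij_betw[where g = "\<lambda>i::int. i + 1" and f = "\<lambda>i. (1 / x) * (?c i * x powi i)"])
    then show ?thesis using x by (simp add: power_int_add)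
  qed
  have "((\<lambda>i. of_real (1 + s ^ (2 * N + 1)) * (?c i * x powi i) + of_real (s ^ N) * (?c (i - 1) * x powi i)
      + of_real (s ^ (N + 1)) * (?c (i + 1) * x powi i)) has_sum
      (of_real (1 + s ^ (2 * N + 1)) * triple_prod s N x + of_real (s ^ N) * (x * triple_prod s N x)
      + of_real (s ^ (N + 1)) * (triple_prod s N x / x))) UNIV"
    by (intro has_sum_add has_sum_cmult_right Suc.IH A B)
  also have "(\<lambda>i. of_real (1 + s ^ (2 * N + 1)) * (?c i * x powi i) + of_real (s ^ N) * (?c (i - 1) * x powi i)
      + of_real (s ^ (N + 1)) * (?c (i + 1) * x powi i)) = (\<lambda>i. of_real (triple_coeff s (Suc N) i) * x powi i)"
    unfolding triple_coeff_Suc[OF s] of_real_add of_real_mult by (rule ext) (simp only: algebra_simps)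
  also have "of_real (1 + s ^ (2 * N + 1)) * triple_prod s N x + of_real (s ^ N) * (x * triple_prod s N x)
      + of_real (s ^ (N + 1)) * (triple_prod s N x / x) = triple_prod s (Suc N) x"
    using x by (simp add: triple_prod_def field_simps power_add power_mult power2_eq_square)
  finally show ?case .
qed

lemma inv_qpoch_bounds:
  assumes s: "0 < s" "s < 1" and L: "L > 0" "\<And>n. L \<le> qpoch s n"
  shows "0 \<le> inv_qpoch s i" "inv_qpoch s i \<le> 1 / L"
  using qpoch_pos[OF s, of "nat i"] L(1) L(2)[of "nat i"] by (auto simp: inv_qpoch_def frac_le)

lemma qpoch_le_1:
  assumes s: "0 < s" "s < 1"
  shows "qpoch s n \<le> 1"
  unfolding qpoch_def by (rule prod_le_1) (use s in \<open>auto simp: power_le_one mult_le_one\<close>)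

text \<open>As N grows, the coefficients tend to \<open>theta_coeff s i / L\<close> and stay below
  the theta majorant divided by L^2. Dominated convergence for the counting measure on the integers
  gives convergence of the products to Theta / L, and a lower bound that is uniform in N
  survives.\<close>

lemma Theta_norm_ge_triple:
  assumes s: "0 < s" "s < 1" and x: "x \<noteq> 0" and L: "L > 0" "qpoch s \<longlonglongrightarrow> L" "\<And>n. L \<le> qpoch s n"
    and b: "\<And>N. b \<le> cmod (triple_prod s N x)"
  shows "L * b \<le> cmod (Theta s x)"
proof -
  define R where "R = max 1 (max (cmod x) (inverse (cmod x)))"
  have summ: "(\<lambda>i::int. theta_coeff s i * R ^ nat \<bar>i\<bar> / L\<^sup>2) summable_on UNIV"
    using summable_on_cmult_left[OF theta_majorant_summable[OF s, of R], of "1 / L\<^sup>2"] by (simp add: R_def)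
  have bd: "norm (of_real (triple_coeff s N i) * x powi i) \<le> theta_coeff s i * R ^ nat \<bar>i\<bar> / L\<^sup>2" for N i
  proof -
    have "qpoch s (2 * N) * inv_qpoch s (int N + i) * inv_qpoch s (int N - i) \<le> 1 * (1 / L) * (1 / L)"
      using inv_qpoch_bounds[OF s L(1,3)] qpoch_le_1[OF s] qpoch_pos[OF s] L(1)
      by (intro mult_mono) (auto intro: less_imp_le)
    moreover have "0 \<le> qpoch s (2 * N) * inv_qpoch s (int N + i) * inv_qpoch s (int N - i)"
      using inv_qpoch_bounds[OF s L(1,3)] qpoch_pos[OF s, of "2 * N"] by auto
    moreover have "triple_coeff s N i = theta_coeff s i * (qpoch s (2 * N) * inv_qpoch s (int N + i) * inv_qpoch s (int N - i))"
      by (simp add: triple_coeff_def)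
    ultimately have "\<bar>triple_coeff s N i\<bar> \<le> theta_coeff s i / L\<^sup>2"
      using theta_coeff_pos[OF s(1), of i] mult_left_mono[of _ "1 / L * (1 / L)" "theta_coeff s i"]
      by (simp add: abs_mult power2_eq_square)
    moreover have "cmod (x powi i) \<le> R ^ nat \<bar>i\<bar>"
      by (rule norm_powi_le_abs) (use x in \<open>auto simp: R_def\<close>)
    ultimately have "\<bar>triple_coeff s N i\<bar> * cmod (x powi i) \<le> theta_coeff s i / L\<^sup>2 * R ^ nat \<bar>i\<bar>"
      using theta_coeff_pos[OF s(1), of i] by (intro mult_mono) auto
    then show ?thesis by (simp add: norm_mult)
  qed
  have lim: "(\<lambda>N. of_real (triple_coeff s N i) * x powi i) \<longlonglongrightarrow> of_real (theta_coeff s i * L * (1 / L) * (1 / L)) * x powi i" for i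
  proof -
    have l: "(\<lambda>N. inv_qpoch s (int N + j)) \<longlonglongrightarrow> 1 / L" for j
    proof -
      have "(\<lambda>N. 1 / qpoch s N) \<longlonglongrightarrow> 1 / L" by (intro tendsto_intros L) (use L in auto)
      moreover have "filterlim (\<lambda>N. nat (int N + j)) sequentially sequentially"
        by (rule filterlim_at_top_mono[OF filterlim_minus_const_nat_at_top[of "nat \<bar>j\<bar>"]]) (auto intro!: always_eventually)
      ultimately have "(\<lambda>N. 1 / qpoch s (nat (int N + j))) \<longlonglongrightarrow> 1 / L" by (rule filterlim_compose)
      moreover have "eventually (\<lambda>N. 1 / qpoch s (nat (int N + j)) = inv_qpoch s (int N + j)) sequentially"
        using eventually_ge_at_top[of "nat \<bar>j\<bar>"] by eventually_elim (auto simp: inv_qpoch_def)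
      ultimately show ?thesis by (rule Lim_transform_eventually)
    qed
    have "filterlim (\<lambda>N::nat. 2 * N) sequentially sequentially"
      by (intro filterlim_subseq) (auto simp: strict_mono_def)
    from filterlim_compose[OF L(2) this] have "(\<lambda>N. qpoch s (2 * N)) \<longlonglongrightarrow> L" by simp
    then show ?thesis unfolding triple_coeff_def
      using l[of i] l[of "- i"] by (intro tendsto_intros) auto
  qed
  let ?f = "\<lambda>N i. of_real (triple_coeff s N i) * x powi i" and ?w = "\<lambda>i::int. theta_coeff s i * R ^ nat \<bar>i\<bar> / L\<^sup>2"
  let ?g = "\<lambda>i. of_real (theta_coeff s i * L * (1 / L) * (1 / L)) * x powi i"
  have w_int: "integrable (count_space UNIV) ?w"
  proof -
    have "norm (?w i) = ?w i" for i
      using theta_coeff_pos[OF s(1), of i] by (simp add: R_def)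
    then have "Infinite_Set_Sum.abs_summable_on ?w UNIV"
      using summ unfolding abs_summable_equivalent[symmetric] by presburger
    then show ?thesis by (simp only: abs_summable_on_def)
  qed
  have f_int: "integrable (count_space UNIV) (?f N)" for N
  proof (rule Bochner_Integration.integrable_bound[OF w_int])
    show "AE i in count_space UNIV. norm (?f N i) \<le> norm (?w i)"
      using bd[of N] by (intro AE_I2) (metis abs_ge_self order_trans real_norm_def)
  qed simp
  have g_sum: "(?g has_sum Theta s x / L) UNIV"
    using has_sum_cmult_left[OF Theta_has_sum[OF s x], of "1 / of_real L"] L(1) by (simp add: mult_ac)
  have conv: "(\<lambda>N. integral\<^sup>L (count_space UNIV) (?f N)) \<longlonglongrightarrow> integral\<^sup>L (count_space UNIV) ?g"
    by (rule integral_dominated_convergence[where s = ?f and f = ?g and w = ?w])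
       (simp, simp, rule w_int, rule AE_I2, rule lim, rule AE_I2, rule bd)
  have g_int: "integrable (count_space UNIV) ?g"
    by (rule integrable_dominated_convergence[where s = ?f and f = ?g and w = ?w])
       (simp, simp, rule w_int, rule AE_I2, rule lim, rule AE_I2, rule bd)
  have 1: "integral\<^sup>L (count_space UNIV) (?f N) = triple_prod s N x" for N
    using infsetsum_infsum[of "?f N" UNIV] f_int[of N] infsumI[OF triple_prod_has_sum[OF s x, of N]]
    by (simp add: abs_summable_on_def infsetsum_def)
  have 2: "integral\<^sup>L (count_space UNIV) ?g = Theta s x / L"
    using infsetsum_infsum[of ?g UNIV] g_int infsumI[OF g_sum]
    by (simp add: abs_summable_on_def infsetsum_def)
  have "(\<lambda>N. cmod (triple_prod s N x)) \<longlonglongrightarrow> cmod (Theta s x / L)"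
    using conv unfolding 1 2 by (rule tendsto_norm)
  then have "b \<le> cmod (Theta s x / L)"
    by (rule LIMSEQ_le_const) (use b in blast)
  then show ?thesis using L(1) by (simp add: norm_divide field_simps)
qed

text \<open>Since cos \<phi> is at least - cos \<eta>, the squared modulus is at least (sin
  \<eta>)^2 + (y - cos \<eta>)^2. Geometrically, a ray at angle at least \<eta> from the negative
  axis has distance at least sin \<eta> from -1.\<close>

lemma norm_one_plus_cis_ge:
  assumes "0 \<le> \<eta>" "\<bar>\<phi>\<bar> \<le> pi - \<eta>" "y \<ge> 0"
  shows "sin \<eta> \<le> cmod (1 + of_real y * cis \<phi>)"
proof -
  have "cos (pi - \<eta>) \<le> cos \<bar>\<phi>\<bar>"
    by (rule cos_monotone_0_pi_le) (use assms in auto)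
  then have c: "- cos \<eta> \<le> cos \<phi>" by simp
  have "(sin \<eta>)\<^sup>2 + (y - cos \<eta>)\<^sup>2 = 1 + 2 * y * (- cos \<eta>) + y\<^sup>2"
    using sin_squared_eq[of \<eta>] by (simp add: power2_eq_square algebra_simps)
  also have "\<dots> \<le> 1 + 2 * y * cos \<phi> + y\<^sup>2"
    using c assms(3) by (intro add_mono mult_left_mono) auto
  also have "\<dots> = (cmod (1 + of_real y * cis \<phi>))\<^sup>2"
  proof -
    have "y\<^sup>2 = y\<^sup>2 * ((cos \<phi>)\<^sup>2 + (sin \<phi>)\<^sup>2)" by simp
    also have "\<dots> = y\<^sup>2 * (cos \<phi>)\<^sup>2 + y\<^sup>2 * (sin \<phi>)\<^sup>2" by (rule distrib_left)
    finally show ?thesis unfolding cmod_power2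
      by (simp add: power2_sum power_mult_distrib)
  qed
  finally have "(sin \<eta>)\<^sup>2 \<le> (cmod (1 + of_real y * cis \<phi>))\<^sup>2"
    using zero_le_power2[of "y - cos \<eta>"] by linarith
  then show ?thesis by (rule power2_le_imp_le) simp
qed

text \<open>On the annulus s <= |x| <= 1 only the two factors with j = 0 can come close to 0, and
  there the direction of x helps. The remaining factors multiply up to a q-Pochhammer symbol, which
  is at least L.\<close>

lemma triple_prod_norm_ge:
  assumes s: "0 < s" "s < 1" and L: "L > 0" "\<And>n. L \<le> qpoch s n"
    and \<eta>: "0 < \<eta>" "\<bar>\<phi>\<bar> \<le> pi - \<eta>" and r: "s \<le> r" "r \<le> 1"
  shows "(sin \<eta> * L)\<^sup>2 \<le> cmod (triple_prod s N (of_real r * cis \<phi>))"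
proof -
  let ?x = "of_real r * cis \<phi>"
  have r0: "r > 0" using s r by simp
  \<comment> \<open>\<open>g j\<close> bounds both factors of index j: for j = 0 by the angle,
    because the added term may have modulus 1, and for j > 0 by the modulus s^j of the added
    term.\<close>
  define g where "g j = (if j = 0 then sin \<eta> else 1 - s ^ j)" for j
  have \<eta>': "\<eta> \<le> pi" using \<eta> by linarith
  have sin: "0 \<le> sin \<eta>" "sin \<eta> \<le> 1" using \<eta> \<eta>' by (auto intro: sin_ge_zero)
  have g0: "0 \<le> g j" for j using sin s by (auto simp: g_def power_le_one)
  have cx: "cmod ?x = r" using r0 by (simp add: norm_mult)
  have 1: "g j \<le> cmod (1 + of_real (s ^ j) * ?x)" for j
  proof (cases "j = 0")
    case True
    then show ?thesis using norm_one_plus_cis_ge[of \<eta> \<phi> r] \<eta> r0 by (simp add: g_def)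
  next
    case False
    have "cmod (of_real (s ^ j) * ?x) \<le> s ^ j"
      using s r r0 by (simp add: norm_mult cx norm_power mult_left_le)
    then have "1 - s ^ j \<le> cmod (1 + of_real (s ^ j) * ?x)"
      using norm_diff_ineq[of 1 "of_real (s ^ j) * ?x"] by simp
    then show ?thesis using False by (simp add: g_def)
  qed
  have 2: "g j \<le> cmod (1 + of_real (s ^ (j + 1)) / ?x)" for j
  proof (cases "j = 0")
    case True
    have "of_real (s ^ (j + 1)) / ?x = of_real (s / r) * cis (- \<phi>)"
      using True r0 by (simp add: divide_inverse)
    then show ?thesis using norm_one_plus_cis_ge[of \<eta> "- \<phi>" "s / r"] \<eta> r0 s True by (simp add: g_def)
  next
    case False
    have "cmod (of_real (s ^ (j + 1)) / ?x) = s ^ j * (s / r)"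
      using s r0 by (simp add: norm_divide norm_mult norm_power)
    also have "\<dots> \<le> s ^ j * 1" using s r r0 by (intro mult_left_mono) auto
    finally have "1 - s ^ j \<le> cmod (1 + of_real (s ^ (j + 1)) / ?x)"
      using norm_diff_ineq[of 1 "of_real (s ^ (j + 1)) / ?x"] by simp
    then show ?thesis using False by (simp add: g_def)
  qed
  have L1: "L \<le> 1" using L(2)[of 0] by (simp add: qpoch_def)
  have "sin \<eta> * L \<le> (\<Prod>j<N. g j)"
  proof (cases N)
    case 0
    then show ?thesis using sin L L1 by (simp add: mult_le_one)
  next
    case (Suc M)
    have "(\<Prod>j<N. g j) = sin \<eta> * qpoch s M"
      unfolding Suc prod.lessThan_Suc_shift by (simp add: g_def qpoch_def)
    then show ?thesis using sin L(2)[of M] by (simp add: mult_left_mono)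
  qed
  then have "(sin \<eta> * L)\<^sup>2 \<le> (\<Prod>j<N. g j)\<^sup>2"
    using sin L by (intro power_mono) auto
  also have "\<dots> = (\<Prod>j<N. g j * g j)" by (simp add: power2_eq_square prod.distrib)
  also have "\<dots> \<le> (\<Prod>j<N. cmod (1 + of_real (s ^ j) * ?x) * cmod (1 + of_real (s ^ (j + 1)) / ?x))"
    using 1 2 g0 by (intro prod_mono) (auto intro!: mult_mono)
  also have "\<dots> = cmod (triple_prod s N ?x)"
    unfolding triple_prod_def prod_norm[symmetric] norm_mult ..
  finally show ?thesis .
qed

text \<open>
  The growth function below satisfies the same functional equation as \<open>Theta s\<close>, so that
  the quotient only needs to be bounded on an annulus.
\<close>

definition theta_growth :: "real \<Rightarrow> real \<Rightarrow> real" where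
  "theta_growth la r = exp ((ln r)\<^sup>2 / (2 * la) + ln r / 2)"

lemma theta_growth_pos [simp]: "theta_growth la r > 0"
  by (simp add: theta_growth_def)

lemma theta_growth_shift:
  assumes "la > 0" "r > 0"
  shows "theta_growth la (exp (- la) * r) = theta_growth la r / r"
proof -
  have "(ln (exp (- la) * r))\<^sup>2 / (2 * la) + ln (exp (- la) * r) / 2 = (ln r)\<^sup>2 / (2 * la) + ln r / 2 - ln r"
    using assms by (simp add: ln_mult power2_eq_square field_simps)
  then show ?thesis unfolding theta_growth_def using assms by (simp only: exp_diff exp_ln)
qed

text \<open>Each dilation by \<open>exp (- la)\<close> divides numerator and denominator by the same
  modulus |x|, so the quotient is multiplicatively periodic.\<close>

lemma Theta_quotient_invariant:
  assumes la: "la > 0" and x: "x \<noteq> 0"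
  shows "cmod (Theta (exp (- la)) (of_real (exp (- la) ^ n) * x)) / theta_growth la (exp (- la) ^ n * cmod x)
    = cmod (Theta (exp (- la)) x) / theta_growth la (cmod x)"
proof (induction n)
  case (Suc n)
  let ?s = "exp (- la)"
  let ?y = "of_real (?s ^ n) * x"
  have y: "?y \<noteq> 0" "cmod ?y = ?s ^ n * cmod x" using x by (auto simp: norm_mult norm_power)
  have "Theta ?s (of_real ?s * ?y) = Theta ?s ?y / ?y"
    by (rule Theta_shift) (use la y in auto)
  moreover have "theta_growth la (?s * cmod ?y) = theta_growth la (cmod ?y) / cmod ?y"
    by (rule theta_growth_shift) (use la y in auto)
  ultimately have "cmod (Theta ?s (of_real ?s * ?y)) / theta_growth la (?s * cmod ?y)
      = cmod (Theta ?s ?y) / theta_growth la (cmod ?y)"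
    using y(1) by (simp only: norm_divide) simp
  then show ?case using Suc.IH unfolding y(2) by (simp add: mult.assoc)
qed simp

lemma quotient_le_transfer:
  fixes c :: real
  assumes "x / g = x' / g'" "c * g' \<le> x'" "g > 0" "g' > 0"
  shows "c * g \<le> x"
proof -
  have "c \<le> x' / g'" using assms by (simp add: pos_le_divide_eq)
  then show ?thesis unfolding assms(1)[symmetric] using assms(3) by (simp add: pos_le_divide_eq)
qed

text \<open>Dilations move every point into the annulus between \<open>exp (- la)\<close> and 1
  without changing its direction. There the triple product bounds Theta below by a constant, and
  \<open>theta_growth\<close> is at most 1.\<close>

lemma Theta_lower_bound:
  assumes la: "la > 0" and \<eta>: "0 < \<eta>" "\<eta> < pi"
  obtains c where "c > 0"
    "\<And>r \<phi>. r > 0 \<Longrightarrow> \<bar>\<phi>\<bar> \<le> pi - \<eta> \<Longrightarrow>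
       c * theta_growth la r \<le> cmod (Theta (exp (- la)) (of_real r * cis \<phi>))"
proof -
  let ?s = "exp (- la)"
  have s: "0 < ?s" "?s < 1" using la by auto
  obtain L where L: "L > 0" "qpoch ?s \<longlonglongrightarrow> L" "\<And>n. L \<le> qpoch ?s n" using qpoch_limit[OF s] by metis
  define c where "c = L * (sin \<eta> * L)\<^sup>2"
  have "sin \<eta> > 0" using \<eta> by (simp add: sin_gt_zero)
  then have c: "c > 0" using L by (simp add: c_def)
  have ann: "c * theta_growth la r \<le> cmod (Theta ?s (of_real r * cis \<phi>))"
    if r: "?s \<le> r" "r \<le> 1" and \<phi>: "\<bar>\<phi>\<bar> \<le> pi - \<eta>" for r \<phi>
  proof -
    have r0: "r > 0" using r s by linarith
    have l: "- la \<le> ln r" "ln r \<le> 0"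
      using r r0 by (auto simp: ln_ge_iff)
    \<comment> \<open>The exponent of \<open>theta_growth\<close> factors, and its zeros ln r = 0
      and ln r = - la are the two ends of the annulus.\<close>
    have "ln r * (ln r + la) \<le> 0" using l by (simp add: mult_nonpos_nonneg)
    moreover have "(ln r)\<^sup>2 / (2 * la) + ln r / 2 = ln r * (ln r + la) / (2 * la)"
      using la by (simp add: field_simps power2_eq_square)
    ultimately have "(ln r)\<^sup>2 / (2 * la) + ln r / 2 \<le> 0" using la by (simp add: divide_nonpos_pos)
    then have "theta_growth la r \<le> 1" by (simp add: theta_growth_def)
    then have "c * theta_growth la r \<le> c" using c by simp
    also have "c \<le> cmod (Theta ?s (of_real r * cis \<phi>))"
      unfolding c_def
      by (rule Theta_norm_ge_triple[OF s _ L]) (use r0 triple_prod_norm_ge[OF s L(1,3) \<eta>(1) \<phi> r] in auto)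
    finally show ?thesis .
  qed
  have "c * theta_growth la r \<le> cmod (Theta ?s (of_real r * cis \<phi>))"
    if r: "r > 0" and \<phi>: "\<bar>\<phi>\<bar> \<le> pi - \<eta>" for r \<phi>
  proof -
    let ?x = "of_real r * cis \<phi>"
    \<comment> \<open>\<open>m\<close> counts the dilations between r and the annulus. The
      invariance lemma only dilates by natural powers of \<open>exp (- la)\<close>, so for negative
      \<open>m\<close> the point r is the one to be dilated, and otherwise its representative
      r'.\<close>
    define m where "m = \<lfloor>- ln r / la\<rfloor>"
    have m: "of_int m * la \<le> - ln r" "- ln r < (of_int m + 1) * la"
      using la floor_correct[of "- ln r / la"] unfolding m_def[symmetric]
      by (auto simp only: pos_le_divide_eq pos_divide_less_eq of_int_add of_int_1)
    show ?thesis
    proof (cases "m \<ge> 0")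
      case True
      then obtain n where n: "m = int n" using nonneg_int_cases by blast
      define r' where "r' = r / ?s ^ n"
      have sn: "?s ^ n = exp (- (real n * la))" by (simp add: exp_of_nat_mult[symmetric])
      have r': "r' = exp (ln r + real n * la)" using r unfolding r'_def sn by (simp add: exp_add exp_minus field_simps)
      have rr: "r = ?s ^ n * r'" unfolding r'_def by simp
      have b: "?s \<le> r'" "r' \<le> 1" using m unfolding r' n by (auto simp: algebra_simps)
      have *: "c * theta_growth la r' \<le> cmod (Theta ?s (of_real r' * cis \<phi>))" using ann[OF b \<phi>] .
      have "cmod (Theta ?s (of_real (?s ^ n) * (of_real r' * cis \<phi>))) / theta_growth la (?s ^ n * cmod (of_real r' * cis \<phi>))
        = cmod (Theta ?s (of_real r' * cis \<phi>)) / theta_growth la (cmod (of_real r' * cis \<phi>))"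
        by (rule Theta_quotient_invariant[OF la]) (simp add: r')
      moreover have "of_real (?s ^ n) * (of_real r' * cis \<phi>) = ?x" by (subst rr) simp
      moreover have "cmod (of_real r' * cis \<phi>) = r'" by (simp add: norm_mult r')
      ultimately have "cmod (Theta ?s ?x) / theta_growth la r = cmod (Theta ?s (of_real r' * cis \<phi>)) / theta_growth la r'"
        by (simp only: rr[symmetric])
      then show ?thesis using * by (rule quotient_le_transfer) auto
    next
      case False
      define n where "n = nat (- m)"
      then have n: "m = - int n" using False by simp
      define r' where "r' = r * ?s ^ n"
      have sn: "?s ^ n = exp (- (real n * la))" by (simp add: exp_of_nat_mult[symmetric])
      have r': "r' = exp (ln r - real n * la)" using r unfolding r'_def sn by (simp add: exp_diff exp_minus field_simps)
      have b: "?s \<le> r'" "r' \<le> 1" using m unfolding r' n by (auto simp: algebra_simps)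
      have *: "c * theta_growth la r' \<le> cmod (Theta ?s (of_real r' * cis \<phi>))" using ann[OF b \<phi>] .
      have "cmod (Theta ?s (of_real (?s ^ n) * ?x)) / theta_growth la (?s ^ n * cmod ?x)
        = cmod (Theta ?s ?x) / theta_growth la (cmod ?x)"
        by (rule Theta_quotient_invariant[OF la]) (use r in simp)
      moreover have "of_real (?s ^ n) * ?x = of_real r' * cis \<phi>" by (simp add: r'_def)
      moreover have "cmod ?x = r" using r by (simp add: norm_mult)
      ultimately have "cmod (Theta ?s ?x) / theta_growth la r = cmod (Theta ?s (of_real r' * cis \<phi>)) / theta_growth la r'"
        by (simp only: mult.commute[of "?s ^ n" r] r'_def[symmetric])
      then show ?thesis using * by (rule quotient_le_transfer) auto
    qed
  qed
  then show ?thesis using c that by blast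
qed

section \<open>Rotation of halflines\<close>

text \<open>With u = exp z, halflines become horizontal lines Im z = y and dr/r becomes dx. A
  primitive \<open>P\<close> exists on the strip; the truncated integrals are differences of values
  of \<open>P\<close>, and moving the line costs only the two vertical sides, each at most B x |y1 -
  y2|.\<close>

lemma rotate_halfline_integral:
  fixes H :: "complex \<Rightarrow> complex"
  assumes holo: "H holomorphic_on {z. a < Im z \<and> Im z < b}"
    and y: "y1 \<in> {a<..<b}" "y2 \<in> {a<..<b}"
    and bound: "\<And>x y. y \<in> closed_segment y1 y2 \<Longrightarrow> cmod (H (Complex x y)) \<le> B x"
    and B: "(B \<longlongrightarrow> 0) at_top" "(B \<longlongrightarrow> 0) at_bot"
    and int: "\<And>y. y \<in> {y1, y2} \<Longrightarrow> set_integrable lborel {0<..} (\<lambda>r. H (Complex (ln r) y) / of_real r)"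
  shows "(LINT r:{0<..}|lborel. H (Complex (ln r) y1) / of_real r) = (LINT r:{0<..}|lborel. H (Complex (ln r) y2) / of_real r)"
proof -
  let ?S = "{z. a < Im z \<and> Im z < b}"
  have S: "open ?S" "convex ?S"
  proof -
    have "?S = {z. Im z > a} \<inter> {z. Im z < b}" by auto
    then show "open ?S" "convex ?S"
      by (auto intro!: open_Int convex_Int open_halfspace_Im_gt open_halfspace_Im_lt convex_halfspace_Im_gt convex_halfspace_Im_lt)
  qed
  obtain P where P: "\<And>z. z \<in> ?S \<Longrightarrow> (P has_field_derivative H z) (at z)"
    using holomorphic_convex_primitive'[OF S(2,1) holo] S(1) by (metis at_within_open)
  have ab: "closed_segment y1 y2 \<subseteq> {a<..<b}"
    using y by (intro closed_segment_subset) auto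
  define J where "J y = (LINT r:{0<..}|lborel. H (Complex (ln r) y) / of_real r)" for y
  \<comment> \<open>The interval from 1/(n+1) to n+1 is symmetric in ln r, so the vertical sides lie
    at plus and minus ln (n+1), where \<open>B\<close> tends to 0.\<close>
  define I where "I y n = (LINT r:{1 / real (Suc n)..real (Suc n)}|lborel. H (Complex (ln r) y) / of_real r)" for y n
  have I_eq: "I y n = P (Complex (ln (real (Suc n))) y) - P (Complex (- ln (real (Suc n))) y)" if yy: "y \<in> {y1, y2}" for y n
  proof -
    let ?A = "{1 / real (Suc n)..real (Suc n)}"
    have pos: "r > 0" if "r \<in> ?A" for r
      using that by (auto intro: less_le_trans[of 0 "1 / real (Suc n)"])
    have yS: "Complex x y \<in> ?S" for x using yy y by auto
    have eq: "Complex x y = of_real x + \<i> * of_real y" for x by (simp add: complex_eq_iff)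
    have "(\<integral>r. indicator ?A r *\<^sub>R (H (Complex (ln r) y) / of_real r) \<partial>lborel)
      = P (Complex (ln (real (Suc n))) y) - P (Complex (ln (1 / real (Suc n))) y)"
    proof (rule integral_FTC_Icc)
      show "1 / real (Suc n) \<le> real (Suc n)" by (simp add: field_simps) 
      fix r assume r: "1 / real (Suc n) \<le> r" "r \<le> real (Suc n)"
      then have r0: "r > 0" using pos by auto
      have "((\<lambda>r. Complex (ln r) y) has_vector_derivative of_real (1 / r)) (at r within ?A)"
        unfolding eq using r0
        by (auto intro!: derivative_eq_intros has_vector_derivative_real_field simp: has_real_derivative_iff_has_vector_derivative[symmetric])
      from field_vector_diff_chain_within[OF this has_field_derivative_at_within[OF P[OF yS]]]
      show "((\<lambda>r. P (Complex (ln r) y)) has_vector_derivative H (Complex (ln r) y) / of_real r) (at r within ?A)"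
        by (simp add: o_def field_simps)
    next
      have "continuous_on ?S H" by (rule holomorphic_on_imp_continuous_on[OF holo])
      moreover have "continuous_on ?A (\<lambda>r. Complex (ln r) y)"
        unfolding eq using pos by (intro continuous_intros) force
      ultimately have "continuous_on ?A (\<lambda>r. H (Complex (ln r) y))"
        by (rule continuous_on_compose2) (use yS in auto)
      then show "continuous_on ?A (\<lambda>r. H (Complex (ln r) y) / of_real r)"
        by (intro continuous_on_divide continuous_on_of_real continuous_on_id) (use pos in force)+
    qed
    then show ?thesis
      by (simp add: I_def set_lebesgue_integral_def ln_div)
  qed
  have lim: "I y \<longlonglongrightarrow> J y" if yy: "y \<in> {y1, y2}" for y
  proof -
    have un: "(\<Union>n. {1 / real (Suc n)..real (Suc n)}) = {0<..}"
    proof (intro equalityI subsetI)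
      fix x :: real assume x: "x \<in> {0<..}"
      obtain n where n: "max x (1 / x) < real n" using reals_Archimedean2 by blast
      then have "x \<le> real (Suc n)" "1 / x \<le> real (Suc n)" by auto
      then have "x \<in> {1 / real (Suc n)..real (Suc n)}" using x by (auto simp: field_simps)
      then show "x \<in> (\<Union>n. {1 / real (Suc n)..real (Suc n)})" by blast
    qed (auto intro: less_le_trans[of 0 "1 / (1 + real _)"])
    have "incseq (\<lambda>n. {1 / real (Suc n)..real (Suc n)})"
      by (intro incseq_SucI) (auto simp: field_simps intro: order_trans)
    moreover have "set_integrable lborel (\<Union>n. {1 / real (Suc n)..real (Suc n)}) (\<lambda>r. H (Complex (ln r) y) / of_real r)"
      unfolding un by (rule int[OF yy])
    ultimately show ?thesis
      unfolding I_def[abs_def] J_def un[symmetric]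
      by (intro set_integral_cont_up) auto
  qed
  have est: "cmod (P (Complex x y1) - P (Complex x y2)) \<le> B x * \<bar>y1 - y2\<bar>" for x
  proof -
    have seg: "z \<in> closed_segment (Complex x y1) (Complex x y2) \<Longrightarrow> Re z = x \<and> Im z \<in> closed_segment y1 y2" for z
      unfolding closed_segment_def by (auto simp: left_diff_distrib)
    have "cmod (P (Complex x y1) - P (Complex x y2)) \<le> B x * cmod (Complex x y1 - Complex x y2)"
    proof (rule field_differentiable_bound[of "closed_segment (Complex x y1) (Complex x y2)" P H])
      fix z assume z: "z \<in> closed_segment (Complex x y1) (Complex x y2)"
      then have zz: "z = Complex x (Im z)" "Im z \<in> closed_segment y1 y2" using seg by (auto simp: complex_eq_iff)
      then have "z \<in> ?S" using ab by auto
      then show "(P has_field_derivative H z) (at z within closed_segment (Complex x y1) (Complex x y2))"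
        by (rule has_field_derivative_at_within[OF P])
      show "cmod (H z) \<le> B x" using bound[OF zz(2)] zz(1) by metis
    qed auto
    moreover have "cmod (Complex x y1 - Complex x y2) = \<bar>y1 - y2\<bar>" by (simp add: cmod_def)
    ultimately show ?thesis by simp
  qed
  have "(\<lambda>n. I y1 n - I y2 n) \<longlonglongrightarrow> 0"
  proof (rule Lim_null_comparison)
    let ?l = "\<lambda>n. ln (real (Suc n))"
    show "eventually (\<lambda>n. cmod (I y1 n - I y2 n) \<le> B (?l n) * \<bar>y1 - y2\<bar> + B (- ?l n) * \<bar>y1 - y2\<bar>) sequentially"
    proof (rule always_eventually, rule allI)
      fix n
      have "I y1 n - I y2 n = (P (Complex (?l n) y1) - P (Complex (?l n) y2)) - (P (Complex (- ?l n) y1) - P (Complex (- ?l n) y2))"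
        by (simp add: I_eq)
      also have "cmod \<dots> \<le> B (?l n) * \<bar>y1 - y2\<bar> + B (- ?l n) * \<bar>y1 - y2\<bar>"
        by (rule order_trans[OF norm_triangle_ineq4 add_mono[OF est est]])
      finally show "cmod (I y1 n - I y2 n) \<le> B (?l n) * \<bar>y1 - y2\<bar> + B (- ?l n) * \<bar>y1 - y2\<bar>" .
    qed
    have "filterlim (\<lambda>n. real (Suc n)) at_top sequentially"
      by (intro filterlim_compose[OF filterlim_real_sequentially] filterlim_Suc)
    from filterlim_compose[OF ln_at_top this] have l: "filterlim ?l at_top sequentially" .
    then have l': "filterlim (\<lambda>n. - ?l n) at_bot sequentially"
      by (simp add: filterlim_uminus_at_bot)
    have "(\<lambda>n. B (?l n) * \<bar>y1 - y2\<bar> + B (- ?l n) * \<bar>y1 - y2\<bar>) \<longlonglongrightarrow> 0 * \<bar>y1 - y2\<bar> + 0 * \<bar>y1 - y2\<bar>"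
      by (intro tendsto_intros filterlim_compose[OF B(1) l] filterlim_compose[OF B(2) l'])
    then show "(\<lambda>n. B (?l n) * \<bar>y1 - y2\<bar> + B (- ?l n) * \<bar>y1 - y2\<bar>) \<longlonglongrightarrow> 0" by simp
  qed
  moreover have "(\<lambda>n. I y1 n - I y2 n) \<longlonglongrightarrow> J y1 - J y2"
    by (intro tendsto_diff lim) auto
  ultimately have "J y1 - J y2 = 0" by (rule LIMSEQ_unique[rotated])
  then show ?thesis by (simp add: J_def)
qed

section \<open>A scale-invariant majorant\<close>

text \<open>For x > 0 this is the minimum of sqrt x and 1 / sqrt x. Its mass for dr/r is finite and
  does not change when r is replaced by r/t.\<close>

definition log_decay :: "real \<Rightarrow> real" where
  "log_decay x = exp (- \<bar>ln x\<bar> / 2)"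

lemma log_decay_pos [simp]: "log_decay x > 0" by (simp add: log_decay_def)

lemma log_decay_integrable_1: "set_integrable lborel {0<..} (\<lambda>r. log_decay r / r)"
proof -
  have m: "set_borel_measurable lborel A (\<lambda>r. log_decay r / r)" if "A \<in> sets borel" for A
    using that unfolding set_borel_measurable_def log_decay_def by measurable
  have conv: "set_integrable lborel A (\<lambda>r. log_decay r / r)"
    if "A \<in> sets borel" "A \<subseteq> {0<..}" "f integrable_on A" "\<And>r. r \<in> A \<Longrightarrow> log_decay r / r = f r" for A and f :: "real \<Rightarrow> real"
  proof -
    have "(\<lambda>r. log_decay r / r) integrable_on A"
      using that(3) integrable_cong[of A "\<lambda>r. log_decay r / r" f] that(4) by blast
    then have "(\<lambda>r. log_decay r / r) absolutely_integrable_on A"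
      by (rule nonnegative_absolutely_integrable_1) (use that(2) in \<open>auto intro!: divide_nonneg_pos less_imp_le\<close>)
    then show ?thesis
      using m[OF that(1)] unfolding set_integrable_def set_borel_measurable_def
      by (subst (asm) integrable_completion) auto
  qed
  have "set_integrable lborel {0<..1} (\<lambda>r. log_decay r / r)"
  proof (rule conv)
    have "(\<lambda>r::real. r powr (- 1 / 2)) integrable_on {0..1}"
      using integrable_on_powr_from_0[of "- 1 / 2" 1] by simp
    then show "(\<lambda>r::real. r powr (- 1 / 2)) integrable_on {0<..1}"
      by (rule integrable_spike_set) (auto intro: negligible_subset[of "{0}"])
    fix r :: real assume "r \<in> {0<..1}"
    then have r: "r > 0" "ln r \<le> 0" by auto
    have "log_decay r / r = exp (ln r / 2) / exp (ln r)" using r by (simp add: log_decay_def)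
    also have "\<dots> = exp (- 1 / 2 * ln r)" by (simp only: exp_diff[symmetric]) simp
    finally show "log_decay r / r = r powr (- 1 / 2)" using r by (simp add: powr_def)
  qed auto
  moreover have "set_integrable lborel {1..} (\<lambda>r. log_decay r / r)"
  proof (rule conv)
    show "(\<lambda>r::real. r powr (- 3 / 2)) integrable_on {1..}"
      using has_integral_powr_to_inf[of "- 3 / 2" 1] by (auto simp: integrable_on_def)
    fix r :: real assume "r \<in> {1..}"
    then have r: "r \<ge> 1" "r > 0" by auto
    have "log_decay r / r = exp (- ln r / 2) / exp (ln r)" using r by (simp add: log_decay_def)
    also have "\<dots> = exp (- 3 / 2 * ln r)" by (simp only: exp_diff[symmetric]) simp
    finally show "log_decay r / r = r powr (- 3 / 2)" using r by (simp add: powr_def)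
  qed auto
  ultimately have "set_integrable lborel ({0<..1} \<union> {1..}) (\<lambda>r. log_decay r / r)"
    by (rule set_integrable_Un) auto
  moreover have "{0<..1} \<union> {1..} = {(0::real)<..}" by auto
  ultimately show ?thesis by simp
qed

lemma halfline_integral_scale:
  fixes f :: "real \<Rightarrow> 'a :: {banach, second_countable_topology, real_normed_field}"
  assumes t: "t > 0"
  shows "(LINT r:{0<..}|lborel. f (r / t) / of_real r) = (LINT r:{0<..}|lborel. f r / of_real r)"
    and "set_integrable lborel {0<..} (\<lambda>r. f r / of_real r) \<Longrightarrow> set_integrable lborel {0<..} (\<lambda>r. f (r / t) / of_real r)"
proof -
  have eq: "indicator {0<..} (t * r) *\<^sub>R (f (t * r / t) / of_real (t * r)) = (1 / t) *\<^sub>R (indicator {0<..} r *\<^sub>R (f r / of_real r))" for r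
    using t by (auto simp: indicator_def zero_less_mult_iff scaleR_conv_of_real)
  show "(LINT r:{0<..}|lborel. f (r / t) / of_real r) = (LINT r:{0<..}|lborel. f r / of_real r)"
    unfolding set_lebesgue_integral_def
    using lborel_integral_real_affine[of t "\<lambda>r. indicator {0<..} r *\<^sub>R (f (r / t) / of_real r)" 0] t
    by (simp only: add_0 eq integral_scaleR_right) simp
  assume "set_integrable lborel {0<..} (\<lambda>r. f r / of_real r)"
  then have "integrable lborel (\<lambda>r. (1 / t) *\<^sub>R (indicator {0<..} r *\<^sub>R (f r / of_real r)))"
    unfolding set_integrable_def by (rule integrable_scaleR_right)
  then show "set_integrable lborel {0<..} (\<lambda>r. f (r / t) / of_real r)"
    unfolding set_integrable_def
    using lborel_integrable_real_affine_iff[of t "\<lambda>r. indicator {0<..} r *\<^sub>R (f (r / t) / of_real r)" 0] t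
    by (simp only: add_0 eq)
qed

definition log_decay_mass :: real where
  "log_decay_mass = (LINT r:{0<..}|lborel. log_decay r / r)"

lemma log_decay_mass_nonneg: "log_decay_mass \<ge> 0"
  unfolding log_decay_mass_def set_lebesgue_integral_def
  by (intro integral_nonneg_AE AE_I2) (auto simp: indicator_def intro!: divide_nonneg_nonneg less_imp_le)

lemma log_decay_integrable:
  assumes "t > 0"
  shows "set_integrable lborel {0<..} (\<lambda>r. log_decay (r / t) / r)"
    and "(LINT r:{0<..}|lborel. log_decay (r / t) / r) = log_decay_mass"
  using halfline_integral_scale[OF assms, of log_decay] log_decay_integrable_1
  by (auto simp: log_decay_mass_def)

text \<open>Two majorants occur because the part of an integrand near the vertex lives at scale t
  and the tail at scale 1. Both have the same mass, so the bound does not depend on t.\<close>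

lemma halfline_integral_bound:
  fixes h :: "real \<Rightarrow> complex"
  assumes t: "t > 0"
    and m: "set_borel_measurable lborel {0<..} (\<lambda>r. h r / of_real r)"
    and b: "\<And>r. r > 0 \<Longrightarrow> cmod (h r) \<le> K1 * log_decay (r / t) + K2 * log_decay r"
  shows "set_integrable lborel {0<..} (\<lambda>r. h r / of_real r)"
    and "cmod (LINT r:{0<..}|lborel. h r / of_real r) \<le> (K1 + K2) * log_decay_mass"
proof -
  let ?w = "\<lambda>r. K1 * (log_decay (r / t) / r) + K2 * (log_decay r / r)"
  note l1 = log_decay_integrable[OF t] and l2 = log_decay_integrable[OF zero_less_one, simplified]
  have w: "set_integrable lborel {0<..} ?w"
    by (intro set_integral_add set_integrable_mult_right) (use l1 l2 in auto)
  have w': "(LINT r:{0<..}|lborel. ?w r) = (K1 + K2) * log_decay_mass"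
    by (subst set_integral_add(2)) (use l1 l2 in \<open>auto simp: distrib_right simp del: times_divide_eq_right\<close>)
  have le: "cmod (h r / of_real r) \<le> ?w r" if "r > 0" for r
    using b[OF that] that by (simp add: norm_divide field_simps)
  show i: "set_integrable lborel {0<..} (\<lambda>r. h r / of_real r)"
  proof (rule set_integrable_bound[OF w m], rule AE_I2, rule impI)
    fix r :: real assume "r \<in> {0<..}"
    then show "cmod (h r / of_real r) \<le> norm (?w r)" using le[of r] abs_ge_self[of "?w r"] unfolding real_norm_def greaterThan_iff by linarith
  qed
  have "cmod (LINT r:{0<..}|lborel. h r / of_real r) \<le> (LINT r:{0<..}|lborel. cmod (h r / of_real r))"
    by (rule set_integral_norm_bound[OF i])
  also have "\<dots> \<le> (LINT r:{0<..}|lborel. ?w r)"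
    by (rule set_integral_mono[OF set_integrable_norm[OF i] w]) (use le in auto)
  finally show "cmod (LINT r:{0<..}|lborel. h r / of_real r) \<le> (K1 + K2) * log_decay_mass"
    unfolding w' .
qed

section \<open>Asymptotics of q-Laplace transforms\<close>

lemma Theta_measurable_ray:
  assumes "la > 0" "t > 0" and f: "continuous_on {0<..} f"
    and "\<And>r. r > 0 \<Longrightarrow> Theta (exp (- la)) (of_real (r / t) * cis \<phi>) \<noteq> 0"
  shows "set_borel_measurable lborel {0<..} (\<lambda>r. f r / Theta (exp (- la)) (of_real (r / t) * cis \<phi>) / of_real r)"
proof -
  have c: "continuous_on (- {0}) (Theta (exp (- la)))"
    by (intro holomorphic_on_imp_continuous_on Theta_holomorphic) (use assms in auto)
  have "continuous_on {0<..} (\<lambda>r. of_real (r / t) * cis \<phi>)"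
    by (intro continuous_intros) (use assms in auto)
  with c have "continuous_on {0<..} (\<lambda>r. Theta (exp (- la)) (of_real (r / t) * cis \<phi>))"
    by (rule continuous_on_compose2) (use assms in auto)
  then have "continuous_on {0<..} (\<lambda>r. f r / Theta (exp (- la)) (of_real (r / t) * cis \<phi>) / of_real r)"
    using assms by (intro continuous_on_divide f continuous_on_of_real continuous_on_id) auto
  then show ?thesis
    unfolding set_borel_measurable_def
    by (simp add: borel_measurable_continuous_on_indicator)
qed

text \<open>With y = ln x, completing the square gives a y - y^2/(2 la) <= la a^2/2. The half powers
  in \<open>theta_growth\<close> and \<open>log_decay\<close> cancel for y >= 0, so that a = N, and
  add up for y < 0, so that a = N - 1; both are at most N + 1 in modulus, also for N = 0.\<close>

lemma monomial_over_theta_growth: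
  assumes la: "la > 0" and x: "x > 0"
  shows "x ^ N / theta_growth la x \<le> exp (la * (real N + 1)\<^sup>2 / 2) * log_decay x"
proof -
  define y where "y = ln x"
  have xy: "x = exp y" using x by (simp add: y_def)
  have sq: "a * y - y\<^sup>2 / (2 * la) \<le> la * (real N + 1)\<^sup>2 / 2" if "\<bar>a\<bar> \<le> real N + 1" for a
  proof -
    have "a\<^sup>2 \<le> (real N + 1)\<^sup>2" using that by (rule power2_le_iff_abs_le[THEN iffD2, rotated]) simp
    have "0 \<le> (la * a - y)\<^sup>2 / (2 * la)" using la by simp
    also have "(la * a - y)\<^sup>2 / (2 * la) = la * a\<^sup>2 / 2 - (a * y - y\<^sup>2 / (2 * la))"
      using la by (simp add: power2_eq_square field_simps)
    finally have "a * y - y\<^sup>2 / (2 * la) \<le> la * a\<^sup>2 / 2" by simp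
    also have "\<dots> \<le> la * (real N + 1)\<^sup>2 / 2"
      using mult_left_mono[OF \<open>a\<^sup>2 \<le> (real N + 1)\<^sup>2\<close>, of la] la by simp
    finally show ?thesis .
  qed
  have "real N * y - y\<^sup>2 / (2 * la) - y / 2 + \<bar>y\<bar> / 2 \<le> la * (real N + 1)\<^sup>2 / 2"
  proof (cases "y \<ge> 0")
    case True then show ?thesis using sq[of "real N"] by simp
  next
    case False then show ?thesis using sq[of "real N - 1"] by (simp add: algebra_simps)
  qed
  then have "exp (real N * y - (y\<^sup>2 / (2 * la) + y / 2)) \<le> exp (la * (real N + 1)\<^sup>2 / 2 + - \<bar>y\<bar> / 2)"
    by simp
  then show ?thesis unfolding theta_growth_def log_decay_def xy
    by (simp only: exp_diff exp_add exp_of_nat_mult ln_exp)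
qed

text \<open>On the tail \<open>r \<ge> R0\<close> the quotient is q-exponentially flat in \<open>t\<close>.\<close>

lemma tail_over_theta_growth:
  assumes la: "la > 0" and R0: "0 < R0" "R0 \<le> 1" and R1: "\<alpha> + ln R1 / la \<le> 0"
  defines "b \<equiv> - ln R0" and "B \<equiv> - ln R0 / la + 1 / 2"
  assumes r: "r \<ge> R0" and t: "0 < t" "t \<le> R1"
  shows "exp ((ln r)\<^sup>2 / (2 * la) + \<alpha> * ln r) / theta_growth la (r / t)
    \<le> exp ((\<bar>\<alpha>\<bar> + 1) * b + la * (real N + B)\<^sup>2 / 2) * t ^ N * log_decay r"
proof -
  define x z where "x = ln r" and "z = ln t"
  have r0: "r > 0" using r R0 by linarith
  have b: "b \<ge> 0" using R0 by (simp add: b_def)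
  have B: "B = b / la + 1 / 2" by (simp add: B_def b_def)
  have B0: "B \<ge> 0" using b la by (simp add: B)
  have xb: "x \<ge> - b" using r R0 by (simp add: x_def b_def)
  have "z \<le> ln R1" using t by (simp add: z_def)
  then have az: "\<alpha> + z / la \<le> 0" using R1 la by (smt (verit) divide_right_mono)
  have lrt: "ln (r / t) = x - z" using r0 t by (simp add: x_def z_def ln_div)
  \<comment> \<open>For x >= 0 the sign in \<open>az\<close> makes the linear term harmless. For x <
    0 one has |x| <= b, a constant that depends on R0 only.\<close>
  have 1: "(\<alpha> + z / la) * x - x / 2 + \<bar>x\<bar> / 2 \<le> (\<bar>\<alpha>\<bar> + 1) * b + b / la * \<bar>z\<bar>"
  proof (cases "x \<ge> 0")
    case True
    then have "(\<alpha> + z / la) * x \<le> 0" using az by (simp add: mult_nonpos_nonneg)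
    moreover have "0 \<le> (\<bar>\<alpha>\<bar> + 1) * b + b / la * \<bar>z\<bar>" using b la by simp
    ultimately show ?thesis using True by simp
  next
    case False
    have "(\<alpha> + z / la) * x = (- (\<alpha> + z / la)) * (- x)" by (rule minus_mult_minus[symmetric])
    also have "\<dots> \<le> (\<bar>\<alpha>\<bar> + \<bar>z\<bar> / la) * b"
    proof (rule mult_mono)
      have "- z / la \<le> \<bar>z\<bar> / la" using la by (intro divide_right_mono) auto
      then show "- (\<alpha> + z / la) \<le> \<bar>\<alpha>\<bar> + \<bar>z\<bar> / la" by simp
      show "0 \<le> \<bar>\<alpha>\<bar> + \<bar>z\<bar> / la" using la by simp
    qed (use False xb in auto)
    finally show ?thesis using False xb by (simp add: algebra_simps)
  qed
  have 2: "(real N + B) * \<bar>z\<bar> - z\<^sup>2 / (2 * la) \<le> la * (real N + B)\<^sup>2 / 2"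
  proof -
    have "0 \<le> (la * (real N + B) - \<bar>z\<bar>)\<^sup>2 / (2 * la)" using la by simp
    also have "(la * (real N + B) - \<bar>z\<bar>)\<^sup>2 / (2 * la) = la * (real N + B)\<^sup>2 / 2 - ((real N + B) * \<bar>z\<bar> - \<bar>z\<bar>\<^sup>2 / (2 * la))"
      using la by (simp add: power2_eq_square field_simps)
    finally show ?thesis by simp
  qed
  \<comment> \<open>The square of x - z cancels the quadratic growth x^2/(2 la). The mixed term
    turns \<alpha> into \<alpha> + z/la, and the remaining - z^2/(2 la) is what makes the tail flat
    in t.\<close>
  have "x\<^sup>2 / (2 * la) + \<alpha> * x - ((x - z)\<^sup>2 / (2 * la) + (x - z) / 2) + \<bar>x\<bar> / 2 - real N * z
     = ((\<alpha> + z / la) * x - x / 2 + \<bar>x\<bar> / 2) + z / 2 - z\<^sup>2 / (2 * la) - real N * z"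
    using la by (simp add: power2_eq_square field_simps)
  also have "\<dots> \<le> ((\<bar>\<alpha>\<bar> + 1) * b + b / la * \<bar>z\<bar>) + \<bar>z\<bar> / 2 - z\<^sup>2 / (2 * la) + real N * \<bar>z\<bar>"
  proof -
    have "- (real N * z) \<le> real N * \<bar>z\<bar>" using mult_left_mono[of "- z" "\<bar>z\<bar>" "real N"] by simp
    then show ?thesis using 1 abs_ge_self[of z] by linarith
  qed
  also have "\<dots> = (\<bar>\<alpha>\<bar> + 1) * b + ((real N + B) * \<bar>z\<bar> - z\<^sup>2 / (2 * la))"
    by (simp add: B algebra_simps)
  also have "\<dots> \<le> (\<bar>\<alpha>\<bar> + 1) * b + la * (real N + B)\<^sup>2 / 2" using 2 by simp
  finally have "exp (x\<^sup>2 / (2 * la) + \<alpha> * x - ((x - z)\<^sup>2 / (2 * la) + (x - z) / 2))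
      \<le> exp ((\<bar>\<alpha>\<bar> + 1) * b + la * (real N + B)\<^sup>2 / 2 + real N * z + - \<bar>x\<bar> / 2)"
    by simp
  also have "\<dots> = exp ((\<bar>\<alpha>\<bar> + 1) * b + la * (real N + B)\<^sup>2 / 2) * t ^ N * log_decay r"
    unfolding x_def z_def log_decay_def by (simp only: exp_add exp_of_nat_mult exp_ln[OF t(1)])
  finally show ?thesis
    unfolding theta_growth_def lrt by (simp only: exp_diff x_def)
qed

text \<open>Up to the normalising constant, the q-Laplace transform sends the monomial u^n to
  \<open>theta_moment la n\<close> times T^n.\<close>

definition theta_moment :: "real \<Rightarrow> nat \<Rightarrow> complex" where
  "theta_moment la n = (LINT r:{0<..}|lborel. of_real r ^ n / Theta (exp (- la)) (of_real r) / of_real r)"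

lemma log_decay_exp_tendsto:
  "((\<lambda>x. log_decay (exp x)) \<longlongrightarrow> 0) at_top" "((\<lambda>x. log_decay (exp x)) \<longlongrightarrow> 0) at_bot"
  unfolding log_decay_def by real_asymp+

lemma Theta_nonzero_ray:
  assumes "la > 0" "\<bar>\<phi>\<bar> < pi" "r > 0"
  shows "Theta (exp (- la)) (of_real r * cis \<phi>) \<noteq> 0"
proof -
  define \<eta> where "\<eta> = (pi - \<bar>\<phi>\<bar>) / 2"
  have \<eta>: "0 < \<eta>" "\<eta> < pi" "\<bar>\<phi>\<bar> \<le> pi - \<eta>" using assms by (auto simp: \<eta>_def field_simps)
  obtain c where "c > 0" "c * theta_growth la r \<le> cmod (Theta (exp (- la)) (of_real r * cis \<phi>))"
    using Theta_lower_bound[OF assms(1) \<eta>(1,2)] \<eta>(3) assms(3) by metis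
  moreover have "c * theta_growth la r > 0" using \<open>c > 0\<close> by simp
  ultimately show ?thesis by force
qed

lemma Theta_bound_pos:
  assumes "c * theta_growth la r \<le> cmod \<theta>" "c > 0" "y \<ge> 0"
  shows "cmod (z / \<theta>) \<le> cmod z / (c * theta_growth la r)"
  unfolding norm_divide by (rule frac_le) (use assms in auto)

lemma complex_ln_cis: "r > 0 \<Longrightarrow> exp (Complex (ln r) y) = of_real r * cis y"
  by (simp add: exp_eq_polar)

text \<open>In the strip |Im z| < pi the function Theta (exp z) has no zeros, so the halfline can be
  turned to the positive axis. Thus the factor acquired by a monomial does not depend on the
  argument of T.\<close>

lemma theta_moment_rotate:
  assumes la: "la > 0" and \<phi>: "\<bar>\<phi>\<bar> < pi"
  shows "(LINT r:{0<..}|lborel. (of_real r * cis \<phi>) ^ n / Theta (exp (- la)) (of_real r * cis \<phi>) / of_real r) = theta_moment la n"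
    and "set_integrable lborel {0<..} (\<lambda>r. (of_real r * cis \<phi>) ^ n / Theta (exp (- la)) (of_real r * cis \<phi>) / of_real r)"
proof -
  define \<eta> where "\<eta> = (pi - \<bar>\<phi>\<bar>) / 2"
  have \<eta>: "0 < \<eta>" "\<eta> < pi" "\<bar>\<phi>\<bar> \<le> pi - \<eta>" using \<phi> by (auto simp: \<eta>_def field_simps)
  obtain c where c: "c > 0" "\<And>r \<phi>. r > 0 \<Longrightarrow> \<bar>\<phi>\<bar> \<le> pi - \<eta> \<Longrightarrow> c * theta_growth la r \<le> cmod (Theta (exp (- la)) (of_real r * cis \<phi>))"
    using Theta_lower_bound[OF la \<eta>(1,2)] by metis
  define K where "K = exp (la * (real n + 1)\<^sup>2 / 2) / c"
  define H where "H z = exp z ^ n / Theta (exp (- la)) (exp z)" for z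
  have HC: "H (Complex (ln r) y) = (of_real r * cis y) ^ n / Theta (exp (- la)) (of_real r * cis y)" if "r > 0" for r y
    using that by (simp add: H_def complex_ln_cis)
  have bd: "cmod ((of_real r * cis y) ^ n / Theta (exp (- la)) (of_real r * cis y)) \<le> K * log_decay r" if "r > 0" "\<bar>y\<bar> \<le> pi - \<eta>" for r y
  proof -
    have "cmod ((of_real r * cis y) ^ n / Theta (exp (- la)) (of_real r * cis y)) \<le> cmod ((of_real r * cis y) ^ n) / (c * theta_growth la r)"
      by (rule Theta_bound_pos[OF c(2)[OF that] c(1) order_refl])
    also have "\<dots> = (r ^ n / theta_growth la r) / c" using that by (simp add: norm_mult norm_power)
    also have "\<dots> \<le> (exp (la * (real n + 1)\<^sup>2 / 2) * log_decay r) / c"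
      by (intro divide_right_mono monomial_over_theta_growth) (use la that c in auto)
    finally show ?thesis by (simp add: K_def)
  qed
  have int: "set_integrable lborel {0<..} (\<lambda>r. (of_real r * cis y) ^ n / Theta (exp (- la)) (of_real r * cis y) / of_real r)"
    if y: "\<bar>y\<bar> \<le> pi - \<eta>" for y
  proof (rule halfline_integral_bound(1)[of 1 _ K 0])
    show "set_borel_measurable lborel {0<..} (\<lambda>r. (of_real r * cis y) ^ n / Theta (exp (- la)) (of_real r * cis y) / of_real r)"
    proof -
      have "continuous_on {0<..} (\<lambda>r. (complex_of_real r * cis y) ^ n)" by (intro continuous_intros)
      then show ?thesis
        using Theta_measurable_ray[OF la zero_less_one, of "\<lambda>r. (of_real r * cis y) ^ n" y]
          Theta_nonzero_ray[OF la, of y] y \<eta> by auto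
    qed
  qed (use bd y in auto)
  have 0: "\<bar>0::real\<bar> \<le> pi - \<eta>" using \<eta> by simp
  have "(LINT r:{0<..}|lborel. H (Complex (ln r) \<phi>) / of_real r) = (LINT r:{0<..}|lborel. H (Complex (ln r) 0) / of_real r)"
  proof (rule rotate_halfline_integral[where a = "- pi" and b = pi and B = "\<lambda>x. K * log_decay (exp x)"])
    show "H holomorphic_on {z. - pi < Im z \<and> Im z < pi}"
      unfolding H_def
    proof (intro holomorphic_intros)
      show "(\<lambda>z. Theta (exp (- la)) (exp z)) holomorphic_on {z. - pi < Im z \<and> Im z < pi}"
        by (rule holomorphic_on_compose_gen[of exp _ "Theta (exp (- la))" "- {0}", unfolded o_def])
           (use Theta_holomorphic[of "exp (- la)"] la in \<open>auto intro!: holomorphic_intros\<close>)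
      fix z assume "z \<in> {z. - pi < Im z \<and> Im z < pi}"
      then show "Theta (exp (- la)) (exp z) \<noteq> 0"
        using Theta_nonzero_ray[OF la, of "Im z" "exp (Re z)"] by (auto simp: exp_eq_polar[of z] abs_less_iff)
    qed
    show "cmod (H (Complex x y)) \<le> K * log_decay (exp x)" if "y \<in> closed_segment \<phi> 0" for x y
    proof -
      have "\<bar>y\<bar> \<le> pi - \<eta>" using that \<eta>(3) by (auto simp: closed_segment_eq_real_ivl split: if_splits)
      then show ?thesis using bd[of "exp x" y] by (simp add: HC[of "exp x" y, simplified])
    qed
    show "((\<lambda>x. K * log_decay (exp x)) \<longlongrightarrow> 0) at_top" "((\<lambda>x. K * log_decay (exp x)) \<longlongrightarrow> 0) at_bot"
      using tendsto_mult_left[OF log_decay_exp_tendsto(1), of K] tendsto_mult_left[OF log_decay_exp_tendsto(2), of K] by simp_all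
    show "set_integrable lborel {0<..} (\<lambda>r. H (Complex (ln r) y) / of_real r)" if "y \<in> {\<phi>, 0}" for y
      using int[of y] that \<eta>(3) 0 by (subst set_integrable_cong[OF refl refl]) (auto simp: HC)
  qed (use \<phi> in auto)
  moreover have "(LINT r:{0<..}|lborel. H (Complex (ln r) y) / of_real r) =
      (LINT r:{0<..}|lborel. (of_real r * cis y) ^ n / Theta (exp (- la)) (of_real r * cis y) / of_real r)" for y
    by (rule set_lebesgue_integral_cong) (auto simp: HC)
  ultimately show "(LINT r:{0<..}|lborel. (of_real r * cis \<phi>) ^ n / Theta (exp (- la)) (of_real r * cis \<phi>) / of_real r) = theta_moment la n"
    by (simp add: theta_moment_def)
  show "set_integrable lborel {0<..} (\<lambda>r. (of_real r * cis \<phi>) ^ n / Theta (exp (- la)) (of_real r * cis \<phi>) / of_real r)"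
    using int \<eta>(3) by blast
qed

lemma theta_moment_bound:
  assumes la: "la > 0"
  obtains K where "K > 0" "\<And>n. cmod (theta_moment la n) \<le> K * exp (la * (real n + 1)\<^sup>2 / 2)"
proof -
  have p: "0 < pi / 2" "pi / 2 < pi" by auto
  obtain c where c: "c > 0" "\<And>r \<phi>. r > 0 \<Longrightarrow> \<bar>\<phi>\<bar> \<le> pi - pi / 2 \<Longrightarrow> c * theta_growth la r \<le> cmod (Theta (exp (- la)) (of_real r * cis \<phi>))"
    using Theta_lower_bound[OF la p] by metis
  have "cmod (theta_moment la n) \<le> (exp (la * (real n + 1)\<^sup>2 / 2) / c + 0) * log_decay_mass" for n
    unfolding theta_moment_def
  proof (rule halfline_integral_bound(2)[of 1])
    show "set_borel_measurable lborel {0<..} (\<lambda>r. of_real r ^ n / Theta (exp (- la)) (of_real r) / of_real r)"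
    proof -
      have "continuous_on {0<..} (\<lambda>r. complex_of_real r ^ n)" by (intro continuous_intros)
      then show ?thesis
        using Theta_measurable_ray[OF la zero_less_one, of "\<lambda>r. of_real r ^ n" 0] Theta_nonzero_ray[OF la, of 0]
        by auto
    qed
    fix r :: real assume r: "r > 0"
    have "cmod (of_real r ^ n / Theta (exp (- la)) (of_real r)) \<le> cmod (of_real r ^ n) / (c * theta_growth la r)"
      by (rule Theta_bound_pos[OF _ c(1) order_refl]) (use c(2)[OF r, of 0] in simp)
    also have "\<dots> = (r ^ n / theta_growth la r) / c" using r by (simp add: norm_power)
    also have "\<dots> \<le> (exp (la * (real n + 1)\<^sup>2 / 2) * log_decay r) / c"
      by (intro divide_right_mono monomial_over_theta_growth) (use la r c in auto)
    finally show "cmod (of_real r ^ n / Theta (exp (- la)) (of_real r)) \<le> exp (la * (real n + 1)\<^sup>2 / 2) / c * log_decay (r / 1) + 0 * log_decay r"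
      by simp
  qed simp
  moreover have "(exp (la * (real n + 1)\<^sup>2 / 2) / c + 0) * log_decay_mass \<le> ((log_decay_mass + 1) / c) * exp (la * (real n + 1)\<^sup>2 / 2)" for n
    using c(1) by (simp add: field_simps)
  ultimately show ?thesis
    by (intro that[of "(log_decay_mass + 1) / c"]) (use c log_decay_mass_nonneg in \<open>auto intro: order_trans\<close>)
qed

text \<open>On the tail this bounds a Taylor polynomial by the first omitted power.\<close>

lemma geometric_sum_le:
  assumes "y \<ge> (2::real)"
  shows "(\<Sum>n<N. y ^ n) \<le> y ^ N"
proof (induction N)
  case (Suc N)
  have "(\<Sum>n<Suc N. y ^ n) \<le> y ^ N + y ^ N" using Suc.IH by simp
  also have "\<dots> \<le> y ^ Suc N" using mult_right_mono[OF assms, of "y ^ N"] assms by simp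
  finally show ?case .
qed simp

text \<open>
  The constants depend on neither \<open>M\<close>, the function, the direction nor \<open>T\<close>; the rate of growth
  \<open>la\<close> of the theta function adds to the rate \<open>sg\<close> of the expansion to be transformed.
\<close>

lemma theta_transform_expansion:
  fixes la sg \<eta> R0 R1 \<alpha> A :: real
  assumes la: "la > 0" and \<eta>: "0 < \<eta>" "\<eta> < pi" and R0: "0 < R0" "R0 \<le> 1"
    and R1: "\<alpha> + ln R1 / la \<le> 0" and A: "A > 0" and sg: "sg \<ge> 0"
  obtains K B where "K > 0" "B > 0"
    "\<And>M g b dr \<phi> t N. \<lbrakk> M \<ge> 0; continuous_on {0<..} (\<lambda>r. g (of_real r * cis dr));
      \<And>n. cmod (b n) \<le> M * A ^ n * exp (sg * (real n)\<^sup>2 / 2);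
      \<And>r N. 0 < r \<Longrightarrow> r < R0 \<Longrightarrow> cmod (g (of_real r * cis dr) - (\<Sum>n<N. b n * (of_real r * cis dr) ^ n))
         \<le> M * A ^ N * exp (sg * (real N)\<^sup>2 / 2) * r ^ N;
      \<And>r. r \<ge> R0 \<Longrightarrow> cmod (g (of_real r * cis dr)) \<le> M * exp ((ln r)\<^sup>2 / (2 * la) + \<alpha> * ln r);
      \<bar>\<phi>\<bar> \<le> pi - \<eta>; 0 < t; t \<le> R1 \<rbrakk> \<Longrightarrow>
      cmod ((LINT r:{0<..}|lborel. g (of_real r * cis dr) / Theta (exp (- la)) (of_real r * cis dr / (of_real t * cis (dr - \<phi>))) / of_real r)
         - (\<Sum>n<N. b n * theta_moment la n * (of_real t * cis (dr - \<phi>)) ^ n))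
       \<le> M * K * B ^ N * exp ((sg + la) * (real N)\<^sup>2 / 2) * t ^ N"
proof -
  obtain c where c: "c > 0" "\<And>r \<phi>. r > 0 \<Longrightarrow> \<bar>\<phi>\<bar> \<le> pi - \<eta> \<Longrightarrow> c * theta_growth la r \<le> cmod (Theta (exp (- la)) (of_real r * cis \<phi>))"
    using Theta_lower_bound[OF la \<eta>] by metis
  define bb where "bb = - ln R0"
  define BB where "BB = - ln R0 / la + 1 / 2"
  have bb0: "bb \<ge> 0" using R0 by (simp add: bb_def)
  have "- ln R0 / la \<ge> 0" using R0 la by (intro divide_nonneg_pos) auto
  then have BB0: "BB \<ge> 0" unfolding BB_def by linarith
  \<comment> \<open>The second entry makes A' r >= 2 for r >= R0, which
    \<open>geometric_sum_le\<close> requires.\<close>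
  define A' where "A' = max A (2 / R0)"
  have A': "A' > 0" "A \<le> A'" "\<And>r. r \<ge> R0 \<Longrightarrow> A' * r \<ge> 2"
  proof -
    show "A' > 0" "A \<le> A'" using A by (auto simp: A'_def)
    show "A' * r \<ge> 2" if "r \<ge> R0" for r
    proof -
      have "2 = (2 / R0) * R0" using R0 by simp
      also have "\<dots> \<le> A' * r" by (rule mult_mono) (use that R0 A in \<open>auto simp: A'_def\<close>)
      finally show ?thesis .
    qed
  qed
  \<comment> \<open>\<open>K1\<close> belongs to the power r^N, which bounds the remainder near 0 as
    well as the Taylor polynomial on the tail; \<open>K2\<close> belongs to the growth of g beyond
    R0.\<close>
  define K1 where "K1 N = A' ^ N * exp (sg * (real N)\<^sup>2 / 2) / c * exp (la * (real N + 1)\<^sup>2 / 2)" for N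
  define K2 where "K2 N = exp ((\<bar>\<alpha>\<bar> + 1) * bb + la * (real N + BB)\<^sup>2 / 2) / c" for N
  define E where "E = BB + 1"
  have main: "cmod ((LINT r:{0<..}|lborel. g (of_real r * cis dr) / Theta (exp (- la)) (of_real r * cis dr / (of_real t * cis (dr - \<phi>))) / of_real r)
         - (\<Sum>n<N. b n * theta_moment la n * (of_real t * cis (dr - \<phi>)) ^ n))
       \<le> M * (K1 N + K2 N) * t ^ N * log_decay_mass"
    if M: "M \<ge> 0" and cont: "continuous_on {0<..} (\<lambda>r. g (of_real r * cis dr))"
      and bn: "\<And>n. cmod (b n) \<le> M * A ^ n * exp (sg * (real n)\<^sup>2 / 2)"
      and small: "\<And>r N. 0 < r \<Longrightarrow> r < R0 \<Longrightarrow> cmod (g (of_real r * cis dr) - (\<Sum>n<N. b n * (of_real r * cis dr) ^ n))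
         \<le> M * A ^ N * exp (sg * (real N)\<^sup>2 / 2) * r ^ N"
      and large: "\<And>r. r \<ge> R0 \<Longrightarrow> cmod (g (of_real r * cis dr)) \<le> M * exp ((ln r)\<^sup>2 / (2 * la) + \<alpha> * ln r)"
      and \<phi>: "\<bar>\<phi>\<bar> \<le> pi - \<eta>" and t: "0 < t" "t \<le> R1" for M g b dr \<phi> t N
  proof -
    let ?u = "\<lambda>r::real. of_real r * cis dr"
    let ?T = "of_real t * cis (dr - \<phi>)"
    let ?th = "\<lambda>r::real. Theta (exp (- la)) (of_real (r / t) * cis \<phi>)"
    have T0: "?T \<noteq> 0" using t by simp
    have uT: "?u r / ?T = of_real (r / t) * cis \<phi>" for r
    proof -
      have "cis dr = cis (dr - \<phi>) * cis \<phi>" by (simp add: cis_mult)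
      then show ?thesis using t by simp
    qed
    have th0: "?th r \<noteq> 0" if "r > 0" for r
      using Theta_nonzero_ray[OF la, of \<phi> "r / t"] \<phi> \<eta> t that by auto
    have thb: "c * theta_growth la (r / t) \<le> cmod (?th r)" if "r > 0" for r
      using c(2)[of "r / t" \<phi>] that t \<phi> by simp
    have small': "cmod (g (?u r) - (\<Sum>n<N. b n * ?u r ^ n)) \<le> M * A' ^ N * exp (sg * (real N)\<^sup>2 / 2) * r ^ N"
      if "0 < r" "r < R0" for r N
    proof -
      have "M * A ^ N * exp (sg * (real N)\<^sup>2 / 2) * r ^ N \<le> M * A' ^ N * exp (sg * (real N)\<^sup>2 / 2) * r ^ N"
        by (intro mult_right_mono mult_left_mono power_mono) (use M A A' that in auto)
      then show ?thesis using small[OF that, of N] by linarith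
    qed
    have large': "cmod (g (?u r) - (\<Sum>n<N. b n * ?u r ^ n))
        \<le> M * A' ^ N * exp (sg * (real N)\<^sup>2 / 2) * r ^ N + M * exp ((ln r)\<^sup>2 / (2 * la) + \<alpha> * ln r)"
      if r: "r \<ge> R0" for r N
    proof -
      have r0: "r > 0" using r R0 by linarith
      have "cmod (\<Sum>n<N. b n * ?u r ^ n) \<le> (\<Sum>n<N. M * exp (sg * (real N)\<^sup>2 / 2) * (A' * r) ^ n)"
      proof (rule order_trans[OF norm_sum sum_mono])
        fix n assume n: "n \<in> {..<N}"
        have "exp (sg * (real n)\<^sup>2 / 2) \<le> exp (sg * (real N)\<^sup>2 / 2)"
          using n sg by (auto intro!: mult_left_mono power_mono)
        then have "M * A ^ n * exp (sg * (real n)\<^sup>2 / 2) \<le> M * A' ^ n * exp (sg * (real N)\<^sup>2 / 2)"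
          by (intro mult_mono power_mono) (use M A A' in auto)
        then have "cmod (b n) \<le> M * A' ^ n * exp (sg * (real N)\<^sup>2 / 2)" using bn[of n] by linarith
        then have "cmod (b n) * r ^ n \<le> M * A' ^ n * exp (sg * (real N)\<^sup>2 / 2) * r ^ n"
          using r0 by (intro mult_right_mono) auto
        then show "cmod (b n * ?u r ^ n) \<le> M * exp (sg * (real N)\<^sup>2 / 2) * (A' * r) ^ n"
          using r0 by (simp add: norm_mult norm_power power_mult_distrib mult_ac)
      qed
      also have "\<dots> = M * exp (sg * (real N)\<^sup>2 / 2) * (\<Sum>n<N. (A' * r) ^ n)" by (simp add: sum_distrib_left)
      also have "\<dots> \<le> M * exp (sg * (real N)\<^sup>2 / 2) * (A' * r) ^ N"
        by (intro mult_left_mono geometric_sum_le A'(3) r) (use M in auto)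
      finally have "cmod (\<Sum>n<N. b n * ?u r ^ n) \<le> M * A' ^ N * exp (sg * (real N)\<^sup>2 / 2) * r ^ N"
        by (simp add: power_mult_distrib mult_ac)
      then show ?thesis using norm_triangle_ineq4[of "g (?u r)" "\<Sum>n<N. b n * ?u r ^ n"] large[OF r] by linarith
    qed
    have bound: "cmod ((g (?u r) - (\<Sum>n<N. b n * ?u r ^ n)) / ?th r) \<le> (M * K1 N * t ^ N) * log_decay (r / t) + (M * K2 N * t ^ N) * log_decay r"
      if r: "r > 0" for r N
    proof -
      let ?X = "M * A' ^ N * exp (sg * (real N)\<^sup>2 / 2) * r ^ N"
      let ?Y = "if r \<ge> R0 then M * exp ((ln r)\<^sup>2 / (2 * la) + \<alpha> * ln r) else 0"
      have "cmod (g (?u r) - (\<Sum>n<N. b n * ?u r ^ n)) \<le> ?X + ?Y"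
        using small'[of r N] large'[of r N] r by (cases "r \<ge> R0") auto
      then have "cmod ((g (?u r) - (\<Sum>n<N. b n * ?u r ^ n)) / ?th r) \<le> (?X + ?Y) / (c * theta_growth la (r / t))"
        unfolding norm_divide by (intro frac_le thb r) (use c M A' r in auto)
      also have "\<dots> = ?X / (c * theta_growth la (r / t)) + ?Y / (c * theta_growth la (r / t))"
        by (rule add_divide_distrib)
      also have "?X / (c * theta_growth la (r / t)) = (M * A' ^ N * exp (sg * (real N)\<^sup>2 / 2) / c * t ^ N) * ((r / t) ^ N / theta_growth la (r / t))"
        using t by (simp add: power_divide)
      also have "\<dots> \<le> (M * A' ^ N * exp (sg * (real N)\<^sup>2 / 2) / c * t ^ N) * (exp (la * (real N + 1)\<^sup>2 / 2) * log_decay (r / t))"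
        by (intro mult_left_mono monomial_over_theta_growth la) (use t r M A' c in auto)
      also have "\<dots> = (M * K1 N * t ^ N) * log_decay (r / t)" by (simp add: K1_def)
      also have "?Y / (c * theta_growth la (r / t)) \<le> (M * K2 N * t ^ N) * log_decay r"
      proof (cases "r \<ge> R0")
        case True
        have "?Y / (c * theta_growth la (r / t)) = (M / c) * (exp ((ln r)\<^sup>2 / (2 * la) + \<alpha> * ln r) / theta_growth la (r / t))"
          using True by simp
        also have "\<dots> \<le> (M / c) * (exp ((\<bar>\<alpha>\<bar> + 1) * bb + la * (real N + BB)\<^sup>2 / 2) * t ^ N * log_decay r)"
          unfolding bb_def BB_def
          by (intro mult_left_mono tail_over_theta_growth[OF la R0 R1]) (use True t M c in auto)
        also have "\<dots> = (M * K2 N * t ^ N) * log_decay r" by (simp add: K2_def)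
        finally show ?thesis .
      next
        case False
        then show ?thesis using M t c by (simp add: K2_def less_imp_le)
      qed
      finally show ?thesis by simp
    qed
    have cont': "continuous_on {0<..} (\<lambda>r. g (?u r) - (\<Sum>n<N. b n * ?u r ^ n))" for N
      by (intro continuous_on_diff cont) (intro continuous_intros)
    note rem = halfline_integral_bound[OF t(1) Theta_measurable_ray[OF la t(1) cont' th0] bound]
    \<comment> \<open>For N = 0 nothing is subtracted, so the remainder estimate itself yields
      integrability of the full integrand.\<close>
    have gi: "set_integrable lborel {0<..} (\<lambda>r. g (?u r) / ?th r / of_real r)"
      using rem(1)[of 0] by simp
    \<comment> \<open>Writing u = T (r/t) e^(i \<phi>) splits off T^n and leaves an integrand in
      r/t, to which scaling invariance and \<open>theta_moment_rotate\<close> apply.\<close>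
    have mono: "set_integrable lborel {0<..} (\<lambda>r. ?u r ^ n / ?th r / of_real r)"
      "(LINT r:{0<..}|lborel. ?u r ^ n / ?th r / of_real r) = ?T ^ n * theta_moment la n" for n
    proof -
      have p: "\<bar>\<phi>\<bar> < pi" using \<phi> \<eta> by linarith
      let ?f = "\<lambda>r::real. (of_real r * cis \<phi>) ^ n / Theta (exp (- la)) (of_real r * cis \<phi>)"
      have u: "?u r = ?T * (of_real (r / t) * cis \<phi>)" for r using uT[of r] T0 by (simp add: field_simps)
      have e: "?u r ^ n / ?th r / of_real r = ?T ^ n * (?f (r / t) / of_real r)" for r
        by (subst u) (use t in \<open>simp add: power_mult_distrib power_divide\<close>)
      note m = theta_moment_rotate[OF la p, of n]
      show "set_integrable lborel {0<..} (\<lambda>r. ?u r ^ n / ?th r / of_real r)"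
        unfolding e by (intro set_integrable_mult_right halfline_integral_scale(2)[OF t(1), of ?f] m(2))
      show "(LINT r:{0<..}|lborel. ?u r ^ n / ?th r / of_real r) = ?T ^ n * theta_moment la n"
        unfolding e set_integral_mult_right
        using halfline_integral_scale(1)[OF t(1), of ?f] m(1) by simp
    qed
    have sumi: "set_integrable lborel {0<..} (\<lambda>r. \<Sum>n<N. b n * (?u r ^ n / ?th r / of_real r))"
      "(LINT r:{0<..}|lborel. \<Sum>n<N. b n * (?u r ^ n / ?th r / of_real r)) = (\<Sum>n<N. b n * (?T ^ n * theta_moment la n))"
    proof -
      have "set_integrable lborel {0<..} (\<lambda>r. b n * (?u r ^ n / ?th r / of_real r))" for n
        by (intro set_integrable_mult_right mono)
      then have i: "integrable lborel (\<lambda>r. indicator {0<..} r *\<^sub>R (b n * (?u r ^ n / ?th r / of_real r)))" for n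
        unfolding set_integrable_def .
      show "set_integrable lborel {0<..} (\<lambda>r. \<Sum>n<N. b n * (?u r ^ n / ?th r / of_real r))"
        unfolding set_integrable_def scaleR_sum_right by (rule Bochner_Integration.integrable_sum[OF i])
      have "(LINT r:{0<..}|lborel. \<Sum>n<N. b n * (?u r ^ n / ?th r / of_real r)) = (\<Sum>n<N. (LINT r:{0<..}|lborel. b n * (?u r ^ n / ?th r / of_real r)))"
        unfolding set_lebesgue_integral_def scaleR_sum_right by (rule Bochner_Integration.integral_sum[OF i])
      also have "\<dots> = (\<Sum>n<N. b n * (?T ^ n * theta_moment la n))"
        by (simp only: set_integral_mult_right mono)
      finally show "(LINT r:{0<..}|lborel. \<Sum>n<N. b n * (?u r ^ n / ?th r / of_real r)) = (\<Sum>n<N. b n * (?T ^ n * theta_moment la n))" .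
    qed
    have "(LINT r:{0<..}|lborel. (g (?u r) - (\<Sum>n<N. b n * ?u r ^ n)) / ?th r / of_real r)
      = (LINT r:{0<..}|lborel. g (?u r) / ?th r / of_real r - (\<Sum>n<N. b n * (?u r ^ n / ?th r / of_real r)))"
      by (rule set_lebesgue_integral_cong) (auto simp: diff_divide_distrib sum_divide_distrib)
    also have "\<dots> = (LINT r:{0<..}|lborel. g (?u r) / ?th r / of_real r) - (\<Sum>n<N. b n * (?T ^ n * theta_moment la n))"
      by (subst set_integral_diff(2)[OF gi sumi(1)]) (simp only: sumi(2))
    finally have "cmod ((LINT r:{0<..}|lborel. g (?u r) / ?th r / of_real r) - (\<Sum>n<N. b n * (?T ^ n * theta_moment la n)))
      \<le> (M * K1 N * t ^ N + M * K2 N * t ^ N) * log_decay_mass"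
      using rem(2)[of N] by simp
    then show ?thesis unfolding uT by (simp add: algebra_simps)
  qed
  \<comment> \<open>In (N+1)^2 and (N + \<open>BB\<close>)^2 the constant terms go into
    \<open>K\<close>, the terms linear in N into the geometric rate \<open>B\<close>, and only N^2
    stays in the exponent.\<close>
  define K where "K = (log_decay_mass + 1) * (exp (la / 2) / c + exp ((\<bar>\<alpha>\<bar> + 1) * bb + la * BB\<^sup>2 / 2) / c)"
  define B where "B = (A' + 1) * (exp la + exp (la * BB))"
  have K: "K > 0" unfolding K_def using c log_decay_mass_nonneg
    by (intro mult_pos_pos add_pos_pos add_nonneg_pos divide_pos_pos) auto
  have B: "B > 0" unfolding B_def using A'(1) by (intro mult_pos_pos add_pos_pos) auto
  have KB: "(K1 N + K2 N) * log_decay_mass \<le> K * B ^ N * exp ((sg + la) * (real N)\<^sup>2 / 2)" for N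
  proof -
    let ?e = "exp ((sg + la) * (real N)\<^sup>2 / 2)"
    have "K1 N = exp (la / 2) / c * (A' * exp la) ^ N * ?e"
      unfolding K1_def power_mult_distrib exp_of_nat_mult[symmetric]
      by (simp add: exp_add[symmetric] power2_eq_square algebra_simps add_divide_distrib)
    also have "\<dots> \<le> exp (la / 2) / c * B ^ N * ?e"
    proof (intro mult_right_mono mult_left_mono power_mono)
      show "A' * exp la \<le> B" unfolding B_def using A'(1) by (intro mult_mono) auto
    qed (use A' c in auto)
    finally have 1: "K1 N \<le> exp (la / 2) / c * B ^ N * ?e" .
    have "K2 N = exp ((\<bar>\<alpha>\<bar> + 1) * bb + la * BB\<^sup>2 / 2) / c * exp (la * BB) ^ N * exp (la * (real N)\<^sup>2 / 2)"
      unfolding K2_def exp_of_nat_mult[symmetric]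
      by (simp add: exp_add[symmetric] power2_eq_square algebra_simps add_divide_distrib)
    also have "\<dots> \<le> exp ((\<bar>\<alpha>\<bar> + 1) * bb + la * BB\<^sup>2 / 2) / c * B ^ N * ?e"
    proof (intro mult_mono mult_left_mono power_mono)
      have "1 * exp (la * BB) \<le> B" unfolding B_def using A'(1) by (intro mult_mono) auto
      then show "exp (la * BB) \<le> B" by simp
      show "exp (la * (real N)\<^sup>2 / 2) \<le> ?e" using sg by (simp add: algebra_simps)
    qed (use c B in auto)
    finally have 2: "K2 N \<le> exp ((\<bar>\<alpha>\<bar> + 1) * bb + la * BB\<^sup>2 / 2) / c * B ^ N * ?e" .
    have "(K1 N + K2 N) * log_decay_mass \<le> ((exp (la / 2) / c + exp ((\<bar>\<alpha>\<bar> + 1) * bb + la * BB\<^sup>2 / 2) / c) * (B ^ N * ?e)) * (log_decay_mass + 1)"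
    proof (rule mult_mono)
      show "K1 N + K2 N \<le> (exp (la / 2) / c + exp ((\<bar>\<alpha>\<bar> + 1) * bb + la * BB\<^sup>2 / 2) / c) * (B ^ N * ?e)"
        using 1 2 by (simp add: distrib_right mult.assoc)
      show "0 \<le> (exp (la / 2) / c + exp ((\<bar>\<alpha>\<bar> + 1) * bb + la * BB\<^sup>2 / 2) / c) * (B ^ N * ?e)"
        using c B by (intro mult_nonneg_nonneg add_nonneg_nonneg) auto
    qed (use log_decay_mass_nonneg in auto)
    then show ?thesis by (simp add: K_def mult_ac)
  qed
  show ?thesis
  proof (rule that[OF K B])
    fix M :: real and g :: "complex \<Rightarrow> complex" and b dr \<phi> t N
    assume a: "M \<ge> 0" "continuous_on {0<..} (\<lambda>r. g (of_real r * cis dr))"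
      "\<And>n. cmod (b n) \<le> M * A ^ n * exp (sg * (real n)\<^sup>2 / 2)"
      "\<And>r N. 0 < r \<Longrightarrow> r < R0 \<Longrightarrow> cmod (g (of_real r * cis dr) - (\<Sum>n<N. b n * (of_real r * cis dr) ^ n))
         \<le> M * A ^ N * exp (sg * (real N)\<^sup>2 / 2) * r ^ N"
      "\<And>r. r \<ge> R0 \<Longrightarrow> cmod (g (of_real r * cis dr)) \<le> M * exp ((ln r)\<^sup>2 / (2 * la) + \<alpha> * ln r)"
      "\<bar>\<phi>\<bar> \<le> pi - \<eta>" "0 < t" "t \<le> R1"
    have "M * (K1 N + K2 N) * t ^ N * log_decay_mass = M * t ^ N * ((K1 N + K2 N) * log_decay_mass)" by simp
    also have "\<dots> \<le> M * t ^ N * (K * B ^ N * exp ((sg + la) * (real N)\<^sup>2 / 2))"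
      by (intro mult_left_mono KB) (use a in auto)
    finally show "cmod ((LINT r:{0<..}|lborel. g (of_real r * cis dr) / Theta (exp (- la)) (of_real r * cis dr / (of_real t * cis (dr - \<phi>))) / of_real r)
         - (\<Sum>n<N. b n * theta_moment la n * (of_real t * cis (dr - \<phi>)) ^ n))
       \<le> M * K * B ^ N * exp ((sg + la) * (real N)\<^sup>2 / 2) * t ^ N"
      using main[OF a, of N] by (simp add: mult_ac)
  qed
qed

section \<open>Bounded holomorphic functions\<close>

definition taylor_coeff :: "(complex \<Rightarrow> complex) \<Rightarrow> nat \<Rightarrow> complex" where
  "taylor_coeff f n = (deriv ^^ n) f 0 / fact n"

text \<open>The bound is known on the open disc only, so Cauchy's inequality is applied on circles
  of radius s < r and s tends to r.\<close>

lemma taylor_coeff_bound: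
  assumes f: "f holomorphic_on ball 0 r" and r: "r > 0" and K: "\<And>x. x \<in> ball 0 r \<Longrightarrow> cmod (f x) \<le> K"
  shows "cmod (taylor_coeff f n) \<le> K / r ^ n"
proof -
  have le: "cmod (taylor_coeff f n) * s ^ n \<le> K" if s: "0 < s" "s < r" for s
  proof -
    have sub: "cball 0 s \<subseteq> ball (0::complex) r" using s by auto
    have "cmod ((deriv ^^ n) f 0) \<le> fact n * K / s ^ n"
    proof (rule Cauchy_inequality)
      show "f holomorphic_on ball 0 s" using f by (rule holomorphic_on_subset) (use s in auto)
      show "continuous_on (cball 0 s) f" using f sub holomorphic_on_imp_continuous_on holomorphic_on_subset by blast
      show "cmod (f x) \<le> K" if "cmod (0 - x) = s" for x using that s by (intro K) auto
    qed (use s in auto)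
    then show ?thesis using s unfolding taylor_coeff_def by (simp add: norm_divide field_simps)
  qed
  have "((\<lambda>s. cmod (taylor_coeff f n) * s ^ n) \<longlongrightarrow> cmod (taylor_coeff f n) * r ^ n) (at_left r)"
    by (intro tendsto_intros)
  moreover have "eventually (\<lambda>s. cmod (taylor_coeff f n) * s ^ n \<le> K) (at_left r)"
    using eventually_at_left_real[OF r] by eventually_elim (use le in auto)
  ultimately have "cmod (taylor_coeff f n) * r ^ n \<le> K"
    by (rule tendsto_upperbound) auto
  then show ?thesis using r by (simp add: field_simps)
qed

lemma taylor_coeff_sums:
  assumes f: "f holomorphic_on ball 0 r" and x: "cmod x < r"
  shows "(\<lambda>n. taylor_coeff f n * x ^ n) sums f x"
  using holomorphic_power_series[OF f, of x] x by (simp add: taylor_coeff_def)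

text \<open>For |x| <= r/2 the geometric tail is at most twice its first term. For larger |x| one
  has 2|x|/r >= 1, so f and the whole polynomial are bounded by multiples of K (2|x|/r)^N. The
  factor 2 in the base buys an estimate that does not degenerate at the boundary.\<close>

lemma taylor_remainder:
  assumes f: "f holomorphic_on ball 0 r" and r: "r > 0" and K: "\<And>x. x \<in> ball 0 r \<Longrightarrow> cmod (f x) \<le> K"
    and x: "cmod x < r"
  shows "cmod (f x - (\<Sum>j<N. taylor_coeff f j * x ^ j)) \<le> 3 * K * (2 * cmod x / r) ^ N"
proof -
  define y where "y = cmod x / r"
  have y: "0 \<le> y" "y < 1" using x r by (auto simp: y_def)
  have K0: "K \<ge> 0" using K[of 0] r by (auto intro: order_trans[OF norm_ge_zero])
  have t: "cmod (taylor_coeff f j * x ^ j) \<le> K * y ^ j" for j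
    using mult_right_mono[OF taylor_coeff_bound[OF f r K, of j], of "cmod x ^ j"]
    by (simp add: norm_mult norm_power y_def power_divide)
  show ?thesis
  proof (cases "y \<le> 1 / 2")
    case True
    have s: "(\<lambda>j. taylor_coeff f (j + N) * x ^ (j + N)) sums (f x - (\<Sum>j<N. taylor_coeff f j * x ^ j))"
      using sums_split_initial_segment[OF taylor_coeff_sums[OF f x], of N] .
    have "cmod (f x - (\<Sum>j<N. taylor_coeff f j * x ^ j)) \<le> (\<Sum>j. K * y ^ N * y ^ j)"
    proof (subst sums_unique[OF s], rule norm_suminf_le)
      show "summable (\<lambda>j. K * y ^ N * y ^ j)" using y by (intro summable_mult summable_geometric) simp
      show "cmod (taylor_coeff f (j + N) * x ^ (j + N)) \<le> K * y ^ N * y ^ j" for j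
        using t[of "j + N"] by (simp add: power_add mult_ac)
    qed
    also have "\<dots> = K * y ^ N * (1 / (1 - y))"
      using y by (subst suminf_mult) (auto simp: suminf_geometric intro!: summable_geometric)
    also have "\<dots> \<le> K * y ^ N * 3"
      using True y K0 by (intro mult_left_mono) (auto simp: field_simps)
    also have "\<dots> \<le> K * (2 * y) ^ N * 3"
      using y K0 by (intro mult_right_mono mult_left_mono power_mono) auto
    finally show ?thesis by (simp add: y_def mult_ac)
  next
    case False
    then have y2: "2 * y \<ge> 1" by simp
    have "(\<Sum>j<N. (1 / 2) ^ j) \<le> (2::real)"
      by (simp add: sum_gp_strict)
    have "cmod (\<Sum>j<N. taylor_coeff f j * x ^ j) \<le> (\<Sum>j<N. K * (2 * y) ^ N * (1 / 2) ^ j)"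
    proof (rule order_trans[OF norm_sum sum_mono])
      fix j assume j: "j \<in> {..<N}"
      have "y ^ j = (2 * y) ^ j * (1 / 2) ^ j" by (simp add: power_mult_distrib power_divide)
      also have "\<dots> \<le> (2 * y) ^ N * (1 / 2) ^ j" using j y2 by (intro mult_right_mono power_increasing) auto
      finally have "K * y ^ j \<le> K * ((2 * y) ^ N * (1 / 2) ^ j)" using K0 by (rule mult_left_mono)
      then show "cmod (taylor_coeff f j * x ^ j) \<le> K * (2 * y) ^ N * (1 / 2) ^ j" using t[of j] by simp
    qed
    also have "\<dots> = K * (2 * y) ^ N * (\<Sum>j<N. (1 / 2) ^ j)" by (simp add: sum_distrib_left)
    also have "\<dots> \<le> K * (2 * y) ^ N * 2"
      using K0 y \<open>(\<Sum>j<N. (1 / 2) ^ j) \<le> (2::real)\<close> by (intro mult_left_mono) auto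
    finally have "cmod (\<Sum>j<N. taylor_coeff f j * x ^ j) \<le> K * (2 * y) ^ N * 2" .
    moreover have "cmod (f x) \<le> K * (2 * y) ^ N"
      using K[of x] x one_le_power[OF y2, of N] K0 mult_left_mono[of 1 "(2 * y) ^ N" K] by auto
    ultimately have "cmod (f x - (\<Sum>j<N. taylor_coeff f j * x ^ j)) \<le> 3 * K * (2 * y) ^ N"
      using norm_triangle_ineq4[of "f x" "\<Sum>j<N. taylor_coeff f j * x ^ j"] by linarith
    then show ?thesis by (simp add: y_def)
  qed
qed

text \<open>The case N = 2 of \<open>taylor_remainder\<close> around z; 12 = 3 * 2^2.\<close>

lemma holomorphic_second_order:
  assumes f: "f holomorphic_on A" and b: "ball z r \<subseteq> A" and r: "r > 0"
    and K: "\<And>x. x \<in> A \<Longrightarrow> cmod (f x) \<le> K" and h: "cmod h < r"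
  shows "cmod (f (z + h) - f z - deriv f z * h) \<le> 12 * K * (cmod h / r)\<^sup>2"
proof -
  define g where "g h = f (z + h)" for h
  have sub: "(\<lambda>h. z + h) ` ball 0 r \<subseteq> A" using b ball_translation[of z 0 r] by simp
  have g: "g holomorphic_on ball 0 r" unfolding g_def
    by (rule holomorphic_on_compose_gen[of "\<lambda>h. z + h" _ f A, unfolded o_def]) (use f sub in \<open>auto intro!: holomorphic_intros\<close>)
  have Kg: "cmod (g x) \<le> K" if "x \<in> ball 0 r" for x
    unfolding g_def by (rule K, rule subsetD[OF sub]) (use that in blast)
  have d: "deriv g 0 = deriv f z"
  proof -
    have "f holomorphic_on ball z r" using f b by (rule holomorphic_on_subset)
    then have "(f has_field_derivative deriv f z) (at (0 + z))"
      using r holomorphic_derivI[of f "ball z r" z] by simp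
    then have "(g has_field_derivative deriv f z) (at 0)"
      unfolding g_def DERIV_shift by (simp add: add.commute)
    then show ?thesis by (rule DERIV_imp_deriv)
  qed
  have "cmod (g h - (\<Sum>j<2. taylor_coeff g j * h ^ j)) \<le> 3 * K * (2 * cmod h / r)\<^sup>2"
    by (rule taylor_remainder[OF g r Kg h])
  moreover have "(\<Sum>j<2. taylor_coeff g j * h ^ j) = f z + deriv f z * h"
    by (simp add: numeral_2_eq_2 taylor_coeff_def d) (simp add: g_def)
  ultimately show ?thesis by (simp add: g_def power_divide power_mult_distrib diff_diff_eq)
qed

section \<open>Separate holomorphy in two variables and the space \<open>F_space\<close>\<close>

definition bounded_separately_holomorphic :: "complex set \<Rightarrow> complex set \<Rightarrow> (complex \<times> complex \<Rightarrow> complex) \<Rightarrow> bool" where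
  "bounded_separately_holomorphic A B f \<longleftrightarrow>
     (\<forall>y\<in>B. (\<lambda>x. f (x, y)) holomorphic_on A) \<and> (\<forall>x\<in>A. (\<lambda>y. f (x, y)) holomorphic_on B) \<and> bounded (f ` (A \<times> B))"

lemma holomorphic2_imp_separately:
  assumes f: "holomorphic2_on f (A \<times> B)"
  shows "y \<in> B \<Longrightarrow> (\<lambda>x. f (x, y)) holomorphic_on A" "x \<in> A \<Longrightarrow> (\<lambda>y. f (x, y)) holomorphic_on B"
proof -
  have 1: "(\<lambda>x. f (x, y)) field_differentiable at x" "(\<lambda>y. f (x, y)) field_differentiable at y"
    if "x \<in> A" "y \<in> B" for x y
  proof -
    obtain a b where d: "(f has_derivative (\<lambda>(v1, v2). a * v1 + b * v2)) (at (x, y))"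
      using f \<open>x \<in> A\<close> \<open>y \<in> B\<close> unfolding holomorphic2_on_def by blast
    have "((\<lambda>x. (x, y)) has_derivative (\<lambda>h. (h, 0))) (at x)" by (auto intro!: derivative_eq_intros)
    from has_derivative_compose[OF this d] show "(\<lambda>x. f (x, y)) field_differentiable at x"
      by (auto simp: field_differentiable_def has_field_derivative_def)
    have "((\<lambda>y. (x, y)) has_derivative (\<lambda>h. (0, h))) (at y)" by (auto intro!: derivative_eq_intros)
    from has_derivative_compose[OF this d] show "(\<lambda>y. f (x, y)) field_differentiable at y"
      by (auto simp: field_differentiable_def has_field_derivative_def)
  qed
  show "y \<in> B \<Longrightarrow> (\<lambda>x. f (x, y)) holomorphic_on A"
    unfolding holomorphic_on_def by (auto intro: field_differentiable_at_within 1)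
  show "x \<in> A \<Longrightarrow> (\<lambda>y. f (x, y)) holomorphic_on B"
    unfolding holomorphic_on_def by (auto intro: field_differentiable_at_within 1)
qed

text \<open>A version of Osgood's lemma; the mixed difference shows that the partial derivative is
  Hoelder continuous with exponent 1/2.\<close>

lemma bounded_separately_holomorphic_imp_holomorphic2:
  assumes A: "open A" and B: "open B" and f: "bounded_separately_holomorphic A B f"
  shows "holomorphic2_on f (A \<times> B)"
  unfolding holomorphic2_on_def
proof
  fix p assume "p \<in> A \<times> B"
  then obtain x y where p: "p = (x, y)" and x: "x \<in> A" and y: "y \<in> B" by auto
  from f obtain M where M: "\<And>x y. x \<in> A \<Longrightarrow> y \<in> B \<Longrightarrow> cmod (f (x, y)) \<le> M"
    unfolding bounded_separately_holomorphic_def bounded_iff by fastforce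
  have M0: "M \<ge> 0" using M[OF x y] norm_ge_zero order_trans by blast
  obtain r1 where r1: "r1 > 0" "ball x r1 \<subseteq> A" using A x open_contains_ball by blast
  obtain r2 where r2: "r2 > 0" "ball y r2 \<subseteq> B" using B y open_contains_ball by blast
  \<comment> \<open>Halving leaves room for a disc of radius r around every point of the disc of
    radius r, and r < 1 allows |h|^2 to be replaced by |h|.\<close>
  define r where "r = min 1 (min r1 r2) / 2"
  have r: "r > 0" "r < 1" "r \<le> r1 / 2" "r \<le> r2 / 2" using r1 r2 by (auto simp: r_def)
  have bx: "x' \<in> A \<and> ball x' r \<subseteq> A" if "dist x x' < r" for x'
  proof -
    have "ball x' r \<subseteq> ball x r1"
    proof
      fix w assume "w \<in> ball x' r"
      then show "w \<in> ball x r1" using that r(3) dist_triangle[of x w x'] by simp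
    qed
    moreover have "x' \<in> ball x' r" using r(1) by simp
    ultimately show ?thesis using r1(2) by blast
  qed
  have by': "y' \<in> B \<and> ball y' r \<subseteq> B" if "dist y y' < r" for y'
  proof -
    have "ball y' r \<subseteq> ball y r2"
    proof
      fix w assume "w \<in> ball y' r"
      then show "w \<in> ball y r2" using that r(4) dist_triangle[of y w y'] by simp
    qed
    moreover have "y' \<in> ball y' r" using r(1) by simp
    ultimately show ?thesis using r2(2) by blast
  qed
  define C where "C = 12 * M / r\<^sup>2"
  have C0: "C \<ge> 0" using M0 by (simp add: C_def)
  define a where "a = deriv (\<lambda>x. f (x, y)) x"
  define b where "b x' = deriv (\<lambda>y. f (x', y)) y" for x'
  have Dx: "cmod (f (x + h, y') - f (x, y') - deriv (\<lambda>x. f (x, y')) x * h) \<le> C * (cmod h)\<^sup>2" if "cmod h < r" "y' \<in> B" for h y'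
  proof -
    have "cmod (f (x + h, y') - f (x, y') - deriv (\<lambda>x. f (x, y')) x * h) \<le> 12 * M * (cmod h / r)\<^sup>2"
      by (rule holomorphic_second_order[of "\<lambda>x. f (x, y')" A])
         (use f that bx[of x] r(1) M in \<open>auto simp: bounded_separately_holomorphic_def\<close>)
    then show ?thesis by (simp add: C_def power_divide)
  qed
  have Dy: "cmod (f (x', y + k) - f (x', y) - b x' * k) \<le> C * (cmod k)\<^sup>2" if "cmod k < r" "x' \<in> A" for k x'
  proof -
    have "cmod (f (x', y + k) - f (x', y) - deriv (\<lambda>y. f (x', y)) y * k) \<le> 12 * M * (cmod k / r)\<^sup>2"
      by (rule holomorphic_second_order[of "\<lambda>y. f (x', y)" B])
         (use f that by'[of y] r(1) M in \<open>auto simp: bounded_separately_holomorphic_def\<close>)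
    then show ?thesis by (simp add: C_def b_def power_divide)
  qed
  define L where "L = M / r + C"
  have Lip: "cmod (f (x + h, y') - f (x, y')) \<le> L * cmod h" if h: "cmod h < r" and y': "y' \<in> B" for h y'
  proof -
    let ?d = "deriv (\<lambda>x. f (x, y')) x"
    have "cmod ?d \<le> M / r"
    proof -
      define g where "g h = f (x + h, y')" for h
      have sub: "(\<lambda>h. x + h) ` ball 0 r \<subseteq> A" using bx[of x] r(1) ball_translation[of x 0 r] by simp
      have g: "g holomorphic_on ball 0 r" unfolding g_def
        by (rule holomorphic_on_compose_gen[of "\<lambda>h. x + h" _ "\<lambda>x. f (x, y')" A, unfolded o_def])
           (use f sub y' in \<open>auto simp: bounded_separately_holomorphic_def intro!: holomorphic_intros\<close>)
      have "cmod (taylor_coeff g 1) \<le> M / r ^ 1"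
      proof (rule taylor_coeff_bound[OF g r(1)])
        fix w :: complex assume "w \<in> ball 0 r"
        then have "x + w \<in> A" using sub by blast
        then show "cmod (g w) \<le> M" using y' by (simp add: g_def M)
      qed
      moreover have "((\<lambda>x. f (x, y')) has_field_derivative ?d) (at (0 + x))"
        using f y' x A by (auto simp: bounded_separately_holomorphic_def intro!: holomorphic_derivI)
      then have "(g has_field_derivative ?d) (at 0)"
        unfolding g_def DERIV_shift by (simp add: add.commute)
      then have "deriv g 0 = ?d" by (rule DERIV_imp_deriv)
      ultimately show ?thesis by (simp add: taylor_coeff_def)
    qed
    then have "cmod (?d * h) \<le> M / r * cmod h" 
      using mult_right_mono[of "cmod ?d" "M / r" "cmod h"] by (simp add: norm_mult)
    moreover have "cmod (f (x + h, y') - f (x, y')) \<le> C * (cmod h)\<^sup>2 + cmod (?d * h)"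
      using Dx[OF h y'] norm_triangle_sub[of "f (x + h, y') - f (x, y')" "?d * h"] by linarith
    moreover have "C * (cmod h)\<^sup>2 \<le> C * cmod h"
      using h r(2) C0 by (intro mult_left_mono) (auto simp: power2_eq_square mult_left_le_one_le)
    ultimately show ?thesis by (simp add: L_def algebra_simps)
  qed
  have L0: "L \<ge> 0" using M0 C0 r by (simp add: L_def)
  have b_hoelder: "cmod (b (x + h) - b x) \<le> (2 * L + 2 * C) * sqrt (cmod h)" if h: "cmod h < r\<^sup>2" for h
  proof (cases "h = 0")
    case False
    \<comment> \<open>The mixed difference over the steps h and s is O(|h|) by the Lipschitz bound,
      and it differs from (b (x + h) - b x) s by O(s^2). The choice s = sqrt |h| balances the two
      errors.\<close>
    define s where "s = sqrt (cmod h)"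
    have s: "s > 0" "s < r" "s * s = cmod h" using False h r(1) by (auto simp: s_def real_less_lsqrt)
    have hr: "cmod h < r" using h r by (smt (verit) power2_eq_square mult_left_le_one_le)
    have xh: "x + h \<in> A" using bx[of "x + h"] hr by (simp add: dist_norm)
    have ys: "y + of_real s \<in> B" using by'[of "y + of_real s"] s by (simp add: dist_norm)
    have "(b (x + h) - b x) * of_real s
       = - (f (x + h, y + of_real s) - f (x + h, y) - b (x + h) * of_real s)
         + (f (x, y + of_real s) - f (x, y) - b x * of_real s)
         + (f (x + h, y + of_real s) - f (x, y + of_real s)) - (f (x + h, y) - f (x, y))"
      by (simp add: algebra_simps)
    also have "cmod \<dots> \<le> C * s\<^sup>2 + C * s\<^sup>2 + L * cmod h + L * cmod h"
    proof -
      have tri: "cmod (- u + v + w - w') \<le> cmod u + cmod v + cmod w + cmod w'" for u v w w'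
        using norm_triangle_ineq4[of "- u + v + w" w'] norm_triangle_ineq[of "- u + v" w] norm_triangle_ineq[of "- u" v]
        by simp
      have "cmod (f (x + h, y + of_real s) - f (x + h, y) - b (x + h) * of_real s) \<le> C * s\<^sup>2"
        using Dy[of "of_real s" "x + h"] s xh by simp
      moreover have "cmod (f (x, y + of_real s) - f (x, y) - b x * of_real s) \<le> C * s\<^sup>2"
        using Dy[of "of_real s" x] s x by simp
      ultimately show ?thesis
        using Lip[OF hr ys] Lip[OF hr y] by (intro order_trans[OF tri]) linarith
    qed
    also have "\<dots> = (2 * L + 2 * C) * (s * s)" using s(3) by (simp add: power2_eq_square algebra_simps)
    finally have "cmod (b (x + h) - b x) * s \<le> ((2 * L + 2 * C) * s) * s"
      using s by (simp add: norm_mult mult.assoc)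
    then show ?thesis using s(1) unfolding s_def[symmetric] by (rule mult_right_le_imp_le)
  qed simp
  have "(f has_derivative (\<lambda>(v1, v2). a * v1 + b x * v2)) (at (x, y))"
    unfolding has_derivative_at_within
  proof (intro conjI)
    show "bounded_linear (\<lambda>(v1, v2). a * v1 + b x * v2)"
      unfolding case_prod_beta
      by (intro bounded_linear_add bounded_linear_mult_right[THEN bounded_linear_compose] bounded_linear_fst bounded_linear_snd)
    let ?F = "\<lambda>p. (f p - f (x, y) - (case p - (x, y) of (v1, v2) \<Rightarrow> a * v1 + b x * v2)) /\<^sub>R norm (p - (x, y))"
    let ?G = "\<lambda>p. 2 * C * norm (p - (x, y)) + (2 * L + 2 * C) * sqrt (norm (p - (x, y)))"
    show "(?F \<longlongrightarrow> 0) (at (x, y))"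
    proof (rule Lim_null_comparison)
      have "(?G \<longlongrightarrow> 2 * C * norm ((x, y) - (x, y)) + (2 * L + 2 * C) * sqrt (norm ((x, y) - (x, y)))) (at (x, y))"
        by (intro tendsto_intros)
      then show "(?G \<longlongrightarrow> 0) (at (x, y))" by simp
      have "eventually (\<lambda>p. p \<in> ball (x, y) (r\<^sup>2)) (at (x, y))"
        using r(1) unfolding eventually_at
        by (intro exI[of _ "r\<^sup>2"]) (auto simp: dist_commute)
      then show "eventually (\<lambda>p. norm (?F p) \<le> ?G p) (at (x, y))"
        using eventually_neq_at_within[of "(x, y)" "(x, y)" UNIV]
      proof eventually_elim
        case (elim p)
        define h k where "h = fst p - x" and "k = snd p - y"
        have ph: "p = (x + h, y + k)" by (simp add: h_def k_def)
        have n: "norm (p - (x, y)) = norm (h, k)" by (simp add: ph)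
        define \<rho> where "\<rho> = norm (h, k)"
        have \<rho>: "\<rho> > 0" "\<rho> < r\<^sup>2"
          using elim unfolding \<rho>_def n[symmetric] by (simp_all add: dist_norm norm_minus_commute)
        have hk: "cmod h \<le> \<rho>" "cmod k \<le> \<rho>" unfolding \<rho>_def using norm_fst_le[of h k] norm_snd_le[of k h] by auto
        have r2: "r\<^sup>2 < r" using r by (simp add: power2_eq_square)
        have xh: "x + h \<in> A" using bx[of "x + h"] hk \<rho> r2 by (simp add: dist_norm)
        have "f p - f (x, y) - (a * h + b x * k) = (f (x + h, y + k) - f (x + h, y) - b (x + h) * k)
           + (b (x + h) - b x) * k + (f (x + h, y) - f (x, y) - a * h)"
          by (simp add: ph algebra_simps)
        also have "cmod \<dots> \<le> C * \<rho>\<^sup>2 + (2 * L + 2 * C) * sqrt \<rho> * \<rho> + C * \<rho>\<^sup>2"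
        proof -
          have tri: "cmod (u + v + w) \<le> cmod u + cmod v + cmod w" for u v w
            using norm_triangle_ineq[of "u + v" w] norm_triangle_ineq[of u v] by simp
          have "cmod (f (x + h, y + k) - f (x + h, y) - b (x + h) * k) \<le> C * (cmod k)\<^sup>2"
            by (rule Dy) (use hk \<rho> r2 xh in auto)
          also have "\<dots> \<le> C * \<rho>\<^sup>2" using hk C0 by (intro mult_left_mono power_mono) auto
          finally have 1: "cmod (f (x + h, y + k) - f (x + h, y) - b (x + h) * k) \<le> C * \<rho>\<^sup>2" .
          have "cmod (f (x + h, y) - f (x, y) - a * h) \<le> C * (cmod h)\<^sup>2"
            unfolding a_def by (rule Dx) (use hk \<rho> r2 y in auto)
          also have "\<dots> \<le> C * \<rho>\<^sup>2" using hk C0 by (intro mult_left_mono power_mono) auto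
          finally have 2: "cmod (f (x + h, y) - f (x, y) - a * h) \<le> C * \<rho>\<^sup>2" .
          have "cmod (b (x + h) - b x) \<le> (2 * L + 2 * C) * sqrt (cmod h)" using hk \<rho> by (intro b_hoelder) auto
          also have "\<dots> \<le> (2 * L + 2 * C) * sqrt \<rho>" using hk L0 C0 by (intro mult_left_mono) auto
          finally have 3: "cmod ((b (x + h) - b x) * k) \<le> (2 * L + 2 * C) * sqrt \<rho> * \<rho>"
            unfolding norm_mult using hk \<rho> L0 C0 by (intro mult_mono) auto
          show ?thesis using 1 2 3 by (intro order_trans[OF tri]) linarith
        qed
        also have "\<dots> = (2 * C * \<rho> + (2 * L + 2 * C) * sqrt \<rho>) * \<rho>" by (simp add: power2_eq_square algebra_simps)
        finally have "cmod (f p - f (x, y) - (a * h + b x * k)) / \<rho> \<le> 2 * C * \<rho> + (2 * L + 2 * C) * sqrt \<rho>"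
          using \<rho>(1) by (simp add: divide_le_eq)
        moreover have "(case p - (x, y) of (v1, v2) \<Rightarrow> a * v1 + b x * v2) = a * h + b x * k" by (simp add: ph)
        ultimately show ?case unfolding n \<rho>_def[symmetric] by (simp add: divide_inverse mult.commute abs_of_pos[OF \<rho>(1)])
      qed
    qed
  qed
  then show "\<exists>a b. (f has_derivative (\<lambda>(v1, v2). a * v1 + b * v2)) (at p)" unfolding p by blast
qed

text \<open>Membership can be tested slice by slice, which suits limits and integrals with a
  parameter.\<close>

lemma F_space_iff:
  assumes "open T" "open H"
  shows "g \<in> F_space T H \<longleftrightarrow> bounded_separately_holomorphic T H g"
  using bounded_separately_holomorphic_imp_holomorphic2[OF assms] holomorphic2_imp_separately
  unfolding F_space_def bounded_separately_holomorphic_def by blast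

lemma F_norm_le:
  assumes "T \<times> H \<noteq> {}" "\<And>x. x \<in> T \<times> H \<Longrightarrow> cmod (g x) \<le> B"
  shows "F_norm T H g \<le> B"
  unfolding F_norm_def wnorm_def using assms by (intro cSUP_least) auto

lemma F_norm_ge:
  assumes "bounded (g ` (T \<times> H))" "x \<in> T \<times> H"
  shows "cmod (g x) \<le> F_norm T H g"
proof -
  have "bdd_above ((\<lambda>x. 1 * cmod (g x)) ` (T \<times> H))"
    using assms(1) by (auto simp: bounded_iff bdd_above_def)
  from cSUP_upper[OF assms(2) this] show ?thesis by (simp add: F_norm_def wnorm_def)
qed

lemma F_space_boundedD:
  assumes "g \<in> F_space T H"
  obtains B where "B \<ge> 0" "\<And>x. x \<in> T \<times> H \<Longrightarrow> cmod (g x) \<le> B"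
proof -
  obtain B where "\<And>x. x \<in> T \<times> H \<Longrightarrow> cmod (g x) \<le> B"
    using assms unfolding F_space_def bounded_iff by auto
  then show ?thesis using that[of "max 0 B"] by fastforce
qed

lemma F_spaceI:
  assumes "open T" "open H" "\<And>z. z \<in> H \<Longrightarrow> (\<lambda>t. g (t, z)) holomorphic_on T" "\<And>t. t \<in> T \<Longrightarrow> (\<lambda>z. g (t, z)) holomorphic_on H"
    "\<And>x. x \<in> T \<times> H \<Longrightarrow> cmod (g x) \<le> B"
  shows "g \<in> F_space T H"
  unfolding F_space_iff[OF assms(1,2)] bounded_separately_holomorphic_def bounded_iff using assms(3-5) by blast

lemma F_spaceD:
  assumes "g \<in> F_space T H"
  shows "z \<in> H \<Longrightarrow> (\<lambda>t. g (t, z)) holomorphic_on T" "t \<in> T \<Longrightarrow> (\<lambda>z. g (t, z)) holomorphic_on H"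
  using assms holomorphic2_imp_separately unfolding F_space_def by blast+

lemma F_space_add:
  assumes o: "open T" "open H" and f: "f \<in> F_space T H" and g: "g \<in> F_space T H"
  shows "(\<lambda>x. a * f x + b * g x) \<in> F_space T H"
proof -
  obtain A where A: "A \<ge> 0" "\<And>x. x \<in> T \<times> H \<Longrightarrow> cmod (f x) \<le> A" using F_space_boundedD[OF f] by metis
  obtain B where B: "B \<ge> 0" "\<And>x. x \<in> T \<times> H \<Longrightarrow> cmod (g x) \<le> B" using F_space_boundedD[OF g] by metis
  show ?thesis
  proof (rule F_spaceI[OF o])
    fix x assume x: "x \<in> T \<times> H"
    have "cmod (a * f x + b * g x) \<le> cmod a * cmod (f x) + cmod b * cmod (g x)"
      using norm_triangle_ineq[of "a * f x" "b * g x"] by (simp add: norm_mult)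
    also have "\<dots> \<le> cmod a * A + cmod b * B"
      by (intro add_mono mult_left_mono A(2)[OF x] B(2)[OF x]) auto
    finally show "cmod (a * f x + b * g x) \<le> cmod a * A + cmod b * B" .
  qed (auto intro!: holomorphic_intros F_spaceD[OF f] F_spaceD[OF g])
qed

lemma F_space_0: "open T \<Longrightarrow> open H \<Longrightarrow> (\<lambda>x. 0) \<in> F_space T H"
  by (rule F_spaceI[where B = 0]) auto

lemma F_space_scale:
  assumes o: "open T" "open H" and f: "f \<in> F_space T H"
  shows "(\<lambda>x. a * f x) \<in> F_space T H"
  using F_space_add[OF o f F_space_0[OF o], of a 0] by simp

lemma F_space_sum:
  assumes o: "open T" "open H" and f: "\<And>n. n \<in> S \<Longrightarrow> f n \<in> F_space T H"
  shows "(\<lambda>x. \<Sum>n\<in>S. f n x * a n) \<in> F_space T H"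
  using f
proof (induction S rule: infinite_finite_induct)
  case (insert n S)
  then show ?case using F_space_add[OF o, of "f n" "\<lambda>x. \<Sum>n\<in>S. f n x * a n" "a n" 1] by (simp add: mult.commute)
qed (auto intro: F_space_0 o)

text \<open>Uniform limits keep every slice holomorphic, and one member at distance less than 1
  bounds the limit. In this way derivatives and expansion coefficients are placed into the
  space.\<close>

lemma F_space_closed:
  assumes o: "open T" "open H" and g: "\<And>i::nat. g i \<in> F_space T H"
    and lim: "uniform_limit (T \<times> H) g l sequentially"
  shows "l \<in> F_space T H"
proof -
  obtain N where N: "\<And>x. x \<in> T \<times> H \<Longrightarrow> dist (g N x) (l x) < 1"
    using uniform_limitD[OF lim, of 1] by (auto simp: eventually_sequentially)
  obtain B where B: "\<And>x. x \<in> T \<times> H \<Longrightarrow> cmod (g N x) \<le> B" using F_space_boundedD[OF g[of N]] by metis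
  show ?thesis
  proof (rule F_spaceI[OF o, where B = "B + 1"])
    fix x assume x: "x \<in> T \<times> H"
    have "cmod (l x) \<le> cmod (g N x) + dist (g N x) (l x)"
      using norm_triangle_sub[of "l x" "g N x"] by (simp add: dist_norm norm_minus_commute)
    then show "cmod (l x) \<le> B + 1" using B[OF x] N[OF x] by linarith
  next
    fix z assume z: "z \<in> H"
    show "(\<lambda>t. l (t, z)) holomorphic_on T"
    proof (rule holomorphic_uniform_sequence[OF o(1), of "\<lambda>i t. g i (t, z)"])
      fix t assume "t \<in> T"
      then obtain d where d: "d > 0" "cball t d \<subseteq> T" using o open_contains_cball by blast
      have "uniform_limit (cball t d) (\<lambda>i t. g i (t, z)) (\<lambda>t. l (t, z)) sequentially"
      proof (rule uniform_limitI)
        fix e :: real assume "e > 0"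
        from uniform_limitD[OF lim this] show "\<forall>\<^sub>F i in sequentially. \<forall>t\<in>cball t d. dist (g i (t, z)) (l (t, z)) < e"
          by eventually_elim (use d z in auto)
      qed
      with d show "\<exists>d>0. cball t d \<subseteq> T \<and> uniform_limit (cball t d) (\<lambda>i t. g i (t, z)) (\<lambda>t. l (t, z)) sequentially" by blast
    qed (rule F_spaceD(1)[OF g z])
  next
    fix t assume t: "t \<in> T"
    show "(\<lambda>z. l (t, z)) holomorphic_on H"
    proof (rule holomorphic_uniform_sequence[OF o(2), of "\<lambda>i z. g i (t, z)"])
      fix z assume "z \<in> H"
      then obtain d where d: "d > 0" "cball z d \<subseteq> H" using o open_contains_cball by blast
      have "uniform_limit (cball z d) (\<lambda>i z. g i (t, z)) (\<lambda>z. l (t, z)) sequentially"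
      proof (rule uniform_limitI)
        fix e :: real assume "e > 0"
        from uniform_limitD[OF lim this] show "\<forall>\<^sub>F i in sequentially. \<forall>z\<in>cball z d. dist (g i (t, z)) (l (t, z)) < e"
          by eventually_elim (use d t in auto)
      qed
      with d show "\<exists>d>0. cball z d \<subseteq> H \<and> uniform_limit (cball z d) (\<lambda>i z. g i (t, z)) (\<lambda>z. l (t, z)) sequentially" by blast
    qed (rule F_spaceD(2)[OF g t])
  qed
qed

lemma F_space_closed_le:
  assumes o: "open T" "open H" and g: "\<And>i::nat. g i \<in> F_space T H"
    and le: "\<And>i x. x \<in> T \<times> H \<Longrightarrow> cmod (g i x - l x) \<le> e i" and e: "e \<longlonglongrightarrow> 0"
  shows "l \<in> F_space T H"
proof (rule F_space_closed[OF o g])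
  show "uniform_limit (T \<times> H) g l sequentially"
  proof (rule uniform_limitI)
    fix r :: real assume "r > 0"
    from order_tendstoD(2)[OF e this] show "\<forall>\<^sub>F n in sequentially. \<forall>x\<in>T \<times> H. dist (g n x) (l x) < r"
      by eventually_elim (auto simp: dist_norm intro: le_less_trans[OF le])
  qed
qed

text \<open>The second order estimate depends only on the common bound M and on r, not on x. So
  pointwise difference quotients converge uniformly in x, and the derivative, as such a uniform
  limit, belongs to the space.\<close>

lemma holo_into_F_space:
  assumes o: "open T" "open H" "open E" and ne: "T \<times> H \<noteq> {}"
    and g: "\<And>\<epsilon>. \<epsilon> \<in> E \<Longrightarrow> g \<epsilon> \<in> F_space T H"
    and h: "\<And>x. x \<in> T \<times> H \<Longrightarrow> (\<lambda>\<epsilon>. g \<epsilon> x) holomorphic_on E"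
    and M: "\<And>\<epsilon> x. \<epsilon> \<in> E \<Longrightarrow> x \<in> T \<times> H \<Longrightarrow> cmod (g \<epsilon> x) \<le> M"
  shows "holo_into (F_space T H) (F_norm T H) E g"
  unfolding holo_into_def
proof (intro conjI ballI)
  fix z assume z: "z \<in> E"
  obtain r where r: "r > 0" "ball z r \<subseteq> E" using o(3) z open_contains_ball by blast
  obtain x0 where x0: "x0 \<in> T \<times> H" using ne by blast
  have M0: "M \<ge> 0" using M[OF z x0] norm_ge_zero order_trans by blast
  define g' where "g' x = deriv (\<lambda>\<epsilon>. g \<epsilon> x) z" for x
  define C where "C = 12 * M / r\<^sup>2"
  have C0: "C \<ge> 0" using M0 by (simp add: C_def)
  have q: "cmod ((g w x - g z x) / (w - z) - g' x) \<le> C * cmod (w - z)" if w: "w \<noteq> z" "cmod (w - z) < r" and x: "x \<in> T \<times> H" for w x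
  proof -
    have "cmod (g (z + (w - z)) x - g z x - g' x * (w - z)) \<le> 12 * M * (cmod (w - z) / r)\<^sup>2"
      unfolding g'_def by (rule holomorphic_second_order[OF h[OF x] r(2,1) _ w(2)]) (use M x in auto)
    then have 1: "cmod (g w x - g z x - g' x * (w - z)) \<le> C * cmod (w - z) * cmod (w - z)"
      by (simp add: C_def power_divide power2_eq_square)
    have "(g w x - g z x) / (w - z) - g' x = (g w x - g z x - g' x * (w - z)) / (w - z)"
      using w by (simp add: field_simps)
    then show ?thesis using 1 w by (simp add: norm_divide divide_le_eq)
  qed
  \<comment> \<open>A sequence of increments tending to 0; the denominator n + 2 keeps it strictly
    inside the disc already at n = 0.\<close>
  define w where "w n = z + of_real (r / real (n + 2))" for n :: nat
  have w: "w n \<noteq> z" "cmod (w n - z) < r" "cmod (w n - z) = r / real (n + 2)" "w n \<in> E" for n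
  proof -
    show 1: "cmod (w n - z) = r / real (n + 2)" using r(1) unfolding w_def by (simp add: norm_divide flip: of_real_divide)
    have "cmod (w n - z) > 0" unfolding 1 using r(1) by simp
    then show "w n \<noteq> z" by auto
    show 2: "cmod (w n - z) < r" using r(1) unfolding 1 by (simp add: field_simps add_pos_nonneg)
    then show "w n \<in> E" using r(2) by (auto simp: dist_norm norm_minus_commute)
  qed
  have "g' \<in> F_space T H"
  proof (rule F_space_closed_le[OF o(1,2)])
    show "(\<lambda>x. 1 / (w n - z) * g (w n) x + - 1 / (w n - z) * g z x) \<in> F_space T H" for n
      by (rule F_space_add[OF o(1,2) g[OF w(4)] g[OF z]])
    have "(\<lambda>n. C * (r / real (n + 2))) \<longlonglongrightarrow> C * 0"
      by (intro tendsto_intros) real_asymp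
    then show "(\<lambda>n. C * (r / real (n + 2))) \<longlonglongrightarrow> 0" by simp
    fix n x assume x: "x \<in> T \<times> H"
    have "1 / (w n - z) * g (w n) x + - 1 / (w n - z) * g z x = (g (w n) x - g z x) / (w n - z)"
      by (simp add: diff_divide_distrib)
    then show "cmod (1 / (w n - z) * g (w n) x + - 1 / (w n - z) * g z x - g' x) \<le> C * (r / real (n + 2))"
      using q[OF w(1,2) x, of n] w(3)[of n] by simp
  qed
  moreover have "((\<lambda>w. F_norm T H (\<lambda>x. (g w x - g z x) / (w - z) - g' x)) \<longlongrightarrow> 0) (at z)"
  proof (rule Lim_null_comparison)
    have "((\<lambda>w. C * cmod (w - z)) \<longlongrightarrow> C * cmod (z - z)) (at z)" by (intro tendsto_intros)
    then show "((\<lambda>w. C * cmod (w - z)) \<longlongrightarrow> 0) (at z)" by simp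
    have "eventually (\<lambda>w. w \<in> ball z r) (at z)" using r(1) unfolding eventually_at
      by (intro exI[of _ r]) (auto simp: dist_commute)
    then show "eventually (\<lambda>w. norm (F_norm T H (\<lambda>x. (g w x - g z x) / (w - z) - g' x)) \<le> C * cmod (w - z)) (at z)"
      using eventually_neq_at_within[of z z UNIV]
    proof eventually_elim
      case (elim w)
      then have w: "w \<noteq> z" "cmod (w - z) < r" by (auto simp: dist_norm norm_minus_commute)
      have "F_norm T H (\<lambda>x. (g w x - g z x) / (w - z) - g' x) \<le> C * cmod (w - z)"
        by (rule F_norm_le[OF ne]) (rule q[OF w])
      moreover have "cmod ((g w x0 - g z x0) / (w - z) - g' x0) \<le> F_norm T H (\<lambda>x. (g w x - g z x) / (w - z) - g' x)"
        by (rule F_norm_ge[OF _ x0]) (use q[OF w] in \<open>auto simp: bounded_iff\<close>)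
      ultimately show ?case
        using norm_ge_zero[of "(g w x0 - g z x0) / (w - z) - g' x0"] unfolding real_norm_def by linarith
    qed
  qed
  ultimately show "\<exists>g'\<in>F_space T H. ((\<lambda>w. F_norm T H (\<lambda>x. (g w x - g z x) / (w - z) - g' x)) \<longlongrightarrow> 0) (at z)"
    by blast
qed (rule g)

lemma holomorphic3_slices:
  assumes h: "holomorphic3_on (\<lambda>(t, z, \<epsilon>). u t z \<epsilon>) (T \<times> H \<times> E)"
  shows "\<epsilon> \<in> E \<Longrightarrow> holomorphic2_on (\<lambda>(t, z). u t z \<epsilon>) (T \<times> H)"
    and "t \<in> T \<Longrightarrow> z \<in> H \<Longrightarrow> (\<lambda>\<epsilon>. u t z \<epsilon>) holomorphic_on E"
proof -
  let ?g = "\<lambda>(t, z, \<epsilon>). u t z \<epsilon>"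
  have d: "\<exists>a b c. (?g has_derivative (\<lambda>(v1, v2, v3). a * v1 + b * v2 + c * v3)) (at (t, z, \<epsilon>))"
    if "t \<in> T" "z \<in> H" "\<epsilon> \<in> E" for t z \<epsilon>
    using h that unfolding holomorphic3_on_def by blast
  show "holomorphic2_on (\<lambda>(t, z). u t z \<epsilon>) (T \<times> H)" if e: "\<epsilon> \<in> E"
    unfolding holomorphic2_on_def
  proof
    fix x assume "x \<in> T \<times> H"
    then obtain t z where x: "x = (t, z)" "t \<in> T" "z \<in> H" by auto
    obtain a b c where D: "(?g has_derivative (\<lambda>(v1, v2, v3). a * v1 + b * v2 + c * v3)) (at (t, z, \<epsilon>))" using d[OF x(2,3) e] by blast
    have "((\<lambda>p. (fst p, snd p, \<epsilon>)) has_derivative (\<lambda>p. (fst p, snd p, 0))) (at (t, z))"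
      by (auto intro!: derivative_eq_intros)
    from has_derivative_compose[OF this, of ?g "\<lambda>(v1, v2, v3). a * v1 + b * v2 + c * v3"] D
    show "\<exists>a b. ((\<lambda>(t, z). u t z \<epsilon>) has_derivative (\<lambda>(v1, v2). a * v1 + b * v2)) (at x)"
      unfolding x(1) case_prod_unfold by (auto simp: case_prod_unfold)
  qed
  show "(\<lambda>\<epsilon>. u t z \<epsilon>) holomorphic_on E" if tz: "t \<in> T" "z \<in> H"
    unfolding holomorphic_on_def
  proof
    fix \<epsilon> assume e: "\<epsilon> \<in> E"
    obtain a b c where D: "(?g has_derivative (\<lambda>(v1, v2, v3). a * v1 + b * v2 + c * v3)) (at (t, z, \<epsilon>))" using d[OF tz e] by blast
    have "((\<lambda>\<epsilon>. (t, z, \<epsilon>)) has_derivative (\<lambda>h. (0, 0, h))) (at \<epsilon>)"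
      by (auto intro!: derivative_eq_intros)
    from has_derivative_compose[OF this D] show "(\<lambda>\<epsilon>. u t z \<epsilon>) field_differentiable at \<epsilon> within E"
      by (auto simp: field_differentiable_def has_field_derivative_def intro: has_derivative_at_withinI)
  qed
qed

section \<open>Rotation of q-Laplace transforms\<close>

lemma log_decay_nonneg [simp]: "0 \<le> log_decay x"
  by (rule less_imp_le) simp

text \<open>Used for a whole range of directions at once, hence uniform in \<phi>. The two summands
  come from r < R0, where the scale is t, and from r >= R0, where it is 1.\<close>

lemma theta_quotient_bound:
  fixes la R0 R1 \<alpha> \<eta> :: real
  assumes la: "la > 0" and \<eta>: "0 < \<eta>" "\<eta> < pi" and R0: "0 < R0" "R0 \<le> 1" and R1: "\<alpha> + ln R1 / la \<le> 0"
  obtains K where "K > 0"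
    "\<And>M v r t \<phi>. M \<ge> 0 \<Longrightarrow> 0 < r \<Longrightarrow> (r < R0 \<Longrightarrow> cmod v \<le> M) \<Longrightarrow>
       (r \<ge> R0 \<Longrightarrow> cmod v \<le> M * exp ((ln r)\<^sup>2 / (2 * la) + \<alpha> * ln r)) \<Longrightarrow>
       \<bar>\<phi>\<bar> \<le> pi - \<eta> \<Longrightarrow> 0 < t \<Longrightarrow> t \<le> R1 \<Longrightarrow>
       cmod (v / Theta (exp (- la)) (of_real (r / t) * cis \<phi>)) \<le> M * K * log_decay (r / t) + M * K * log_decay r"
proof -
  obtain c where c: "c > 0" "\<And>r \<phi>. r > 0 \<Longrightarrow> \<bar>\<phi>\<bar> \<le> pi - \<eta> \<Longrightarrow> c * theta_growth la r \<le> cmod (Theta (exp (- la)) (of_real r * cis \<phi>))"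
    using Theta_lower_bound[OF la \<eta>] by metis
  define K1 K2 where "K1 = exp (la / 2) / c"
    and "K2 = exp ((\<bar>\<alpha>\<bar> + 1) * (- ln R0) + la * (- ln R0 / la + 1 / 2)\<^sup>2 / 2) / c"
  have K: "K1 > 0" "K2 > 0" using c by (auto simp: K1_def K2_def)
  show ?thesis
  proof (rule that[of "K1 + K2"])
    fix M v r t \<phi>
    assume a: "(M::real) \<ge> 0" "(0::real) < r" "r < R0 \<Longrightarrow> cmod v \<le> M"
      "r \<ge> R0 \<Longrightarrow> cmod v \<le> M * exp ((ln r)\<^sup>2 / (2 * la) + \<alpha> * ln r)" "\<bar>\<phi>\<bar> \<le> pi - \<eta>" "0 < t" "t \<le> R1"
    have rt: "r / t > 0" using a by simp
    have b: "cmod (v / Theta (exp (- la)) (of_real (r / t) * cis \<phi>)) \<le> cmod v / (c * theta_growth la (r / t))"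
      by (rule Theta_bound_pos[OF c(2)[OF rt a(5)] c(1) order_refl])
    show "cmod (v / Theta (exp (- la)) (of_real (r / t) * cis \<phi>)) \<le> M * (K1 + K2) * log_decay (r / t) + M * (K1 + K2) * log_decay r"
    proof (cases "r < R0")
      case True
      have "cmod v / (c * theta_growth la (r / t)) \<le> M / (c * theta_growth la (r / t))"
        using a(3)[OF True] c(1) by (intro divide_right_mono mult_nonneg_nonneg) (auto intro: less_imp_le)
      also have "\<dots> = M / c * ((r / t) ^ 0 / theta_growth la (r / t))" by simp
      also have "\<dots> \<le> M / c * (exp (la * (real 0 + 1)\<^sup>2 / 2) * log_decay (r / t))"
        by (intro mult_left_mono monomial_over_theta_growth la rt) (use a c in auto)
      also have "\<dots> = M * K1 * log_decay (r / t)" by (simp add: K1_def)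
      also have "\<dots> \<le> M * (K1 + K2) * log_decay (r / t)"
        by (intro mult_right_mono mult_left_mono) (use a K in \<open>auto intro: less_imp_le\<close>)
      finally have "cmod v / (c * theta_growth la (r / t)) \<le> M * (K1 + K2) * log_decay (r / t)" .
      moreover have "0 \<le> M * (K1 + K2) * log_decay r" using a K by (intro mult_nonneg_nonneg) auto
      ultimately show ?thesis using b by linarith
    next
      case False
      then have r: "r \<ge> R0" by simp
      have "cmod v / (c * theta_growth la (r / t)) \<le> M * exp ((ln r)\<^sup>2 / (2 * la) + \<alpha> * ln r) / (c * theta_growth la (r / t))"
        using a(4)[OF r] c(1) by (intro divide_right_mono mult_nonneg_nonneg) (auto intro: less_imp_le)
      also have "\<dots> = M / c * (exp ((ln r)\<^sup>2 / (2 * la) + \<alpha> * ln r) / theta_growth la (r / t))" by simp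
      also have "\<dots> \<le> M / c * (exp ((\<bar>\<alpha>\<bar> + 1) * (- ln R0) + la * (real 0 + (- ln R0 / la + 1 / 2))\<^sup>2 / 2) * t ^ 0 * log_decay r)"
        by (intro mult_left_mono tail_over_theta_growth[OF la R0 R1 r]) (use a c in auto)
      also have "\<dots> = M * K2 * log_decay r" by (simp add: K2_def)
      also have "\<dots> \<le> M * (K1 + K2) * log_decay r"
        by (intro mult_right_mono mult_left_mono) (use a K in \<open>auto intro: less_imp_le\<close>)
      finally have "cmod v / (c * theta_growth la (r / t)) \<le> M * (K1 + K2) * log_decay r" .
      moreover have "0 \<le> M * (K1 + K2) * log_decay (r / t)" using a K by (intro mult_nonneg_nonneg) auto
      ultimately show ?thesis using b by linarith
    qed
  qed (use K in simp)
qed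

lemma polar_quotient:
  assumes "t > 0"
  shows "of_real r * cis y / (of_real t * cis (dr - \<phi>)) = of_real (r / t) * cis (y - dr + \<phi>)"
proof -
  have "cis y = cis (dr - \<phi>) * cis (y - dr + \<phi>)" by (simp add: cis_mult)
  then show ?thesis using assms by simp
qed

lemma log_decay_shift_tendsto:
  "((\<lambda>x. log_decay (exp x / t)) \<longlongrightarrow> 0) at_top" "((\<lambda>x. log_decay (exp x / t)) \<longlongrightarrow> 0) at_bot" if "t > 0" for t :: real
proof -
  have "log_decay (exp x / t) = log_decay (exp (- ln t + x))" for x
    using that by (simp add: exp_diff)
  moreover have "filterlim (\<lambda>x. - ln t + x) at_top at_top" "filterlim (\<lambda>x. - ln t + x) at_bot at_bot"
    by real_asymp+
  ultimately show "((\<lambda>x. log_decay (exp x / t)) \<longlongrightarrow> 0) at_top" "((\<lambda>x. log_decay (exp x / t)) \<longlongrightarrow> 0) at_bot"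
    using filterlim_compose[OF log_decay_exp_tendsto(1)] filterlim_compose[OF log_decay_exp_tendsto(2)] by auto
qed

text \<open>In logarithmic coordinates the strip is the intersection of the sector where g is
  holomorphic with the sector where Theta (u / T) has no zeros. Both end directions lie in it, and
  \<open>theta_quotient_bound\<close> supplies the decay at both ends.\<close>

lemma theta_transform_rotate:
  fixes la R0 R1 \<alpha> M t dr \<phi> a y1 :: real
  assumes la: "la > 0" and R0: "0 < R0" "R0 \<le> 1" and R1: "\<alpha> + ln R1 / la \<le> 0"
    and g: "g holomorphic_on S" and S: "\<And>r \<theta>. 0 < r \<Longrightarrow> \<bar>\<theta> - dr\<bar> < a \<Longrightarrow> of_real r * cis \<theta> \<in> S"
    and M: "M \<ge> 0" and small: "\<And>r \<theta>. 0 < r \<Longrightarrow> r < R0 \<Longrightarrow> \<bar>\<theta> - dr\<bar> < a \<Longrightarrow> cmod (g (of_real r * cis \<theta>)) \<le> M"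
    and large: "\<And>r \<theta>. r \<ge> R0 \<Longrightarrow> \<bar>\<theta> - dr\<bar> < a \<Longrightarrow> cmod (g (of_real r * cis \<theta>)) \<le> M * exp ((ln r)\<^sup>2 / (2 * la) + \<alpha> * ln r)"
    and \<phi>: "\<bar>\<phi>\<bar> < pi" and t: "0 < t" "t \<le> R1" and a: "a > 0"
    and y1: "\<bar>y1 - dr\<bar> < a" "\<bar>y1 - dr + \<phi>\<bar> < pi"
  defines "T \<equiv> of_real t * cis (dr - \<phi>)"
  shows "(LINT r:{0<..}|lborel. g (of_real r * cis y1) / Theta (exp (- la)) (of_real r * cis y1 / T) / of_real r)
    = (LINT r:{0<..}|lborel. g (of_real r * cis dr) / Theta (exp (- la)) (of_real r * cis dr / T) / of_real r)"
proof -
  \<comment> \<open>Half of the smaller gap between the end directions and the negative axis. The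
    angle varies linearly along the segment, so its modulus is largest at an end.\<close>
  define \<eta> where "\<eta> = (pi - max \<bar>\<phi>\<bar> \<bar>y1 - dr + \<phi>\<bar>) / 2"
  have \<eta>: "0 < \<eta>" "\<eta> < pi" using \<phi> y1 by (auto simp: \<eta>_def max_def)
  have seg: "\<bar>y - dr\<bar> < a \<and> \<bar>y - dr + \<phi>\<bar> \<le> pi - \<eta>" if "y \<in> closed_segment y1 dr" for y
  proof
    show "\<bar>y - dr\<bar> < a" using that y1 a by (auto simp: closed_segment_eq_real_ivl split: if_splits)
    have "\<bar>y - dr + \<phi>\<bar> \<le> max \<bar>\<phi>\<bar> \<bar>y1 - dr + \<phi>\<bar>"
      using that by (auto simp: closed_segment_eq_real_ivl split: if_splits)
    also have "\<dots> \<le> pi - \<eta>" using \<phi> y1 by (simp add: \<eta>_def max_def field_simps)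
    finally show "\<bar>y - dr + \<phi>\<bar> \<le> pi - \<eta>" .
  qed
  obtain K where K: "K > 0"
    "\<And>M v r t \<phi>. M \<ge> 0 \<Longrightarrow> 0 < r \<Longrightarrow> (r < R0 \<Longrightarrow> cmod v \<le> M) \<Longrightarrow>
       (r \<ge> R0 \<Longrightarrow> cmod v \<le> M * exp ((ln r)\<^sup>2 / (2 * la) + \<alpha> * ln r)) \<Longrightarrow>
       \<bar>\<phi>\<bar> \<le> pi - \<eta> \<Longrightarrow> 0 < t \<Longrightarrow> t \<le> R1 \<Longrightarrow>
       cmod (v / Theta (exp (- la)) (of_real (r / t) * cis \<phi>)) \<le> M * K * log_decay (r / t) + M * K * log_decay r"
    using theta_quotient_bound[OF la \<eta> R0 R1] by metis
  define H where "H z = g (exp z) / Theta (exp (- la)) (exp z / T)" for z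
  have HC: "H (Complex (ln r) y) = g (of_real r * cis y) / Theta (exp (- la)) (of_real (r / t) * cis (y - dr + \<phi>))" if "r > 0" for r y
    using that by (simp add: H_def complex_ln_cis T_def polar_quotient[OF t(1)])
  have bd: "cmod (H (Complex (ln r) y)) \<le> M * K * log_decay (r / t) + M * K * log_decay r" if "r > 0" "y \<in> closed_segment y1 dr" for r y
    unfolding HC[OF that(1)] using seg[OF that(2)] that t by (intro K(2) M small large) auto
  have e: "(of_real r * cis y / T) = of_real (r / t) * cis (y - dr + \<phi>)" for r y
    unfolding T_def by (rule polar_quotient[OF t(1)])
  have int: "set_integrable lborel {0<..} (\<lambda>r. H (Complex (ln r) y) / of_real r)" if y: "y \<in> closed_segment y1 dr" for y
  proof (rule halfline_integral_bound(1)[OF t(1)])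
    have c: "continuous_on {0<..} (\<lambda>r. g (of_real r * cis y))"
      by (rule continuous_on_compose2[OF holomorphic_on_imp_continuous_on[OF g]])
         (use seg[OF y] in \<open>auto intro!: continuous_intros S\<close>)
    have "set_borel_measurable lborel {0<..} (\<lambda>r. g (of_real r * cis y) / Theta (exp (- la)) (of_real (r / t) * cis (y - dr + \<phi>)) / of_real r)"
    proof (rule Theta_measurable_ray[OF la t(1) c])
      fix r :: real assume "r > 0"
      then show "Theta (exp (- la)) (of_real (r / t) * cis (y - dr + \<phi>)) \<noteq> 0"
        using seg[OF y] \<eta> t by (intro Theta_nonzero_ray[OF la]) auto
    qed
    then show "set_borel_measurable lborel {0<..} (\<lambda>r. H (Complex (ln r) y) / of_real r)"
      unfolding set_borel_measurable_def
      by (rule measurable_cong[THEN iffD1, rotated]) (auto simp: indicator_def HC)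
  qed (use bd y in auto)
  have "(LINT r:{0<..}|lborel. H (Complex (ln r) y1) / of_real r) = (LINT r:{0<..}|lborel. H (Complex (ln r) dr) / of_real r)"
  proof (rule rotate_halfline_integral[where a = "max (dr - a) (dr - \<phi> - pi)" and b = "min (dr + a) (dr - \<phi> + pi)"
        and B = "\<lambda>x. M * K * log_decay (exp x / t) + M * K * log_decay (exp x)"])
    let ?S = "{z. max (dr - a) (dr - \<phi> - pi) < Im z \<and> Im z < min (dr + a) (dr - \<phi> + pi)}"
    show "H holomorphic_on ?S"
      unfolding H_def
    proof (intro holomorphic_intros)
      show "(\<lambda>z. g (exp z)) holomorphic_on ?S"
      proof (rule holomorphic_on_compose_gen[of exp _ g S, unfolded o_def])
        show "exp ` ?S \<subseteq> S" using S by (auto simp: exp_eq_polar abs_less_iff)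
      qed (use g in \<open>auto intro!: holomorphic_intros\<close>)
      show "(\<lambda>z. Theta (exp (- la)) (exp z / T)) holomorphic_on ?S"
        by (rule holomorphic_on_compose_gen[of "\<lambda>z. exp z / T" _ "Theta (exp (- la))" "- {0}", unfolded o_def])
           (use Theta_holomorphic[of "exp (- la)"] la t in \<open>auto simp: T_def intro!: holomorphic_intros\<close>)
      fix z assume z: "z \<in> ?S"
      have "exp z / T = of_real (exp (Re z) / t) * cis (Im z - dr + \<phi>)"
        unfolding exp_eq_polar[of z] using e[of "exp (Re z)" "Im z"] by simp
      then show "Theta (exp (- la)) (exp z / T) \<noteq> 0"
        using Theta_nonzero_ray[OF la, of "Im z - dr + \<phi>" "exp (Re z) / t"] z t by (auto simp: abs_less_iff)
    qed
    show "cmod (H (Complex x y)) \<le> M * K * log_decay (exp x / t) + M * K * log_decay (exp x)" if "y \<in> closed_segment y1 dr" for x y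
      using bd[of "exp x" y] that by simp
    have "((\<lambda>x. M * K * log_decay (exp x / t) + M * K * log_decay (exp x)) \<longlongrightarrow> M * K * 0 + M * K * 0) at_top"
      by (intro tendsto_intros log_decay_shift_tendsto log_decay_exp_tendsto t)
    then show "((\<lambda>x. M * K * log_decay (exp x / t) + M * K * log_decay (exp x)) \<longlongrightarrow> 0) at_top" by simp
    have "((\<lambda>x. M * K * log_decay (exp x / t) + M * K * log_decay (exp x)) \<longlongrightarrow> M * K * 0 + M * K * 0) at_bot"
      by (intro tendsto_intros log_decay_shift_tendsto log_decay_exp_tendsto t)
    then show "((\<lambda>x. M * K * log_decay (exp x / t) + M * K * log_decay (exp x)) \<longlongrightarrow> 0) at_bot" by simp
    show "set_integrable lborel {0<..} (\<lambda>r. H (Complex (ln r) y) / of_real r)" if "y \<in> {y1, dr}" for y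
      using int that by auto
  qed (use \<phi> y1 a in \<open>auto simp: abs_less_iff\<close>)
  moreover have "(LINT r:{0<..}|lborel. H (Complex (ln r) y) / of_real r)
    = (LINT r:{0<..}|lborel. g (of_real r * cis y) / Theta (exp (- la)) (of_real r * cis y / T) / of_real r)" for y
    by (rule set_lebesgue_integral_cong) (auto simp: HC e)
  ultimately show ?thesis by simp
qed

section \<open>Sectors\<close>

text \<open>The sector is the image of a half-strip under the open map exp; no branch of the
  logarithm enters, so the opening may be arbitrary.\<close>

lemma sector_open: "open (sector d a r)"
proof (cases "r > 0")
  case True
  let ?S = "{z. Re z < ln r} \<inter> {z. Im z > d - a} \<inter> {z. Im z < d + a}"
  have "sector d a r = exp ` ?S"
  proof (intro equalityI subsetI)
    fix x assume "x \<in> sector d a r"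
    then obtain s \<theta> where x: "x = of_real s * cis \<theta>" "0 < s" "s < r" "\<bar>\<theta> - d\<bar> < a" by (auto simp: sector_def)
    have "x = exp (Complex (ln s) \<theta>)" using x by (simp add: complex_ln_cis)
    moreover have "Complex (ln s) \<theta> \<in> ?S" using x True by (auto simp: abs_less_iff)
    ultimately show "x \<in> exp ` ?S" by blast
  next
    fix x assume "x \<in> exp ` ?S"
    then obtain z where z: "x = exp z" "z \<in> ?S" by blast
    have "exp (Re z) < r" using z True by (metis IntD1 exp_less_cancel_iff exp_ln mem_Collect_eq)
    then show "x \<in> sector d a r" unfolding sector_def using z
      by (intro CollectI exI[of _ "exp (Re z)"] exI[of _ "Im z"]) (auto simp: exp_eq_polar[of z] abs_less_iff)
  qed
  moreover have "open (exp ` ?S)"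
  proof (rule open_mapping_thm[of exp UNIV])
    show "\<not> (exp :: complex \<Rightarrow> complex) constant_on UNIV"
    proof
      assume "(exp :: complex \<Rightarrow> complex) constant_on UNIV"
      then obtain w :: complex where w: "\<And>x. exp x = w" unfolding constant_on_def by blast
      have "exp (0::complex) = exp (of_real 1)" by (rule trans[OF w w[symmetric]])
      then have "Re (exp 0) = Re (exp (of_real (1::real)))" by simp
      then show False by (simp add: Re_exp)
    qed
  qed (auto intro!: holomorphic_intros open_Int open_halfspace_Re_lt open_halfspace_Im_gt open_halfspace_Im_lt)
  ultimately show ?thesis by simp
next
  case False
  then have "sector d a r = {}" by (auto simp: sector_def)
  then show ?thesis by simp
qed

text \<open>The right-hand side is the continuous image of a compact rectangle, hence
  closed.\<close>

lemma sector_closure_subset: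
  "closure (sector d a r) \<subseteq> {of_real s * cis \<theta> | s \<theta>. 0 \<le> s \<and> s \<le> r \<and> \<bar>\<theta> - d\<bar> \<le> a}"
proof (rule closure_minimal)
  let ?f = "\<lambda>(s, \<theta>). of_real s * cis \<theta>"
  have eq: "{of_real s * cis \<theta> | s \<theta>. 0 \<le> s \<and> s \<le> r \<and> \<bar>\<theta> - d\<bar> \<le> a} = ?f ` ({0..r} \<times> {d - a..d + a})"
  proof (intro equalityI subsetI)
    fix x assume "x \<in> {of_real s * cis \<theta> | s \<theta>. 0 \<le> s \<and> s \<le> r \<and> \<bar>\<theta> - d\<bar> \<le> a}"
    then obtain s \<theta> where "x = ?f (s, \<theta>)" "(s, \<theta>) \<in> {0..r} \<times> {d - a..d + a}" by (auto simp: abs_le_iff)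
    then show "x \<in> ?f ` ({0..r} \<times> {d - a..d + a})" by blast
  next
    fix x assume "x \<in> ?f ` ({0..r} \<times> {d - a..d + a})"
    then show "x \<in> {of_real s * cis \<theta> | s \<theta>. 0 \<le> s \<and> s \<le> r \<and> \<bar>\<theta> - d\<bar> \<le> a}" by (fastforce simp: abs_le_iff)
  qed
  have "compact (?f ` ({0..r} \<times> {d - a..d + a}))"
    unfolding case_prod_unfold
    by (intro compact_continuous_image compact_Times) (auto intro!: continuous_intros)
  then show "closed {of_real s * cis \<theta> | s \<theta>. 0 \<le> s \<and> s \<le> r \<and> \<bar>\<theta> - d\<bar> \<le> a}"
    unfolding eq by (rule compact_imp_closed)
  show "sector d a r \<subseteq> {of_real s * cis \<theta> | s \<theta>. 0 \<le> s \<and> s \<le> r \<and> \<bar>\<theta> - d\<bar> \<le> a}"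
    unfolding sector_def by fastforce
qed

text \<open>The value r = |T| in the definition of \<open>R_dom\<close> already bounds the angle
  between T and the direction d away from pi, uniformly in T and d.\<close>

lemma R_dom_polar:
  assumes c: "0 < c" "c < 1"
  obtains \<eta> where "0 < \<eta>" "\<eta> < pi"
    "\<And>d T. T \<in> R_dom d c \<Longrightarrow> \<exists>\<phi>. T = of_real (cmod T) * cis (d - \<phi>) \<and> \<bar>\<phi>\<bar> \<le> pi - \<eta>"
proof -
  \<comment> \<open>|1 + e^(i \<phi>)|^2 = 2 + 2 cos \<phi> > c^2 means cos \<phi> > - x, and \<eta>
    is the angle with cosine x.\<close>
  define x where "x = 1 - c\<^sup>2 / 2"
  have c2: "0 < c\<^sup>2" "c\<^sup>2 < 1" using c by (auto simp: power_less_one_iff)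
  have x: "-1 < x" "x < 1" using c2 by (auto simp: x_def)
  define \<eta> where "\<eta> = arccos x"
  have \<eta>: "0 < \<eta>" "\<eta> < pi" "cos \<eta> = x"
    using x arccos_lt_bounded[of x] by (auto simp: \<eta>_def)
  show ?thesis
  proof (rule that[OF \<eta>(1,2)])
    fix d T assume T: "T \<in> R_dom d c"
    then have T0: "T \<noteq> 0" and gt: "cmod (1 + cis d * of_real (cmod T) / T) > c" by (auto simp: R_dom_def)
    define \<phi> where "\<phi> = Arg (cis d / T)"
    have p: "- pi < \<phi>" "\<phi> \<le> pi" using Arg_bounded[of "cis d / T"] by (auto simp: \<phi>_def)
    have "cis \<phi> = sgn (cis d / T)" unfolding \<phi>_def using T0 by (intro cis_Arg) auto
    then have cp: "cis \<phi> = cis d * of_real (cmod T) / T"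
      using T0 by (simp add: sgn_div_norm norm_divide scaleR_conv_of_real field_simps)
    then have Teq: "T = of_real (cmod T) * cis (d - \<phi>)"
      using T0 by (simp add: cis_divide[symmetric] field_simps)
    have "(cmod (1 + cis \<phi>))\<^sup>2 = 2 + 2 * cos \<phi>"
      unfolding cmod_power2 using sin_cos_squared_add[of \<phi>] by (simp add: power2_eq_square algebra_simps)
    moreover have "c\<^sup>2 < (cmod (1 + cis \<phi>))\<^sup>2"
      using gt c unfolding cp by (intro power_strict_mono) auto
    ultimately have "cos (pi - \<eta>) < cos \<bar>\<phi>\<bar>" using \<eta>(3) by (simp add: x_def)
    then have "\<bar>\<phi>\<bar> \<le> pi - \<eta>"
      using cos_mono_less_eq[of "pi - \<eta>" "\<bar>\<phi>\<bar>"] \<eta> p by (auto simp: abs_le_iff)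
    then show "\<exists>\<phi>. T = of_real (cmod T) * cis (d - \<phi>) \<and> \<bar>\<phi>\<bar> \<le> pi - \<eta>" using Teq by blast
  qed
qed

section \<open>The inverse Fourier transform\<close>

lemma integrable_exp_abs:
  assumes c: "c > (0::real)"
  shows "integrable lborel (\<lambda>m::real. exp (- c * \<bar>m\<bar>))"
proof -
  have "(\<lambda>m::real. exp (- c * m)) absolutely_integrable_on {0..}"
    by (rule nonnegative_absolutely_integrable_1[OF integrable_on_exp_minus_to_infinity[OF c]]) auto
  then have 1: "integrable lborel (\<lambda>m::real. indicator {0..} m *\<^sub>R exp (- c * m))"
    unfolding set_integrable_def by (subst (asm) integrable_completion) auto
  then have 2: "integrable lborel (\<lambda>m::real. indicator {0..} (0 + (-1) * m) *\<^sub>R exp (- c * (0 + (-1) * m)))"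
    by (rule lborel_integrable_real_affine) simp
  show ?thesis
  proof (rule Bochner_Integration.integrable_bound[OF Bochner_Integration.integrable_add[OF 1 2]])
    show "AE m in lborel. norm (exp (- c * \<bar>m\<bar>)) \<le> norm (indicator {0..} m *\<^sub>R exp (- c * m) + indicator {0..} (0 + (-1) * m) *\<^sub>R exp (- c * (0 + (-1) * m)))"
      by (intro AE_I2) (auto simp: indicator_def abs_if)
  qed simp
qed

lemma E_weight_ge_exp: "\<mu> \<ge> 0 \<Longrightarrow> exp (\<beta> * \<bar>m\<bar>) \<le> E_weight \<beta> \<mu> m"
  unfolding E_weight_def by (simp add: ge_one_powr_ge_zero)

lemma E_weight_pos [simp]: "E_weight \<beta> \<mu> m > 0"
  unfolding E_weight_def by (intro mult_pos_pos) (auto intro!: powr_gt_zero[THEN iffD2])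

lemma divide_E_weight_le:
  assumes "\<mu> \<ge> 0" "M \<ge> 0"
  shows "M / E_weight \<beta> \<mu> m \<le> M * exp (- \<beta> * \<bar>m\<bar>)"
proof -
  have "M / E_weight \<beta> \<mu> m \<le> M / exp (\<beta> * \<bar>m\<bar>)"
    by (intro divide_left_mono E_weight_ge_exp) (use assms in auto)
  then show ?thesis by (simp add: exp_minus divide_inverse)
qed

definition fourier_bound :: "real \<Rightarrow> real" where
  "fourier_bound c = (LINT m|lborel. exp (- c * \<bar>m\<bar>))"

lemma fourier_bound_nonneg: "fourier_bound c \<ge> 0"
  unfolding fourier_bound_def by (intro integral_nonneg_AE AE_I2) auto

text \<open>On |Im z| <= b the kernel e^(izm) grows at most like e^(b|m|), which leaves the decay
  e^(-(\<beta>-b)|m|) of the weight. With b = \<beta>' this is the only place where the strip loses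
  width.\<close>

lemma fourier_integrand:
  assumes \<mu>: "\<mu> \<ge> 0" and b: "b < \<beta>" and z: "\<bar>Im z\<bar> \<le> b" and M: "M \<ge> 0"
    and h: "h \<in> borel_measurable borel" "\<And>m. cmod (h m) \<le> M / E_weight \<beta> \<mu> m"
  shows "integrable lborel (\<lambda>m. h m * exp (\<i> * z * of_real m))"
    and "cmod (inv_fourier h z) \<le> M * fourier_bound (\<beta> - b)"
proof -
  have le: "cmod (h m * exp (\<i> * z * of_real m)) \<le> M * exp (- (\<beta> - b) * \<bar>m\<bar>)" for m
  proof -
    have "- (Im z * m) \<le> b * \<bar>m\<bar>"
      using z by (metis abs_ge_minus_self abs_ge_zero abs_mult mult_right_mono order_trans)
    then have "cmod (exp (\<i> * z * of_real m)) \<le> exp (b * \<bar>m\<bar>)" by simp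
    moreover have "cmod (h m) \<le> M * exp (- \<beta> * \<bar>m\<bar>)" using h(2)[of m] divide_E_weight_le[OF \<mu> M] order_trans by blast
    ultimately have "cmod (h m * exp (\<i> * z * of_real m)) \<le> (M * exp (- \<beta> * \<bar>m\<bar>)) * exp (b * \<bar>m\<bar>)"
      unfolding norm_mult using M by (intro mult_mono) auto
    also have "\<dots> = M * exp (- (\<beta> - b) * \<bar>m\<bar>)" by (simp add: exp_add[symmetric] algebra_simps)
    finally show ?thesis .
  qed
  have gi: "integrable lborel (\<lambda>m. M * exp (- (\<beta> - b) * \<bar>m\<bar>))"
    by (intro integrable_mult_right integrable_exp_abs) (use b in auto)
  show i: "integrable lborel (\<lambda>m. h m * exp (\<i> * z * of_real m))"
  proof (rule Bochner_Integration.integrable_bound[OF gi])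
    show "(\<lambda>m. h m * exp (\<i> * z * of_real m)) \<in> borel_measurable lborel" using h(1) by measurable
    show "AE m in lborel. norm (h m * exp (\<i> * z * of_real m)) \<le> norm (M * exp (- (\<beta> - b) * \<bar>m\<bar>))"
      using le M by (intro AE_I2) (simp add: abs_mult)
  qed
  have "cmod (LINT m|lborel. h m * exp (\<i> * z * of_real m)) \<le> (LINT m|lborel. M * exp (- (\<beta> - b) * \<bar>m\<bar>))"
    by (rule Bochner_Integration.integral_norm_bound_integral[OF i gi]) (rule le)
  also have "\<dots> = M * fourier_bound (\<beta> - b)" by (simp add: fourier_bound_def)
  finally have 1: "cmod (LINT m|lborel. h m * exp (\<i> * z * of_real m)) \<le> M * fourier_bound (\<beta> - b)" .
  have "1 / sqrt (2 * pi) \<le> 1" using pi_ge_two by (simp add: real_le_rsqrt)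
  then have "cmod (of_real (1 / sqrt (2 * pi))) \<le> 1" unfolding norm_of_real by simp
  then have "cmod (inv_fourier h z) \<le> 1 * cmod (LINT m|lborel. h m * exp (\<i> * z * of_real m))"
    unfolding inv_fourier_def norm_mult by (rule mult_right_mono) simp
  then show "cmod (inv_fourier h z) \<le> M * fourier_bound (\<beta> - b)" using 1 by linarith
qed

lemma inv_fourier_diff:
  assumes "integrable lborel (\<lambda>m. h m * exp (\<i> * z * of_real m))" "integrable lborel (\<lambda>m. g m * exp (\<i> * z * of_real m))"
  shows "inv_fourier (\<lambda>m. h m - g m) z = inv_fourier h z - inv_fourier g z"
  unfolding inv_fourier_def left_diff_distrib Bochner_Integration.integral_diff[OF assms] by (simp add: right_diff_distrib)

lemma inv_fourier_sum:
  assumes "\<And>i. i \<in> S \<Longrightarrow> integrable lborel (\<lambda>m. h i m * exp (\<i> * z * of_real m))"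
  shows "inv_fourier (\<lambda>m. \<Sum>i\<in>S. a i * h i m) z = (\<Sum>i\<in>S. a i * inv_fourier (h i) z)"
proof -
  have "(LINT m|lborel. (\<Sum>i\<in>S. a i * h i m) * exp (\<i> * z * of_real m)) = (LINT m|lborel. (\<Sum>i\<in>S. a i * (h i m * exp (\<i> * z * of_real m))))"
    by (simp add: sum_distrib_right mult.assoc)
  also have "\<dots> = (\<Sum>i\<in>S. (LINT m|lborel. a i * (h i m * exp (\<i> * z * of_real m))))"
    by (rule Bochner_Integration.integral_sum) (intro integrable_mult_right assms)
  also have "\<dots> = (\<Sum>i\<in>S. a i * (LINT m|lborel. h i m * exp (\<i> * z * of_real m)))"
    by simp
  finally show ?thesis unfolding inv_fourier_def by (simp add: sum_distrib_left mult_ac)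
qed

section \<open>Parameter dependence of Taylor coefficients\<close>

text \<open>Taylor coefficients are iterated limits of difference quotients, so they depend measurably on a parameter.\<close>

lemma taylor_coeff_limit:
  assumes f: "f holomorphic_on ball 0 r" and r: "r > 0"
  defines "x i \<equiv> of_real (r / real (i + 2)) :: complex"
  shows "(\<lambda>i. (f (x i) - (\<Sum>j<n. taylor_coeff f j * x i ^ j)) / x i ^ n) \<longlonglongrightarrow> taylor_coeff f n"
proof -
  \<comment> \<open>No bound on f is assumed, so one is obtained by compactness on the half
    disc.\<close>
  have sub: "cball 0 (r / 2) \<subseteq> ball (0::complex) r" using r by auto
  have "compact (f ` cball 0 (r / 2))"
    using sub by (intro compact_continuous_image continuous_on_subset[OF holomorphic_on_imp_continuous_on[OF f]]) auto
  then obtain K where K: "\<And>x. x \<in> cball 0 (r / 2) \<Longrightarrow> cmod (f x) \<le> K"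
    using compact_imp_bounded bounded_iff by (metis imageI)
  define s where "s = r / 2"
  have s: "s > 0" using r by (simp add: s_def)
  have fs: "f holomorphic_on ball 0 s" using f by (rule holomorphic_on_subset) (use s in \<open>auto simp: s_def\<close>)
  have Ks: "cmod (f x) \<le> K" if "x \<in> ball 0 s" for x using K that by (auto simp: s_def)
  have xi: "cmod (x i) = r / real (i + 2)" "x i \<noteq> 0" for i
    using r unfolding x_def norm_of_real by (auto simp del: of_real_divide of_real_add of_nat_add)
  show ?thesis
  proof (rule LIM_zero_cancel, rule Lim_null_comparison)
    show "eventually (\<lambda>i. norm ((f (x i) - (\<Sum>j<n. taylor_coeff f j * x i ^ j)) / x i ^ n - taylor_coeff f n)
        \<le> 3 * K * (2 / s) ^ Suc n * (r / real (i + 2))) sequentially"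
      using eventually_gt_at_top[of 0]
    proof eventually_elim
      case (elim i)
      then have "cmod (x i) < s" unfolding xi s_def using r by (intro divide_strict_left_mono) auto
      from taylor_remainder[OF fs s Ks this, of "Suc n"]
      have "cmod (f (x i) - (\<Sum>j<n. taylor_coeff f j * x i ^ j) - taylor_coeff f n * x i ^ n) \<le> 3 * K * (2 * cmod (x i) / s) ^ Suc n"
        by (simp add: diff_diff_eq)
      also have "(f (x i) - (\<Sum>j<n. taylor_coeff f j * x i ^ j) - taylor_coeff f n * x i ^ n)
         = ((f (x i) - (\<Sum>j<n. taylor_coeff f j * x i ^ j)) / x i ^ n - taylor_coeff f n) * x i ^ n"
        using xi(2)[of i] by (simp add: field_simps)
      also have "3 * K * (2 * cmod (x i) / s) ^ Suc n = (3 * K * (2 / s) ^ Suc n * cmod (x i)) * cmod (x i) ^ n"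
        by (simp add: power_divide power_mult_distrib field_simps)
      finally have "cmod ((f (x i) - (\<Sum>j<n. taylor_coeff f j * x i ^ j)) / x i ^ n - taylor_coeff f n)
         \<le> 3 * K * (2 / s) ^ Suc n * cmod (x i)"
        unfolding norm_mult norm_power using xi(2)[of i] by (auto intro: mult_right_le_imp_le)
      then show ?case unfolding xi .
    qed
    have "(\<lambda>i. 3 * K * (2 / s) ^ Suc n * (r / real (i + 2))) \<longlonglongrightarrow> 3 * K * (2 / s) ^ Suc n * 0"
      by (intro tendsto_mult tendsto_const) real_asymp
    then show "(\<lambda>i. 3 * K * (2 / s) ^ Suc n * (r / real (i + 2))) \<longlonglongrightarrow> 0" by simp
  qed
qed

lemma taylor_coeff_measurable:
  assumes f: "\<And>m. (\<lambda>x. f x m) holomorphic_on ball 0 r" and r: "r > 0"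
    and meas: "\<And>x. x \<in> ball 0 r \<Longrightarrow> f x \<in> borel_measurable M"
  shows "(\<lambda>m. taylor_coeff (\<lambda>x. f x m) n) \<in> borel_measurable M"
proof (induction n rule: less_induct)
  case (less n)
  let ?x = "\<lambda>i::nat. of_real (r / real (i + 2)) :: complex"
  have xi: "?x i \<in> ball 0 r" for i
  proof -
    have "cmod (?x i) = r / real (i + 2)" using r unfolding norm_of_real by simp
    also have "\<dots> < r" using r by (simp add: field_simps add_pos_nonneg)
    finally show ?thesis by simp
  qed
  show ?case
  proof (rule borel_measurable_LIMSEQ_metric)
    show "(\<lambda>m. (f (?x i) m - (\<Sum>j<n. taylor_coeff (\<lambda>x. f x m) j * ?x i ^ j)) / ?x i ^ n) \<in> borel_measurable M" for i
      by (intro borel_measurable_divide borel_measurable_diff borel_measurable_sum borel_measurable_times meas[OF xi] less borel_measurable_const) auto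
    show "(\<lambda>i. (f (?x i) m - (\<Sum>j<n. taylor_coeff (\<lambda>x. f x m) j * ?x i ^ j)) / ?x i ^ n) \<longlonglongrightarrow> taylor_coeff (\<lambda>x. f x m) n" for m
      by (rule taylor_coeff_limit[OF f r])
  qed
qed

text \<open>The quotients that define the n-th coefficient from the lower ones converge at a rate
  depending on K and r only, hence uniformly in y, and holomorphy passes to the limit.\<close>

lemma taylor_coeff_holomorphic:
  assumes f: "\<And>y. y \<in> B \<Longrightarrow> (\<lambda>x. f x y) holomorphic_on ball 0 r" and r: "r > 0" and B: "open B"
    and g: "\<And>x. x \<in> ball 0 r \<Longrightarrow> f x holomorphic_on B"
    and K: "\<And>x y. x \<in> ball 0 r \<Longrightarrow> y \<in> B \<Longrightarrow> cmod (f x y) \<le> K"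
  shows "(\<lambda>y. taylor_coeff (\<lambda>x. f x y) n) holomorphic_on B"
proof (induction n rule: less_induct)
  case (less n)
  let ?x = "\<lambda>i::nat. of_real (r / real (i + 2)) :: complex"
  have nx: "cmod (?x i) = r / real (i + 2)" for i using r unfolding norm_of_real by simp
  have xi: "?x i \<in> ball 0 r" "?x i \<noteq> 0" for i
  proof -
    have "r / real (i + 2) < r" using r by (simp add: field_simps add_pos_nonneg)
    then show "?x i \<in> ball 0 r" using nx[of i] by simp
    show "?x i \<noteq> 0" using nx[of i] r by (metis add_2_eq_Suc' divide_eq_0_iff norm_zero of_nat_eq_0_iff order_less_irrefl nat.distinct(1))
  qed
  show ?case
  proof (rule holomorphic_uniform_sequence[OF B])
    let ?g = "\<lambda>i y. (f (?x i) y - (\<Sum>j<n. taylor_coeff (\<lambda>x. f x y) j * ?x i ^ j)) / ?x i ^ n"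
    show "?g i holomorphic_on B" for i
      by (intro holomorphic_intros g[OF xi(1)] less) (use xi(2)[of i] in auto)
    fix y assume "y \<in> B"
    then obtain d where d: "d > 0" "cball y d \<subseteq> B" using B open_contains_cball by blast
    have bd: "cmod (?g i y - taylor_coeff (\<lambda>x. f x y) n) \<le> 3 * K * (2 / r) ^ Suc n * (r / real (i + 2))" if y: "y \<in> B" for i y
    proof -
      let ?a = "taylor_coeff (\<lambda>x. f x y)"
      have "cmod (f (?x i) y - (\<Sum>j<Suc n. ?a j * ?x i ^ j)) \<le> 3 * K * (2 * cmod (?x i) / r) ^ Suc n"
        by (rule taylor_remainder[OF f[OF y] r K[OF _ y]]) (use xi(1)[of i] in auto)
      also have "f (?x i) y - (\<Sum>j<Suc n. ?a j * ?x i ^ j) = (?g i y - ?a n) * ?x i ^ n"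
      proof -
        have "F - (G + a * p) = ((F - G) / p - a) * p" if "p \<noteq> 0" for F G a p :: complex
          using that by (simp add: field_simps)
        then show ?thesis using xi(2)[of i] by (simp only: sum.lessThan_Suc power_not_zero not_False_eq_True)
      qed
      also have "3 * K * (2 * cmod (?x i) / r) ^ Suc n = (3 * K * (2 / r) ^ Suc n * cmod (?x i)) * cmod (?x i) ^ n"
      proof -
        have "3 * K * (2 * c / r) ^ Suc n = (3 * K * (2 / r) ^ Suc n * c) * c ^ n" for c
          by (simp add: power_divide power_mult_distrib)
        then show ?thesis .
      qed
      finally have *: "cmod (?g i y - ?a n) * cmod (?x i) ^ n \<le> (3 * K * (2 / r) ^ Suc n * cmod (?x i)) * cmod (?x i) ^ n"
        unfolding norm_mult norm_power .
      have "0 < cmod (?x i) ^ n" using xi(2)[of i] by (simp only: zero_less_power zero_less_norm_iff not_False_eq_True)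
      from mult_right_le_imp_le[OF * this] show ?thesis unfolding nx .
    qed
    have "uniform_limit (cball y d) ?g (\<lambda>y. taylor_coeff (\<lambda>x. f x y) n) sequentially"
    proof (rule uniform_limitI)
      fix e :: real assume e: "e > 0"
      have "(\<lambda>i. 3 * K * (2 / r) ^ Suc n * (r / real (i + 2))) \<longlonglongrightarrow> 3 * K * (2 / r) ^ Suc n * 0"
        by (intro tendsto_mult tendsto_const) real_asymp
      then have "eventually (\<lambda>i. 3 * K * (2 / r) ^ Suc n * (r / real (i + 2)) < e) sequentially"
        using e by (intro order_tendstoD) auto
      then show "eventually (\<lambda>i. \<forall>y\<in>cball y d. dist (?g i y) (taylor_coeff (\<lambda>x. f x y) n) < e) sequentially"
      proof eventually_elim
        case (elim i)
        show ?case unfolding dist_norm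
          by (intro ballI le_less_trans[OF bd elim]) (use d in auto)
      qed
    qed
    with d show "\<exists>d>0. cball y d \<subseteq> B \<and> uniform_limit (cball y d) ?g (\<lambda>y. taylor_coeff (\<lambda>x. f x y) n) sequentially" by blast
  qed
qed

section \<open>The weights and the convolution\<close>

lemma wnorm_bound:
  assumes "wbounded X w h" "wnorm X w h \<le> B" "x \<in> X"
  shows "w x * cmod (h x) \<le> B"
proof -
  have "w x * cmod (h x) \<le> wnorm X w h"
    unfolding wnorm_def by (rule cSUP_upper[OF assms(3)]) (use assms(1) in \<open>simp add: wbounded_def\<close>)
  then show ?thesis using assms(2) by linarith
qed

lemma Exp_weight_bound:
  assumes "Exp_weight q k \<beta> \<mu> \<alpha> s (\<tau>, m) * cmod v \<le> B" "ln q > 0" "k > 0"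
  shows "cmod v \<le> B / E_weight \<beta> \<mu> m * exp ((ln (cmod (\<tau> + of_real s)))\<^sup>2 / (2 * (ln q / k)) + \<alpha> * ln (cmod (\<tau> + of_real s)))"
proof -
  let ?X = "(ln (cmod (\<tau> + of_real s)))\<^sup>2 / (2 * (ln q / k)) + \<alpha> * ln (cmod (\<tau> + of_real s))"
  have "Exp_weight q k \<beta> \<mu> \<alpha> s (\<tau>, m) = E_weight \<beta> \<mu> m * exp (- ?X)"
    using assms(2,3) by (simp add: Exp_weight_def field_simps)
  then have "cmod v * (E_weight \<beta> \<mu> m * exp (- ?X)) \<le> B" using assms(1) by (simp add: mult.commute)
  then have "cmod v \<le> B / (E_weight \<beta> \<mu> m * exp (- ?X))" by (simp add: pos_le_divide_eq)
  moreover have "B / (e * exp (- x)) = B / e * exp x" for e x :: real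
    by (simp add: exp_minus divide_inverse)
  ultimately show ?thesis by (simp only:)
qed

text \<open>The first family of weights is written in |\<tau> + \<delta>|, the transform estimates
  in |\<tau>|. Along a ray the two logarithms differ by O(1/r), so their squares differ by O(ln r /
  r), which is bounded.\<close>

lemma shifted_weight_ray:
  fixes la \<alpha> \<delta> dr R0 :: real
  assumes la: "la > 0" and R0: "R0 > 0" and nz: "\<And>r. r \<ge> R0 \<Longrightarrow> of_real r * cis dr + of_real \<delta> \<noteq> 0"
  obtains K where "K > 0" "\<And>r. r \<ge> R0 \<Longrightarrow>
    exp ((ln (cmod (of_real r * cis dr + of_real \<delta>)))\<^sup>2 / (2 * la) + \<alpha> * ln (cmod (of_real r * cis dr + of_real \<delta>)))
      \<le> K * exp ((ln r)\<^sup>2 / (2 * la) + \<alpha> * ln r)"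
proof -
  define G where "G r = ln (cmod (of_real r * cis dr + of_real \<delta>))" for r
  define P where "P r = ((G r)\<^sup>2 / (2 * la) + \<alpha> * G r) - ((ln r)\<^sup>2 / (2 * la) + \<alpha> * ln r)" for r
  \<comment> \<open>For r >= \<open>R\<close> the relative change caused by the shift is at most
    1/2, so ln (1 + y) is comparable with y. On the compact interval below \<open>R\<close>
    continuity suffices.\<close>
  define R where "R = max R0 (max 1 (2 * \<bar>\<delta>\<bar>))"
  have R: "R \<ge> R0" "R \<ge> 1" "R \<ge> 2 * \<bar>\<delta>\<bar>" by (auto simp: R_def)
  have "continuous_on {R0..R} P"
    unfolding P_def G_def by (intro continuous_intros) (use R0 nz la in auto)
  then have "compact (P ` {R0..R})" by (intro compact_continuous_image) auto
  then obtain B where B: "\<And>r. r \<in> {R0..R} \<Longrightarrow> \<bar>P r\<bar> \<le> B"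
    using compact_imp_bounded bounded_iff by (metis imageI real_norm_def)
  define B' where "B' = (2 * \<bar>\<delta>\<bar> * (2 + 2 * \<bar>\<delta>\<bar>)) / (2 * la) + \<bar>\<alpha>\<bar> * (2 * \<bar>\<delta>\<bar>)"
  have big: "P r \<le> B'" if r: "r \<ge> R" for r
  proof -
    have r1: "r \<ge> 1" "r > 0" using r R by linarith+
    define y where "y = cmod (cis dr + of_real (\<delta> / r)) - 1"
    define D where "D = G r - ln r"
    have dr: "\<bar>\<delta>\<bar> / r \<le> 1 / 2" using r R r1 by (simp add: field_simps)
    have y: "\<bar>y\<bar> \<le> \<bar>\<delta>\<bar> / r"
    proof -
      have "\<bar>cmod (cis dr + of_real (\<delta> / r)) - cmod (cis dr)\<bar> \<le> cmod (of_real (\<delta> / r))"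
        using norm_triangle_ineq3[of "cis dr + of_real (\<delta> / r)" "cis dr"] by simp
      also have "\<dots> = \<bar>\<delta>\<bar> / r" using r1 unfolding norm_of_real by simp
      finally show ?thesis by (simp add: y_def)
    qed
    have "of_real r * cis dr + of_real \<delta> = of_real r * (cis dr + of_real (\<delta> / r))"
      using r1 by (simp add: field_simps)
    then have "cmod (of_real r * cis dr + of_real \<delta>) = r * (1 + y)"
      using r1 by (simp add: norm_mult y_def)
    moreover have y1: "1 + y > 0" using y dr by linarith
    ultimately have D: "D = ln (1 + y)" using r1 by (simp add: D_def G_def ln_mult)
    have "\<bar>ln (1 + y) - y\<bar> \<le> 2 * y\<^sup>2" using y dr by (intro abs_ln_one_plus_x_minus_x_bound) linarith
    also have "\<dots> = 2 * \<bar>y\<bar> * \<bar>y\<bar>" by (simp add: power2_eq_square)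
    also have "\<dots> \<le> 1 * \<bar>y\<bar>"
    proof (rule mult_right_mono)
      have "\<bar>y\<bar> \<le> 1 / 2" using y dr by linarith
      then show "2 * \<bar>y\<bar> \<le> 1" by simp
    qed simp
    finally have Dy: "\<bar>D\<bar> \<le> 2 * (\<bar>\<delta>\<bar> / r)" using y unfolding D by linarith
    have "1 / r \<le> 1" using r1 by simp
    then have Dr: "\<bar>D\<bar> \<le> 2 * \<bar>\<delta>\<bar>" using Dy mult_left_mono[of "1 / r" 1 "2 * \<bar>\<delta>\<bar>"] by simp
    have "ln r \<le> r" using r1 ln_less_self[of r] by linarith
    have "\<bar>D\<bar> * (2 * ln r) \<le> 2 * (\<bar>\<delta>\<bar> / r) * (2 * r)"
      using Dy \<open>ln r \<le> r\<close> r1 by (intro mult_mono) auto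
    also have "\<dots> = 4 * \<bar>\<delta>\<bar>" using r1 by simp
    finally have 1: "\<bar>D\<bar> * (2 * ln r) \<le> 4 * \<bar>\<delta>\<bar>" .
    have 2: "\<bar>D\<bar> * \<bar>D\<bar> \<le> 2 * \<bar>\<delta>\<bar> * (2 * \<bar>\<delta>\<bar>)" using Dr by (intro mult_mono) auto
    have "(G r)\<^sup>2 - (ln r)\<^sup>2 = D * (2 * ln r) + D * D" by (simp add: D_def power2_eq_square algebra_simps)
    also have "\<dots> \<le> \<bar>D\<bar> * (2 * ln r) + \<bar>D\<bar> * \<bar>D\<bar>"
      using r1 by (intro add_mono mult_right_mono) auto
    also have "\<dots> \<le> 2 * \<bar>\<delta>\<bar> * (2 + 2 * \<bar>\<delta>\<bar>)" using 1 2 by (simp add: algebra_simps)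
    finally have 3: "(G r)\<^sup>2 - (ln r)\<^sup>2 \<le> 2 * \<bar>\<delta>\<bar> * (2 + 2 * \<bar>\<delta>\<bar>)" .
    have "\<alpha> * D \<le> \<bar>\<alpha>\<bar> * \<bar>D\<bar>" by (metis abs_ge_self abs_mult)
    also have "\<dots> \<le> \<bar>\<alpha>\<bar> * (2 * \<bar>\<delta>\<bar>)" using Dr by (intro mult_left_mono) auto
    finally have 4: "\<alpha> * D \<le> \<bar>\<alpha>\<bar> * (2 * \<bar>\<delta>\<bar>)" .
    have "P r = ((G r)\<^sup>2 - (ln r)\<^sup>2) / (2 * la) + \<alpha> * D"
      by (simp add: P_def D_def diff_divide_distrib algebra_simps)
    also have "\<dots> \<le> B'" unfolding B'_def using 3 4 la by (intro add_mono divide_right_mono) auto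
    finally show ?thesis .
  qed
  show ?thesis
  proof (rule that[of "exp (max B B')"])
    fix r assume r: "r \<ge> R0"
    have "P r \<le> max B B'"
    proof (cases "r \<le> R")
      case True then show ?thesis using B[of r] r by auto
    next
      case False then show ?thesis using big[of r] by auto
    qed
    then have "exp ((G r)\<^sup>2 / (2 * la) + \<alpha> * G r) \<le> exp (max B B' + ((ln r)\<^sup>2 / (2 * la) + \<alpha> * ln r))"
      unfolding P_def by simp
    then show "exp ((ln (cmod (of_real r * cis dr + of_real \<delta>)))\<^sup>2 / (2 * la) + \<alpha> * ln (cmod (of_real r * cis dr + of_real \<delta>)))
      \<le> exp (max B B') * exp ((ln r)\<^sup>2 / (2 * la) + \<alpha> * ln r)"
      unfolding G_def exp_add[symmetric] .
  qed simp
qed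

lemma poly_imaginary_bound:
  obtains K where "K > 0" "\<And>m::real. cmod (poly p (\<i> * of_real m)) \<le> K * (1 + \<bar>m\<bar>) ^ degree p"
proof (rule that[of "(\<Sum>i\<le>degree p. cmod (coeff p i)) + 1"])
  show "(\<Sum>i\<le>degree p. cmod (coeff p i)) + 1 > 0" by (intro add_nonneg_pos sum_nonneg) auto
  fix m :: real
  have "cmod (poly p (\<i> * of_real m)) \<le> (\<Sum>i\<le>degree p. cmod (coeff p i) * (1 + \<bar>m\<bar>) ^ degree p)"
    unfolding poly_altdef
  proof (rule order_trans[OF norm_sum sum_mono])
    fix i assume i: "i \<in> {..degree p}"
    have "\<bar>m\<bar> ^ i \<le> (1 + \<bar>m\<bar>) ^ i" by (intro power_mono) auto
    also have "\<dots> \<le> (1 + \<bar>m\<bar>) ^ degree p" using i by (intro power_increasing) auto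
    finally show "cmod (coeff p i * (\<i> * of_real m) ^ i) \<le> cmod (coeff p i) * (1 + \<bar>m\<bar>) ^ degree p"
      by (simp add: norm_mult norm_power mult_left_mono)
  qed
  also have "\<dots> = (\<Sum>i\<le>degree p. cmod (coeff p i)) * (1 + \<bar>m\<bar>) ^ degree p" by (simp add: sum_distrib_right)
  also have "\<dots> \<le> ((\<Sum>i\<le>degree p. cmod (coeff p i)) + 1) * (1 + \<bar>m\<bar>) ^ degree p" by (intro mult_right_mono) auto
  finally show "cmod (poly p (\<i> * of_real m)) \<le> ((\<Sum>i\<le>degree p. cmod (coeff p i)) + 1) * (1 + \<bar>m\<bar>) ^ degree p" .
qed

text \<open>The growth of p on the imaginary axis is absorbed by the power in
  \<open>E_weight\<close>, since \<mu> is at least the degree, and the exponential factor makes the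
  integral converge. As h enters through its supremum only, the bound carries no weight in
  m.\<close>

lemma rconv_diff_bound:
  assumes \<beta>: "\<beta> > 0" and \<mu>: "\<mu> \<ge> real (degree p)"
  obtains K where "K > 0"
    "\<And>h w w' A B m M. continuous_on UNIV h \<Longrightarrow> (\<And>x. cmod (h x) \<le> A) \<Longrightarrow> w \<in> borel_measurable borel \<Longrightarrow> w' \<in> borel_measurable borel \<Longrightarrow>
      (\<And>x. cmod (w x) \<le> M / E_weight \<beta> \<mu> x) \<Longrightarrow> (\<And>x. cmod (w' x) \<le> M / E_weight \<beta> \<mu> x) \<Longrightarrow>
      (\<And>x. cmod (w x - w' x) \<le> B / E_weight \<beta> \<mu> x) \<Longrightarrow> cmod (rconv p h w m - rconv p h w' m) \<le> A * B * K"
proof -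
  obtain P where P: "P > 0" "\<And>m::real. cmod (poly p (\<i> * of_real m)) \<le> P * (1 + \<bar>m\<bar>) ^ degree p"
    using poly_imaginary_bound by metis
  have pw: "cmod (poly p (\<i> * of_real x)) * (M / E_weight \<beta> \<mu> x) \<le> P * M * exp (- \<beta> * \<bar>x\<bar>)" if "M \<ge> 0" for x M :: real
  proof -
    have "(1 + \<bar>x\<bar>) ^ degree p \<le> (1 + \<bar>x\<bar>) powr \<mu>"
    proof -
      have "(1 + \<bar>x\<bar>) ^ degree p = (1 + \<bar>x\<bar>) powr real (degree p)" by (simp add: powr_realpow)
      also have "\<dots> \<le> (1 + \<bar>x\<bar>) powr \<mu>" using \<mu> by (intro powr_mono) auto
      finally show ?thesis .
    qed
    then have "P * (1 + \<bar>x\<bar>) ^ degree p \<le> P * (1 + \<bar>x\<bar>) powr \<mu>" using P(1) by (intro mult_left_mono) auto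
    then have "cmod (poly p (\<i> * of_real x)) \<le> P * (1 + \<bar>x\<bar>) powr \<mu>" using P(2)[of x] by linarith
    then have "cmod (poly p (\<i> * of_real x)) * (M / E_weight \<beta> \<mu> x) \<le> P * (1 + \<bar>x\<bar>) powr \<mu> * (M / E_weight \<beta> \<mu> x)"
      using that by (intro mult_right_mono divide_nonneg_nonneg) (auto intro: less_imp_le)
    also have "\<dots> = P * M * exp (- \<beta> * \<bar>x\<bar>)"
    proof -
      have "(1 + \<bar>x\<bar>) powr \<mu> > 0" by (intro powr_gt_zero[THEN iffD2]) linarith
      then show ?thesis by (simp add: E_weight_def exp_minus field_simps)
    qed
    finally show ?thesis .
  qed
  show ?thesis
  proof (rule that[of "P * fourier_bound \<beta> + 1"])
    show "P * fourier_bound \<beta> + 1 > 0" using P fourier_bound_nonneg[of \<beta>] by (intro add_nonneg_pos) auto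
    fix h w w' A B m M
    assume h: "continuous_on UNIV (h :: real \<Rightarrow> complex)" "\<And>x. cmod (h x) \<le> A"
      and w: "w \<in> borel_measurable borel" "w' \<in> borel_measurable borel"
        "\<And>x. cmod (w x) \<le> M / E_weight \<beta> \<mu> x" "\<And>x. cmod (w' x) \<le> M / E_weight \<beta> \<mu> x"
      and B: "\<And>x. cmod (w x - w' x) \<le> B / E_weight \<beta> \<mu> x"
    have A0: "A \<ge> 0" using h(2)[of 0] norm_ge_zero order_trans by blast
    have nn: "X \<ge> 0" if "\<And>x. cmod (v x) \<le> X / E_weight \<beta> \<mu> x" for X and v :: "real \<Rightarrow> complex"
      using order_trans[OF norm_ge_zero that[of 0]] E_weight_pos[of \<beta> \<mu> 0] by (simp add: zero_le_divide_iff)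
    have le: "cmod (h (m - x) * poly p (\<i> * of_real x) * v x) \<le> A * P * X * exp (- \<beta> * \<bar>x\<bar>)"
      if v: "\<And>x. cmod (v x) \<le> X / E_weight \<beta> \<mu> x" for v :: "real \<Rightarrow> complex" and X x
    proof -
      have "cmod (h (m - x) * poly p (\<i> * of_real x) * v x) = cmod (h (m - x)) * (cmod (poly p (\<i> * of_real x)) * cmod (v x))"
        by (simp add: norm_mult)
      also have "\<dots> \<le> A * (cmod (poly p (\<i> * of_real x)) * (X / E_weight \<beta> \<mu> x))"
        by (intro mult_mono mult_left_mono h v) (use A0 in auto)
      also have "\<dots> \<le> A * (P * X * exp (- \<beta> * \<bar>x\<bar>))" by (intro mult_left_mono pw nn[OF v] A0)
      finally show ?thesis by simp
    qed
    have gi: "integrable lborel (\<lambda>x. X * exp (- \<beta> * \<bar>x\<bar>))" for X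
      by (intro integrable_mult_right integrable_exp_abs \<beta>)
    have hm: "(\<lambda>x. h (m - x)) \<in> borel_measurable borel"
      by (intro borel_measurable_continuous_onI continuous_on_compose2[OF h(1)] continuous_intros) auto
    have pm: "(\<lambda>x::real. poly p (\<i> * of_real x)) \<in> borel_measurable borel"
      by (intro borel_measurable_continuous_onI continuous_intros)
    have i: "integrable lborel (\<lambda>x. h (m - x) * poly p (\<i> * of_real x) * v x)"
      if v: "\<And>x. cmod (v x) \<le> X / E_weight \<beta> \<mu> x" and vm: "v \<in> borel_measurable borel" for v :: "real \<Rightarrow> complex" and X
    proof (rule Bochner_Integration.integrable_bound[OF gi[of "A * P * X"]])
      show "(\<lambda>x. h (m - x) * poly p (\<i> * of_real x) * v x) \<in> borel_measurable lborel"
        using borel_measurable_times[OF borel_measurable_times[OF hm pm] vm] by simp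
      show "AE x in lborel. norm (h (m - x) * poly p (\<i> * of_real x) * v x) \<le> norm (A * P * X * exp (- \<beta> * \<bar>x\<bar>))"
        using le[OF v] by (intro AE_I2) (simp only: real_norm_def, meson abs_ge_self order_trans)
    qed
    have "rconv p h w m - rconv p h w' m = (LINT x|lborel. h (m - x) * poly p (\<i> * of_real x) * (w x - w' x))"
      unfolding rconv_def
      by (subst Bochner_Integration.integral_diff[OF i[OF w(3,1)] i[OF w(4,2)], symmetric]) (simp add: right_diff_distrib)
    also have "cmod \<dots> \<le> (LINT x|lborel. A * P * B * exp (- \<beta> * \<bar>x\<bar>))"
      by (rule Bochner_Integration.integral_norm_bound_integral[OF i[OF B borel_measurable_diff[OF w(1,2)]] gi]) (rule le[OF B])
    also have "\<dots> = A * B * (P * fourier_bound \<beta>)" by (simp add: fourier_bound_def)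
    also have "\<dots> \<le> A * B * (P * fourier_bound \<beta> + 1)"
      using A0 nn[OF B] by (intro mult_left_mono) auto
    finally show "cmod (rconv p h w m - rconv p h w' m) \<le> A * B * (P * fourier_bound \<beta> + 1)" .
  qed
qed

text \<open>Cauchy's estimate on the circle of radius s gives a multiple of s^(N-j), and s tends to
  0.\<close>

lemma taylor_coeff_zero_of_order:
  assumes f: "f holomorphic_on ball 0 r" and r: "r > 0"
    and b: "\<And>x. x \<in> ball 0 r \<Longrightarrow> cmod (f x) \<le> K * cmod x ^ N" and j: "j < N"
  shows "taylor_coeff f j = 0"
proof -
  have K0: "K \<ge> 0"
  proof -
    have "0 \<le> K * (r / 2) ^ N" using order_trans[OF norm_ge_zero b[of "of_real (r / 2)"]] r by (simp add: norm_divide)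
    moreover have "(r / 2) ^ N > 0" using r by simp
    ultimately show ?thesis by (meson mult_neg_pos not_le)
  qed
  have le: "cmod (taylor_coeff f j) \<le> K * s ^ (N - j)" if s: "0 < s" "s < r" for s
  proof -
    have "cmod (taylor_coeff f j) \<le> K * s ^ N / s ^ j"
    proof (rule taylor_coeff_bound)
      show "f holomorphic_on ball 0 s" using f by (rule holomorphic_on_subset) (use s in auto)
      fix x :: complex assume x: "x \<in> ball 0 s"
      have "cmod (f x) \<le> K * cmod x ^ N" using x s by (intro b) auto
      also have "\<dots> \<le> K * s ^ N" using x K0 by (intro mult_left_mono power_mono) auto
      finally show "cmod (f x) \<le> K * s ^ N" .
    qed (rule s)
    also have "\<dots> = K * s ^ (N - j)" using s j by (simp add: power_diff)
    finally show ?thesis .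
  qed
  have "((\<lambda>s. K * s ^ (N - j)) \<longlongrightarrow> K * 0 ^ (N - j)) (at_right 0)" by (intro tendsto_intros)
  moreover have "eventually (\<lambda>s. cmod (taylor_coeff f j) \<le> K * s ^ (N - j)) (at_right 0)"
    using eventually_at_right_real[OF r] by eventually_elim (use le in auto)
  ultimately have "cmod (taylor_coeff f j) \<le> K * 0 ^ (N - j)"
    by (rule tendsto_lowerbound) simp
  moreover have "(0::real) ^ (N - j) = 0" using j by (intro zero_power) simp
  ultimately show ?thesis by (simp only: mult_zero_right norm_le_zero_iff)
qed

section \<open>The Borel transforms\<close>

context q_solutions
begin

definition la1 :: real where "la1 = ln q / real k1"
definition la2 :: real where "la2 = ln q / real k2"
definition lak :: real where "lak = ln q / \<kappa>"

lemma ln_q_pos: "ln q > 0" using q by simp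

lemma kappa_pos: "\<kappa> > 0"
proof -
  have "1 / real k2 < 1 / real k1" using k by (intro divide_strict_left_mono) auto
  then have "1 / \<kappa> > 0" using kappa by simp
  then show ?thesis by simp
qed

lemma la_pos: "la1 > 0" "la2 > 0" "lak > 0"
  using ln_q_pos kappa_pos k by (auto simp: la1_def la2_def lak_def)

lemma la1_eq: "la1 = lak + la2"
proof -
  have "lak = ln q * (1 / \<kappa>)" by (simp add: lak_def)
  also have "\<dots> = la1 - la2" unfolding kappa by (simp add: la1_def la2_def right_diff_distrib)
  finally show ?thesis by simp
qed

lemma q_powr_neg: "k' > 0 \<Longrightarrow> q powr (- 1 / k') = exp (- (ln q / k'))"
  using q by (simp add: powr_def)

lemma qlaplace_kappa:
  "qlaplace q \<kappa> \<theta> g x = of_real (1 / pi_q q \<kappa>) *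
     (LINT r:{0<..}|lborel. g (of_real r * cis \<theta>) / Theta (exp (- lak)) (of_real r * cis \<theta> / x) / of_real r)"
  unfolding qlaplace_def lak_def by (simp only: jtheta_eq_Theta[OF q kappa_pos] q_powr_neg[OF kappa_pos])

lemma qlaplace_k2:
  "qlaplace q (real k2) \<theta> g x = of_real (1 / pi_q q (real k2)) *
     (LINT r:{0<..}|lborel. g (of_real r * cis \<theta>) / Theta (exp (- la2)) (of_real r * cis \<theta> / x) / of_real r)"
proof -
  have k2: "real k2 > 0" using k by simp
  show ?thesis unfolding qlaplace_def la2_def by (simp only: jtheta_eq_Theta[OF q k2] q_powr_neg[OF k2])
qed

lemma nE: "0 < n\<^sub>E"
  using covering by (simp add: good_covering_def)

lemma mu_nonneg: "\<mu> \<ge> 0" using mu by linarith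

text \<open>The case r = 0 of the condition in \<open>R_dom\<close>, at a point of the nonempty set
  \<open>Rb 0\<close>.\<close>

lemma delta1_less: "\<delta>\<^sub>1 < 1"
proof -
  obtain x where "x \<in> Rb 0" using Rb_inter[OF nE] by blast
  then have "\<forall>r\<ge>0. cmod (1 + cis (dir 0) * of_real r / x) > \<delta>\<^sub>1" by (simp add: Rb_eq Rb_dom_def R_dom_def)
  from this[rule_format, of 0] show ?thesis by simp
qed

lemma radius: "0 < \<epsilon>\<^sub>0 * r\<^sub>T" "\<epsilon>\<^sub>0 * r\<^sub>T < 1"
  using eps0 small mult_strict_mono[of "\<epsilon>\<^sub>0" 1 "r\<^sub>T" 1] by auto

lemma E_sub: "p < n\<^sub>E \<Longrightarrow> \<epsilon> \<in> E p \<Longrightarrow> \<epsilon> \<in> ball 0 \<epsilon>\<^sub>0"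
  using covering unfolding good_covering_def is_sector_def sector_def by (fastforce simp: norm_mult)

lemma w1_weighted:
  assumes p: "p < n\<^sub>E" and e: "\<epsilon> \<in> ball 0 \<epsilon>\<^sub>0" and x: "x \<in> U p \<union> cball 0 \<rho>"
  shows "cmod (w1 p x m \<epsilon>) \<le> W / E_weight \<beta> \<mu> m *
    exp ((ln (cmod (x + of_real \<delta>\<^sub>0)))\<^sup>2 / (2 * lak) + \<alpha> * ln (cmod (x + of_real \<delta>\<^sub>0)))"
proof -
  have "wbounded ((U p \<union> cball 0 \<rho>) \<times> UNIV) (Exp_weight q \<kappa> \<beta> \<mu> \<alpha> \<delta>\<^sub>0) (\<lambda>(\<tau>, m). w1 p \<tau> m \<epsilon>)"
    "wnorm ((U p \<union> cball 0 \<rho>) \<times> UNIV) (Exp_weight q \<kappa> \<beta> \<mu> \<alpha> \<delta>\<^sub>0) (\<lambda>(\<tau>, m). w1 p \<tau> m \<epsilon>) \<le> W"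
    using w1_sol[OF p e] by (auto simp: Exp1_space_def Exp_space_def Exp1_norm_def)
  from wnorm_bound[OF this, of "(x, m)"] x
  show ?thesis unfolding lak_def by (intro Exp_weight_bound) (use ln_q_pos kappa_pos in auto)
qed

lemma w2_weighted:
  assumes p: "p < n\<^sub>E" and e: "\<epsilon> \<in> ball 0 \<epsilon>\<^sub>0" and x: "x \<in> Exp2_dom (S p) (Rb p)"
  shows "cmod (w2 p x m \<epsilon>) \<le> W / E_weight \<beta> \<mu> m * exp ((ln (cmod x))\<^sup>2 / (2 * la2) + \<nu> * ln (cmod x))"
proof -
  have "wbounded (Exp2_dom (S p) (Rb p) \<times> UNIV) (Exp_weight q (real k2) \<beta> \<mu> \<nu> 0) (\<lambda>(\<tau>, m). w2 p \<tau> m \<epsilon>)"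
    "wnorm (Exp2_dom (S p) (Rb p) \<times> UNIV) (Exp_weight q (real k2) \<beta> \<mu> \<nu> 0) (\<lambda>(\<tau>, m). w2 p \<tau> m \<epsilon>) \<le> W"
    using w2_sol[OF p e] by (auto simp: Exp2_space_def Exp_space_def Exp2_norm_def)
  from wnorm_bound[OF this, of "(x, m)"] x
  have "Exp_weight q (real k2) \<beta> \<mu> \<nu> 0 (x, m) * cmod (w2 p x m \<epsilon>) \<le> W" by simp
  from Exp_weight_bound[OF this ln_q_pos] show ?thesis using k by (simp add: la2_def)
qed

text \<open>The assumed distance is positive from the union with the open disc; the closed disc lies
  in the closure of that union and is therefore also avoided.\<close>

lemma delta0_shift_nonzero:
  assumes "p < n\<^sub>E" "x \<in> U p \<union> cball 0 \<rho>"
  shows "x + of_real \<delta>\<^sub>0 \<noteq> 0"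
proof
  assume "x + of_real \<delta>\<^sub>0 = 0"
  then have x: "x = - of_real \<delta>\<^sub>0" by (simp add: eq_neg_iff_add_eq_0)
  have "x \<in> closure (U p \<union> ball 0 \<rho>)"
    using assms(2) rho closure_subset[of "U p"] by (auto simp: closure_Un)
  then have "infdist x (U p \<union> ball 0 \<rho>) = 0"
    using rho by (subst (asm) in_closure_iff_infdist_zero) auto
  then show False using delta0(2)[OF assms(1)] x by simp
qed

text \<open>The part of the weight that depends on \<tau> is continuous on the compact disc, so only
  the weight in m survives. The constant serves all p and \<epsilon> at once.\<close>

lemma w1_disc:
  obtains K where "K > 0" "\<And>p \<epsilon> x m. p < n\<^sub>E \<Longrightarrow> \<epsilon> \<in> ball 0 \<epsilon>\<^sub>0 \<Longrightarrow> x \<in> cball 0 \<rho> \<Longrightarrow> cmod (w1 p x m \<epsilon>) \<le> K / E_weight \<beta> \<mu> m"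
proof -
  let ?G = "\<lambda>x::complex. exp ((ln (cmod (x + of_real \<delta>\<^sub>0)))\<^sup>2 / (2 * lak) + \<alpha> * ln (cmod (x + of_real \<delta>\<^sub>0)))"
  have "continuous_on (cball 0 \<rho>) ?G"
    by (intro continuous_intros) (use delta0_shift_nonzero[OF nE] la_pos in auto)
  then have "bounded (?G ` cball 0 \<rho>)" by (intro compact_imp_bounded compact_continuous_image) auto
  then obtain B where "\<forall>y\<in>?G ` cball 0 \<rho>. norm y \<le> B" unfolding bounded_iff by blast
  then have B: "norm (?G x) \<le> B" if "x \<in> cball 0 \<rho>" for x :: complex using that by blast
  have B0: "B > 0" using B[of 0] rho by (auto intro: less_le_trans[OF exp_gt_zero])
  show ?thesis
  proof (rule that[of "W * B"])
    fix p m and \<epsilon> x :: complex assume a: "p < n\<^sub>E" "\<epsilon> \<in> ball 0 \<epsilon>\<^sub>0" "x \<in> cball 0 \<rho>"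
    have "cmod (w1 p x m \<epsilon>) \<le> W / E_weight \<beta> \<mu> m * ?G x" using a by (intro w1_weighted) auto
    also have "\<dots> \<le> W / E_weight \<beta> \<mu> m * B"
      using B[OF a(3)] W by (intro mult_left_mono divide_nonneg_nonneg) (auto intro: less_imp_le)
    finally show "cmod (w1 p x m \<epsilon>) \<le> W * B / E_weight \<beta> \<mu> m" by simp
  qed (use W B0 in simp)
qed

lemma w1_holo_tau:
  assumes "p < n\<^sub>E" "\<epsilon> \<in> ball 0 \<epsilon>\<^sub>0"
  shows "(\<lambda>x. w1 p x m \<epsilon>) holomorphic_on U p \<union> ball 0 \<rho>"
  using w1_sol[OF assms] by (auto simp: Exp1_space_def Exp_space_def)

lemma w1_continuous:
  assumes "p < n\<^sub>E" "\<epsilon> \<in> ball 0 \<epsilon>\<^sub>0"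
  shows "continuous_on ((U p \<union> cball 0 \<rho>) \<times> UNIV) (\<lambda>(x, m). w1 p x m \<epsilon>)"
  using w1_sol[OF assms] by (auto simp: Exp1_space_def Exp_space_def)

lemma w1_measurable:
  assumes "p < n\<^sub>E" "\<epsilon> \<in> ball 0 \<epsilon>\<^sub>0" "x \<in> U p \<union> cball 0 \<rho>"
  shows "(\<lambda>m. w1 p x m \<epsilon>) \<in> borel_measurable borel"
proof (rule borel_measurable_continuous_onI)
  have "continuous_on UNIV (\<lambda>m::real. (x, m))" by (intro continuous_intros)
  from continuous_on_compose2[OF w1_continuous[OF assms(1,2)] this] assms(3)
  show "continuous_on UNIV (\<lambda>m. w1 p x m \<epsilon>)" by (simp add: image_subset_iff)
qed

text \<open>
  Two solutions \<open>w1 p\<close> agree near 0: both sides of the difference of their equations show that a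
  zero of order \<open>n\<close> is one of order \<open>n + 1\<close>, since every \<open>\<tau>\<close>-power on the right exceeds the one on the left.
\<close>

lemma dilation_exponent:
  assumes "j \<in> {1..D-1}" "l \<in> I j"
  shows "real (\<delta> j) - real (d l j) / real k1 - 1 \<le> 0"
proof -
  have "real (d l j) / real k2 \<le> real (d l j) / real k1" using k by (intro divide_left_mono) auto
  then show ?thesis using d_delta[OF assms] by linarith
qed

text \<open>All dilations in the first auxiliary equation have nonpositive exponent, so they map the
  disc into itself and preserve an order estimate. Each power of \<tau> on the right exceeds the one
  on the left by at least one, which is the gain. The new constant may depend on m.\<close>

lemma w1_difference_order:
  assumes p: "p < n\<^sub>E" and e: "\<epsilon> \<in> ball 0 \<epsilon>\<^sub>0" and B0: "B \<ge> 0"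
    and hyp: "\<And>x m. cmod x < \<rho> \<Longrightarrow> cmod (w1 p x m \<epsilon> - w1 0 x m \<epsilon>) \<le> B * cmod x ^ n / E_weight \<beta> \<mu> m"
  obtains K where "\<And>x. cmod x < \<rho> \<Longrightarrow> x \<noteq> 0 \<Longrightarrow> cmod (w1 p x m \<epsilon> - w1 0 x m \<epsilon>) \<le> K * cmod x ^ Suc n"
proof -
  obtain K1 where K1: "K1 > 0" "\<And>p \<epsilon> x m. p < n\<^sub>E \<Longrightarrow> \<epsilon> \<in> ball 0 \<epsilon>\<^sub>0 \<Longrightarrow> x \<in> cball 0 \<rho> \<Longrightarrow> cmod (w1 p x m \<epsilon>) \<le> K1 / E_weight \<beta> \<mu> m"
    using w1_disc by metis
  define P where "P s g = (of_real (q powr s) * g :: complex)" for s g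
  have P_le: "cmod (P s x) \<le> cmod x" if "s \<le> 0" for s x
  proof -
    have "q powr s \<le> q powr 0" using that q by (intro powr_mono) auto
    then show ?thesis using q by (simp add: P_def norm_mult mult_left_le_one_le)
  qed
  have conv: "\<exists>G\<ge>0. \<forall>x. cmod x < \<rho> \<longrightarrow> cmod (rconv (R j) (\<lambda>m'. C l j m' \<epsilon>) (\<lambda>m. w1 p x m \<epsilon>) m - rconv (R j) (\<lambda>m'. C l j m' \<epsilon>) (\<lambda>m. w1 0 x m \<epsilon>) m)
      \<le> G * cmod x ^ n" if j: "j \<in> {1..D-1}" "l \<in> I j" for j l
  proof -
    have deg: "\<mu> \<ge> real (degree (R j))" using mu deg_R[OF j(1)] by linarith
    obtain K where K: "K > 0"
      "\<And>h w w' A B m M. continuous_on UNIV h \<Longrightarrow> (\<And>x. cmod (h x) \<le> A) \<Longrightarrow> w \<in> borel_measurable borel \<Longrightarrow> w' \<in> borel_measurable borel \<Longrightarrow>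
      (\<And>x. cmod (w x) \<le> M / E_weight \<beta> \<mu> x) \<Longrightarrow> (\<And>x. cmod (w' x) \<le> M / E_weight \<beta> \<mu> x) \<Longrightarrow>
      (\<And>x. cmod (w x - w' x) \<le> B / E_weight \<beta> \<mu> x) \<Longrightarrow> cmod (rconv (R j) h w m - rconv (R j) h w' m) \<le> A * B * K"
    proof (rule rconv_diff_bound[OF beta deg], goal_cases)
      case (1 K)
      show thesis by (rule 1(1)[OF 1(2,3)])
    qed
    have CE: "(\<lambda>m. C l j m \<epsilon>) \<in> E_space \<beta> \<mu>" using C_holo[OF j] e by (simp add: holo_into_def)
    have Cb: "cmod (C l j m \<epsilon>) \<le> C' l j" for m
    proof -
      have 1: "E_weight \<beta> \<mu> m * cmod (C l j m \<epsilon>) \<le> C' l j"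
        by (rule wnorm_bound[of UNIV "E_weight \<beta> \<mu>" "\<lambda>m. C l j m \<epsilon>"])
           (use CE C_bound[OF j e] in \<open>auto simp: E_space_def E_norm_def\<close>)
      have "1 \<le> exp (\<beta> * \<bar>m\<bar>)" using beta by simp
      then have "1 \<le> E_weight \<beta> \<mu> m" using E_weight_ge_exp[OF mu_nonneg, of \<beta> m] by linarith
      then have "1 * cmod (C l j m \<epsilon>) \<le> E_weight \<beta> \<mu> m * cmod (C l j m \<epsilon>)" by (intro mult_right_mono) auto
      then show ?thesis using 1 by simp
    qed
    have Cc: "continuous_on UNIV (\<lambda>m. C l j m \<epsilon>)" using CE by (simp add: E_space_def)
    have C0: "C' l j \<ge> 0" using Cb[of 0] norm_ge_zero order_trans by blast
    have "cmod (rconv (R j) (\<lambda>m'. C l j m' \<epsilon>) (\<lambda>m. w1 p x m \<epsilon>) m - rconv (R j) (\<lambda>m'. C l j m' \<epsilon>) (\<lambda>m. w1 0 x m \<epsilon>) m)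
      \<le> C' l j * (B * cmod x ^ n) * K" if x: "cmod x < \<rho>" for x
      by (rule K(2)[OF Cc Cb w1_measurable[OF p e] w1_measurable[OF nE e] K1(2)[OF p e] K1(2)[OF nE e] hyp[OF x]]) (use x in auto)
    then show ?thesis using C0 K(1) B0
      by (intro exI[of _ "C' l j * B * K"]) (auto simp: mult_ac)
  qed
  define cv where "cv j l = (SOME G. G \<ge> 0 \<and> (\<forall>x. cmod x < \<rho> \<longrightarrow> cmod (rconv (R j) (\<lambda>m'. C l j m' \<epsilon>) (\<lambda>m. w1 p x m \<epsilon>) m - rconv (R j) (\<lambda>m'. C l j m' \<epsilon>) (\<lambda>m. w1 0 x m \<epsilon>) m)
      \<le> G * cmod x ^ n))" for j l
  have cv: "cv j l \<ge> 0" "\<And>x. cmod x < \<rho> \<Longrightarrow> cmod (rconv (R j) (\<lambda>m'. C l j m' \<epsilon>) (\<lambda>m. w1 p x m \<epsilon>) m - rconv (R j) (\<lambda>m'. C l j m' \<epsilon>) (\<lambda>m. w1 0 x m \<epsilon>) m)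
      \<le> cv j l * cmod x ^ n" if "j \<in> {1..D-1}" "l \<in> I j" for j l
    using someI_ex[OF conv[OF that, unfolded Bex_def]] unfolding cv_def by auto
  define Qm where "Qm = poly Q (\<i> * of_real m)"
  define RDm where "RDm = poly (R D) (\<i> * of_real m)"
  define c0 where "c0 = cq q (real k1) k1"
  have cq_pos: "cq q k n > 0" for k n using q by (simp add: cq_def)
  define KR where "KR = \<rho> ^ (d\<^sub>D - 1) / cq q (real k1) (d\<^sub>D + k1) * (cmod RDm * (B / E_weight \<beta> \<mu> m))"
  define KS where "KS = (\<Sum>j=1..D-1. \<Sum>l\<in>I j. cmod \<epsilon> ^ (\<Delta> l j - d l j) * \<rho> ^ (d l j - 1) / cq q (real k1) (d l j + k1) * (1 / sqrt (2 * pi) * cv j l))"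
  have main: "cmod (w1 p x m \<epsilon> - w1 0 x m \<epsilon>) \<le> (c0 / cmod Qm * (KR + KS)) * cmod x ^ Suc n" if x: "cmod x < \<rho>" "x \<noteq> 0" for x
  proof -
    define v where "v y = w1 p y m \<epsilon> - w1 0 y m \<epsilon>" for y
    let ?s = "\<lambda>j l. real (\<delta> j) - real (d l j) / real k1 - 1"
    let ?rc = "\<lambda>p' j l. rconv (R j) (\<lambda>m'. C l j m' \<epsilon>) (\<lambda>m. w1 p' (P (?s j l) x) m \<epsilon>) m"
    \<comment> \<open>Near 0 the forcing terms are sums of the same power series, so they cancel in
      the difference of the two equations.\<close>
    have psi: "\<psi>1 p x m \<epsilon> = \<psi>1 0 x m \<epsilon>"
      using psi1_series[OF p _ e, of x m] psi1_series[OF nE _ e, of x m] x sums_unique2 by (metis mem_ball_0)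
    have eq: "Qm * (x ^ k1 / of_real c0) * w1 p' x m \<epsilon> =
        x ^ (d\<^sub>D + k1) / of_real (cq q (real k1) (d\<^sub>D + k1)) * (RDm * w1 p' (P (- (real d\<^sub>D / \<kappa>)) x) m \<epsilon>)
        + (\<Sum>j=1..D-1. \<Sum>l\<in>I j. \<epsilon> ^ (\<Delta> l j - d l j) * x ^ (d l j + k1) / of_real (cq q (real k1) (d l j + k1)) * (of_real (1 / sqrt (2 * pi)) * ?rc p' j l))
        + x ^ k1 / of_real c0 * \<psi>1 p' x m \<epsilon>" if p': "p' < n\<^sub>E" for p'
      using w1_sol[OF p' e] x unfolding aux_equation_def sigma_q_def Qm_def RDm_def c0_def P_def by auto
    have diff: "Qm * (x ^ k1 / of_real c0) * v x =
        x ^ (d\<^sub>D + k1) / of_real (cq q (real k1) (d\<^sub>D + k1)) * (RDm * v (P (- (real d\<^sub>D / \<kappa>)) x))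
        + (\<Sum>j=1..D-1. \<Sum>l\<in>I j. \<epsilon> ^ (\<Delta> l j - d l j) * x ^ (d l j + k1) / of_real (cq q (real k1) (d l j + k1)) * (of_real (1 / sqrt (2 * pi)) * (?rc p j l - ?rc 0 j l)))"
      using eq[OF p] eq[OF nE] psi
      by (simp add: v_def right_diff_distrib sum_subtractf)
    \<comment> \<open>Because a >= 1, one factor |x| beyond |x|^k1 can be kept, and the others are
      bounded by powers of \<rho>.\<close>
    have xk: "cmod x ^ (a + k1) \<le> \<rho> ^ (a - 1) * cmod x ^ Suc k1" if "a \<ge> 1" for a
    proof -
      have "a + k1 = (a - 1) + Suc k1" using that by simp
      then have "cmod x ^ (a + k1) = cmod x ^ (a - 1) * cmod x ^ Suc k1" by (simp only: power_add)
      also have "\<dots> \<le> \<rho> ^ (a - 1) * cmod x ^ Suc k1" using x by (intro mult_right_mono power_mono) auto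
      finally show ?thesis .
    qed
    have t1: "cmod (x ^ (d\<^sub>D + k1) / of_real (cq q (real k1) (d\<^sub>D + k1)) * (RDm * v (P (- (real d\<^sub>D / \<kappa>)) x))) \<le> KR * cmod x ^ Suc n * cmod x ^ k1"
    proof -
      have s: "- (real d\<^sub>D / \<kappa>) \<le> 0" using kappa_pos by simp
      let ?y = "P (- (real d\<^sub>D / \<kappa>)) x"
      have "cmod (v ?y) \<le> B * cmod ?y ^ n / E_weight \<beta> \<mu> m"
        unfolding v_def using P_le[OF s, of x] x by (intro hyp) auto
      also have "\<dots> \<le> B * cmod x ^ n / E_weight \<beta> \<mu> m"
        using P_le[OF s, of x] B0 by (intro divide_right_mono mult_left_mono power_mono) (auto intro: less_imp_le)
      finally have v: "cmod (v ?y) \<le> B / E_weight \<beta> \<mu> m * cmod x ^ n" by simp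
      have "cmod (x ^ (d\<^sub>D + k1) / of_real (cq q (real k1) (d\<^sub>D + k1)) * (RDm * v ?y))
        = cmod x ^ (d\<^sub>D + k1) / cq q (real k1) (d\<^sub>D + k1) * (cmod RDm * cmod (v ?y))"
        using cq_pos[of "real k1" "d\<^sub>D + k1"] by (simp add: norm_mult norm_divide norm_power)
      also have "\<dots> \<le> (\<rho> ^ (d\<^sub>D - 1) * cmod x ^ Suc k1) / cq q (real k1) (d\<^sub>D + k1) * (cmod RDm * (B / E_weight \<beta> \<mu> m * cmod x ^ n))"
        by (intro mult_mono divide_right_mono mult_left_mono v xk dD)
           (use cq_pos rho x in \<open>auto intro!: mult_nonneg_nonneg divide_nonneg_nonneg less_imp_le\<close>)
      also have "\<dots> = KR * cmod x ^ Suc n * cmod x ^ k1" by (simp add: KR_def)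
      finally show ?thesis .
    qed
    have t2: "cmod (\<Sum>j=1..D-1. \<Sum>l\<in>I j. \<epsilon> ^ (\<Delta> l j - d l j) * x ^ (d l j + k1) / of_real (cq q (real k1) (d l j + k1)) * (of_real (1 / sqrt (2 * pi)) * (?rc p j l - ?rc 0 j l)))
      \<le> KS * cmod x ^ Suc n * cmod x ^ k1"
    proof -
      have "cmod (\<Sum>j=1..D-1. \<Sum>l\<in>I j. \<epsilon> ^ (\<Delta> l j - d l j) * x ^ (d l j + k1) / of_real (cq q (real k1) (d l j + k1)) * (of_real (1 / sqrt (2 * pi)) * (?rc p j l - ?rc 0 j l)))
        \<le> (\<Sum>j=1..D-1. \<Sum>l\<in>I j. (cmod \<epsilon> ^ (\<Delta> l j - d l j) * \<rho> ^ (d l j - 1) / cq q (real k1) (d l j + k1) * (1 / sqrt (2 * pi) * cv j l)) * (cmod x ^ Suc n * cmod x ^ k1))"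
      proof (rule order_trans[OF norm_sum sum_mono], rule order_trans[OF norm_sum sum_mono])
        fix j l assume j: "j \<in> {1..D-1}" "l \<in> I j"
        note s = dilation_exponent[OF j]
        have "cmod (?rc p j l - ?rc 0 j l) \<le> cv j l * cmod (P (?s j l) x) ^ n"
          using P_le[OF s, of x] x by (intro cv(2)[OF j]) auto
        also have "\<dots> \<le> cv j l * cmod x ^ n"
          using P_le[OF s, of x] cv(1)[OF j] by (intro mult_left_mono power_mono) auto
        finally have r: "cmod (?rc p j l - ?rc 0 j l) \<le> cv j l * cmod x ^ n" .
        have "cmod (\<epsilon> ^ (\<Delta> l j - d l j) * x ^ (d l j + k1) / of_real (cq q (real k1) (d l j + k1)) * (of_real (1 / sqrt (2 * pi)) * (?rc p j l - ?rc 0 j l)))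
          = cmod \<epsilon> ^ (\<Delta> l j - d l j) * cmod x ^ (d l j + k1) / cq q (real k1) (d l j + k1) * (1 / sqrt (2 * pi) * cmod (?rc p j l - ?rc 0 j l))"
          using cq_pos[of "real k1" "d l j + k1"] by (simp add: norm_mult norm_divide norm_power)
        also have "\<dots> \<le> cmod \<epsilon> ^ (\<Delta> l j - d l j) * (\<rho> ^ (d l j - 1) * cmod x ^ Suc k1) / cq q (real k1) (d l j + k1) * (1 / sqrt (2 * pi) * (cv j l * cmod x ^ n))"
          by (intro mult_mono divide_right_mono mult_left_mono r xk d[OF j])
             (use less_imp_le[OF cq_pos] less_imp_le[OF rho] x in \<open>auto intro!: mult_nonneg_nonneg divide_nonneg_nonneg\<close>)
        also have "\<dots> = (cmod \<epsilon> ^ (\<Delta> l j - d l j) * \<rho> ^ (d l j - 1) / cq q (real k1) (d l j + k1) * (1 / sqrt (2 * pi) * cv j l)) * (cmod x ^ Suc n * cmod x ^ k1)"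
          by simp
        finally show "cmod (\<epsilon> ^ (\<Delta> l j - d l j) * x ^ (d l j + k1) / of_real (cq q (real k1) (d l j + k1)) * (of_real (1 / sqrt (2 * pi)) * (?rc p j l - ?rc 0 j l)))
          \<le> (cmod \<epsilon> ^ (\<Delta> l j - d l j) * \<rho> ^ (d l j - 1) / cq q (real k1) (d l j + k1) * (1 / sqrt (2 * pi) * cv j l)) * (cmod x ^ Suc n * cmod x ^ k1)" .
      qed
      also have "\<dots> = KS * (cmod x ^ Suc n * cmod x ^ k1)" unfolding KS_def by (simp only: sum_distrib_right)
      finally show ?thesis by (simp only: mult.assoc)
    qed
    have "cmod (Qm * (x ^ k1 / of_real c0) * v x) \<le> (KR + KS) * cmod x ^ Suc n * cmod x ^ k1"
      unfolding diff using t1 t2 by (intro order_trans[OF norm_triangle_ineq]) (simp only: distrib_right add_mono)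
    moreover have "cmod (Qm * (x ^ k1 / of_real c0) * v x) = (cmod Qm / c0 * cmod (v x)) * cmod x ^ k1"
      using cq_pos[of "real k1" k1] by (simp add: c0_def norm_mult norm_divide norm_power)
    moreover have "cmod x ^ k1 > 0" using x by simp
    ultimately have le: "cmod Qm / c0 * cmod (v x) \<le> (KR + KS) * cmod x ^ Suc n" by (metis mult_le_cancel_right_pos)
    have Qp: "cmod Qm > 0" "c0 > 0" using Q_nz cq_pos by (auto simp: Qm_def c0_def)
    have "cmod (v x) = c0 / cmod Qm * (cmod Qm / c0 * cmod (v x))" using Qp by simp
    also have "\<dots> \<le> c0 / cmod Qm * ((KR + KS) * cmod x ^ Suc n)"
      using Qp by (intro mult_left_mono le) auto
    finally show ?thesis by (simp add: v_def mult.assoc)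
  qed
  show ?thesis by (rule that[OF main])
qed

end

text \<open>At \<tau> = 0 the auxiliary equation is void, since all its terms carry a power of
  \<tau>; the value there has to come from continuity.\<close>

lemma zero_of_positive_order:
  fixes f :: "complex \<Rightarrow> complex"
  assumes "isCont f 0" "r > 0" "\<And>x. cmod x < r \<Longrightarrow> x \<noteq> 0 \<Longrightarrow> cmod (f x) \<le> K * cmod x ^ Suc n"
  shows "f 0 = 0"
proof -
  have "((\<lambda>x. cmod (f x)) \<longlongrightarrow> cmod (f 0)) (at 0)"
    using assms(1) by (intro tendsto_norm) (simp add: isCont_def)
  moreover have "((\<lambda>x::complex. K * cmod x ^ Suc n) \<longlongrightarrow> K * cmod 0 ^ Suc n) (at 0)"
    by (intro tendsto_intros)
  moreover have "eventually (\<lambda>x. cmod (f x) \<le> K * cmod x ^ Suc n) (at 0)"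
    unfolding eventually_at using assms(2,3) by (intro exI[of _ r]) auto
  ultimately have "cmod (f 0) \<le> K * cmod (0::complex) ^ Suc n"
    by (intro tendsto_le[of "at (0::complex)"]) auto
  then show ?thesis by simp
qed

context q_solutions
begin

text \<open>\<open>w1_difference_order\<close> gains a power of x but loses uniformity in m. The
  gain is therefore only used to annihilate the next Taylor coefficient; the weighted estimate of
  the next order then comes back from \<open>taylor_remainder\<close> and the initial weighted
  bound.\<close>

lemma w1_agree:
  assumes p: "p < n\<^sub>E" and e: "\<epsilon> \<in> ball 0 \<epsilon>\<^sub>0" and x: "cmod x < \<rho>"
  shows "w1 p x m \<epsilon> = w1 0 x m \<epsilon>"
proof -
  define v where "v x m = w1 p x m \<epsilon> - w1 0 x m \<epsilon>" for x m
  obtain K1 where K1: "K1 > 0" "\<And>p \<epsilon> x m. p < n\<^sub>E \<Longrightarrow> \<epsilon> \<in> ball 0 \<epsilon>\<^sub>0 \<Longrightarrow> x \<in> cball 0 \<rho> \<Longrightarrow> cmod (w1 p x m \<epsilon>) \<le> K1 / E_weight \<beta> \<mu> m"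
    using w1_disc by metis
  have holo: "(\<lambda>x. v x m) holomorphic_on ball 0 \<rho>" for m
    unfolding v_def
    by (intro holomorphic_on_diff holomorphic_on_subset[OF w1_holo_tau[OF p e]] holomorphic_on_subset[OF w1_holo_tau[OF nE e]]) auto
  have bd: "cmod (v x m) \<le> 2 * K1 / E_weight \<beta> \<mu> m" if "x \<in> ball 0 \<rho>" for x m
  proof -
    have "cmod (v x m) \<le> cmod (w1 p x m \<epsilon>) + cmod (w1 0 x m \<epsilon>)" unfolding v_def by (rule norm_triangle_ineq4)
    also have "\<dots> \<le> K1 / E_weight \<beta> \<mu> m + K1 / E_weight \<beta> \<mu> m"
      using that by (intro add_mono K1(2) p nE e) auto
    finally show ?thesis by simp
  qed
  have order: "\<exists>B\<ge>0. \<forall>x m. cmod x < \<rho> \<longrightarrow> cmod (v x m) \<le> B * cmod x ^ n / E_weight \<beta> \<mu> m"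
    and coeff: "\<And>j m. j < n \<Longrightarrow> taylor_coeff (\<lambda>x. v x m) j = 0" for n
  proof (induction n)
    case 0
    show "\<exists>B\<ge>0. \<forall>x m. cmod x < \<rho> \<longrightarrow> cmod (v x m) \<le> B * cmod x ^ 0 / E_weight \<beta> \<mu> m"
      using bd K1(1) by (intro exI[of _ "2 * K1"]) auto
    show "taylor_coeff (\<lambda>x. v x m) j = 0" if "j < 0" for j m using that by simp
  next
    case (Suc n)
    obtain B where B: "B \<ge> 0" "\<And>x m. cmod x < \<rho> \<Longrightarrow> cmod (v x m) \<le> B * cmod x ^ n / E_weight \<beta> \<mu> m" using Suc(1) by blast
    have z: "taylor_coeff (\<lambda>x. v x m) j = 0" if j: "j < Suc n" for j m
    proof -
      obtain K where K: "\<And>x. cmod x < \<rho> \<Longrightarrow> x \<noteq> 0 \<Longrightarrow> cmod (v x m) \<le> K * cmod x ^ Suc n"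
        unfolding v_def by (rule w1_difference_order[OF p e B(1), of n m]) (use B(2) in \<open>auto simp: v_def\<close>)
      have "isCont (\<lambda>x. v x m) 0"
        using holomorphic_on_imp_continuous_on[OF holo[of m]] rho continuous_on_interior[of "ball 0 \<rho>" _ 0] by auto
      from zero_of_positive_order[OF this rho K] have "v 0 m = 0" .
      then have "cmod (v x m) \<le> K * cmod x ^ Suc n" if "x \<in> ball 0 \<rho>" for x
        using K[of x] that by (cases "x = 0") auto
      from taylor_coeff_zero_of_order[OF holo rho this j] show ?thesis .
    qed
    then show "taylor_coeff (\<lambda>x. v x m) j = 0" if "j < Suc n" for j m using that .
    show "\<exists>B\<ge>0. \<forall>x m. cmod x < \<rho> \<longrightarrow> cmod (v x m) \<le> B * cmod x ^ Suc n / E_weight \<beta> \<mu> m"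
    \<comment> \<open>The factor 6 is 3 from \<open>taylor_remainder\<close> times 2 from the bound
      for the difference of two solutions.\<close>
    proof (intro exI[of _ "6 * K1 * (2 / \<rho>) ^ Suc n"] conjI allI impI)
      show "0 \<le> 6 * K1 * (2 / \<rho>) ^ Suc n" using K1 rho by simp
      fix x m assume x: "cmod x < \<rho>"
      have "cmod (v x m - (\<Sum>j<Suc n. taylor_coeff (\<lambda>x. v x m) j * x ^ j)) \<le> 3 * (2 * K1 / E_weight \<beta> \<mu> m) * (2 * cmod x / \<rho>) ^ Suc n"
        by (rule taylor_remainder[OF holo rho bd x])
      moreover have "(\<Sum>j<Suc n. taylor_coeff (\<lambda>x. v x m) j * x ^ j) = 0"
        by (intro sum.neutral ballI) (simp add: z)
      moreover have "(2 * cmod x / \<rho>) ^ Suc n = (2 / \<rho>) ^ Suc n * cmod x ^ Suc n"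
        by (simp add: power_mult_distrib power_divide)
      ultimately have "cmod (v x m) \<le> 3 * (2 * K1 / E_weight \<beta> \<mu> m) * ((2 / \<rho>) ^ Suc n * cmod x ^ Suc n)"
        by (simp only: diff_zero)
      then show "cmod (v x m) \<le> 6 * K1 * (2 / \<rho>) ^ Suc n * cmod x ^ Suc n / E_weight \<beta> \<mu> m"
        by (simp add: mult_ac)
    qed
  qed
  have "taylor_coeff (\<lambda>x. v x m) n = 0" for n using coeff[of n "Suc n"] by simp
  then have "(\<lambda>n. 0) sums v x m" using taylor_coeff_sums[OF holo x, of m] by simp
  then have "v x m = 0" using sums_zero sums_unique2 by blast
  then show ?thesis by (simp add: v_def)
qed

text \<open>Taken from the solution with index 0; by \<open>w1_agree\<close> these are the
  coefficients for every p.\<close>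

definition wco :: "nat \<Rightarrow> real \<Rightarrow> complex \<Rightarrow> complex" where
  "wco n m \<epsilon> = taylor_coeff (\<lambda>x. w1 0 x m \<epsilon>) n"

text \<open>The coefficients of \<open>w2 p\<close> expected from a termwise q-Laplace transform of
  order \<kappa>.\<close>

definition w2co :: "nat \<Rightarrow> real \<Rightarrow> complex \<Rightarrow> complex" where
  "w2co n m \<epsilon> = of_real (1 / pi_q q \<kappa>) * (wco n m \<epsilon> * theta_moment lak n)"

lemma w1_0_holo: "\<epsilon> \<in> ball 0 \<epsilon>\<^sub>0 \<Longrightarrow> (\<lambda>x. w1 0 x m \<epsilon>) holomorphic_on ball 0 \<rho>"
  by (rule holomorphic_on_subset[OF w1_holo_tau[OF nE]]) auto

lemma ray_in_sector:
  assumes "is_unbounded_sector dr V" "r > 0"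
  shows "of_real r * cis dr \<in> V"
proof -
  obtain a where a: "a > 0" and V: "V = {of_real s * cis \<theta> | s \<theta>. 0 < s \<and> \<bar>\<theta> - dr\<bar> < a}"
    using assms(1) unfolding is_unbounded_sector_def by blast
  show ?thesis unfolding V
    by (rule CollectI, rule exI[of _ r], rule exI[of _ dr]) (use a assms in auto)
qed

lemma Rb_polar:
  obtains \<eta> where "0 < \<eta>" "\<eta> < pi"
    "\<And>p x. x \<in> Rb p \<Longrightarrow> \<exists>\<phi>. x = of_real (cmod x) * cis (dir p - \<phi>) \<and> \<bar>\<phi>\<bar> \<le> pi - \<eta> \<and> 0 < cmod x \<and> cmod x < \<epsilon>\<^sub>0 * r\<^sub>T"
proof -
  obtain \<eta> where \<eta>: "0 < \<eta>" "\<eta> < pi"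
    "\<And>d T. T \<in> R_dom d \<delta>\<^sub>1 \<Longrightarrow> \<exists>\<phi>. T = of_real (cmod T) * cis (d - \<phi>) \<and> \<bar>\<phi>\<bar> \<le> pi - \<eta>"
    using R_dom_polar[OF delta1 delta1_less] by metis
  show ?thesis
  proof (rule that[OF \<eta>(1,2)])
    fix p x assume "x \<in> Rb p"
    then have "x \<in> R_dom (dir p) \<delta>\<^sub>1" "cmod x < \<epsilon>\<^sub>0 * r\<^sub>T" "x \<noteq> 0"
      by (auto simp: Rb_eq Rb_dom_def R_dom_def)
    then show "\<exists>\<phi>. x = of_real (cmod x) * cis (dir p - \<phi>) \<and> \<bar>\<phi>\<bar> \<le> pi - \<eta> \<and> 0 < cmod x \<and> cmod x < \<epsilon>\<^sub>0 * r\<^sub>T"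
      using \<eta>(3) by fastforce
  qed
qed

text \<open>On the bisecting ray the number inside the modulus is 1 + s/r, which is at least 1 and
  hence exceeds \<open>\<delta>\<^sub>1\<close>.\<close>

lemma ray_in_Rb:
  assumes "0 < r" "r < \<epsilon>\<^sub>0 * r\<^sub>T"
  shows "of_real r * cis (dir p) \<in> Rb p"
proof -
  have "cmod (1 + cis (dir p) * of_real s / (of_real r * cis (dir p))) > \<delta>\<^sub>1" if "s \<ge> 0" for s
  proof -
    have "1 + cis (dir p) * of_real s / (of_real r * cis (dir p)) = of_real (1 + s / r)" using assms by simp
    then have "cmod (1 + cis (dir p) * of_real s / (of_real r * cis (dir p))) = \<bar>1 + s / r\<bar>" by (simp only: norm_of_real)
    moreover have "s / r \<ge> 0" using that assms by simp
    ultimately show ?thesis using delta1_less by simp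
  qed
  then show ?thesis using assms by (simp add: Rb_eq Rb_dom_def R_dom_def norm_mult)
qed

text \<open>The first transform: \<open>w1 p\<close> has a convergent Taylor series at 0, so
  \<open>sg = 0\<close>, and the result grows at the rate \<open>lak\<close>. Assumption
  \<open>alpha_small\<close> is the tail condition at
  \<open>R1 = \<epsilon>\<^sub>0 * r\<^sub>T\<close>.\<close>

lemma w2_expansion:
  assumes p: "p < n\<^sub>E"
  shows "\<exists>M B. M \<ge> 0 \<and> B > 0 \<and> (\<forall>\<epsilon>\<in>ball 0 \<epsilon>\<^sub>0. \<forall>m. \<forall>x\<in>Rb p. \<forall>N.
     cmod (w2 p x m \<epsilon> - (\<Sum>n<N. w2co n m \<epsilon> * x ^ n)) \<le> M / E_weight \<beta> \<mu> m * B ^ N * exp (lak * (real N)\<^sup>2 / 2) * cmod x ^ N)"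
proof -
  obtain \<eta> where \<eta>: "0 < \<eta>" "\<eta> < pi"
    "\<And>p x. x \<in> Rb p \<Longrightarrow> \<exists>\<phi>. x = of_real (cmod x) * cis (dir p - \<phi>) \<and> \<bar>\<phi>\<bar> \<le> pi - \<eta> \<and> 0 < cmod x \<and> cmod x < \<epsilon>\<^sub>0 * r\<^sub>T"
    using Rb_polar by metis
  obtain K1 where K1: "K1 > 0" "\<And>p \<epsilon> x m. p < n\<^sub>E \<Longrightarrow> \<epsilon> \<in> ball 0 \<epsilon>\<^sub>0 \<Longrightarrow> x \<in> cball 0 \<rho> \<Longrightarrow> cmod (w1 p x m \<epsilon>) \<le> K1 / E_weight \<beta> \<mu> m"
    using w1_disc by metis
  define R0 where "R0 = min 1 \<rho>"
  have R0: "0 < R0" "R0 \<le> 1" "R0 \<le> \<rho>" using rho by (auto simp: R0_def)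
  have rayU: "of_real r * cis (dir p) \<in> U p" if "r > 0" for r using ray_in_sector[OF U[OF p] that] .
  have nz: "of_real r * cis (dir p) + of_real \<delta>\<^sub>0 \<noteq> 0" if "r \<ge> R0" for r
    using delta0_shift_nonzero[OF p] rayU[of r] R0 that by auto
  obtain Cw where Cw: "Cw > 0" "\<And>r. r \<ge> R0 \<Longrightarrow>
    exp ((ln (cmod (of_real r * cis (dir p) + of_real \<delta>\<^sub>0)))\<^sup>2 / (2 * lak) + \<alpha> * ln (cmod (of_real r * cis (dir p) + of_real \<delta>\<^sub>0)))
      \<le> Cw * exp ((ln r)\<^sup>2 / (2 * lak) + \<alpha> * ln r)"
    using shifted_weight_ray[OF la_pos(3) R0(1) nz, where \<alpha> = \<alpha>] by metis
  \<comment> \<open>The first entry covers the Taylor remainder on the disc, the second the weighted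
    norm along the ray after the shift has been removed from the weight.\<close>
  define Mc where "Mc = max (3 * K1) (W * Cw)"
  have Mc: "Mc \<ge> 3 * K1" "Mc \<ge> W * Cw" "Mc > 0" using K1 by (auto simp: Mc_def)
  have R1: "\<alpha> + ln (\<epsilon>\<^sub>0 * r\<^sub>T) / lak \<le> 0"
    using alpha_small ln_q_pos kappa_pos by (simp add: lak_def mult.commute)
  have A: "2 / \<rho> > 0" using rho by simp
  show ?thesis
  proof (rule theta_transform_expansion[OF la_pos(3) \<eta>(1,2) R0(1,2) R1 A order_refl], goal_cases)
    case (1 K B)
    show ?case
    proof (rule exI[of _ "\<bar>1 / pi_q q \<kappa>\<bar> * (Mc * K)"], rule exI[of _ B], intro conjI ballI allI)
      show "0 \<le> \<bar>1 / pi_q q \<kappa>\<bar> * (Mc * K)" using Mc 1 by simp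
      show "B > 0" by (rule 1)
      fix \<epsilon> x :: complex and m N assume e: "\<epsilon> \<in> ball 0 \<epsilon>\<^sub>0" and x: "x \<in> Rb p"
      let ?Mm = "Mc / E_weight \<beta> \<mu> m"
      have MM: "K1 / E_weight \<beta> \<mu> m \<le> ?Mm" "3 * K1 / E_weight \<beta> \<mu> m \<le> ?Mm" "W * Cw / E_weight \<beta> \<mu> m \<le> ?Mm"
        using Mc K1 by (auto intro!: divide_right_mono less_imp_le[OF E_weight_pos])
      obtain \<phi> where \<phi>: "x = of_real (cmod x) * cis (dir p - \<phi>)" "\<bar>\<phi>\<bar> \<le> pi - \<eta>" "0 < cmod x" "cmod x < \<epsilon>\<^sub>0 * r\<^sub>T"
        using \<eta>(3)[OF x] by blast
      have K1': "cmod (w1 0 y m \<epsilon>) \<le> K1 / E_weight \<beta> \<mu> m" if "y \<in> ball 0 \<rho>" for y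
        using that by (intro K1(2) nE e) auto
      have "cmod ((LINT r:{0<..}|lborel. w1 p (of_real r * cis (dir p)) m \<epsilon> / Theta (exp (- lak)) (of_real r * cis (dir p) / (of_real (cmod x) * cis (dir p - \<phi>))) / of_real r)
         - (\<Sum>n<N. wco n m \<epsilon> * theta_moment lak n * (of_real (cmod x) * cis (dir p - \<phi>)) ^ n))
         \<le> ?Mm * K * B ^ N * exp ((0 + lak) * (real N)\<^sup>2 / 2) * cmod x ^ N"
      proof (rule 1(3)[where g = "\<lambda>y. w1 p y m \<epsilon>" and b = "\<lambda>n. wco n m \<epsilon>" and dr = "dir p"])
        show "0 \<le> ?Mm" using Mc by (intro divide_nonneg_nonneg less_imp_le[OF E_weight_pos]) auto
        have c: "continuous_on {0<..} (\<lambda>r::real. (of_real r * cis (dir p), m))" by (intro continuous_intros)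
        have "(\<lambda>r::real. (of_real r * cis (dir p), m)) ` {0<..} \<subseteq> (U p \<union> cball 0 \<rho>) \<times> UNIV" using rayU by auto
        from continuous_on_compose2[OF w1_continuous[OF p e] c this]
        show "continuous_on {0<..} (\<lambda>r. w1 p (of_real r * cis (dir p)) m \<epsilon>)" by simp
        show "cmod (wco n m \<epsilon>) \<le> ?Mm * (2 / \<rho>) ^ n * exp (0 * (real n)\<^sup>2 / 2)" for n
        proof -
          have "cmod (wco n m \<epsilon>) \<le> K1 / E_weight \<beta> \<mu> m / \<rho> ^ n"
            unfolding wco_def by (rule taylor_coeff_bound[OF w1_0_holo[OF e] rho K1'])
          also have "\<dots> = K1 / E_weight \<beta> \<mu> m * (1 / \<rho>) ^ n" by (simp add: power_divide)
          also have "\<dots> \<le> ?Mm * (2 / \<rho>) ^ n"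
            using MM(1) rho Mc by (intro mult_mono power_mono divide_right_mono divide_nonneg_nonneg less_imp_le[OF E_weight_pos]) auto
          finally show ?thesis by simp
        qed
        show "cmod (w1 p (of_real r * cis (dir p)) m \<epsilon> - (\<Sum>n<N. wco n m \<epsilon> * (of_real r * cis (dir p)) ^ n))
           \<le> ?Mm * (2 / \<rho>) ^ N * exp (0 * (real N)\<^sup>2 / 2) * r ^ N" if r: "0 < r" "r < R0" for r N
        proof -
          let ?y = "of_real r * cis (dir p)"
          have ny: "cmod ?y = r" using r by (simp add: norm_mult)
          have y: "cmod ?y < \<rho>" using ny r R0 by linarith
          have "cmod (w1 0 ?y m \<epsilon> - (\<Sum>n<N. wco n m \<epsilon> * ?y ^ n)) \<le> 3 * (K1 / E_weight \<beta> \<mu> m) * (2 * cmod ?y / \<rho>) ^ N"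
            unfolding wco_def by (rule taylor_remainder[OF w1_0_holo[OF e] rho K1' y])
          also have "\<dots> = 3 * K1 / E_weight \<beta> \<mu> m * ((2 / \<rho>) ^ N * r ^ N)"
            unfolding ny by (simp add: power_mult_distrib power_divide)
          also have "\<dots> \<le> ?Mm * ((2 / \<rho>) ^ N * r ^ N)"
            using MM(2) rho r by (intro mult_right_mono) auto
          finally show ?thesis using w1_agree[OF p e y] by simp
        qed
        show "cmod (w1 p (of_real r * cis (dir p)) m \<epsilon>) \<le> ?Mm * exp ((ln r)\<^sup>2 / (2 * lak) + \<alpha> * ln r)" if r: "r \<ge> R0" for r
        proof -
          have r0: "r > 0" using r R0 by linarith
          have "cmod (w1 p (of_real r * cis (dir p)) m \<epsilon>) \<le> W / E_weight \<beta> \<mu> m *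
             exp ((ln (cmod (of_real r * cis (dir p) + of_real \<delta>\<^sub>0)))\<^sup>2 / (2 * lak) + \<alpha> * ln (cmod (of_real r * cis (dir p) + of_real \<delta>\<^sub>0)))"
            by (rule w1_weighted[OF p e]) (use rayU[OF r0] in blast)
          also have "\<dots> \<le> W / E_weight \<beta> \<mu> m * (Cw * exp ((ln r)\<^sup>2 / (2 * lak) + \<alpha> * ln r))"
            using W by (intro mult_left_mono Cw(2)[OF r] divide_nonneg_nonneg less_imp_le[OF E_weight_pos]) auto
          also have "\<dots> = W * Cw / E_weight \<beta> \<mu> m * exp ((ln r)\<^sup>2 / (2 * lak) + \<alpha> * ln r)" by simp
          also have "\<dots> \<le> ?Mm * exp ((ln r)\<^sup>2 / (2 * lak) + \<alpha> * ln r)" by (intro mult_right_mono MM) auto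
          finally show ?thesis .
        qed
      qed (use \<phi> in auto)
      then have main: "cmod ((LINT r:{0<..}|lborel. w1 p (of_real r * cis (dir p)) m \<epsilon> / Theta (exp (- lak)) (of_real r * cis (dir p) / x) / of_real r)
         - (\<Sum>n<N. wco n m \<epsilon> * theta_moment lak n * x ^ n)) \<le> ?Mm * K * B ^ N * exp (lak * (real N)\<^sup>2 / 2) * cmod x ^ N"
        unfolding \<phi>(1)[symmetric] by simp
      have "w2 p x m \<epsilon> - (\<Sum>n<N. w2co n m \<epsilon> * x ^ n) = of_real (1 / pi_q q \<kappa>) *
        ((LINT r:{0<..}|lborel. w1 p (of_real r * cis (dir p)) m \<epsilon> / Theta (exp (- lak)) (of_real r * cis (dir p) / x) / of_real r)
         - (\<Sum>n<N. wco n m \<epsilon> * theta_moment lak n * x ^ n))"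
        unfolding w2_continuation[OF p e x] qlaplace_kappa w2co_def right_diff_distrib sum_distrib_left by (simp only: mult.assoc)
      then have "cmod (w2 p x m \<epsilon> - (\<Sum>n<N. w2co n m \<epsilon> * x ^ n)) \<le> \<bar>1 / pi_q q \<kappa>\<bar> * (?Mm * K * B ^ N * exp (lak * (real N)\<^sup>2 / 2) * cmod x ^ N)"
        using main by (simp only: norm_mult norm_of_real) (rule mult_left_mono, assumption, simp)
      also have "\<dots> = \<bar>1 / pi_q q \<kappa>\<bar> * (Mc * K) / E_weight \<beta> \<mu> m * B ^ N * exp (lak * (real N)\<^sup>2 / 2) * cmod x ^ N" by simp
      finally show "cmod (w2 p x m \<epsilon> - (\<Sum>n<N. w2co n m \<epsilon> * x ^ n)) \<le> \<bar>1 / pi_q q \<kappa>\<bar> * (Mc * K) / E_weight \<beta> \<mu> m * B ^ N * exp (lak * (real N)\<^sup>2 / 2) * cmod x ^ N" .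
    qed
  qed
qed

text \<open>Continuity is kept jointly in r and m because measurability in m of the Laplace
  transform depends on it.\<close>

lemma w2_continuous_ray:
  assumes p: "p < n\<^sub>E" and e: "\<epsilon> \<in> ball 0 \<epsilon>\<^sub>0"
  shows "continuous_on ({0<..} \<times> UNIV) (\<lambda>(r::real, m). w2 p (of_real r * cis (dir p)) m \<epsilon>)"
proof -
  have c: "continuous_on (Exp2_dom (S p) (Rb p) \<times> UNIV) (\<lambda>(x, m). w2 p x m \<epsilon>)"
    using w2_sol[OF p e] by (auto simp: Exp2_space_def Exp_space_def)
  have c2: "continuous_on ({0<..} \<times> UNIV) (\<lambda>x. (of_real (fst x) * cis (dir p), snd x :: real))"
    by (intro continuous_intros)
  have "(\<lambda>x. (of_real (fst x) * cis (dir p), snd x :: real)) ` ({0<..} \<times> UNIV) \<subseteq> Exp2_dom (S p) (Rb p) \<times> UNIV"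
    using ray_in_sector[OF S[OF p]] by (auto simp: Exp2_dom_def)
  from continuous_on_compose2[OF c c2 this] show ?thesis by (simp add: case_prod_unfold)
qed

text \<open>The factor that the two successive transforms put on the n-th Taylor
  coefficient.\<close>

definition uco :: "nat \<Rightarrow> complex" where
  "uco n = of_real (1 / pi_q q (real k2)) * of_real (1 / pi_q q \<kappa>) * theta_moment lak n * theta_moment la2 n"

text \<open>The second transform starts from an expansion of rate \<open>lak\<close> and adds
  \<open>la2\<close>, which gives \<open>la1\<close>.\<close>

lemma w2_laplace_expansion:
  assumes p: "p < n\<^sub>E"
  shows "\<exists>M B. M \<ge> 0 \<and> B > 0 \<and> (\<forall>\<epsilon>\<in>ball 0 \<epsilon>\<^sub>0. \<forall>m. \<forall>x\<in>Rb p. \<forall>N.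
     cmod (qlaplace q (real k2) (dir p) (\<lambda>y. w2 p y m \<epsilon>) x - (\<Sum>n<N. uco n * wco n m \<epsilon> * x ^ n))
       \<le> M / E_weight \<beta> \<mu> m * B ^ N * exp (la1 * (real N)\<^sup>2 / 2) * cmod x ^ N)"
proof -
  obtain \<eta> where \<eta>: "0 < \<eta>" "\<eta> < pi"
    "\<And>p x. x \<in> Rb p \<Longrightarrow> \<exists>\<phi>. x = of_real (cmod x) * cis (dir p - \<phi>) \<and> \<bar>\<phi>\<bar> \<le> pi - \<eta> \<and> 0 < cmod x \<and> cmod x < \<epsilon>\<^sub>0 * r\<^sub>T"
    using Rb_polar by metis
  obtain K1 where K1: "K1 > 0" "\<And>p \<epsilon> x m. p < n\<^sub>E \<Longrightarrow> \<epsilon> \<in> ball 0 \<epsilon>\<^sub>0 \<Longrightarrow> x \<in> cball 0 \<rho> \<Longrightarrow> cmod (w1 p x m \<epsilon>) \<le> K1 / E_weight \<beta> \<mu> m"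
    using w1_disc by metis
  obtain Kt where Kt: "Kt > 0" "\<And>n. cmod (theta_moment lak n) \<le> Kt * exp (lak * (real n + 1)\<^sup>2 / 2)"
    using theta_moment_bound[OF la_pos(3)] by metis
  obtain M B where MB: "M \<ge> 0" "B > 0" "\<And>\<epsilon> m x N. \<epsilon> \<in> ball 0 \<epsilon>\<^sub>0 \<Longrightarrow> x \<in> Rb p \<Longrightarrow>
     cmod (w2 p x m \<epsilon> - (\<Sum>n<N. w2co n m \<epsilon> * x ^ n)) \<le> M / E_weight \<beta> \<mu> m * B ^ N * exp (lak * (real N)\<^sup>2 / 2) * cmod x ^ N"
    using w2_expansion[OF p] by blast
  \<comment> \<open>Up to this radius the ray lies in \<open>Rb p\<close>, where
    \<open>w2_expansion\<close> applies; beyond it only the weighted norm is available.\<close>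
  define R0 where "R0 = \<epsilon>\<^sub>0 * r\<^sub>T"
  have R0: "0 < R0" "R0 \<le> 1" using radius by (auto simp: R0_def)
  have R1: "\<nu> + ln R0 / la2 \<le> 0"
  proof -
    have "ln R0 \<le> ln r\<^sub>T" using eps0 small mult_left_le_one_le[of "r\<^sub>T" "\<epsilon>\<^sub>0"] by (simp add: R0_def)
    then have "ln R0 / la2 \<le> ln r\<^sub>T / la2" using la_pos by (intro divide_right_mono) auto
    moreover have "\<nu> + ln r\<^sub>T / la2 < 0" using nu_small k by (simp add: la2_def mult.commute)
    ultimately show ?thesis by linarith
  qed
  \<comment> \<open>exp lak is the linear part of the exponent in the moment bound with (n+1)^2, and
    1/\<rho> comes from the Cauchy bound for \<open>wco\<close>.\<close>
  define A where "A = max B (exp lak / \<rho>)"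
  have A: "A > 0" "B \<le> A" "exp lak / \<rho> \<le> A" using MB by (auto simp: A_def)
  define Mc where "Mc = max M (max W (\<bar>1 / pi_q q \<kappa>\<bar> * (K1 * (Kt * exp (lak / 2)))))"
  have Mc: "M \<le> Mc" "W \<le> Mc" "\<bar>1 / pi_q q \<kappa>\<bar> * (K1 * (Kt * exp (lak / 2))) \<le> Mc" "Mc \<ge> 0" using MB(1) by (auto simp: Mc_def)
  show ?thesis
  proof (rule theta_transform_expansion[OF la_pos(2) \<eta>(1,2) R0(1,2) R1 A(1) less_imp_le[OF la_pos(3)]], goal_cases)
    case (1 K B')
    show ?case
    proof (rule exI[of _ "\<bar>1 / pi_q q (real k2)\<bar> * (Mc * K)"], rule exI[of _ B'], intro conjI ballI allI)
      show "0 \<le> \<bar>1 / pi_q q (real k2)\<bar> * (Mc * K)" using Mc 1 by simp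
      show "B' > 0" by (rule 1)
      fix \<epsilon> x :: complex and m N assume e: "\<epsilon> \<in> ball 0 \<epsilon>\<^sub>0" and x: "x \<in> Rb p"
      let ?Mm = "Mc / E_weight \<beta> \<mu> m"
      have Mm0: "0 \<le> ?Mm" using Mc by (intro divide_nonneg_nonneg less_imp_le[OF E_weight_pos]) auto
      have MM: "M / E_weight \<beta> \<mu> m \<le> ?Mm" "W / E_weight \<beta> \<mu> m \<le> ?Mm"
        "\<bar>1 / pi_q q \<kappa>\<bar> * (K1 * (Kt * exp (lak / 2))) / E_weight \<beta> \<mu> m \<le> ?Mm"
        by (rule divide_right_mono[OF Mc(1) less_imp_le[OF E_weight_pos]] divide_right_mono[OF Mc(2) less_imp_le[OF E_weight_pos]]
          divide_right_mono[OF Mc(3) less_imp_le[OF E_weight_pos]])+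
      obtain \<phi> where \<phi>: "x = of_real (cmod x) * cis (dir p - \<phi>)" "\<bar>\<phi>\<bar> \<le> pi - \<eta>" "0 < cmod x" "cmod x < \<epsilon>\<^sub>0 * r\<^sub>T"
        using \<eta>(3)[OF x] by blast
      have K1': "cmod (w1 0 y m \<epsilon>) \<le> K1 / E_weight \<beta> \<mu> m" if "y \<in> ball 0 \<rho>" for y
        using that by (intro K1(2) nE e) auto
      have "cmod ((LINT r:{0<..}|lborel. w2 p (of_real r * cis (dir p)) m \<epsilon> / Theta (exp (- la2)) (of_real r * cis (dir p) / (of_real (cmod x) * cis (dir p - \<phi>))) / of_real r)
         - (\<Sum>n<N. w2co n m \<epsilon> * theta_moment la2 n * (of_real (cmod x) * cis (dir p - \<phi>)) ^ n))
         \<le> ?Mm * K * B' ^ N * exp ((lak + la2) * (real N)\<^sup>2 / 2) * cmod x ^ N"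
      proof (rule 1(3)[where g = "\<lambda>y. w2 p y m \<epsilon>" and b = "\<lambda>n. w2co n m \<epsilon>" and dr = "dir p"])
        show "0 \<le> ?Mm" by (rule Mm0)
        have c: "continuous_on {0<..} (\<lambda>r::real. (r, m))" by (intro continuous_intros)
        have "(\<lambda>r::real. (r, m)) ` {0<..} \<subseteq> {0<..} \<times> UNIV" by auto
        from continuous_on_compose2[OF w2_continuous_ray[OF p e] c this]
        show "continuous_on {0<..} (\<lambda>r. w2 p (of_real r * cis (dir p)) m \<epsilon>)" by simp
        show "cmod (w2co n m \<epsilon>) \<le> ?Mm * A ^ n * exp (lak * (real n)\<^sup>2 / 2)" for n
        proof -
          have "cmod (w2co n m \<epsilon>) = \<bar>1 / pi_q q \<kappa>\<bar> * (cmod (wco n m \<epsilon>) * cmod (theta_moment lak n))"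
            unfolding w2co_def norm_mult norm_of_real ..
          also have "\<dots> \<le> \<bar>1 / pi_q q \<kappa>\<bar> * (K1 / E_weight \<beta> \<mu> m / \<rho> ^ n * (Kt * exp (lak * (real n + 1)\<^sup>2 / 2)))"
          proof (intro mult_left_mono mult_mono Kt(2))
            show "cmod (wco n m \<epsilon>) \<le> K1 / E_weight \<beta> \<mu> m / \<rho> ^ n"
              unfolding wco_def by (rule taylor_coeff_bound[OF w1_0_holo[OF e] rho K1'])
            show "0 \<le> K1 / E_weight \<beta> \<mu> m / \<rho> ^ n"
              using K1 rho by (intro divide_nonneg_nonneg less_imp_le[OF E_weight_pos]) auto
          qed auto
          also have "lak * (real n + 1)\<^sup>2 / 2 = lak / 2 + real n * lak + lak * (real n)\<^sup>2 / 2"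
            by (simp add: power2_eq_square field_simps)
          also have "\<bar>1 / pi_q q \<kappa>\<bar> * (K1 / E_weight \<beta> \<mu> m / \<rho> ^ n * (Kt * exp (lak / 2 + real n * lak + lak * (real n)\<^sup>2 / 2)))
            = (\<bar>1 / pi_q q \<kappa>\<bar> * (K1 * (Kt * exp (lak / 2))) / E_weight \<beta> \<mu> m) * (exp lak / \<rho>) ^ n * exp (lak * (real n)\<^sup>2 / 2)"
            by (simp add: exp_add exp_of_nat_mult power_divide)
          also have "\<dots> \<le> ?Mm * A ^ n * exp (lak * (real n)\<^sup>2 / 2)"
            by (intro mult_right_mono mult_mono power_mono MM(3) A(3)) (use rho Mm0 in auto)
          finally show ?thesis .
        qed
        show "cmod (w2 p (of_real r * cis (dir p)) m \<epsilon> - (\<Sum>n<N. w2co n m \<epsilon> * (of_real r * cis (dir p)) ^ n))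
           \<le> ?Mm * A ^ N * exp (lak * (real N)\<^sup>2 / 2) * r ^ N" if r: "0 < r" "r < R0" for r N
        proof -
          let ?y = "of_real r * cis (dir p)"
          have ny: "cmod ?y = r" using r by (simp add: norm_mult)
          have y: "?y \<in> Rb p" by (rule ray_in_Rb) (use r in \<open>auto simp: R0_def\<close>)
          have "cmod (w2 p ?y m \<epsilon> - (\<Sum>n<N. w2co n m \<epsilon> * ?y ^ n)) \<le> M / E_weight \<beta> \<mu> m * B ^ N * exp (lak * (real N)\<^sup>2 / 2) * r ^ N"
            using MB(3)[OF e y, of m N] unfolding ny .
          also have "\<dots> \<le> ?Mm * A ^ N * exp (lak * (real N)\<^sup>2 / 2) * r ^ N"
            by (intro mult_right_mono mult_mono power_mono MM(1) A(2)) (use r MB Mm0 in auto)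
          finally show ?thesis .
        qed
        show "cmod (w2 p (of_real r * cis (dir p)) m \<epsilon>) \<le> ?Mm * exp ((ln r)\<^sup>2 / (2 * la2) + \<nu> * ln r)" if r: "r \<ge> R0" for r
        proof -
          have r0: "r > 0" using r R0 by linarith
          have "of_real r * cis (dir p) \<in> Exp2_dom (S p) (Rb p)"
            using ray_in_sector[OF S[OF p] r0] by (simp add: Exp2_dom_def)
          from w2_weighted[OF p e this, of m] have "cmod (w2 p (of_real r * cis (dir p)) m \<epsilon>) \<le> W / E_weight \<beta> \<mu> m * exp ((ln r)\<^sup>2 / (2 * la2) + \<nu> * ln r)"
            using r0 by (simp add: norm_mult)
          also have "\<dots> \<le> ?Mm * exp ((ln r)\<^sup>2 / (2 * la2) + \<nu> * ln r)" by (intro mult_right_mono MM) auto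
          finally show ?thesis .
        qed
      qed (use \<phi> in \<open>auto simp: R0_def\<close>)
      then have main: "cmod ((LINT r:{0<..}|lborel. w2 p (of_real r * cis (dir p)) m \<epsilon> / Theta (exp (- la2)) (of_real r * cis (dir p) / x) / of_real r)
         - (\<Sum>n<N. w2co n m \<epsilon> * theta_moment la2 n * x ^ n)) \<le> ?Mm * K * B' ^ N * exp (la1 * (real N)\<^sup>2 / 2) * cmod x ^ N"
        unfolding \<phi>(1)[symmetric] la1_eq by simp
      have co: "uco n * wco n m \<epsilon> * x ^ n = of_real (1 / pi_q q (real k2)) * (w2co n m \<epsilon> * theta_moment la2 n * x ^ n)" for n
        unfolding uco_def w2co_def by (simp only: mult.assoc mult.commute mult.left_commute)
      have "qlaplace q (real k2) (dir p) (\<lambda>y. w2 p y m \<epsilon>) x - (\<Sum>n<N. uco n * wco n m \<epsilon> * x ^ n) = of_real (1 / pi_q q (real k2)) *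
        ((LINT r:{0<..}|lborel. w2 p (of_real r * cis (dir p)) m \<epsilon> / Theta (exp (- la2)) (of_real r * cis (dir p) / x) / of_real r)
         - (\<Sum>n<N. w2co n m \<epsilon> * theta_moment la2 n * x ^ n))"
        unfolding qlaplace_k2 co right_diff_distrib sum_distrib_left ..
      then have "cmod (qlaplace q (real k2) (dir p) (\<lambda>y. w2 p y m \<epsilon>) x - (\<Sum>n<N. uco n * wco n m \<epsilon> * x ^ n))
         \<le> \<bar>1 / pi_q q (real k2)\<bar> * (?Mm * K * B' ^ N * exp (la1 * (real N)\<^sup>2 / 2) * cmod x ^ N)"
        using main by (simp only: norm_mult norm_of_real) (rule mult_left_mono, assumption, simp)
      also have "\<dots> = \<bar>1 / pi_q q (real k2)\<bar> * (Mc * K) / E_weight \<beta> \<mu> m * B' ^ N * exp (la1 * (real N)\<^sup>2 / 2) * cmod x ^ N" by simp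
      finally show "cmod (qlaplace q (real k2) (dir p) (\<lambda>y. w2 p y m \<epsilon>) x - (\<Sum>n<N. uco n * wco n m \<epsilon> * x ^ n))
         \<le> \<bar>1 / pi_q q (real k2)\<bar> * (Mc * K) / E_weight \<beta> \<mu> m * B' ^ N * exp (la1 * (real N)\<^sup>2 / 2) * cmod x ^ N" .
    qed
  qed
qed

end

section \<open>The expansion of the solutions\<close>

lemma sum_triangle_diff:
  fixes g :: "nat \<Rightarrow> nat \<Rightarrow> 'a :: comm_monoid_add"
  shows "(\<Sum>n<N. \<Sum>j<N - n. g n j) = (\<Sum>k<N. \<Sum>n\<le>k. g n (k - n))"
proof -
  have "(\<Sum>n<N. \<Sum>j<N - n. g n j) = (\<Sum>(n, j)\<in>Sigma {..<N} (\<lambda>n. {..<N - n}). g n j)"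
    by (simp add: sum.Sigma)
  also have "Sigma {..<N} (\<lambda>n. {..<N - n}) = {(n, j). n + j < N}" by auto
  finally show ?thesis by (simp add: sum.triangle_reindex)
qed

text \<open>Otherwise the segment would contain a boundary direction dr + a or dr - a. As a <= pi,
  such a direction differs from every direction of the open sector by a nonzero amount below 2 pi,
  so its halfline is not in V.\<close>

lemma halfline_in_unbounded_sector:
  assumes a: "0 < a" "a \<le> pi" and V: "V = {of_real s * cis \<theta> | s \<theta>. 0 < s \<and> \<bar>\<theta> - dr\<bar> < a}"
    and h: "\<And>\<theta>. \<theta> \<in> closed_segment dr y \<Longrightarrow> halfline \<theta> \<subseteq> V"
  shows "\<bar>y - dr\<bar> < a"
proof (rule ccontr)
  assume n: "\<not> \<bar>y - dr\<bar> < a"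
  define sg :: real where "sg = (if y \<ge> dr then 1 else - 1)"
  define \<theta> where "\<theta> = dr + sg * a"
  have "\<theta> \<in> closed_segment dr y"
    using n a by (auto simp: \<theta>_def sg_def closed_segment_eq_real_ivl)
  from h[OF this] have "cis \<theta> \<in> V" unfolding halfline_def by (auto intro!: exI[of _ 1])
  then obtain s \<theta>' where s: "cis \<theta> = of_real s * cis \<theta>'" "0 < s" "\<bar>\<theta>' - dr\<bar> < a" unfolding V by blast
  have "1 = s" using arg_cong[OF s(1), of cmod] s(2) by (simp add: norm_mult)
  then have "cis \<theta> = cis \<theta>'" using s by simp
  then have "cis (\<theta> - \<theta>') = 1" by (simp add: cis_divide[symmetric])
  then have "cos (\<theta> - \<theta>') = 1" by (metis cis.sel(1) one_complex.sel(1))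
  then obtain k :: int where k: "\<theta> - \<theta>' = of_int k * (2 * pi)" using cos_one_2pi_int by auto
  have b: "0 < \<bar>\<theta> - \<theta>'\<bar>" "\<bar>\<theta> - \<theta>'\<bar> < 2 * pi"
    using s(3) a by (auto simp: \<theta>_def sg_def abs_if split: if_splits)
  have "\<bar>of_int k\<bar> * (2 * pi) < 1 * (2 * pi)" using b(2) unfolding k by (simp add: abs_mult)
  then have "\<bar>of_int k :: real\<bar> < 1" by (rule mult_right_less_imp_less) simp
  then have "k = 0" by linarith
  then show False using b(1) k by simp
qed

context q_solutions
begin

text \<open>The case N = 0 of \<open>w2_expansion\<close>. The norm of the space does not give it,
  since the growth allowed there is unbounded as \<tau> tends to 0.\<close>

lemma w2_bounded_Rb:
  assumes p: "p < n\<^sub>E"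
  obtains M where "M > 0" "\<And>\<epsilon> x m. \<epsilon> \<in> ball 0 \<epsilon>\<^sub>0 \<Longrightarrow> x \<in> Rb p \<Longrightarrow> cmod (w2 p x m \<epsilon>) \<le> M / E_weight \<beta> \<mu> m"
proof -
  obtain M B where MB: "M \<ge> 0" "\<And>\<epsilon> m x N. \<epsilon> \<in> ball 0 \<epsilon>\<^sub>0 \<Longrightarrow> x \<in> Rb p \<Longrightarrow>
     cmod (w2 p x m \<epsilon> - (\<Sum>n<N. w2co n m \<epsilon> * x ^ n)) \<le> M / E_weight \<beta> \<mu> m * B ^ N * exp (lak * (real N)\<^sup>2 / 2) * cmod x ^ N"
    using w2_expansion[OF p] by blast
  show ?thesis
  proof (rule that[of "M + 1"])
    fix \<epsilon> x :: complex and m assume "\<epsilon> \<in> ball 0 \<epsilon>\<^sub>0" "x \<in> Rb p"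
    from MB(2)[OF this, of m 0] have "cmod (w2 p x m \<epsilon>) \<le> M / E_weight \<beta> \<mu> m" by simp
    also have "\<dots> \<le> (M + 1) / E_weight \<beta> \<mu> m" by (rule divide_right_mono[OF _ less_imp_le[OF E_weight_pos]]) simp
    finally show "cmod (w2 p x m \<epsilon>) \<le> (M + 1) / E_weight \<beta> \<mu> m" .
  qed (use MB in simp)
qed

text \<open>The rotation from \<open>dir p\<close> to the chosen direction has to stay in the sector
  of \<open>w2\<close> (\<open>g1\<close>) and must not cross the halfline of poles through - x
  (\<open>g2\<close>).\<close>

lemma qlaplace_w2_direction:
  assumes p: "p < n\<^sub>E" and t: "t \<in> T" and e: "\<epsilon> \<in> E p"
  shows "qlaplace q (real k2) (\<gamma> p (\<epsilon> * t)) (\<lambda>y. w2 p y m \<epsilon>) (\<epsilon> * t) = qlaplace q (real k2) (dir p) (\<lambda>y. w2 p y m \<epsilon>) (\<epsilon> * t)"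
proof -
  have e0: "\<epsilon> \<in> ball 0 \<epsilon>\<^sub>0" using E_sub[OF p e] .
  define x where "x = \<epsilon> * t"
  have x: "x \<in> Rb p" using eps_t[OF p t e] by (simp add: x_def)
  obtain \<eta> \<phi> where \<phi>: "0 < \<eta>" "x = of_real (cmod x) * cis (dir p - \<phi>)" "\<bar>\<phi>\<bar> \<le> pi - \<eta>" "0 < cmod x" "cmod x < \<epsilon>\<^sub>0 * r\<^sub>T"
    using Rb_polar x by metis
  have \<phi>': "\<bar>\<phi>\<bar> < pi" using \<phi> by linarith
  obtain a where a: "0 < a" "a \<le> pi" and V: "S p = {of_real s * cis \<theta> | s \<theta>. 0 < s \<and> \<bar>\<theta> - dir p\<bar> < a}"
    using S[OF p] unfolding is_unbounded_sector_def by blast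
  note g = gamma[OF p t e, folded x_def]
  have g1: "\<bar>\<gamma> p x - dir p\<bar> < a" by (rule halfline_in_unbounded_sector[OF a V]) (use g in blast)
  \<comment> \<open>If the angle reached pi, one of the directions dir p - \<phi> + pi and dir p -
    \<phi> - pi would lie between \<open>dir p\<close> and the chosen one; its halfline contains -
    x, against assumption \<open>gamma\<close>.\<close>
  have g2: "\<bar>\<gamma> p x - dir p + \<phi>\<bar> < pi"
  proof (rule ccontr)
    assume n: "\<not> \<bar>\<gamma> p x - dir p + \<phi>\<bar> < pi"
    define sg :: real where "sg = (if \<gamma> p x \<ge> dir p then 1 else - 1)"
    define \<theta> where "\<theta> = dir p - \<phi> + sg * pi"
    have "\<theta> \<in> closed_segment (dir p) (\<gamma> p x)"
      using n \<phi>' by (auto simp: \<theta>_def sg_def closed_segment_eq_real_ivl abs_if split: if_splits)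
    moreover have "- x \<in> halfline \<theta>"
    proof -
      have "cis (- pi) = - 1" by (simp add: complex_eq_iff)
      then have "cis \<theta> = - cis (dir p - \<phi>)" unfolding \<theta>_def sg_def by (auto simp: cis_mult[symmetric] cis_divide[symmetric])
      then have "- x = of_real (cmod x) * cis \<theta>" by (subst \<phi>(2)) simp
      then show ?thesis unfolding halfline_def using \<phi>(4) by blast
    qed
    ultimately show False using g by blast
  qed
  define R0 where "R0 = \<epsilon>\<^sub>0 * r\<^sub>T"
  have R0: "0 < R0" "R0 \<le> 1" using radius by (auto simp: R0_def)
  have R1: "\<nu> + ln R0 / la2 \<le> 0"
  proof -
    have "ln R0 \<le> ln r\<^sub>T" using eps0 small mult_left_le_one_le[of "r\<^sub>T" "\<epsilon>\<^sub>0"] by (simp add: R0_def)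
    then have "ln R0 / la2 \<le> ln r\<^sub>T / la2" using la_pos by (intro divide_right_mono) auto
    moreover have "\<nu> + ln r\<^sub>T / la2 < 0" using nu_small k by (simp add: la2_def mult.commute)
    ultimately show ?thesis by linarith
  qed
  obtain M where M: "M > 0" "\<And>\<epsilon> x m. \<epsilon> \<in> ball 0 \<epsilon>\<^sub>0 \<Longrightarrow> x \<in> Rb p \<Longrightarrow> cmod (w2 p x m \<epsilon>) \<le> M / E_weight \<beta> \<mu> m"
    using w2_bounded_Rb[OF p] by metis
  define Mm where "Mm = max M W / E_weight \<beta> \<mu> m"
  have Mm: "M / E_weight \<beta> \<mu> m \<le> Mm" "W / E_weight \<beta> \<mu> m \<le> Mm" "0 \<le> Mm"
    unfolding Mm_def using M(1) by (auto intro!: divide_right_mono divide_nonneg_nonneg less_imp_le[OF E_weight_pos])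
  have inS: "of_real r * cis \<theta> \<in> S p" if "0 < r" "\<bar>\<theta> - dir p\<bar> < a" for r \<theta>
    unfolding V using that by blast
  have "(LINT r:{0<..}|lborel. w2 p (of_real r * cis (\<gamma> p x)) m \<epsilon> / Theta (exp (- la2)) (of_real r * cis (\<gamma> p x) / (of_real (cmod x) * cis (dir p - \<phi>))) / of_real r)
    = (LINT r:{0<..}|lborel. w2 p (of_real r * cis (dir p)) m \<epsilon> / Theta (exp (- la2)) (of_real r * cis (dir p) / (of_real (cmod x) * cis (dir p - \<phi>))) / of_real r)"
  proof (rule theta_transform_rotate[OF la_pos(2) R0 R1, where g = "\<lambda>y. w2 p y m \<epsilon>" and S = "S p" and M = Mm and a = a])
    have "(\<lambda>y. w2 p y m \<epsilon>) holomorphic_on S p \<union> Rb p"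
      using w2_sol[OF p e0] by (auto simp: Exp2_space_def Exp_space_def)
    then show "(\<lambda>y. w2 p y m \<epsilon>) holomorphic_on S p" by (rule holomorphic_on_subset) auto
    fix r \<theta> assume \<theta>: "\<bar>\<theta> - dir p\<bar> < a"
    show "cmod (w2 p (of_real r * cis \<theta>) m \<epsilon>) \<le> Mm" if r: "0 < r" "r < R0"
    proof -
      have "of_real r * cis \<theta> \<in> Rb p"
        using subsetD[OF S_sub[OF p] inS[OF r(1) \<theta>]] r by (simp add: Rb_eq Rb_dom_def R0_def norm_mult)
      from M(2)[OF e0 this, of m] show ?thesis using Mm(1) by linarith
    qed
    show "cmod (w2 p (of_real r * cis \<theta>) m \<epsilon>) \<le> Mm * exp ((ln r)\<^sup>2 / (2 * la2) + \<nu> * ln r)" if r: "r \<ge> R0"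
    proof -
      have r0: "r > 0" using r R0 by linarith
      have "of_real r * cis \<theta> \<in> Exp2_dom (S p) (Rb p)" using inS[OF r0 \<theta>] by (simp add: Exp2_dom_def)
      from w2_weighted[OF p e0 this, of m] have "cmod (w2 p (of_real r * cis \<theta>) m \<epsilon>) \<le> W / E_weight \<beta> \<mu> m * exp ((ln r)\<^sup>2 / (2 * la2) + \<nu> * ln r)"
        using r0 by (simp add: norm_mult)
      also have "\<dots> \<le> Mm * exp ((ln r)\<^sup>2 / (2 * la2) + \<nu> * ln r)" by (intro mult_right_mono Mm) auto
      finally show ?thesis .
    qed
  qed (use inS Mm a \<phi> \<phi>' g1 g2 in \<open>auto simp: R0_def\<close>)
  then show ?thesis unfolding qlaplace_k2 x_def[symmetric] \<phi>(2)[symmetric] by simp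
qed

section \<open>Expansion of the Laplace transform in powers of \<epsilon>\<close>

definition lap :: "nat \<Rightarrow> complex \<Rightarrow> complex \<Rightarrow> real \<Rightarrow> complex" where
  "lap p \<epsilon> x m = qlaplace q (real k2) (dir p) (\<lambda>y. w2 p y m \<epsilon>) x"

lemma u_eq_lap:
  assumes "p < n\<^sub>E" "t \<in> T" "\<epsilon> \<in> E p"
  shows "u p t z \<epsilon> = inv_fourier (lap p \<epsilon> (\<epsilon> * t)) z"
  unfolding u_eq lap_def[abs_def] qlaplace_w2_direction[OF assms] ..

text \<open>The integrand is continuous in (m, r) on an open set, hence jointly measurable after
  extension by 0, and integrating out r keeps measurability in m.\<close>

lemma lap_measurable:
  assumes p: "p < n\<^sub>E" and e: "\<epsilon> \<in> ball 0 \<epsilon>\<^sub>0" and x: "x \<in> Rb p"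
  shows "lap p \<epsilon> x \<in> borel_measurable borel"
proof -
  obtain \<eta> \<phi> where \<phi>: "0 < \<eta>" "x = of_real (cmod x) * cis (dir p - \<phi>)" "\<bar>\<phi>\<bar> \<le> pi - \<eta>" "0 < cmod x"
    using Rb_polar x by metis
  let ?th = "\<lambda>r. Theta (exp (- la2)) (of_real r * cis (dir p) / x)"
  have th: "?th r \<noteq> 0" if "r > 0" for r
  proof -
    have "of_real r * cis (dir p) / x = of_real (r / cmod x) * cis (dir p - dir p + \<phi>)"
      by (subst \<phi>(2), rule polar_quotient[OF \<phi>(4)])
    then show ?thesis using Theta_nonzero_ray[OF la_pos(2), of \<phi> "r / cmod x"] \<phi> that by simp
  qed
  let ?F = "\<lambda>y::real \<times> real. w2 p (of_real (snd y) * cis (dir p)) (fst y) \<epsilon> / ?th (snd y) / of_real (snd y)"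
  have c1: "continuous_on (UNIV \<times> {0<..}) (\<lambda>y::real \<times> real. w2 p (of_real (snd y) * cis (dir p)) (fst y) \<epsilon>)"
  proof -
    have s: "continuous_on (UNIV \<times> {0<..}) (\<lambda>y::real \<times> real. (snd y, fst y))" by (intro continuous_intros)
    have "(\<lambda>y::real \<times> real. (snd y, fst y)) ` (UNIV \<times> {0<..}) \<subseteq> {0<..} \<times> UNIV" by auto
    from continuous_on_compose2[OF w2_continuous_ray[OF p e] s this] show ?thesis by simp
  qed
  have c2: "continuous_on (UNIV \<times> {0<..}) (\<lambda>y::real \<times> real. ?th (snd y))"
  proof -
    have h: "continuous_on (- {0}) (Theta (exp (- la2)))"
      by (intro holomorphic_on_imp_continuous_on Theta_holomorphic) (use la_pos in auto)
    have "continuous_on (UNIV \<times> {0<..}) (\<lambda>y::real \<times> real. of_real (snd y) * cis (dir p) / x)"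
      by (intro continuous_intros) (use \<phi> in auto)
    with h show ?thesis by (rule continuous_on_compose2) (use \<phi> in auto)
  qed
  have c3: "continuous_on (UNIV \<times> {0<..}) (\<lambda>y::real \<times> real. complex_of_real (snd y))" by (intro continuous_intros)
  have c: "continuous_on (UNIV \<times> {0<..}) ?F"
    by (intro continuous_on_divide c1 c2 c3) (use th in auto)
  have "(\<lambda>y. indicator (UNIV \<times> {0<..}) y *\<^sub>R ?F y) \<in> borel_measurable borel"
    by (rule borel_measurable_continuous_on_indicator[OF _ c]) (intro borel_open open_Times, auto)
  then have "(\<lambda>y. indicator (UNIV \<times> {0<..}) y *\<^sub>R ?F y) \<in> borel_measurable (borel \<Otimes>\<^sub>M lborel)"
    by (simp add: borel_prod[symmetric] cong: measurable_cong_sets)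
  moreover have "(\<lambda>y. indicator (UNIV \<times> {0<..}) y *\<^sub>R ?F y) = case_prod (\<lambda>m r. indicator {0<..} r *\<^sub>R (w2 p (of_real r * cis (dir p)) m \<epsilon> / ?th r / of_real r))"
    by (auto simp: fun_eq_iff indicator_def)
  ultimately have "(\<lambda>m. \<integral>r. indicator {0<..} r *\<^sub>R (w2 p (of_real r * cis (dir p)) m \<epsilon> / ?th r / of_real r) \<partial>lborel) \<in> borel_measurable borel"
    by (intro lborel.borel_measurable_lebesgue_integral) simp
  then show ?thesis
    unfolding lap_def[abs_def] qlaplace_k2 set_lebesgue_integral_def by measurable
qed

text \<open>\<open>wco n m\<close> still depends on \<epsilon> and is expanded once more, at
  \<epsilon> = 0.\<close>

definition aco :: "nat \<Rightarrow> nat \<Rightarrow> real \<Rightarrow> complex" where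
  "aco n j m = taylor_coeff (wco n m) j"

lemma wco_bound:
  obtains K1 where "K1 > 0" "\<And>n m \<epsilon>. \<epsilon> \<in> ball 0 \<epsilon>\<^sub>0 \<Longrightarrow> cmod (wco n m \<epsilon>) \<le> K1 / E_weight \<beta> \<mu> m / \<rho> ^ n"
    "\<And>n m. wco n m holomorphic_on ball 0 \<epsilon>\<^sub>0"
proof -
  obtain K1 where K1: "K1 > 0" "\<And>p \<epsilon> x m. p < n\<^sub>E \<Longrightarrow> \<epsilon> \<in> ball 0 \<epsilon>\<^sub>0 \<Longrightarrow> x \<in> cball 0 \<rho> \<Longrightarrow> cmod (w1 p x m \<epsilon>) \<le> K1 / E_weight \<beta> \<mu> m"
    using w1_disc by metis
  have K1': "cmod (w1 0 x m \<epsilon>) \<le> K1 / E_weight \<beta> \<mu> m" if "\<epsilon> \<in> ball 0 \<epsilon>\<^sub>0" "x \<in> ball 0 \<rho>" for \<epsilon> x m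
    using that by (intro K1(2) nE) auto
  show ?thesis
  proof (rule that[OF K1(1)])
    show "cmod (wco n m \<epsilon>) \<le> K1 / E_weight \<beta> \<mu> m / \<rho> ^ n" if "\<epsilon> \<in> ball 0 \<epsilon>\<^sub>0" for n m \<epsilon>
      unfolding wco_def by (rule taylor_coeff_bound[OF w1_0_holo[OF that] rho K1'[OF that]])
    show "wco n m holomorphic_on ball 0 \<epsilon>\<^sub>0" for n m
      unfolding wco_def[abs_def]
    proof (rule taylor_coeff_holomorphic[where r = \<rho> and K = "K1 / E_weight \<beta> \<mu> m"])
      show "w1 0 x m holomorphic_on ball 0 \<epsilon>\<^sub>0" if "x \<in> ball 0 \<rho>" for x
        using w1_holo[OF nE, of x m] that by auto
    qed (use w1_0_holo rho K1' in auto)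
  qed
qed

lemma wco_measurable: "\<epsilon> \<in> ball 0 \<epsilon>\<^sub>0 \<Longrightarrow> (\<lambda>m. wco n m \<epsilon>) \<in> borel_measurable borel"
  unfolding wco_def by (rule taylor_coeff_measurable[OF w1_0_holo rho w1_measurable[OF nE]]) auto

lemma aco_measurable: "aco n j \<in> borel_measurable borel"
proof -
  obtain K1 where "\<And>n m. wco n m holomorphic_on ball 0 \<epsilon>\<^sub>0" using wco_bound by metis
  then show ?thesis unfolding aco_def[abs_def]
    by (intro taylor_coeff_measurable[where f = "\<lambda>\<epsilon> m. wco n m \<epsilon>" and r = "\<epsilon>\<^sub>0"]) (auto intro: eps0 wco_measurable)
qed

lemma uco_bound:
  obtains K B where "K > 0" "B > 0" "\<And>n. cmod (uco n) \<le> K * B ^ n * exp (la1 * (real n)\<^sup>2 / 2)"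
proof -
  obtain Kt where Kt: "Kt > 0" "\<And>n. cmod (theta_moment lak n) \<le> Kt * exp (lak * (real n + 1)\<^sup>2 / 2)"
    using theta_moment_bound[OF la_pos(3)] by metis
  obtain Ks where Ks: "Ks > 0" "\<And>n. cmod (theta_moment la2 n) \<le> Ks * exp (la2 * (real n + 1)\<^sup>2 / 2)"
    using theta_moment_bound[OF la_pos(2)] by metis
  define P where "P = \<bar>1 / pi_q q (real k2)\<bar> * \<bar>1 / pi_q q \<kappa>\<bar>"
  have P: "P \<ge> 0" by (simp add: P_def)
  show ?thesis
  proof (rule that[of "(P + 1) * (Kt * Ks * exp (la1 / 2))" "exp la1"])
    show "(P + 1) * (Kt * Ks * exp (la1 / 2)) > 0" using P Kt Ks by (intro mult_pos_pos) auto
    show "exp la1 > 0" by simp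
    fix n
    have "cmod (uco n) = P * (cmod (theta_moment lak n) * cmod (theta_moment la2 n))"
      unfolding uco_def P_def norm_mult norm_of_real by simp
    also have "\<dots> \<le> (P + 1) * ((Kt * exp (lak * (real n + 1)\<^sup>2 / 2)) * (Ks * exp (la2 * (real n + 1)\<^sup>2 / 2)))"
      by (intro mult_mono Kt(2) Ks(2)) (use P Kt Ks in auto)
    also have "\<dots> = (P + 1) * (Kt * Ks * (exp (lak * (real n + 1)\<^sup>2 / 2) * exp (la2 * (real n + 1)\<^sup>2 / 2)))" by simp
    also have "exp (lak * (real n + 1)\<^sup>2 / 2) * exp (la2 * (real n + 1)\<^sup>2 / 2) = exp (la1 / 2) * exp la1 ^ n * exp (la1 * (real n)\<^sup>2 / 2)"
      unfolding la1_eq exp_of_nat_mult[symmetric] exp_add[symmetric] by (simp add: power2_eq_square field_simps)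
    finally show "cmod (uco n) \<le> (P + 1) * (Kt * Ks * exp (la1 / 2)) * exp la1 ^ n * exp (la1 * (real n)\<^sup>2 / 2)" by simp
  qed
qed

text \<open>The transform is evaluated at \<epsilon> t, so its n-th term brings \<epsilon>^n t^n;
  the other N - n powers of \<epsilon> come from \<open>wco\<close>.\<close>

definition usol :: "nat \<Rightarrow> complex \<times> complex \<Rightarrow> complex" where
  "usol N = (\<lambda>(t, z). \<Sum>n\<le>N. uco n * t ^ n * inv_fourier (aco n (N - n)) z)"

lemma T_norm: "t \<in> T \<Longrightarrow> cmod t \<le> 1"
  using T small unfolding is_sector_def sector_def by (fastforce simp: norm_mult)

text \<open>The n-th term of the expansion in \<epsilon> t is itself cut at order N - n in
  \<epsilon>, so that every error is of order N. The inner Taylor series converge with fixed radius,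
  so they affect only the geometric rate and not \<open>la1\<close>.\<close>

lemma lap_expansion:
  assumes p: "p < n\<^sub>E"
  obtains K A where "K > 0" "A > 0"
    "\<And>\<epsilon> t m N. \<epsilon> \<in> E p \<Longrightarrow> t \<in> T \<Longrightarrow>
      cmod (lap p \<epsilon> (\<epsilon> * t) m - (\<Sum>i<N. \<Sum>n\<le>i. uco n * t ^ n * \<epsilon> ^ i * aco n (i - n) m))
        \<le> K * A ^ N * exp (la1 * (real N)\<^sup>2 / 2) * cmod \<epsilon> ^ N / E_weight \<beta> \<mu> m"
proof -
  obtain M B where MB: "M \<ge> 0" "B > 0" "\<And>\<epsilon> m x N. \<epsilon> \<in> ball 0 \<epsilon>\<^sub>0 \<Longrightarrow> x \<in> Rb p \<Longrightarrow>
     cmod (lap p \<epsilon> x m - (\<Sum>n<N. uco n * wco n m \<epsilon> * x ^ n))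
       \<le> M / E_weight \<beta> \<mu> m * B ^ N * exp (la1 * (real N)\<^sup>2 / 2) * cmod x ^ N"
    using w2_laplace_expansion[OF p] unfolding lap_def by blast
  obtain K1 where K1: "K1 > 0" "\<And>n m \<epsilon>. \<epsilon> \<in> ball 0 \<epsilon>\<^sub>0 \<Longrightarrow> cmod (wco n m \<epsilon>) \<le> K1 / E_weight \<beta> \<mu> m / \<rho> ^ n"
    "\<And>n m. wco n m holomorphic_on ball 0 \<epsilon>\<^sub>0" using wco_bound by metis
  obtain Ku Bu where Ku: "Ku > 0" "Bu > 0" "\<And>n. cmod (uco n) \<le> Ku * Bu ^ n * exp (la1 * (real n)\<^sup>2 / 2)"
    using uco_bound by metis
  \<comment> \<open>The two entries are the rates of the outer and the inner expansion; their powers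
    n and N - n combine to at most \<open>A2 ^ N\<close>.\<close>
  define A2 where "A2 = max (Bu / \<rho>) (2 / \<epsilon>\<^sub>0)"
  have A2: "Bu / \<rho> \<le> A2" "2 / \<epsilon>\<^sub>0 \<le> A2" "A2 > 0" using eps0 by (auto simp: A2_def less_max_iff_disj)
  define A where "A = max B (2 * A2)"
  have A: "B \<le> A" "2 * A2 \<le> A" "A > 0" using A2 by (auto simp: A_def)
  show ?thesis
  proof (rule that[of "M + 3 * Ku * K1" A])
    show "M + 3 * Ku * K1 > 0" using MB Ku K1 by (intro add_nonneg_pos) auto
    show "A > 0" by (rule A)
    fix \<epsilon> t m N assume e: "\<epsilon> \<in> E p" and t: "t \<in> T"
    have e0: "\<epsilon> \<in> ball 0 \<epsilon>\<^sub>0" using E_sub[OF p e] .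
    have x: "\<epsilon> * t \<in> Rb p" using eps_t[OF p t e] .
    let ?Ew = "E_weight \<beta> \<mu> m" and ?X = "exp (la1 * (real N)\<^sup>2 / 2) * cmod \<epsilon> ^ N"
    have E: "?Ew > 0" by simp
    have X0: "?X \<ge> 0" by simp
    have "(\<Sum>i<N. \<Sum>n\<le>i. uco n * t ^ n * \<epsilon> ^ i * aco n (i - n) m)
       = (\<Sum>i<N. \<Sum>n\<le>i. uco n * t ^ n * \<epsilon> ^ (n + (i - n)) * aco n (i - n) m)"
      by (intro sum.cong refl) auto
    also have "\<dots> = (\<Sum>n<N. \<Sum>j<N - n. uco n * t ^ n * \<epsilon> ^ (n + j) * aco n j m)"
      by (rule sum_triangle_diff[symmetric])
    also have "\<dots> = (\<Sum>n<N. uco n * (\<epsilon> * t) ^ n * (\<Sum>j<N - n. aco n j m * \<epsilon> ^ j))"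
      by (simp add: sum_distrib_left power_add power_mult_distrib mult_ac)
    finally have eq: "(\<Sum>i<N. \<Sum>n\<le>i. uco n * t ^ n * \<epsilon> ^ i * aco n (i - n) m) = (\<Sum>n<N. uco n * (\<epsilon> * t) ^ n * (\<Sum>j<N - n. aco n j m * \<epsilon> ^ j))" .
    have "cmod ((\<Sum>n<N. uco n * wco n m \<epsilon> * (\<epsilon> * t) ^ n) - (\<Sum>n<N. uco n * (\<epsilon> * t) ^ n * (\<Sum>j<N - n. aco n j m * \<epsilon> ^ j)))
      = cmod (\<Sum>n<N. uco n * (\<epsilon> * t) ^ n * (wco n m \<epsilon> - (\<Sum>j<N - n. aco n j m * \<epsilon> ^ j)))"
      by (simp add: sum_subtractf[symmetric] algebra_simps)
    also have "\<dots> \<le> (\<Sum>n<N. 3 * Ku * K1 / ?Ew * A2 ^ N * ?X)"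
    proof (rule order_trans[OF norm_sum sum_mono])
      fix n assume n: "n \<in> {..<N}"
      have r: "cmod (wco n m \<epsilon> - (\<Sum>j<N - n. aco n j m * \<epsilon> ^ j)) \<le> 3 * (K1 / ?Ew / \<rho> ^ n) * (2 * cmod \<epsilon> / \<epsilon>\<^sub>0) ^ (N - n)"
        unfolding aco_def by (rule taylor_remainder[OF K1(3) eps0 K1(2)]) (use e0 in auto)
      have tn: "cmod (\<epsilon> * t) ^ n \<le> cmod \<epsilon> ^ n"
        using T_norm[OF t] by (intro power_mono) (auto simp: norm_mult mult_left_le)
      have "exp (la1 * (real n)\<^sup>2 / 2) \<le> exp (la1 * (real N)\<^sup>2 / 2)"
        using n la_pos by (auto intro!: mult_left_mono power_mono)
      then have "Ku * Bu ^ n * exp (la1 * (real n)\<^sup>2 / 2) \<le> Ku * Bu ^ n * exp (la1 * (real N)\<^sup>2 / 2)"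
        using Ku(1,2) by (intro mult_left_mono) auto
      then have un: "cmod (uco n) \<le> Ku * Bu ^ n * exp (la1 * (real N)\<^sup>2 / 2)"
        using Ku(3)[of n] by linarith
      have "cmod (uco n * (\<epsilon> * t) ^ n * (wco n m \<epsilon> - (\<Sum>j<N - n. aco n j m * \<epsilon> ^ j)))
        = cmod (uco n) * cmod (\<epsilon> * t) ^ n * cmod (wco n m \<epsilon> - (\<Sum>j<N - n. aco n j m * \<epsilon> ^ j))"
        by (simp add: norm_mult norm_power)
      also have "\<dots> \<le> (Ku * Bu ^ n * exp (la1 * (real N)\<^sup>2 / 2)) * cmod \<epsilon> ^ n * (3 * (K1 / ?Ew / \<rho> ^ n) * (2 * cmod \<epsilon> / \<epsilon>\<^sub>0) ^ (N - n))"
        by (intro mult_mono un tn r) (use Ku in auto)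
      also have "\<dots> = 3 * Ku * K1 / ?Ew * ((Bu / \<rho>) ^ n * (2 / \<epsilon>\<^sub>0) ^ (N - n)) * (exp (la1 * (real N)\<^sup>2 / 2) * (cmod \<epsilon> ^ n * cmod \<epsilon> ^ (N - n)))"
        by (simp add: power_divide power_mult_distrib mult_ac)
      also have "cmod \<epsilon> ^ n * cmod \<epsilon> ^ (N - n) = cmod \<epsilon> ^ N" using n by (simp add: power_add[symmetric])
      also have "3 * Ku * K1 / ?Ew * ((Bu / \<rho>) ^ n * (2 / \<epsilon>\<^sub>0) ^ (N - n)) * ?X \<le> 3 * Ku * K1 / ?Ew * A2 ^ N * ?X"
      proof (intro mult_right_mono mult_left_mono X0)
        have "(Bu / \<rho>) ^ n * (2 / \<epsilon>\<^sub>0) ^ (N - n) \<le> A2 ^ n * A2 ^ (N - n)"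
          by (intro mult_mono power_mono A2) (use Ku rho eps0 A2 in auto)
        also have "\<dots> = A2 ^ N" using n by (simp add: power_add[symmetric])
        finally show "(Bu / \<rho>) ^ n * (2 / \<epsilon>\<^sub>0) ^ (N - n) \<le> A2 ^ N" .
        show "0 \<le> 3 * Ku * K1 / ?Ew" using Ku K1 E by (intro divide_nonneg_pos) auto
      qed
      finally show "cmod (uco n * (\<epsilon> * t) ^ n * (wco n m \<epsilon> - (\<Sum>j<N - n. aco n j m * \<epsilon> ^ j))) \<le> 3 * Ku * K1 / ?Ew * A2 ^ N * ?X" .
    qed
    also have "\<dots> = real N * (3 * Ku * K1 / ?Ew * A2 ^ N * ?X)" by simp
    \<comment> \<open>The number N of summands is absorbed into the geometric rate, which explains
      the 2 in \<open>A\<close>.\<close>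
    also have "\<dots> \<le> 2 ^ N * (3 * Ku * K1 / ?Ew * A2 ^ N * ?X)"
    proof (rule mult_right_mono)
      show "real N \<le> 2 ^ N" using of_nat_less_two_power[of N] by (rule less_imp_le)
      show "0 \<le> 3 * Ku * K1 / ?Ew * A2 ^ N * ?X" using Ku K1 A2 E by (intro mult_nonneg_nonneg divide_nonneg_pos) auto
    qed
    also have "\<dots> = 3 * Ku * K1 / ?Ew * (2 * A2) ^ N * ?X" by (simp add: power_mult_distrib)
    also have "\<dots> \<le> 3 * Ku * K1 / ?Ew * A ^ N * ?X"
      by (intro mult_right_mono mult_left_mono power_mono A X0) (use A2 Ku K1 E in \<open>auto intro!: divide_nonneg_pos\<close>)
    finally have e2: "cmod ((\<Sum>n<N. uco n * wco n m \<epsilon> * (\<epsilon> * t) ^ n) - (\<Sum>n<N. uco n * (\<epsilon> * t) ^ n * (\<Sum>j<N - n. aco n j m * \<epsilon> ^ j)))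
      \<le> 3 * Ku * K1 / ?Ew * A ^ N * ?X" .
    have "cmod (lap p \<epsilon> (\<epsilon> * t) m - (\<Sum>n<N. uco n * wco n m \<epsilon> * (\<epsilon> * t) ^ n)) \<le> M / ?Ew * B ^ N * exp (la1 * (real N)\<^sup>2 / 2) * cmod (\<epsilon> * t) ^ N"
      by (rule MB(3)[OF e0 x])
    also have "\<dots> \<le> M / ?Ew * A ^ N * exp (la1 * (real N)\<^sup>2 / 2) * cmod \<epsilon> ^ N"
      using T_norm[OF t] MB A E
      by (intro mult_mono mult_right_mono mult_left_mono power_mono) (auto simp: norm_mult mult_left_le intro!: divide_nonneg_pos)
    finally have e1: "cmod (lap p \<epsilon> (\<epsilon> * t) m - (\<Sum>n<N. uco n * wco n m \<epsilon> * (\<epsilon> * t) ^ n)) \<le> M / ?Ew * A ^ N * ?X" by simp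
    have "cmod (lap p \<epsilon> (\<epsilon> * t) m - (\<Sum>n<N. uco n * (\<epsilon> * t) ^ n * (\<Sum>j<N - n. aco n j m * \<epsilon> ^ j)))
      \<le> M / ?Ew * A ^ N * ?X + 3 * Ku * K1 / ?Ew * A ^ N * ?X"
      by (rule norm_triangle_le[OF add_mono[OF e1 e2], simplified add_diff_eq diff_add_cancel]) 
    also have "\<dots> = (M + 3 * Ku * K1) * A ^ N * exp (la1 * (real N)\<^sup>2 / 2) * cmod \<epsilon> ^ N / ?Ew"
    proof -
      have "a / w * x * (y * y') + b / w * x * (y * y') = (a + b) * x * y * y' / w" for a b w x y y' :: real
        by (simp add: add_divide_distrib ring_distribs)
      then show ?thesis .
    qed
    finally show "cmod (lap p \<epsilon> (\<epsilon> * t) m - (\<Sum>i<N. \<Sum>n\<le>i. uco n * t ^ n * \<epsilon> ^ i * aco n (i - n) m))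
      \<le> (M + 3 * Ku * K1) * A ^ N * exp (la1 * (real N)\<^sup>2 / 2) * cmod \<epsilon> ^ N / ?Ew"
      unfolding eq .
  qed
qed

end

section \<open>Asymptotic power series along a ray\<close>

text \<open>Poincare asymptotics along one ray, with the coefficients stored as a formal power
  series. Sums and products of functions then correspond to operations in the ring of formal series,
  and a functional identity becomes a formal one.\<close>

definition asymptotic_on_ray :: "real \<Rightarrow> (complex \<Rightarrow> complex) \<Rightarrow> complex fps \<Rightarrow> bool" where
  "asymptotic_on_ray d g a \<longleftrightarrow>
     (\<forall>N. (\<lambda>s. g (of_real s * cis d) - (\<Sum>n<N. fps_nth a n * (of_real s * cis d) ^ n)) \<in> O[at_right 0](\<lambda>s. of_real (s ^ N)))"

lemma ray_power_bigo: "(\<lambda>s. c * (of_real s * cis d) ^ n) \<in> O[at_right 0](\<lambda>s. complex_of_real (s ^ N))" if "N \<le> n"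
proof (rule bigoI[where c = "cmod c"])
  show "\<forall>\<^sub>F s in at_right 0. norm (c * (of_real s * cis d) ^ n) \<le> cmod c * norm (complex_of_real (s ^ N))"
    using eventually_at_right_real[of 0 1, simplified]
  proof eventually_elim
    case (elim s)
    have "s ^ n \<le> s ^ N" using elim that by (intro power_decreasing) auto
    then show ?case using elim by (simp add: norm_mult norm_power mult_left_mono)
  qed
qed

lemma asymptotic_cong:
  assumes "asymptotic_on_ray d f a" "\<forall>\<^sub>F s in at_right 0. f (of_real s * cis d) = g (of_real s * cis d)"
  shows "asymptotic_on_ray d g a"
  unfolding asymptotic_on_ray_def
proof
  fix N
  have "(\<lambda>s. f (of_real s * cis d) - (\<Sum>n<N. fps_nth a n * (of_real s * cis d) ^ n)) \<in> O[at_right 0](\<lambda>s. of_real (s ^ N))"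
    using assms(1) by (simp add: asymptotic_on_ray_def)
  moreover have "\<forall>\<^sub>F s in at_right 0. f (of_real s * cis d) - (\<Sum>n<N. fps_nth a n * (of_real s * cis d) ^ n)
     = g (of_real s * cis d) - (\<Sum>n<N. fps_nth a n * (of_real s * cis d) ^ n)"
    using assms(2) by eventually_elim simp
  ultimately show "(\<lambda>s. g (of_real s * cis d) - (\<Sum>n<N. fps_nth a n * (of_real s * cis d) ^ n)) \<in> O[at_right 0](\<lambda>s. of_real (s ^ N))"
    by (rule landau_o.big.in_cong[THEN iffD1, rotated])
qed

text \<open>If the lower coefficients agree, the difference of the N-th ones times s^N is
  O(s^(N+1)); dividing by s^N and letting s tend to 0 gives equality.\<close>

lemma asymptotic_unique:
  assumes "asymptotic_on_ray d f a" "asymptotic_on_ray d f b"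
  shows "a = b"
proof (rule fps_ext)
  fix N show "fps_nth a N = fps_nth b N"
  proof (induction N rule: less_induct)
    case (less N)
    let ?e = "\<lambda>s. of_real s * cis d"
    have "(\<lambda>s. (f (?e s) - (\<Sum>n<Suc N. fps_nth a n * ?e s ^ n)) - (f (?e s) - (\<Sum>n<Suc N. fps_nth b n * ?e s ^ n))) \<in> O[at_right 0](\<lambda>s. of_real (s ^ Suc N))"
      by (rule sum_in_bigo(2)[OF assms(1)[unfolded asymptotic_on_ray_def, rule_format, of "Suc N"]
            assms(2)[unfolded asymptotic_on_ray_def, rule_format, of "Suc N"]])
    moreover have "(f (?e s) - (\<Sum>n<Suc N. fps_nth a n * ?e s ^ n)) - (f (?e s) - (\<Sum>n<Suc N. fps_nth b n * ?e s ^ n)) = (fps_nth b N - fps_nth a N) * ?e s ^ N" for s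
    proof -
      have "(\<Sum>n<N. fps_nth a n * ?e s ^ n) = (\<Sum>n<N. fps_nth b n * ?e s ^ n)" using less by (intro sum.cong) auto
      then show ?thesis by (simp add: algebra_simps)
    qed
    ultimately have "(\<lambda>s. (fps_nth b N - fps_nth a N) * ?e s ^ N) \<in> O[at_right 0](\<lambda>s. of_real (s ^ Suc N))" by simp
    then obtain c where c: "\<forall>\<^sub>F s in at_right 0. norm ((fps_nth b N - fps_nth a N) * ?e s ^ N) \<le> c * norm (complex_of_real (s ^ Suc N))"
      by (elim landau_o.bigE)
    have "\<forall>\<^sub>F s in at_right 0. cmod (fps_nth b N - fps_nth a N) \<le> c * s"
      using c eventually_at_right_less[of "0::real"]
    proof eventually_elim
      case (elim s)
      then have "cmod (fps_nth b N - fps_nth a N) * s ^ N \<le> (c * s) * s ^ N" by (simp add: norm_mult norm_power mult_ac)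
      then show ?case by (rule mult_right_le_imp_le) (use elim in simp)
    qed
    moreover have "((\<lambda>s. c * s) \<longlongrightarrow> c * 0) (at_right 0)" by (intro tendsto_intros)
    ultimately have "cmod (fps_nth b N - fps_nth a N) \<le> c * 0" by (intro tendsto_lowerbound[of "\<lambda>s. c * s" _ "at_right 0"]) auto
    then show ?case by simp
  qed
qed

lemma asymptotic_add:
  assumes "asymptotic_on_ray d f a" "asymptotic_on_ray d g b"
  shows "asymptotic_on_ray d (\<lambda>x. f x + g x) (a + b)"
  unfolding asymptotic_on_ray_def
proof
  fix N
  let ?e = "\<lambda>s. of_real s * cis d"
  have "(\<lambda>s. (f (?e s) - (\<Sum>n<N. fps_nth a n * ?e s ^ n)) + (g (?e s) - (\<Sum>n<N. fps_nth b n * ?e s ^ n))) \<in> O[at_right 0](\<lambda>s. of_real (s ^ N))"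
    by (rule sum_in_bigo(1)[OF assms(1)[unfolded asymptotic_on_ray_def, rule_format, of N]
          assms(2)[unfolded asymptotic_on_ray_def, rule_format, of N]])
  then show "(\<lambda>s. f (?e s) + g (?e s) - (\<Sum>n<N. fps_nth (a + b) n * ?e s ^ n)) \<in> O[at_right 0](\<lambda>s. of_real (s ^ N))"
    by (simp add: distrib_right sum.distrib algebra_simps)
qed

lemma asymptotic_const: "asymptotic_on_ray d (\<lambda>x. c) (fps_const c)"
  unfolding asymptotic_on_ray_def
proof
  fix N
  show "(\<lambda>s. c - (\<Sum>n<N. fps_nth (fps_const c) n * (of_real s * cis d) ^ n)) \<in> O[at_right 0](\<lambda>s. of_real (s ^ N))"
  proof (cases N)
    case 0
    then show ?thesis using ray_power_bigo[of 0 0 c d] by simp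
  next
    case (Suc M)
    have "(\<Sum>n<Suc M. fps_nth (fps_const c) n * x ^ n) = (\<Sum>n\<in>{0}. fps_nth (fps_const c) n * x ^ n)" for x :: complex
      by (rule sum.mono_neutral_right) auto
    then have "(\<Sum>n<Suc M. fps_nth (fps_const c) n * x ^ n) = c" for x :: complex by simp
    then show ?thesis unfolding Suc by simp
  qed
qed

lemma asymptotic_bounded:
  assumes "asymptotic_on_ray d f a"
  shows "(\<lambda>s. f (of_real s * cis d)) \<in> O[at_right 0](\<lambda>s. 1)"
  using assms[unfolded asymptotic_on_ray_def, rule_format, of 0] by simp

text \<open>With the truncations P and Q, write fg = (f - P) g + P (g - Q) + PQ. The product PQ
  differs from the truncated Cauchy product only by powers of order at least N.\<close>

lemma asymptotic_mult:
  assumes f: "asymptotic_on_ray d f a" and g: "asymptotic_on_ray d g b"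
  shows "asymptotic_on_ray d (\<lambda>x. f x * g x) (a * b)"
  unfolding asymptotic_on_ray_def
proof
  fix N
  let ?e = "\<lambda>s. of_real s * cis d" and ?O = "O[at_right 0](\<lambda>s. complex_of_real (s ^ N))"
  define P where "P s = (\<Sum>n<N. fps_nth a n * ?e s ^ n)" for s
  define Q where "Q s = (\<Sum>n<N. fps_nth b n * ?e s ^ n)" for s
  have P1: "P \<in> O[at_right 0](\<lambda>s. 1)"
    unfolding P_def[abs_def] using ray_power_bigo[of 0 _ _ d] by (intro big_sum_in_bigo) simp
  have fP: "(\<lambda>s. f (?e s) - P s) \<in> ?O" and gQ: "(\<lambda>s. g (?e s) - Q s) \<in> ?O"
    using f g unfolding asymptotic_on_ray_def P_def Q_def by blast+
  have 1: "(\<lambda>s. (f (?e s) - P s) * g (?e s)) \<in> ?O"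
    using landau_o.big.mult[OF fP asymptotic_bounded[OF g]] by simp
  have 2: "(\<lambda>s. P s * (g (?e s) - Q s)) \<in> ?O"
    using landau_o.big.mult[OF P1 gQ] by simp
  have 3: "(\<lambda>s. P s * Q s - (\<Sum>n<N. fps_nth (a * b) n * ?e s ^ n)) \<in> ?O"
  proof -
    have "P s * Q s - (\<Sum>n<N. fps_nth (a * b) n * ?e s ^ n) = (\<Sum>i<N. \<Sum>j\<in>{N - i..<N}. (fps_nth a i * fps_nth b j) * ?e s ^ (i + j))" for s
    proof -
      have "(\<Sum>n<N. fps_nth (a * b) n * ?e s ^ n) = (\<Sum>n<N. \<Sum>i\<le>n. fps_nth a i * fps_nth b (n - i) * ?e s ^ (i + (n - i)))"
        by (intro sum.cong refl) (simp add: fps_mult_nth sum_distrib_right atMost_atLeast0)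
      also have "\<dots> = (\<Sum>i<N. \<Sum>j<N - i. fps_nth a i * fps_nth b j * ?e s ^ (i + j))"
        by (rule sum_triangle_diff[symmetric])
      finally have t: "(\<Sum>n<N. fps_nth (a * b) n * ?e s ^ n) = (\<Sum>i<N. \<Sum>j<N - i. fps_nth a i * fps_nth b j * ?e s ^ (i + j))" .
      have "P s * Q s = (\<Sum>i<N. \<Sum>j<N. fps_nth a i * fps_nth b j * ?e s ^ (i + j))"
        unfolding P_def Q_def sum_product by (simp add: power_add mult_ac)
      also have "\<dots> = (\<Sum>i<N. (\<Sum>j<N - i. fps_nth a i * fps_nth b j * ?e s ^ (i + j)) + (\<Sum>j\<in>{N - i..<N}. fps_nth a i * fps_nth b j * ?e s ^ (i + j)))"
      proof (rule sum.cong[OF refl])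
        fix i
        have sp: "{..<N} = {..<N - i} \<union> {N - i..<N}" by auto
        show "(\<Sum>j<N. fps_nth a i * fps_nth b j * ?e s ^ (i + j)) = (\<Sum>j<N - i. fps_nth a i * fps_nth b j * ?e s ^ (i + j)) + (\<Sum>j\<in>{N - i..<N}. fps_nth a i * fps_nth b j * ?e s ^ (i + j))"
          by (subst sp, rule sum.union_disjoint) auto
      qed
      finally show ?thesis unfolding t by (simp add: sum.distrib)
    qed
    moreover have "(\<lambda>s. \<Sum>i<N. \<Sum>j\<in>{N - i..<N}. (fps_nth a i * fps_nth b j) * ?e s ^ (i + j)) \<in> ?O"
      by (intro big_sum_in_bigo ray_power_bigo) auto
    ultimately show ?thesis by simp
  qed
  have "(\<lambda>s. ((f (?e s) - P s) * g (?e s) + P s * (g (?e s) - Q s)) + (P s * Q s - (\<Sum>n<N. fps_nth (a * b) n * ?e s ^ n))) \<in> ?O"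
    by (rule sum_in_bigo(1)[OF sum_in_bigo(1)[OF 1 2] 3])
  then show "(\<lambda>s. f (?e s) * g (?e s) - (\<Sum>n<N. fps_nth (a * b) n * ?e s ^ n)) \<in> ?O"
    by (simp add: algebra_simps)
qed

lemma asymptotic_sum:
  assumes "\<And>i. i \<in> S \<Longrightarrow> asymptotic_on_ray d (f i) (a i)"
  shows "asymptotic_on_ray d (\<lambda>x. \<Sum>i\<in>S. f i x) (\<Sum>i\<in>S. a i)"
  using assms
proof (induction S rule: infinite_finite_induct)
  case (insert i S)
  then show ?case using asymptotic_add[of d "f i" "a i" "\<lambda>x. \<Sum>i\<in>S. f i x" "\<Sum>i\<in>S. a i"] by simp
qed (use asymptotic_const[of d 0] in auto)

lemma asymptotic_power:
  assumes "asymptotic_on_ray d f a"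
  shows "asymptotic_on_ray d (\<lambda>x. f x ^ n) (a ^ n)"
proof (induction n)
  case 0
  then show ?case using asymptotic_const[of d 1] by simp
next
  case (Suc n)
  then show ?case using asymptotic_mult[OF assms Suc] by simp
qed

lemma asymptotic_fps_expansion:
  assumes f: "f holomorphic_on ball 0 r" and r: "r > 0"
  shows "asymptotic_on_ray d f (fps_expansion f 0)"
  unfolding asymptotic_on_ray_def
proof
  fix N
  have "continuous_on (cball 0 (r / 2)) f"
    by (rule continuous_on_subset[OF holomorphic_on_imp_continuous_on[OF f]]) (use r in auto)
  then have "bounded (f ` cball 0 (r / 2))" by (intro compact_imp_bounded compact_continuous_image) auto
  then obtain K where "\<forall>y\<in>f ` cball 0 (r / 2). norm y \<le> K" unfolding bounded_iff by blast
  then have K: "cmod (f x) \<le> K" if "x \<in> ball 0 (r / 2)" for x :: complex using that by auto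
  have f': "f holomorphic_on ball 0 (r / 2)" using f by (rule holomorphic_on_subset) (use r in auto)
  show "(\<lambda>s. f (of_real s * cis d) - (\<Sum>n<N. fps_nth (fps_expansion f 0) n * (of_real s * cis d) ^ n)) \<in> O[at_right 0](\<lambda>s. of_real (s ^ N))"
  proof (rule bigoI[where c = "3 * K * (2 / (r / 2)) ^ N"])
    have "\<forall>\<^sub>F s in at_right 0. s \<in> {0<..<r / 2}" using r by (intro eventually_at_right_real) auto
    then show "\<forall>\<^sub>F s in at_right 0. norm (f (of_real s * cis d) - (\<Sum>n<N. fps_nth (fps_expansion f 0) n * (of_real s * cis d) ^ n)) \<le> 3 * K * (2 / (r / 2)) ^ N * norm (complex_of_real (s ^ N))"
    proof eventually_elim
      case (elim s)
      then have n: "cmod (of_real s * cis d) = s" by (simp add: norm_mult)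
      have "cmod (f (of_real s * cis d) - (\<Sum>n<N. taylor_coeff f n * (of_real s * cis d) ^ n)) \<le> 3 * K * (2 * cmod (of_real s * cis d) / (r / 2)) ^ N"
        by (rule taylor_remainder[OF f' _ K]) (use r elim n in auto)
      also have "\<dots> = 3 * K * (2 / (r / 2)) ^ N * norm (complex_of_real (s ^ N))"
        unfolding n using elim by (simp add: power_divide power_mult_distrib norm_power)
      finally show ?case by (simp add: taylor_coeff_def fps_expansion_def)
    qed
  qed
qed

lemma asymptotic_X: "asymptotic_on_ray d (\<lambda>x. x) fps_X"
proof -
  have "fps_expansion (\<lambda>x::complex. x) 0 = fps_X"
    by (rule fps_ext) (auto simp: fps_expansion_def fps_X_def higher_deriv_ident)
  then show ?thesis using asymptotic_fps_expansion[of "\<lambda>x. x" 1 d] by (simp add: holomorphic_on_ident)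
qed

text \<open>Cauchy's inequality on a fixed circle around z makes the differential operator,
  evaluated at z, a bounded functional for the supremum norm on H.\<close>

lemma poly_diff_bound:
  assumes H: "open H" and z: "z \<in> H"
  obtains K where "K > 0" "\<And>g M. g holomorphic_on H \<Longrightarrow> (\<And>\<zeta>. \<zeta> \<in> H \<Longrightarrow> cmod (g \<zeta>) \<le> M) \<Longrightarrow> cmod (poly_diff R g z) \<le> K * M"
proof -
  obtain r where r: "r > 0" "cball z r \<subseteq> H" using H z open_contains_cball by blast
  define K where "K = (\<Sum>i\<le>degree R. cmod (coeff R i) * (fact i / r ^ i)) + 1"
  show ?thesis
  proof (rule that[of K])
    show "K > 0" unfolding K_def using r by (intro add_nonneg_pos sum_nonneg) auto
    fix g :: "complex \<Rightarrow> complex" and M assume g: "g holomorphic_on H" and M: "\<And>\<zeta>. \<zeta> \<in> H \<Longrightarrow> cmod (g \<zeta>) \<le> M"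
    have M0: "M \<ge> 0" using M[OF z] norm_ge_zero order_trans by blast
    have "cmod ((deriv ^^ i) g z) \<le> fact i * M / r ^ i" for i
    proof (rule Cauchy_inequality)
      show "g holomorphic_on ball z r" by (rule holomorphic_on_subset[OF g]) (use r in auto)
      show "continuous_on (cball z r) g" using holomorphic_on_imp_continuous_on[OF g] r(2) by (rule continuous_on_subset)
      show "cmod (g x) \<le> M" if "cmod (z - x) = r" for x
        using r(2) that by (intro M) (auto simp: dist_norm)
    qed (rule r)
    then have "cmod (poly_diff R g z) \<le> (\<Sum>i\<le>degree R. cmod (coeff R i) * (fact i * M / r ^ i))"
      unfolding poly_diff_def by (intro order_trans[OF norm_sum sum_mono]) (auto simp only: norm_mult intro!: mult_left_mono norm_ge_zero)
    also have "\<dots> = (\<Sum>i\<le>degree R. cmod (coeff R i) * (fact i / r ^ i)) * M"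
      unfolding sum_distrib_right by (intro sum.cong refl) simp
    also have "\<dots> \<le> K * M" unfolding K_def using M0 by (intro mult_right_mono) auto
    finally show "cmod (poly_diff R g z) \<le> K * M" .
  qed
qed

lemma poly_diff_remainder:
  fixes h :: "nat \<Rightarrow> complex \<Rightarrow> complex"
  assumes H: "open H" and z: "z \<in> H" and g: "g holomorphic_on H" and h: "\<And>n. h n holomorphic_on H"
  shows "poly_diff R (\<lambda>\<zeta>. g \<zeta> - (\<Sum>n<N. h n \<zeta> * c n)) z = poly_diff R g z - (\<Sum>n<N. poly_diff R (h n) z * c n)"
proof -
  have hd: "(deriv ^^ i) (\<lambda>\<zeta>. g \<zeta> - (\<Sum>n<N. h n \<zeta> * c n)) z = (deriv ^^ i) g z - (\<Sum>n<N. (deriv ^^ i) (h n) z * c n)" for i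
  proof (induction N)
    case (Suc N)
    let ?G = "\<lambda>\<zeta>. g \<zeta> - (\<Sum>n<N. h n \<zeta> * c n)"
    have G: "?G holomorphic_on H" by (intro holomorphic_intros g h)
    have c: "(\<lambda>\<zeta>. c N * h N \<zeta>) holomorphic_on H" by (intro holomorphic_intros h)
    have "(\<lambda>\<zeta>. g \<zeta> - (\<Sum>n<Suc N. h n \<zeta> * c n)) = (\<lambda>\<zeta>. ?G \<zeta> - c N * h N \<zeta>)" by (auto simp: algebra_simps)
    then have "(deriv ^^ i) (\<lambda>\<zeta>. g \<zeta> - (\<Sum>n<Suc N. h n \<zeta> * c n)) z = (deriv ^^ i) ?G z - (deriv ^^ i) (\<lambda>\<zeta>. c N * h N \<zeta>) z"
      using higher_deriv_diff[OF G c H z] by simp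
    also have "(deriv ^^ i) (\<lambda>\<zeta>. c N * h N \<zeta>) z = c N * (deriv ^^ i) (h N) z"
      by (rule higher_deriv_cmult[OF h z H])
    finally show ?case unfolding Suc by (simp add: diff_diff_eq mult.commute)
  qed simp
  show ?thesis
    unfolding poly_diff_def hd right_diff_distrib sum_subtractf
    by (simp add: sum_distrib_left sum_distrib_right mult.assoc sum.swap[of _ "{..<N}"])
qed

text \<open>The remainder is small uniformly on H, and \<open>poly_diff_bound\<close> transfers this
  to its derivatives at z; asymptotics at the single point z would not permit
  differentiation.\<close>

lemma asymptotic_poly_diff:
  assumes H: "open H" and z: "z \<in> H" and g: "\<forall>\<^sub>F s in at_right 0. (\<lambda>\<zeta>. g \<zeta> (of_real s * cis d)) holomorphic_on H"
    and h: "\<And>n. h n holomorphic_on H"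
    and est: "\<And>N. \<exists>C. \<forall>\<^sub>F s in at_right 0. \<forall>\<zeta>\<in>H. cmod (g \<zeta> (of_real s * cis d) - (\<Sum>n<N. h n \<zeta> * (of_real s * cis d) ^ n)) \<le> C * s ^ N"
  shows "asymptotic_on_ray d (\<lambda>\<epsilon>. poly_diff R (\<lambda>\<zeta>. g \<zeta> \<epsilon>) z) (Abs_fps (\<lambda>n. poly_diff R (h n) z))"
  unfolding asymptotic_on_ray_def
proof
  fix N
  obtain K where K: "K > 0" "\<And>g M. g holomorphic_on H \<Longrightarrow> (\<And>\<zeta>. \<zeta> \<in> H \<Longrightarrow> cmod (g \<zeta>) \<le> M) \<Longrightarrow> cmod (poly_diff R g z) \<le> K * M"
    using poly_diff_bound[OF H z] by metis
  obtain C where C: "\<forall>\<^sub>F s in at_right 0. \<forall>\<zeta>\<in>H. cmod (g \<zeta> (of_real s * cis d) - (\<Sum>n<N. h n \<zeta> * (of_real s * cis d) ^ n)) \<le> C * s ^ N"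
    using est by blast
  show "(\<lambda>s. poly_diff R (\<lambda>\<zeta>. g \<zeta> (of_real s * cis d)) z - (\<Sum>n<N. fps_nth (Abs_fps (\<lambda>n. poly_diff R (h n) z)) n * (of_real s * cis d) ^ n)) \<in> O[at_right 0](\<lambda>s. of_real (s ^ N))"
  proof (rule bigoI[where c = "K * C"])
    show "\<forall>\<^sub>F s in at_right 0. norm (poly_diff R (\<lambda>\<zeta>. g \<zeta> (of_real s * cis d)) z - (\<Sum>n<N. fps_nth (Abs_fps (\<lambda>n. poly_diff R (h n) z)) n * (of_real s * cis d) ^ n)) \<le> K * C * norm (complex_of_real (s ^ N))"
      using C g eventually_at_right_less[of "0::real"]
    proof eventually_elim
      case (elim s)
      have "cmod (poly_diff R (\<lambda>\<zeta>. g \<zeta> (of_real s * cis d) - (\<Sum>n<N. h n \<zeta> * (of_real s * cis d) ^ n)) z) \<le> K * (C * s ^ N)"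
        by (rule K(2)) (use elim h in \<open>auto intro!: holomorphic_intros\<close>)
      then show ?case
        unfolding poly_diff_remainder[OF H z elim(2) h] using elim by (simp add: norm_power)
    qed
  qed
qed

section \<open>The asymptotic expansion and the formal solution\<close>

lemma qgevrey_expansion_0:
  assumes o: "open T" "open H" "open V" and ne: "T \<times> H \<noteq> {}"
  shows "qgevrey_expansion q k T H V (\<lambda>\<epsilon> x. 0) (\<lambda>n x. 0)"
  unfolding qgevrey_expansion_def
proof (intro conjI allI impI)
  show "holo_into (F_space T H) (F_norm T H) V (\<lambda>\<epsilon> x. 0)"
    by (rule holo_into_F_space[OF o ne, where M = 0]) (auto intro: F_space_0 o)
  show "(\<lambda>x. 0) \<in> F_space T H" by (rule F_space_0[OF o(1,2)])
  fix U r
  have "F_norm T H (\<lambda>x. 0 - (\<Sum>n\<le>N. 0 * \<epsilon> ^ n)) \<le> 1 * 1 ^ (N + 1) * q powr (real N * (real N + 1) / (2 * k)) * cmod \<epsilon> ^ (N + 1)" for \<epsilon> N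
    by (rule F_norm_le[OF ne]) simp
  from this show "\<exists>A>0. \<exists>C>0. \<forall>\<epsilon>\<in>U. \<forall>N. F_norm T H (\<lambda>x. 0 - (\<Sum>n\<le>N. 0 * \<epsilon> ^ n)) \<le> C * A ^ (N + 1) * q powr (real N * (real N + 1) / (2 * k)) * cmod \<epsilon> ^ (N + 1)"
    by (metis zero_less_one)
qed

text \<open>A supremum bounds the values only if they are bounded, so the remainder is first shown
  to lie in \<open>F_space\<close>.\<close>

lemma qgevrey_expansion_pointwise:
  assumes o: "open T" "open H" and g: "qgevrey_expansion q k T H V g gh"
    and U: "0 < r" "is_sector r U" "closure U - {0} \<subseteq> V" "U \<subseteq> V"
  shows "\<exists>C. \<forall>\<epsilon>\<in>U. \<forall>x\<in>T \<times> H. cmod (g \<epsilon> x - (\<Sum>n\<le>N. gh n x * \<epsilon> ^ n)) \<le> C * cmod \<epsilon> ^ (N + 1)"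
proof -
  obtain A C where AC: "\<And>\<epsilon> N. \<epsilon> \<in> U \<Longrightarrow> F_norm T H (\<lambda>x. g \<epsilon> x - (\<Sum>n\<le>N. gh n x * \<epsilon> ^ n)) \<le>
      C * A ^ (N + 1) * q powr (real N * (real N + 1) / (2 * k)) * cmod \<epsilon> ^ (N + 1)"
    using g U unfolding qgevrey_expansion_def by blast
  show ?thesis
  proof (intro exI ballI)
    fix \<epsilon> x assume e: "\<epsilon> \<in> U" and x: "x \<in> T \<times> H"
    have gF: "g \<epsilon> \<in> F_space T H" "\<And>n. gh n \<in> F_space T H"
      using g e U(4) unfolding qgevrey_expansion_def holo_into_def by auto
    have "(\<lambda>x. 1 * g \<epsilon> x + - 1 * (\<Sum>n\<le>N. gh n x * \<epsilon> ^ n)) \<in> F_space T H"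
      by (intro F_space_add o gF F_space_sum)
    then have "bounded ((\<lambda>x. g \<epsilon> x - (\<Sum>n\<le>N. gh n x * \<epsilon> ^ n)) ` (T \<times> H))" by (simp add: F_space_def)
    from F_norm_ge[OF this x] AC[OF e, of N]
    show "cmod (g \<epsilon> x - (\<Sum>n\<le>N. gh n x * \<epsilon> ^ n)) \<le> (C * A ^ (N + 1) * q powr (real N * (real N + 1) / (2 * k))) * cmod \<epsilon> ^ (N + 1)"
      by linarith
  qed
qed

context q_solutions
begin

lemma H_open: "open H" and H_nonempty: "0 \<in> H"
proof -
  have "H = {z. - \<beta>' < Im z} \<inter> {z. Im z < \<beta>'}" unfolding H_eq strip_def by auto
  then show "open H" by (auto intro!: open_Int open_halfspace_Im_gt open_halfspace_Im_lt)
  show "0 \<in> H" unfolding H_eq strip_def using beta' by simp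
qed

lemma T_open: "open T"
  using T sector_open unfolding is_sector_def by blast

lemma T_nonempty: "T \<noteq> {}"
proof -
  obtain d0 a where "0 < a" "T = sector d0 a r\<^sub>T" using T unfolding is_sector_def by blast
  moreover have "0 < r\<^sub>T / 2 \<and> r\<^sub>T / 2 < r\<^sub>T \<and> \<bar>d0 - d0\<bar> < a" using small \<open>0 < a\<close> by simp
  ultimately have "of_real (r\<^sub>T / 2) * cis d0 \<in> T" unfolding sector_def by blast
  then show ?thesis by blast
qed

lemma TH_nonempty: "T \<times> H \<noteq> {}" using T_nonempty H_nonempty by blast

lemma E_open: "p < n\<^sub>E \<Longrightarrow> open (E p)"
  using covering sector_open unfolding good_covering_def is_sector_def by metis

lemma aco_bound:
  obtains K where "K > 0" "\<And>n j m. cmod (aco n j m) \<le> K / \<rho> ^ n / \<epsilon>\<^sub>0 ^ j / E_weight \<beta> \<mu> m"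
proof -
  obtain K1 where K1: "K1 > 0" "\<And>n m \<epsilon>. \<epsilon> \<in> ball 0 \<epsilon>\<^sub>0 \<Longrightarrow> cmod (wco n m \<epsilon>) \<le> K1 / E_weight \<beta> \<mu> m / \<rho> ^ n"
    "\<And>n m. wco n m holomorphic_on ball 0 \<epsilon>\<^sub>0" using wco_bound by metis
  show ?thesis
  proof (rule that[OF K1(1)])
    fix n j m
    have "cmod (aco n j m) \<le> K1 / E_weight \<beta> \<mu> m / \<rho> ^ n / \<epsilon>\<^sub>0 ^ j"
      unfolding aco_def by (rule taylor_coeff_bound[OF K1(3) eps0 K1(2)])
    then show "cmod (aco n j m) \<le> K1 / \<rho> ^ n / \<epsilon>\<^sub>0 ^ j / E_weight \<beta> \<mu> m" by (simp add: mult_ac)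
  qed
qed

text \<open>The inverse Fourier transform is applied to the finite sum term by term and to the
  remainder as a whole. The weight 1 / \<open>E_weight\<close> in the remainder turns into the
  factor \<open>fourier_bound (\<beta> - \<beta>')\<close>.\<close>

lemma u_expansion:
  assumes p: "p < n\<^sub>E"
  obtains K A where "K > 0" "A > 0"
    "\<And>\<epsilon> t z N. \<epsilon> \<in> E p \<Longrightarrow> t \<in> T \<Longrightarrow> z \<in> H \<Longrightarrow>
      cmod (u p t z \<epsilon> - (\<Sum>n<N. usol n (t, z) * \<epsilon> ^ n)) \<le> K * A ^ N * exp (la1 * (real N)\<^sup>2 / 2) * cmod \<epsilon> ^ N"
proof -
  obtain K A where KA: "K > 0" "A > 0"
    "\<And>\<epsilon> t m N. \<epsilon> \<in> E p \<Longrightarrow> t \<in> T \<Longrightarrow>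
      cmod (lap p \<epsilon> (\<epsilon> * t) m - (\<Sum>i<N. \<Sum>n\<le>i. uco n * t ^ n * \<epsilon> ^ i * aco n (i - n) m))
        \<le> K * A ^ N * exp (la1 * (real N)\<^sup>2 / 2) * cmod \<epsilon> ^ N / E_weight \<beta> \<mu> m"
    by (rule lap_expansion[OF p]) blast
  obtain Ka where Ka: "Ka > 0" "\<And>n j m. cmod (aco n j m) \<le> Ka / \<rho> ^ n / \<epsilon>\<^sub>0 ^ j / E_weight \<beta> \<mu> m"
    by (rule aco_bound) blast
  define FB where "FB = fourier_bound (\<beta> - \<beta>')"
  have FB: "FB \<ge> 0" by (simp add: FB_def fourier_bound_nonneg)
  show ?thesis
  proof (rule that[of "K * (FB + 1)" A])
    show "K * (FB + 1) > 0" "A > 0" using KA FB by auto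
    fix \<epsilon> t z and N :: nat assume e: "\<epsilon> \<in> E p" and t: "t \<in> T" and z: "z \<in> H"
    have z': "\<bar>Im z\<bar> \<le> \<beta>'" using z unfolding H_eq strip_def by simp
    have e0: "\<epsilon> \<in> ball 0 \<epsilon>\<^sub>0" using E_sub[OF p e] .
    have x: "\<epsilon> * t \<in> Rb p" using eps_t[OF p t e] .
    have ai: "integrable lborel (\<lambda>m. aco n j m * exp (\<i> * z * of_real m))" for n j
      by (rule fourier_integrand(1)[OF mu_nonneg beta'(2) z' _ aco_measurable Ka(2)]) (use Ka rho eps0 in auto)
    let ?S = "Sigma {..<N} (\<lambda>i. {..i})"
    let ?a = "\<lambda>(i, n). uco n * t ^ n * \<epsilon> ^ i" and ?h = "\<lambda>(i, n). aco n (i - n)"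
    define h where "h m = (\<Sum>x\<in>?S. ?a x * ?h x m)" for m
    have h_eq: "h m = (\<Sum>i<N. \<Sum>n\<le>i. uco n * t ^ n * \<epsilon> ^ i * aco n (i - n) m)" for m
      unfolding h_def by (subst sum.Sigma) (auto simp: case_prod_unfold)
    have hi: "integrable lborel (\<lambda>m. h m * exp (\<i> * z * of_real m))"
    proof -
      have "integrable lborel (\<lambda>m. \<Sum>x\<in>?S. ?a x * (?h x m * exp (\<i> * z * of_real m)))"
        by (intro Bochner_Integration.integrable_sum integrable_mult_right) (auto simp: ai)
      then show ?thesis unfolding h_def by (simp add: sum_distrib_right mult.assoc)
    qed
    have hm: "h \<in> borel_measurable borel"
      unfolding h_def[abs_def] by (intro borel_measurable_sum borel_measurable_times borel_measurable_const) (auto simp: aco_measurable)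
    have "inv_fourier h z = (\<Sum>x\<in>?S. ?a x * inv_fourier (?h x) z)"
      unfolding h_def[abs_def] by (rule inv_fourier_sum) (auto simp: ai)
    also have "\<dots> = (\<Sum>i<N. \<Sum>n\<le>i. uco n * t ^ n * \<epsilon> ^ i * inv_fourier (aco n (i - n)) z)"
      by (subst sum.Sigma) (auto simp: case_prod_unfold)
    also have "\<dots> = (\<Sum>i<N. usol i (t, z) * \<epsilon> ^ i)"
      unfolding usol_def case_prod_conv sum_distrib_right by (intro sum.cong refl) (simp add: mult_ac)
    finally have ih: "inv_fourier h z = (\<Sum>i<N. usol i (t, z) * \<epsilon> ^ i)" .
    \<comment> \<open>The case N = 0 of \<open>lap_expansion\<close> supplies the weighted bound for
      the transform itself.\<close>
    have li: "integrable lborel (\<lambda>m. lap p \<epsilon> (\<epsilon> * t) m * exp (\<i> * z * of_real m))"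
    proof (rule fourier_integrand(1)[OF mu_nonneg beta'(2) z' less_imp_le[OF KA(1)] lap_measurable[OF p e0 x]])
      show "cmod (lap p \<epsilon> (\<epsilon> * t) m) \<le> K / E_weight \<beta> \<mu> m" for m using KA(3)[OF e t, of m 0] by simp
    qed
    let ?M = "K * A ^ N * exp (la1 * (real N)\<^sup>2 / 2) * cmod \<epsilon> ^ N"
    have M0: "?M \<ge> 0" using KA by simp
    have "cmod (inv_fourier (\<lambda>m. lap p \<epsilon> (\<epsilon> * t) m - h m) z) \<le> ?M * FB"
      unfolding FB_def
    proof (rule fourier_integrand(2)[OF mu_nonneg beta'(2) z' M0])
      show "(\<lambda>m. lap p \<epsilon> (\<epsilon> * t) m - h m) \<in> borel_measurable borel"
        by (intro borel_measurable_diff lap_measurable[OF p e0 x] hm)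
      show "cmod (lap p \<epsilon> (\<epsilon> * t) m - h m) \<le> ?M / E_weight \<beta> \<mu> m" for m
        unfolding h_eq by (rule KA(3)[OF e t])
    qed
    also have "\<dots> \<le> ?M * (FB + 1)" using M0 by (intro mult_left_mono) auto
    finally have "cmod (inv_fourier (\<lambda>m. lap p \<epsilon> (\<epsilon> * t) m - h m) z) \<le> ?M * (FB + 1)" .
    then show "cmod (u p t z \<epsilon> - (\<Sum>n<N. usol n (t, z) * \<epsilon> ^ n)) \<le> K * (FB + 1) * A ^ N * exp (la1 * (real N)\<^sup>2 / 2) * cmod \<epsilon> ^ N"
      unfolding u_eq_lap[OF p t e] inv_fourier_diff[OF li hi] ih by (simp add: mult_ac)
  qed
qed

lemma u_F_space: "p < n\<^sub>E \<Longrightarrow> \<epsilon> \<in> E p \<Longrightarrow> (\<lambda>(t, z). u p t z \<epsilon>) \<in> F_space T H"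
proof -
  assume p: "p < n\<^sub>E" and e: "\<epsilon> \<in> E p"
  have "(\<lambda>(t, z). u p t z \<epsilon>) ` (T \<times> H) \<subseteq> (\<lambda>(t, z, \<epsilon>). u p t z \<epsilon>) ` (T \<times> H \<times> E p)"
    using e by force
  then have "bounded ((\<lambda>(t, z). u p t z \<epsilon>) ` (T \<times> H))" using u_bounded[OF p] bounded_subset by blast
  then show ?thesis unfolding F_space_def using holomorphic3_slices(1)[OF u_holo[OF p] e] by simp
qed

lemma E_ray:
  obtains d0 a where "0 < a" "a \<le> pi" "E 0 = sector d0 a \<epsilon>\<^sub>0"
    "\<And>s. 0 < s \<Longrightarrow> s < \<epsilon>\<^sub>0 \<Longrightarrow> of_real s * cis d0 \<in> E 0"
proof -
  have "is_sector \<epsilon>\<^sub>0 (E 0)" using covering nE unfolding good_covering_def by simp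
  then obtain d0 a where a: "0 < a" "a \<le> pi" "E 0 = sector d0 a \<epsilon>\<^sub>0"
    unfolding is_sector_def by blast
  have "of_real s * cis d0 \<in> E 0" if "0 < s" "s < \<epsilon>\<^sub>0" for s
  proof -
    have "\<bar>d0 - d0\<bar> < a" using a(1) by simp
    then show ?thesis unfolding a(3) sector_def using that by blast
  qed
  then show ?thesis by (rule that[OF a])
qed

text \<open>By strong induction, \<open>usol N\<close> is the uniform limit of (u - lower terms) /
  \<epsilon>^N along points of a ray in \<open>E 0\<close>, so holomorphy and boundedness in (t, z)
  are inherited from u.\<close>

lemma usol_F_space: "usol N \<in> F_space T H"
proof (induction N rule: less_induct)
  case (less N)
  obtain K A where KA: "K > 0" "A > 0"
    "\<And>\<epsilon> t z N. \<epsilon> \<in> E 0 \<Longrightarrow> t \<in> T \<Longrightarrow> z \<in> H \<Longrightarrow>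
      cmod (u 0 t z \<epsilon> - (\<Sum>n<N. usol n (t, z) * \<epsilon> ^ n)) \<le> K * A ^ N * exp (la1 * (real N)\<^sup>2 / 2) * cmod \<epsilon> ^ N"
    by (rule u_expansion[OF nE]) blast
  obtain d0 where ray: "\<And>s. 0 < s \<Longrightarrow> s < \<epsilon>\<^sub>0 \<Longrightarrow> of_real s * cis d0 \<in> E 0" by (rule E_ray) blast
  define s where "s i = \<epsilon>\<^sub>0 / real (i + 2)" for i :: nat
  define \<epsilon> where "\<epsilon> i = of_real (s i) * cis d0" for i
  have s: "0 < s i" "s i < \<epsilon>\<^sub>0" for i using eps0 by (auto simp: s_def field_simps add_pos_nonneg)
  have eE: "\<epsilon> i \<in> E 0" and en: "cmod (\<epsilon> i) = s i" for i
    using ray[OF s] s(1)[of i] by (auto simp: \<epsilon>_def norm_mult)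
  have e0: "\<epsilon> i \<noteq> 0" for i using en[of i] s(1)[of i] by auto
  define C where "C = K * A ^ Suc N * exp (la1 * (real (Suc N))\<^sup>2 / 2)"
  show ?case
  proof (rule F_space_closed_le[OF T_open H_open])
    show "(\<lambda>x. (1 / \<epsilon> i ^ N) * (case x of (t, z) \<Rightarrow> u 0 t z (\<epsilon> i)) + (- (1 / \<epsilon> i ^ N)) * (\<Sum>n<N. usol n x * \<epsilon> i ^ n)) \<in> F_space T H" for i
      by (intro F_space_add T_open H_open u_F_space[OF nE eE] F_space_sum less) auto
    have "(\<lambda>i. C * s i) \<longlonglongrightarrow> C * 0" unfolding s_def by (intro tendsto_mult tendsto_const) real_asymp
    then show "(\<lambda>i. C * s i) \<longlonglongrightarrow> 0" by simp
    fix i x assume "x \<in> T \<times> H"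
    then obtain t z where x: "x = (t, z)" "t \<in> T" "z \<in> H" by auto
    have "(1 / \<epsilon> i ^ N) * (case x of (t, z) \<Rightarrow> u 0 t z (\<epsilon> i)) + (- (1 / \<epsilon> i ^ N)) * (\<Sum>n<N. usol n x * \<epsilon> i ^ n) - usol N x
      = (u 0 t z (\<epsilon> i) - (\<Sum>n<Suc N. usol n (t, z) * \<epsilon> i ^ n)) / \<epsilon> i ^ N"
      using e0[of i] by (simp add: x(1) field_simps)
    also have "cmod \<dots> \<le> C * s i"
    proof -
      have "cmod (u 0 t z (\<epsilon> i) - (\<Sum>n<Suc N. usol n (t, z) * \<epsilon> i ^ n)) \<le> C * s i ^ Suc N"
        using KA(3)[OF eE x(2,3), of i "Suc N"] unfolding C_def en .
      then show ?thesis using s(1)[of i] unfolding norm_divide norm_power en by (simp add: divide_le_eq mult_ac)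
    qed
    finally show "cmod ((1 / \<epsilon> i ^ N) * (case x of (t, z) \<Rightarrow> u 0 t z (\<epsilon> i)) + (- (1 / \<epsilon> i ^ N)) * (\<Sum>n<N. usol n x * \<epsilon> i ^ n) - usol N x) \<le> C * s i" .
  qed
qed

lemma u_qgevrey:
  assumes p: "p < n\<^sub>E"
  shows "qgevrey_expansion q k1 T H (E p) (\<lambda>\<epsilon> (t, z). u p t z \<epsilon>) usol"
  unfolding qgevrey_expansion_def
proof (intro conjI allI impI usol_F_space)
  obtain B where B: "\<forall>y\<in>(\<lambda>(t, z, \<epsilon>). u p t z \<epsilon>) ` (T \<times> H \<times> E p). norm y \<le> B"
    using u_bounded[OF p] unfolding bounded_iff by blast
  show "holo_into (F_space T H) (F_norm T H) (E p) (\<lambda>\<epsilon> (t, z). u p t z \<epsilon>)"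
  proof (rule holo_into_F_space[OF T_open H_open E_open[OF p] TH_nonempty u_F_space[OF p]])
    show "(\<lambda>\<epsilon>. case x of (t, z) \<Rightarrow> u p t z \<epsilon>) holomorphic_on E p" if "x \<in> T \<times> H" for x
      using holomorphic3_slices(2)[OF u_holo[OF p]] that by auto
    show "cmod (case x of (t, z) \<Rightarrow> u p t z \<epsilon>) \<le> B" if "\<epsilon> \<in> E p" "x \<in> T \<times> H" for \<epsilon> x
      using B that by force
  qed
  fix V r assume V: "0 < r \<and> is_sector r V \<and> closure V - {0} \<subseteq> E p"
  have VE: "\<epsilon> \<in> E p" if "\<epsilon> \<in> V" for \<epsilon>
  proof -
    have "\<epsilon> \<noteq> 0" using that V unfolding is_sector_def sector_def by auto
    then show ?thesis using that V closure_subset by blast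
  qed
  obtain K A where KA: "K > 0" "A > 0"
    "\<And>\<epsilon> t z N. \<epsilon> \<in> E p \<Longrightarrow> t \<in> T \<Longrightarrow> z \<in> H \<Longrightarrow>
      cmod (u p t z \<epsilon> - (\<Sum>n<N. usol n (t, z) * \<epsilon> ^ n)) \<le> K * A ^ N * exp (la1 * (real N)\<^sup>2 / 2) * cmod \<epsilon> ^ N"
    by (rule u_expansion[OF p]) blast
  show "\<exists>A>0. \<exists>C>0. \<forall>\<epsilon>\<in>V. \<forall>N. F_norm T H (\<lambda>x. (case x of (t, z) \<Rightarrow> u p t z \<epsilon>) - (\<Sum>n\<le>N. usol n x * \<epsilon> ^ n))
      \<le> C * A ^ (N + 1) * q powr (real N * (real N + 1) / (2 * real k1)) * cmod \<epsilon> ^ (N + 1)"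
  proof (rule exI[of _ "A * exp (la1 / 2)"], intro conjI, use KA in simp, rule exI[of _ K], intro conjI ballI allI, rule KA(1))
    fix \<epsilon> N assume e: "\<epsilon> \<in> V"
    \<comment> \<open>(N+1)^2 = N(N+1) + (N+1): the first summand gives the required power of q, the
      second goes into the geometric constant. The partial sum up to N contains N+1 terms, so
      \<open>u_expansion\<close> is used at Suc N.\<close>
    have ex: "exp (la1 * (real (Suc N))\<^sup>2 / 2) = exp (la1 / 2) ^ (N + 1) * q powr (real N * (real N + 1) / (2 * real k1))"
    proof -
      have "q powr (real N * (real N + 1) / (2 * real k1)) = exp (la1 * (real N * (real N + 1)) / 2)"
        using q by (simp add: powr_def la1_def mult_ac)
      then show ?thesis unfolding exp_of_nat_mult[symmetric] by (simp add: exp_add[symmetric] power2_eq_square field_simps)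
    qed
    have "F_norm T H (\<lambda>x. (case x of (t, z) \<Rightarrow> u p t z \<epsilon>) - (\<Sum>n\<le>N. usol n x * \<epsilon> ^ n)) \<le> K * A ^ Suc N * exp (la1 * (real (Suc N))\<^sup>2 / 2) * cmod \<epsilon> ^ Suc N"
    proof (rule F_norm_le[OF TH_nonempty])
      fix x assume "x \<in> T \<times> H"
      then show "cmod ((case x of (t, z) \<Rightarrow> u p t z \<epsilon>) - (\<Sum>n\<le>N. usol n x * \<epsilon> ^ n)) \<le> K * A ^ Suc N * exp (la1 * (real (Suc N))\<^sup>2 / 2) * cmod \<epsilon> ^ Suc N"
        using KA(3)[OF VE[OF e], of "fst x" "snd x" "Suc N"] unfolding lessThan_Suc_atMost by auto
    qed
    also have "\<dots> = K * (A * exp (la1 / 2)) ^ (N + 1) * q powr (real N * (real N + 1) / (2 * real k1)) * cmod \<epsilon> ^ (N + 1)"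
      unfolding ex by (simp add: power_mult_distrib mult_ac)
    finally show "F_norm T H (\<lambda>x. (case x of (t, z) \<Rightarrow> u p t z \<epsilon>) - (\<Sum>n\<le>N. usol n x * \<epsilon> ^ n))
      \<le> K * (A * exp (la1 / 2)) ^ (N + 1) * q powr (real N * (real N + 1) / (2 * real k1)) * cmod \<epsilon> ^ (N + 1)" .
  qed
qed

text \<open>Evaluation of the inverse Fourier transform at z is linear and bounded on the weighted
  space, so convergence in norm of the difference quotients of \<open>C\<close> gives complex
  differentiability of \<open>c\<close>. Then \<open>c\<close> may be replaced by its Taylor
  series.\<close>

lemma c_holomorphic:
  assumes j: "j \<in> {1..D-1}" "l \<in> I j" and z: "z \<in> H"
  shows "c l j z holomorphic_on ball 0 \<epsilon>\<^sub>0"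
  unfolding holomorphic_on_def
proof
  fix \<epsilon> :: complex assume e: "\<epsilon> \<in> ball 0 \<epsilon>\<^sub>0"
  have z': "\<bar>Im z\<bar> \<le> \<beta>'" using z unfolding H_eq strip_def by simp
  note h = C_holo[OF j, unfolded holo_into_def]
  have CE: "(\<lambda>m. C l j m w) \<in> E_space \<beta> \<mu>" if "w \<in> ball 0 \<epsilon>\<^sub>0" for w :: complex using h that by blast
  obtain C1 :: "real \<Rightarrow> complex" where C1: "C1 \<in> E_space \<beta> \<mu>"
    "((\<lambda>w. E_norm \<beta> \<mu> (\<lambda>m. (C l j m w - C l j m \<epsilon>) / (w - \<epsilon>) - C1 m)) \<longlongrightarrow> 0) (at \<epsilon>)" using h e by blast
  have bound: "\<exists>M\<ge>0. \<forall>m. cmod (g m) \<le> M / E_weight \<beta> \<mu> m" if "g \<in> E_space \<beta> \<mu>" for g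
  proof -
    have "E_weight \<beta> \<mu> m * cmod (g m) \<le> E_norm \<beta> \<mu> g" for m
      unfolding E_norm_def by (rule wnorm_bound) (use that in \<open>auto simp: E_space_def\<close>)
    then have "cmod (g m) \<le> \<bar>E_norm \<beta> \<mu> g\<bar> / E_weight \<beta> \<mu> m" for m
      using abs_ge_self[of "E_norm \<beta> \<mu> g"] by (simp add: pos_le_divide_eq mult.commute) (metis order_trans)
    then show ?thesis by (intro exI[of _ "\<bar>E_norm \<beta> \<mu> g\<bar>"]) auto
  qed
  have meas: "g \<in> borel_measurable borel" if "g \<in> E_space \<beta> \<mu>" for g
    using that by (intro borel_measurable_continuous_onI) (simp add: E_space_def)
  have int: "integrable lborel (\<lambda>m. g m * exp (\<i> * z * of_real m))" if g: "g \<in> E_space \<beta> \<mu>" for g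
    using bound[OF g] fourier_integrand(1)[OF mu_nonneg beta'(2) z' _ meas[OF g]] by blast
  let ?g = "\<lambda>w m. (C l j m w - C l j m \<epsilon>) / (w - \<epsilon>) - C1 m"
  let ?FB = "fourier_bound (\<beta> - \<beta>')"
  have gE: "?g w \<in> E_space \<beta> \<mu>" if w: "w \<in> ball 0 \<epsilon>\<^sub>0" "w \<noteq> \<epsilon>" for w
  proof -
    obtain M1 where M1: "\<And>m. cmod (C l j m w) \<le> M1 / E_weight \<beta> \<mu> m" using bound[OF CE[OF w(1)]] by blast
    obtain M2 where M2: "\<And>m. cmod (C l j m \<epsilon>) \<le> M2 / E_weight \<beta> \<mu> m" using bound[OF CE[OF e]] by blast
    obtain M3 where M3: "\<And>m. cmod (C1 m) \<le> M3 / E_weight \<beta> \<mu> m" using bound[OF C1(1)] by blast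
    have "continuous_on UNIV (?g w)"
      using CE[OF w(1)] CE[OF e] C1(1) w(2) by (intro continuous_intros) (auto simp: E_space_def)
    moreover have "wbounded UNIV (E_weight \<beta> \<mu>) (?g w)"
      unfolding wbounded_def
    proof (rule bdd_aboveI2)
      fix m
      have "cmod (?g w m) \<le> (cmod (C l j m w) + cmod (C l j m \<epsilon>)) / cmod (w - \<epsilon>) + cmod (C1 m)"
        by (intro order_trans[OF norm_triangle_ineq4] add_mono) (auto simp: norm_divide intro!: divide_right_mono norm_triangle_ineq4)
      also have "\<dots> \<le> (M1 / E_weight \<beta> \<mu> m + M2 / E_weight \<beta> \<mu> m) / cmod (w - \<epsilon>) + M3 / E_weight \<beta> \<mu> m"
        by (intro add_mono divide_right_mono M1 M2 M3) auto
      also have "\<dots> = ((M1 + M2) / cmod (w - \<epsilon>) + M3) / E_weight \<beta> \<mu> m"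
        by (simp add: add_divide_distrib mult_ac)
      finally show "E_weight \<beta> \<mu> m * cmod (?g w m) \<le> (M1 + M2) / cmod (w - \<epsilon>) + M3"
        by (simp add: pos_le_divide_eq mult.commute)
    qed
    ultimately show ?thesis by (simp add: E_space_def)
  qed
  have "((\<lambda>w. (c l j z w - c l j z \<epsilon>) / (w - \<epsilon>) - inv_fourier C1 z) \<longlongrightarrow> 0) (at \<epsilon>)"
  proof (rule Lim_null_comparison)
    have "((\<lambda>w. \<bar>E_norm \<beta> \<mu> (?g w)\<bar> * ?FB) \<longlongrightarrow> \<bar>0\<bar> * ?FB) (at \<epsilon>)"
      by (intro tendsto_intros C1(2))
    then show "((\<lambda>w. \<bar>E_norm \<beta> \<mu> (?g w)\<bar> * ?FB) \<longlongrightarrow> 0) (at \<epsilon>)" by simp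
    have "\<forall>\<^sub>F w in at \<epsilon>. w \<in> ball 0 \<epsilon>\<^sub>0" using e by (intro eventually_at_in_open') auto
    then show "\<forall>\<^sub>F w in at \<epsilon>. norm ((c l j z w - c l j z \<epsilon>) / (w - \<epsilon>) - inv_fourier C1 z) \<le> \<bar>E_norm \<beta> \<mu> (?g w)\<bar> * ?FB"
      using eventually_neq_at_within[of \<epsilon> \<epsilon> UNIV]
    proof eventually_elim
      case (elim w)
      let ?q = "\<lambda>m. (C l j m w - C l j m \<epsilon>) / (w - \<epsilon>)"
      have i1: "integrable lborel (\<lambda>m. C l j m w * exp (\<i> * z * of_real m))" by (rule int[OF CE[OF elim(1)]])
      have i2: "integrable lborel (\<lambda>m. C l j m \<epsilon> * exp (\<i> * z * of_real m))" by (rule int[OF CE[OF e]])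
      have iq: "integrable lborel (\<lambda>m. ?q m * exp (\<i> * z * of_real m))"
        using integrable_mult_right[OF Bochner_Integration.integrable_diff[OF i1 i2], of "1 / (w - \<epsilon>)"]
        by (simp add: left_diff_distrib diff_divide_distrib)
      have "inv_fourier ?q z = inv_fourier (\<lambda>m. 1 / (w - \<epsilon>) * (C l j m w - C l j m \<epsilon>)) z" by simp
      also have "\<dots> = 1 / (w - \<epsilon>) * inv_fourier (\<lambda>m. C l j m w - C l j m \<epsilon>) z"
        unfolding inv_fourier_def mult.assoc integral_mult_right_zero by (simp only: mult.left_commute)
      also have "\<dots> = (c l j z w - c l j z \<epsilon>) / (w - \<epsilon>)"
        unfolding inv_fourier_diff[OF i1 i2] c_eq by simp
      finally have "(c l j z w - c l j z \<epsilon>) / (w - \<epsilon>) - inv_fourier C1 z = inv_fourier (?g w) z"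
        using inv_fourier_diff[OF iq int[OF C1(1)]] by simp
      also have "cmod \<dots> \<le> \<bar>E_norm \<beta> \<mu> (?g w)\<bar> * ?FB"
      proof (rule fourier_integrand(2)[OF mu_nonneg beta'(2) z' abs_ge_zero meas[OF gE[OF elim]]])
        fix m
        have "E_weight \<beta> \<mu> m * cmod (?g w m) \<le> E_norm \<beta> \<mu> (?g w)"
          unfolding E_norm_def by (rule wnorm_bound[OF _ order_refl]) (use gE[OF elim] in \<open>auto simp: E_space_def\<close>)
        then have "cmod (?g w m) * E_weight \<beta> \<mu> m \<le> \<bar>E_norm \<beta> \<mu> (?g w)\<bar>" unfolding mult.commute[of "cmod _"] by linarith
        then show "cmod (?g w m) \<le> \<bar>E_norm \<beta> \<mu> (?g w)\<bar> / E_weight \<beta> \<mu> m" by (simp only: pos_le_divide_eq[OF E_weight_pos])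
      qed
      finally show ?case .
    qed
  qed
  then have "((\<lambda>w. (c l j z w - c l j z \<epsilon>) / (w - \<epsilon>)) \<longlongrightarrow> inv_fourier C1 z) (at \<epsilon>)" by (rule LIM_zero_cancel)
  then have "(c l j z has_field_derivative inv_fourier C1 z) (at \<epsilon>)" by (simp add: has_field_derivative_iff)
  then show "c l j z field_differentiable at \<epsilon> within ball 0 \<epsilon>\<^sub>0"
    using field_differentiable_at_within field_differentiable_def by blast
qed

text \<open>At fixed t and z both sides of the main problem for p = 0 are functions of \<epsilon> on
  a ray in \<open>E 0\<close>; their asymptotic series are the two sides of the formal equation and
  must coincide.\<close>

lemma formal_solution:
  assumes t: "t \<in> t_dom q k2 D d\<^sub>D \<delta> T" and z: "z \<in> H"
  shows "formal_op q 1 Q usol t z =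
         (fps_X * fps_const t) ^ d\<^sub>D * formal_op q (real d\<^sub>D / real k2 + 1) (R D) usol t z
         + (\<Sum>j=1..D-1. \<Sum>l\<in>I j. fps_const (t ^ d l j) * fps_X ^ \<Delta> l j *
              (fps_expansion (c l j z) 0 * formal_op q (real (\<delta> j)) (R j) usol t z))
         + formal_op q 1 1 (\<lambda>n x. fh n x / fact n) t z"
proof -
  obtain d0 a where a: "0 < a" "a \<le> pi" "E 0 = sector d0 a \<epsilon>\<^sub>0"
    and ray: "\<And>s. 0 < s \<Longrightarrow> s < \<epsilon>\<^sub>0 \<Longrightarrow> of_real s * cis d0 \<in> E 0" by (rule E_ray) blast
  have ev: "\<forall>\<^sub>F s in at_right 0. of_real s * cis d0 \<in> E 0"
    using eventually_at_right_real[OF eps0] by eventually_elim (use ray in auto)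
  obtain K A where KA: "K > 0" "A > 0"
    "\<And>\<epsilon> t z N. \<epsilon> \<in> E 0 \<Longrightarrow> t \<in> T \<Longrightarrow> z \<in> H \<Longrightarrow>
      cmod (u 0 t z \<epsilon> - (\<Sum>n<N. usol n (t, z) * \<epsilon> ^ n)) \<le> K * A ^ N * exp (la1 * (real N)\<^sup>2 / 2) * cmod \<epsilon> ^ N"
    by (rule u_expansion[OF nE]) blast
  have usol_asym: "asymptotic_on_ray d0 (\<lambda>\<epsilon>. poly_diff R' (\<lambda>\<zeta>. u 0 t' \<zeta> \<epsilon>) z) (Abs_fps (\<lambda>n. poly_diff R' (\<lambda>\<zeta>. usol n (t', \<zeta>)) z))"
    if t': "t' \<in> T" for t' R'
  proof (rule asymptotic_poly_diff[OF H_open z])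
    show "\<forall>\<^sub>F s in at_right 0. (\<lambda>\<zeta>. u 0 t' \<zeta> (of_real s * cis d0)) holomorphic_on H"
      using ev by eventually_elim (use F_spaceD(2)[OF u_F_space[OF nE] t'] in auto)
    show "(\<lambda>\<zeta>. usol n (t', \<zeta>)) holomorphic_on H" for n by (rule F_spaceD(2)[OF usol_F_space t'])
    show "\<exists>C. \<forall>\<^sub>F s in at_right 0. \<forall>\<zeta>\<in>H. cmod (u 0 t' \<zeta> (of_real s * cis d0) - (\<Sum>n<N. usol n (t', \<zeta>) * (of_real s * cis d0) ^ n)) \<le> C * s ^ N" for N
    proof (rule exI[of _ "K * A ^ N * exp (la1 * (real N)\<^sup>2 / 2)"])
      show "\<forall>\<^sub>F s in at_right 0. \<forall>\<zeta>\<in>H. cmod (u 0 t' \<zeta> (of_real s * cis d0) - (\<Sum>n<N. usol n (t', \<zeta>) * (of_real s * cis d0) ^ n)) \<le> K * A ^ N * exp (la1 * (real N)\<^sup>2 / 2) * s ^ N"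
        using ev eventually_at_right_less[of "0::real"]
      proof eventually_elim
        case (elim s)
        then show ?case using KA(3)[OF elim(1) t', of _ N] by (simp add: norm_mult)
      qed
    qed
  qed
  \<comment> \<open>The forcing term is written with the operator of the constant polynomial 1, the
    form in which the formal equation contains it.\<close>
  have f_asym: "asymptotic_on_ray d0 (\<lambda>\<epsilon>. f 0 t' z \<epsilon>) (Abs_fps (\<lambda>n. poly_diff 1 (\<lambda>\<zeta>. fh n (t', \<zeta>) / fact n) z))" if t': "t' \<in> T" for t'
  proof -
    note fe = f_expansion[OF nE]
    have fF: "(\<lambda>(t, z). f 0 t z \<epsilon>) \<in> F_space T H" if "\<epsilon> \<in> E 0" for \<epsilon>
      using fe that unfolding qgevrey_expansion_def holo_into_def by blast
    have fhF: "(\<lambda>x. fh n x / fact n) \<in> F_space T H" for n using fe unfolding qgevrey_expansion_def by blast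
    \<comment> \<open>The q-Gevrey estimate for f is available on subsectors with closure inside
      \<open>E 0\<close> only, so opening and radius are halved; the bisecting ray remains.\<close>
    define V where "V = sector d0 (a / 2) (\<epsilon>\<^sub>0 / 2)"
    have V: "is_sector (\<epsilon>\<^sub>0 / 2) V" unfolding is_sector_def V_def
      by (rule exI[of _ d0], rule exI[of _ "a / 2"]) (use a in auto)
    have VE: "closure V - {0} \<subseteq> E 0"
    proof
      fix x assume "x \<in> closure V - {0}"
      then obtain s \<theta> where x: "x = of_real s * cis \<theta>" "0 \<le> s" "s \<le> \<epsilon>\<^sub>0 / 2" "\<bar>\<theta> - d0\<bar> \<le> a / 2" "x \<noteq> 0"
        using sector_closure_subset[of d0 "a / 2" "\<epsilon>\<^sub>0 / 2"] unfolding V_def by blast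
      then have "s > 0" by (cases "s = 0") auto
      then show "x \<in> E 0" unfolding a(3) sector_def x(1) using x a eps0 by (intro CollectI) (rule exI[of _ s], rule exI[of _ \<theta>], auto)
    qed
    have VE': "V \<subseteq> E 0"
    proof
      fix x assume x: "x \<in> V"
      then have "x \<noteq> 0" unfolding V_def sector_def by auto
      then show "x \<in> E 0" using VE closure_subset x by blast
    qed
    have evV: "\<forall>\<^sub>F s in at_right 0. of_real s * cis d0 \<in> V"
    proof -
      have "\<forall>\<^sub>F s in at_right 0. s \<in> {0<..<\<epsilon>\<^sub>0 / 2}" using eps0 by (intro eventually_at_right_real) auto
      then show ?thesis
      proof eventually_elim
        case (elim s)
        show ?case unfolding V_def sector_def
          by (rule CollectI, rule exI[of _ s], rule exI[of _ d0]) (use elim a in auto)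
      qed
    qed
    have "asymptotic_on_ray d0 (\<lambda>\<epsilon>. poly_diff 1 (\<lambda>\<zeta>. f 0 t' \<zeta> \<epsilon>) z) (Abs_fps (\<lambda>n. poly_diff 1 (\<lambda>\<zeta>. fh n (t', \<zeta>) / fact n) z))"
    proof (rule asymptotic_poly_diff[OF H_open z])
      show "\<forall>\<^sub>F s in at_right 0. (\<lambda>\<zeta>. f 0 t' \<zeta> (of_real s * cis d0)) holomorphic_on H"
        using ev by eventually_elim (use F_spaceD(2)[OF fF t'] in auto)
      show "(\<lambda>\<zeta>. fh n (t', \<zeta>) / fact n) holomorphic_on H" for n using F_spaceD(2)[OF fhF t'] by simp
      show "\<exists>C. \<forall>\<^sub>F s in at_right 0. \<forall>\<zeta>\<in>H. cmod (f 0 t' \<zeta> (of_real s * cis d0) - (\<Sum>n<N. fh n (t', \<zeta>) / fact n * (of_real s * cis d0) ^ n)) \<le> C * s ^ N" for N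
      \<comment> \<open>The estimates of \<open>qgevrey_expansion\<close> always subtract at least
        the term of order 0. For N = 0 nothing is subtracted, and the boundedness of f is used
        instead.\<close>
      proof (cases N)
        case 0
        obtain B where B: "\<forall>y\<in>(\<lambda>(t, z, \<epsilon>). f 0 t z \<epsilon>) ` (T \<times> H \<times> E 0). norm y \<le> B"
          using f_bounded[OF nE] unfolding bounded_iff by blast
        have "\<forall>\<^sub>F s in at_right 0. \<forall>\<zeta>\<in>H. cmod (f 0 t' \<zeta> (of_real s * cis d0)) \<le> B"
          using ev by eventually_elim (use B t' in force)
        then show ?thesis using 0 by auto
      next
        case (Suc M)
        obtain C where C: "\<forall>\<epsilon>\<in>V. \<forall>x\<in>T \<times> H. cmod ((case x of (t, z) \<Rightarrow> f 0 t z \<epsilon>) - (\<Sum>n\<le>M. fh n x / fact n * \<epsilon> ^ n)) \<le> C * cmod \<epsilon> ^ (M + 1)"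
          using qgevrey_expansion_pointwise[OF T_open H_open fe _ V VE VE', of M] eps0 by auto
        have "\<forall>\<^sub>F s in at_right 0. \<forall>\<zeta>\<in>H. cmod (f 0 t' \<zeta> (of_real s * cis d0) - (\<Sum>n<N. fh n (t', \<zeta>) / fact n * (of_real s * cis d0) ^ n)) \<le> C * s ^ N"
          using evV eventually_at_right_less[of "0::real"]
        proof eventually_elim
          case (elim s)
          show ?case
          proof
            fix \<zeta> assume \<zeta>: "\<zeta> \<in> H"
            have "cmod (of_real s * cis d0) = s" using elim by (simp add: norm_mult)
            then show "cmod (f 0 t' \<zeta> (of_real s * cis d0) - (\<Sum>n<N. fh n (t', \<zeta>) / fact n * (of_real s * cis d0) ^ n)) \<le> C * s ^ N"
              using C[rule_format, OF elim(1), of "(t', \<zeta>)"] t' \<zeta> unfolding Suc lessThan_Suc_atMost by simp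
          qed
        qed
        then show ?thesis by blast
      qed
    qed
    then show ?thesis by (simp add: poly_diff_def)
  qed
  have tT: "of_real q * t \<in> T" "of_real (q powr (real d\<^sub>D / real k2 + 1)) * t \<in> T"
    "\<And>j. j \<in> {1..D-1} \<Longrightarrow> of_real (q powr real (\<delta> j)) * t \<in> T"
    using t by (auto simp: t_dom_def)
  have q1: "q powr 1 = q" using q by simp
  let ?L = "\<lambda>\<epsilon>. sigma_q q 1 (\<lambda>t'. poly_diff Q (\<lambda>\<zeta>. u 0 t' \<zeta> \<epsilon>) z) t"
  let ?R = "\<lambda>\<epsilon>. (\<epsilon> * t) ^ d\<^sub>D * sigma_q q (real d\<^sub>D / real k2 + 1) (\<lambda>t'. poly_diff (R D) (\<lambda>\<zeta>. u 0 t' \<zeta> \<epsilon>) z) t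
       + (\<Sum>j=1..D-1. \<Sum>l\<in>I j. t ^ d l j * \<epsilon> ^ \<Delta> l j *
           sigma_q q (real (\<delta> j)) (\<lambda>t'. c l j z \<epsilon> * poly_diff (R j) (\<lambda>\<zeta>. u 0 t' \<zeta> \<epsilon>) z) t)
       + sigma_q q 1 (\<lambda>t'. f 0 t' z \<epsilon>) t"
  have L: "asymptotic_on_ray d0 ?L (formal_op q 1 Q usol t z)"
    unfolding sigma_q_def formal_op_def q1 by (rule usol_asym[OF tT(1)])
  have "asymptotic_on_ray d0 ?R ((fps_X * fps_const t) ^ d\<^sub>D * formal_op q (real d\<^sub>D / real k2 + 1) (R D) usol t z
         + (\<Sum>j=1..D-1. \<Sum>l\<in>I j. fps_const (t ^ d l j) * fps_X ^ \<Delta> l j *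
              (fps_expansion (c l j z) 0 * formal_op q (real (\<delta> j)) (R j) usol t z))
         + formal_op q 1 1 (\<lambda>n x. fh n x / fact n) t z)"
    unfolding sigma_q_def formal_op_def q1
    by (intro asymptotic_add asymptotic_sum asymptotic_mult asymptotic_power asymptotic_X asymptotic_const
        usol_asym[OF tT(2)] usol_asym[OF tT(3)] f_asym[OF tT(1)] asymptotic_fps_expansion[OF c_holomorphic[OF _ _ z] eps0])
  moreover have "\<forall>\<^sub>F s in at_right 0. ?R (of_real s * cis d0) = ?L (of_real s * cis d0)"
    using ev
  proof eventually_elim
    case (elim s)
    from u_solves[OF nE, unfolded main_problem_def, rule_format, OF t z elim]
    show ?case by (rule sym)
  qed
  ultimately have "asymptotic_on_ray d0 ?L ((fps_X * fps_const t) ^ d\<^sub>D * formal_op q (real d\<^sub>D / real k2 + 1) (R D) usol t z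
         + (\<Sum>j=1..D-1. \<Sum>l\<in>I j. fps_const (t ^ d l j) * fps_X ^ \<Delta> l j *
              (fps_expansion (c l j z) 0 * formal_op q (real (\<delta> j)) (R j) usol t z))
         + formal_op q 1 1 (\<lambda>n x. fh n x / fact n) t z)"
    by (rule asymptotic_cong)
  from asymptotic_unique[OF L this] show ?thesis .
qed

end

theorem theorem4:
  fixes q :: real and k1 k2 D d\<^sub>D :: nat
    and I :: "nat \<Rightarrow> nat set" and \<delta> :: "nat \<Rightarrow> nat" and d \<Delta> :: "nat \<Rightarrow> nat \<Rightarrow> nat"
    and Q :: "complex poly" and R :: "nat \<Rightarrow> complex poly"
    and r\<^sub>Q d\<^sub>Q \<eta>\<^sub>Q :: real
    and \<beta> \<mu> \<beta>' \<epsilon>\<^sub>0 \<rho> :: real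
    and C :: "nat \<Rightarrow> nat \<Rightarrow> real \<Rightarrow> complex \<Rightarrow> complex" and C' :: "nat \<Rightarrow> nat \<Rightarrow> real"
    and F :: "nat \<Rightarrow> real \<Rightarrow> complex \<Rightarrow> complex" and C\<^sub>F :: real
    and \<kappa> :: real and c :: "nat \<Rightarrow> nat \<Rightarrow> complex \<Rightarrow> complex \<Rightarrow> complex"
    and \<alpha> \<nu> :: real and n\<^sub>E :: nat and E :: "nat \<Rightarrow> complex set"
    and dir :: "nat \<Rightarrow> real" and U S :: "nat \<Rightarrow> complex set"
    and \<delta>\<^sub>0 \<delta>\<^sub>1 r\<^sub>T :: real and T H :: "complex set" and Rb :: "nat \<Rightarrow> complex set"
    and rt :: "nat \<Rightarrow> real \<Rightarrow> complex"
    and \<psi>1 \<psi>2 :: "nat \<Rightarrow> complex \<Rightarrow> real \<Rightarrow> complex \<Rightarrow> complex" and Z :: real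
    and f :: "nat \<Rightarrow> complex \<Rightarrow> complex \<Rightarrow> complex \<Rightarrow> complex"
    and W :: real and w1 w2 :: "nat \<Rightarrow> complex \<Rightarrow> real \<Rightarrow> complex \<Rightarrow> complex"
    and \<gamma> :: "nat \<Rightarrow> complex \<Rightarrow> real"
    and u :: "nat \<Rightarrow> complex \<Rightarrow> complex \<Rightarrow> complex \<Rightarrow> complex"
    and fh :: "nat \<Rightarrow> complex \<times> complex \<Rightarrow> complex"
  assumes "q_solutions q k1 k2 D d\<^sub>D I \<delta> d \<Delta> Q R r\<^sub>Q d\<^sub>Q \<eta>\<^sub>Q \<beta> \<mu> \<beta>' \<epsilon>\<^sub>0 \<rho> C C' F C\<^sub>F \<kappa> c
    \<alpha> \<nu> n\<^sub>E E dir U S \<delta>\<^sub>0 \<delta>\<^sub>1 r\<^sub>T T H Rb rt \<psi>1 \<psi>2 Z f W w1 w2 \<gamma> u fh"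
  shows "\<exists>h :: nat \<Rightarrow> complex \<times> complex \<Rightarrow> complex.
    let uh = (\<lambda>n x. h n x / fact n); fh' = (\<lambda>n x. fh n x / fact n) in
    (\<forall>n. h n \<in> F_space T H) \<and>
    (\<forall>t\<in>t_dom q k2 D d\<^sub>D \<delta> T. \<forall>z\<in>H.
       formal_op q 1 Q uh t z =
         (fps_X * fps_const t) ^ d\<^sub>D * formal_op q (real d\<^sub>D / real k2 + 1) (R D) uh t z
         + (\<Sum>j=1..D-1. \<Sum>l\<in>I j. fps_const (t ^ d l j) * fps_X ^ \<Delta> l j *
              (fps_expansion (c l j z) 0 * formal_op q (real (\<delta> j)) (R j) uh t z))
         + formal_op q 1 1 fh' t z) \<and>
    (\<forall>p<n\<^sub>E. qgevrey_expansion q k1 T H (E p) (\<lambda>\<epsilon> (t, z). u p t z \<epsilon>) uh) \<and>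
    (\<exists>a uh1 uh2.
       F_convergent T H a \<and>
       (\<forall>n. uh1 n \<in> F_space T H \<and> uh2 n \<in> F_space T H) \<and>
       (\<forall>n. \<forall>x\<in>T \<times> H. uh n x = a n x + uh1 n x + uh2 n x) \<and>
       (\<forall>p<n\<^sub>E. \<exists>u1 u2.
          qgevrey_expansion q k1 T H (E p) u1 uh1 \<and>
          qgevrey_expansion q k2 T H (E p) u2 uh2 \<and>
          (\<forall>t\<in>T. \<forall>z\<in>H. \<forall>\<epsilon>\<in>E p.
             summable (\<lambda>n. a n (t, z) * \<epsilon> ^ n) \<and>
             u p t z \<epsilon> = (\<Sum>n. a n (t, z) * \<epsilon> ^ n) + u1 \<epsilon> (t, z) + u2 \<epsilon> (t, z))))"
proof -
  interpret q_solutions q k1 k2 D d\<^sub>D I \<delta> d \<Delta> Q R r\<^sub>Q d\<^sub>Q \<eta>\<^sub>Q \<beta> \<mu> \<beta>' \<epsilon>\<^sub>0 \<rho> C C' F C\<^sub>F \<kappa> c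
    \<alpha> \<nu> n\<^sub>E E dir U S \<delta>\<^sub>0 \<delta>\<^sub>1 r\<^sub>T T H Rb rt \<psi>1 \<psi>2 Z f W w1 w2 \<gamma> u fh
    by (rule assms)
  show ?thesis
  \<comment> \<open>\<open>usol\<close> collects the coefficients of \<epsilon>^n, whereas h is
    normalised by \<epsilon>^n / n!.\<close>
  proof (rule exI[of _ "\<lambda>n x. fact n * usol n x"], unfold Let_def, intro conjI)
    have h: "(\<lambda>n x. fact n * usol n x / fact n) = usol" by (intro ext) simp
    show "\<forall>n. (\<lambda>x. fact n * usol n x) \<in> F_space T H"
      by (intro allI F_space_scale T_open H_open usol_F_space)
    show "\<forall>t\<in>t_dom q k2 D d\<^sub>D \<delta> T. \<forall>z\<in>H.
         formal_op q 1 Q (\<lambda>n x. fact n * usol n x / fact n) t z =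
           (fps_X * fps_const t) ^ d\<^sub>D * formal_op q (real d\<^sub>D / real k2 + 1) (R D) (\<lambda>n x. fact n * usol n x / fact n) t z
           + (\<Sum>j=1..D-1. \<Sum>l\<in>I j. fps_const (t ^ d l j) * fps_X ^ \<Delta> l j *
                (fps_expansion (c l j z) 0 * formal_op q (real (\<delta> j)) (R j) (\<lambda>n x. fact n * usol n x / fact n) t z))
           + formal_op q 1 1 (\<lambda>n x. fh n x / fact n) t z"
      unfolding h using formal_solution by blast
    show "\<forall>p<n\<^sub>E. qgevrey_expansion q k1 T H (E p) (\<lambda>\<epsilon> (t, z). u p t z \<epsilon>) (\<lambda>n x. fact n * usol n x / fact n)"
      unfolding h using u_qgevrey by blast
    have "F_norm T H (\<lambda>x. 0) = 0"
      using TH_nonempty by (simp add: F_norm_def wnorm_def)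
    then have a: "F_convergent T H (\<lambda>n x. 0)"
      unfolding F_convergent_def by (intro conjI allI F_space_0 T_open H_open exI[of _ 1]) auto
    show "\<exists>a uh1 uh2.
         F_convergent T H a \<and>
         (\<forall>n. uh1 n \<in> F_space T H \<and> uh2 n \<in> F_space T H) \<and>
         (\<forall>n. \<forall>x\<in>T \<times> H. fact n * usol n x / fact n = a n x + uh1 n x + uh2 n x) \<and>
         (\<forall>p<n\<^sub>E. \<exists>u1 u2.
            qgevrey_expansion q k1 T H (E p) u1 uh1 \<and>
            qgevrey_expansion q k2 T H (E p) u2 uh2 \<and>
            (\<forall>t\<in>T. \<forall>z\<in>H. \<forall>\<epsilon>\<in>E p.
               summable (\<lambda>n. a n (t, z) * \<epsilon> ^ n) \<and>
               u p t z \<epsilon> = (\<Sum>n. a n (t, z) * \<epsilon> ^ n) + u1 \<epsilon> (t, z) + u2 \<epsilon> (t, z)))"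
    proof (rule exI[of _ "\<lambda>n x. 0"], rule exI[of _ usol], rule exI[of _ "\<lambda>n x. 0"], intro conjI a allI impI ballI
        usol_F_space F_space_0 T_open H_open)
      show "fact n * usol n x / fact n = 0 + usol n x + 0" for n x by simp
      fix p assume p: "p < n\<^sub>E"
      show "\<exists>u1 u2. qgevrey_expansion q k1 T H (E p) u1 usol \<and>
            qgevrey_expansion q k2 T H (E p) u2 (\<lambda>n x. 0) \<and>
            (\<forall>t\<in>T. \<forall>z\<in>H. \<forall>\<epsilon>\<in>E p. summable (\<lambda>n. 0 * \<epsilon> ^ n) \<and>
               u p t z \<epsilon> = (\<Sum>n. 0 * \<epsilon> ^ n) + u1 \<epsilon> (t, z) + u2 \<epsilon> (t, z))"
        by (rule exI[of _ "\<lambda>\<epsilon> (t, z). u p t z \<epsilon>"], rule exI[of _ "\<lambda>\<epsilon> x. 0"], intro conjI u_qgevrey[OF p]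
            qgevrey_expansion_0[OF T_open H_open E_open[OF p] TH_nonempty]) simp
    qed
  qed
qed

end
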